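(* Consider the contaminated AR($p$) model and the symmetrized Pearson statistic $\hat\chi_n^2$ described in the context. Suppose that the local alternative $H_{1n}(\rho)$ holds, i.e. for sample size $n$ the innovations have distribution function $A_n(x)=(1-\rho_n)\Phi(x/\theta_0)+\rho_nH(x)$ with $\rho_n=\min(1,\rho n^{-1/2})$. Assume that (i) a random variable with distribution function $H$ has zero mean and finite variance, (ii) $H$ is twice differentiable with bounded second derivative, and (iii) $H$ is symmetric about zero. Then for any finite nonnegative $\Gamma,R$, $$\sup_{x\in\mathbb{R},\;\rho\le R,\;\gamma\le\Gamma}\big|P(\hat\chi_n^2\le x)-F_{m-2}(x,\hat\lambda^2(\rho,\gamma,\Pi))\big|\to0,\quad n\to\infty,$$ where $F_{m-2}(\cdot,\lambda^2)$ is the distribution function of the noncentral chi-square distribution with $m-2$ degrees of freedom and noncentrality parameter $\lambda^2$, and $$\hat\lambda^2(\rho,\gamma,\Pi)=\big|(E_m-\alpha_0\alpha_0^T)P_0^{-1/2}\big[\rho(p_H-p_0)+\gamma\,\delta(\Pi)\big]\big|^2 .$$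
   Context: Model. $\{v_t\}_{t\in\mathbb{Z}}$ is the stationary solution of $v_t=\beta_1v_{t-1}+\dots+\beta_pv_{t-p}+\nu+\varepsilon_t$, $t\in\mathbb{Z}$, where $\{\varepsilon_t\}$ are i.i.d. with unknown distribution function $G$, $E\varepsilon_1=0$, $0<E\varepsilon_1^2<\infty$; $\boldsymbol\beta=(\beta_1,\dots,\beta_p)^T\in\mathbb{R}^p$ is an unknown vector such that all roots of the corresponding characteristic equation are less than one in modulus; $\nu\in\mathbb{R}$ is unknown. The constant $\mu$ is defined by $\nu=(1-\beta_1-\dots-\beta_p)\mu$. Observations. One observes $y_t=v_t+z_t^{\gamma_n}\xi_t$, $t=1-p,\dots,n$, where $\{z_t^{\gamma_n}\}$ are i.i.d. Bernoulli variables (values $0,1$) with $P(z_t^{\gamma_n}=1)=\gamma_n=\min(1,\gamma n^{-1/2})$, $\gamma\ge0$ unknown, and $\{\xi_t\}$ are i.i.d. with an arbitrary unknown distribution $\Pi$. Local alternative. $\Phi$ is the standard normal distribution function, $\theta_0>0$ is the unknown true value of the scale parameter $\theta$ under the normality hypothesis $G\in\{\Phi(x/\theta),\theta>0\}$, $H$ is a distribution function, and $\rho\ge0$. $H_{1n}(\rho)$ is the assumption that $G(x)=A_n(x):=(1-\rho_n)\Phi(x/\theta_0)+\rho_nH(x)$, $\rho_n=\min(1,\rho n^{-1/2})$. Residuals. $\hat\mu_n$ and $\hat{\boldsymbol\beta}_n=(\hat\beta_{1n},\dots,\hat\beta_{pn})^T$ are any sequences such that, under $H_{1n}(\rho)$,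 for any finite $\Gamma,R\ge0$, $n^{1/2}(\hat\mu_n-\mu)=O_P(1)$ and $n^{1/2}(\hat{\boldsymbol\beta}_n-\boldsymbol\beta)=O_P(1)$ as $n\to\infty$, uniformly in $\rho\le R$, $\gamma\le\Gamma$. Put $\hat u_t=y_t-\hat\mu_n$, $t=1-p,\dots,n$, and $\hat\varepsilon_t=\hat u_t-\hat\beta_{1n}\hat u_{t-1}-\dots-\hat\beta_{pn}\hat u_{t-p}$, $t=1,\dots,n$. Statistic. Fix $m>2$ and $0=x_0<x_1<\dots<x_m=\infty$. Let $B_j^+=(x_{j-1},x_j]$, $B_j^-=(-x_j,-x_{j-1}]$, and $p_j(\theta)=2[\Phi(x_j/\theta)-\Phi(x_{j-1}/\theta)]$, $j=1,\dots,m$, $\theta>0$. Let $\hat\nu_j$ be the number of residuals among $\hat\varepsilon_1,\dots,\hat\varepsilon_n$ lying in $B_j^+$ plus the number lying in $B_j^-$. The estimator $\hat\theta_n$ of $\theta_0$ is an $n^{1/2}$-consistent solution of the equation $\sum_{j=1}^m\frac{\hat\nu_j}{p_j(\theta)}p_j'(\theta)=0$ (prime denotes $d/d\theta$). The symmetrized Pearson statistic is $$\hat\chi_n^2=\sum_{j=1}^m\frac{(\hat\nu_j-np_j(\hat\theta_n))^2}{np_j(\hat\theta_n)}.$$ Notation in the noncentrality parameter. $|\cdot|$ is the Euclidean norm; $E_m$ is the $m\times m$ identity matrix; $P_0=\mathrm{diag}\{p_1(\theta_0),\dots,p_m(\theta_0)\}$; $p_0=(p_1(\theta_0),\dots,p_m(\theta_0))^T$;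 $p_0'=(p_1'(\theta_0),\dots,p_m'(\theta_0))^T$; $b_0=P_0^{-1/2}p_0'$; $\alpha_0=b_0/|b_0|$; $p_H=(p_1^H,\dots,p_m^H)^T$ with $p_j^H=2(H(x_j)-H(x_{j-1}))$; $\delta(\Pi)=(\delta_1(\Pi),\dots,\delta_m(\Pi))^T$ with $\delta_j(\Pi)=2[\Delta_S(x_j,\Pi)-\Delta_S(x_{j-1},\Pi)]$, where $\Delta_S(x,\Pi)=\frac12[\Delta_0(x,\Pi)-\Delta_0(-x,\Pi)]$, $\Delta_0(x,\Pi)=\sum_{j=0}^p[E\,G_0(x+\beta_j\xi_1)-G_0(x)]$, $\beta_0=-1$, $G_0(x)=\Phi(x/\theta_0)$; values at $x_m=\infty$ are understood as limits.
   Formalization: The sequences {ε_t}, {z_t}, {ξ_t} are assumed mutually independent (the claim fails otherwise), and the n^{1/2}-consistency of θ̂_n is taken uniformly in ρ≤R, γ≤Γ, with θ̂_n solving its equation with probability tending to one uniformly. *)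

theory Defs
  imports "HOL-Probability.Probability"
begin

section \<open>Distribution functions and cells\<close>

definition std_normal_cdf :: "real \<Rightarrow> real"
  where "std_normal_cdf = cdf std_normal_distribution"

text \<open>Evaluation at an extended real point, the value at \<open>\<infinity>\<close> being the limit.
  Only points in \<open>[0, \<infinity>]\<close> are ever used.\<close>

definition val_at :: "(real \<Rightarrow> real) \<Rightarrow> ereal \<Rightarrow> real"
  where "val_at f a = (if a = \<infinity> then Lim at_top f else f (real_of_ereal a))"

text \<open>The edges \<open>x 0 = 0 < x 1 < \<dots> < x m = \<infinity>\<close> are extended reals; the cells are
  numbered from \<open>1\<close> to \<open>m\<close>.\<close>

definition cell_pos :: "(nat \<Rightarrow> ereal) \<Rightarrow> nat \<Rightarrow> real set"
  where "cell_pos x j = {e. x (j - 1) < ereal e \<and> ereal e \<le> x j}"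

definition cell_neg :: "(nat \<Rightarrow> ereal) \<Rightarrow> nat \<Rightarrow> real set"
  where "cell_neg x j = {e. - x j < ereal e \<and> ereal e \<le> - x (j - 1)}"

text \<open>\<open>2 [F(x\<^sub>j) - F(x\<^sub>j\<^sub>-\<^sub>1)]\<close>\<close>

definition sym_increment :: "(nat \<Rightarrow> ereal) \<Rightarrow> (real \<Rightarrow> real) \<Rightarrow> nat \<Rightarrow> real"
  where "sym_increment x F j = 2 * (val_at F (x j) - val_at F (x (j - 1)))"

text \<open>\<open>p\<^sub>j(\<theta>)\<close>; meaningful for \<open>\<theta> > 0\<close>.\<close>

definition cell_prob :: "(nat \<Rightarrow> ereal) \<Rightarrow> nat \<Rightarrow> real \<Rightarrow> real"
  where "cell_prob x j \<theta> = sym_increment x (\<lambda>u. std_normal_cdf (u / \<theta>)) j"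

text \<open>The \<open>\<rho>\<^sub>n\<close> and the \<open>\<gamma>\<^sub>n\<close> of the model.\<close>

definition local_rate :: "real \<Rightarrow> nat \<Rightarrow> real"
  where "local_rate a n = min 1 (a / sqrt (real n))"

text \<open>\<open>A\<^sub>n\<close>; distributions are represented by Borel probability measures, so the distribution
  function called \<open>H\<close> in the mathematical statement is \<open>cdf H\<close> here.\<close>

definition local_alt :: "real \<Rightarrow> real measure \<Rightarrow> real \<Rightarrow> nat \<Rightarrow> real \<Rightarrow> real"
  where "local_alt \<theta>\<^sub>0 H \<rho> n u =
    (1 - local_rate \<rho> n) * std_normal_cdf (u / \<theta>\<^sub>0) + local_rate \<rho> n * cdf H u"


section \<open>The contaminated autoregression\<close>

text \<open>Vectors in \<open>\<real>\<^sup>p\<close> and \<open>\<real>\<^sup>m\<close> are functions on \<open>nat\<close> of which only the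
  arguments \<open>1, \<dots>, p\<close> (respectively \<open>1, \<dots>, m\<close>) are used.\<close>

definition char_roots_inside :: "nat \<Rightarrow> (nat \<Rightarrow> real) \<Rightarrow> bool"
  where "char_roots_inside p \<beta> \<longleftrightarrow>
    (\<forall>w::complex. w ^ p = (\<Sum>j=1..p. complex_of_real (\<beta> j) * w ^ (p - j)) \<longrightarrow> cmod w < 1)"

definition strictly_stationary :: "'w measure \<Rightarrow> (int \<Rightarrow> 'w \<Rightarrow> real) \<Rightarrow> bool"
  where "strictly_stationary M v \<longleftrightarrow>
    (\<forall>k. distr M (Pi\<^sub>M UNIV (\<lambda>_. borel)) (\<lambda>\<omega> t. v (t + k) \<omega>) =
         distr M (Pi\<^sub>M UNIV (\<lambda>_. borel)) (\<lambda>\<omega> t. v t \<omega>))"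

text \<open>The model for one sample size \<open>n\<close>: \<open>G\<close> is the distribution function of the
  innovations \<open>\<epsilon>\<close>, \<open>g\<close> the contamination probability and \<open>Q\<close> (usually written \<open>\<Pi>\<close>) the law of the
  contaminating variables \<open>\<xi>\<close>. The innovations, the Bernoulli variables \<open>z\<close> and the
  \<open>\<xi>\<close> are i.i.d. sequences that are independent of each other, which is joint independence of
  all these variables together. Under \<open>char_roots_inside\<close> the stationary solution \<open>v\<close> is
  unique up to null sets.\<close>

locale contaminated_ar = prob_space M
  for M :: "'w measure" +
  fixes p n :: nat and \<beta> :: "nat \<Rightarrow> real" and \<nu> :: real
    and G :: "real \<Rightarrow> real" and g :: real and Q :: "real measure"
    and \<epsilon> v z \<xi> :: "int \<Rightarrow> 'w \<Rightarrow> real"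
  assumes indep: "indep_vars (\<lambda>_. borel)
      (\<lambda>i. case i of Inl t \<Rightarrow> \<epsilon> t | Inr (Inl t) \<Rightarrow> z t | Inr (Inr t) \<Rightarrow> \<xi> t)
      (UNIV <+> ({1 - int p..int n} <+> {1 - int p..int n}))"
    and eps_law: "\<And>t. cdf (distr M borel (\<epsilon> t)) = G"
    and eps_square_integrable: "\<And>t. integrable M (\<lambda>\<omega>. (\<epsilon> t \<omega>)\<^sup>2)"
    and eps_mean: "\<And>t. expectation (\<epsilon> t) = 0"
    and eps_nondegenerate: "\<And>t. 0 < expectation (\<lambda>\<omega>. (\<epsilon> t \<omega>)\<^sup>2)"
    and z_values: "\<And>t \<omega>. t \<in> {1 - int p..int n} \<Longrightarrow> \<omega> \<in> space M \<Longrightarrow> z t \<omega> \<in> {0, 1}"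
    and z_law: "\<And>t. t \<in> {1 - int p..int n} \<Longrightarrow> prob {\<omega> \<in> space M. z t \<omega> = 1} = g"
    and xi_law: "\<And>t. t \<in> {1 - int p..int n} \<Longrightarrow> distr M borel (\<xi> t) = Q"
    and v_measurable: "\<And>t. random_variable borel (v t)"
    and v_stationary: "strictly_stationary M v"
    and v_equation: "\<And>t. AE \<omega> in M. v t \<omega> = (\<Sum>j=1..p. \<beta> j * v (t - int j) \<omega>) + \<nu> + \<epsilon> t \<omega>"

definition observation :: "(int \<Rightarrow> 'w \<Rightarrow> real) \<Rightarrow> (int \<Rightarrow> 'w \<Rightarrow> real) \<Rightarrow> (int \<Rightarrow> 'w \<Rightarrow> real) \<Rightarrow>
    'w \<Rightarrow> int \<Rightarrow> real"
  where "observation v z \<xi> \<omega> t = v t \<omega> + z t \<omega> * \<xi> t \<omega>"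


section \<open>Residuals and the symmetrized Pearson statistic\<close>

definition residual :: "nat \<Rightarrow> (int \<Rightarrow> real) \<Rightarrow> real \<Rightarrow> (nat \<Rightarrow> real) \<Rightarrow> int \<Rightarrow> real"
  where "residual p y a b t = (y t - a) - (\<Sum>j=1..p. b j * (y (t - int j) - a))"

definition cell_count :: "(nat \<Rightarrow> ereal) \<Rightarrow> nat \<Rightarrow> (int \<Rightarrow> real) \<Rightarrow> nat \<Rightarrow> nat"
  where "cell_count x n e j =
    card {t \<in> {1..int n}. e t \<in> cell_pos x j} + card {t \<in> {1..int n}. e t \<in> cell_neg x j}"

definition solves_scale_equation :: "(nat \<Rightarrow> ereal) \<Rightarrow> nat \<Rightarrow> nat \<Rightarrow> (int \<Rightarrow> real) \<Rightarrow> real \<Rightarrow> bool"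
  where "solves_scale_equation x m n e \<theta> \<longleftrightarrow> 0 < \<theta> \<and>
    (\<Sum>j=1..m. real (cell_count x n e j) / cell_prob x j \<theta> * deriv (cell_prob x j) \<theta>) = 0"

definition pearson_stat :: "(nat \<Rightarrow> ereal) \<Rightarrow> nat \<Rightarrow> nat \<Rightarrow> (int \<Rightarrow> real) \<Rightarrow> real \<Rightarrow> real"
  where "pearson_stat x m n e \<theta> =
    (\<Sum>j=1..m. (real (cell_count x n e j) - real n * cell_prob x j \<theta>)\<^sup>2
                / (real n * cell_prob x j \<theta>))"


section \<open>Uniform asymptotics under the local alternatives\<close>

text \<open>The probability space and the random variables may depend on \<open>n\<close>, \<open>\<rho>\<close> and
  \<open>\<gamma>\<close> (in this order). The first notion is \<open>X = O\<^sub>P(1)\<close> as \<open>n \<rightarrow> \<infinity>\<close>, uniformly in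
  \<open>\<rho> \<le> R\<close>, \<open>\<gamma> \<le> \<Gamma>\<close> for all finite \<open>R\<close> and \<open>\<Gamma>\<close>; the second is that
  \<open>S\<close> holds with probability tending to one, with the same uniformity.\<close>

definition unif_bounded_in_prob ::
    "(nat \<Rightarrow> real \<Rightarrow> real \<Rightarrow> 'w measure) \<Rightarrow> (nat \<Rightarrow> real \<Rightarrow> real \<Rightarrow> 'w \<Rightarrow> real) \<Rightarrow> bool"
  where "unif_bounded_in_prob M X \<longleftrightarrow>
    (\<forall>R\<ge>0. \<forall>\<Gamma>\<ge>0. \<forall>\<eta>>0. \<exists>C. \<forall>\<^sub>F n in sequentially. \<forall>\<rho>\<in>{0..R}. \<forall>\<gamma>\<in>{0..\<Gamma>}.
       measure (M n \<rho> \<gamma>) {\<omega> \<in> space (M n \<rho> \<gamma>). C < \<bar>X n \<rho> \<gamma> \<omega>\<bar>} < \<eta>)"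

definition unif_asymp_sure ::
    "(nat \<Rightarrow> real \<Rightarrow> real \<Rightarrow> 'w measure) \<Rightarrow> (nat \<Rightarrow> real \<Rightarrow> real \<Rightarrow> 'w \<Rightarrow> bool) \<Rightarrow> bool"
  where "unif_asymp_sure M S \<longleftrightarrow>
    (\<forall>R\<ge>0. \<forall>\<Gamma>\<ge>0. \<forall>\<eta>>0. \<forall>\<^sub>F n in sequentially. \<forall>\<rho>\<in>{0..R}. \<forall>\<gamma>\<in>{0..\<Gamma>}.
       1 - \<eta> < measure (M n \<rho> \<gamma>) {\<omega> \<in> space (M n \<rho> \<gamma>). S n \<rho> \<gamma> \<omega>})"


section \<open>The limit law\<close>

text \<open>The law of \<open>(N\<^sub>1 + \<lambda>)\<^sup>2 + N\<^sub>2\<^sup>2 + \<dots> + N\<^sub>k\<^sup>2\<close> for independent standard normal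
  \<open>N\<^sub>i\<close> and \<open>k \<ge> 1\<close>, so that the noncentrality parameter is \<open>l = \<lambda>\<^sup>2\<close> (the sum of the
  squared means, without a factor \<open>1/2\<close>).\<close>

definition noncentral_chi_square :: "nat \<Rightarrow> real \<Rightarrow> real measure"
  where "noncentral_chi_square k l =
    distr (Pi\<^sub>M {..<k} (\<lambda>_. std_normal_distribution)) borel
      (\<lambda>\<omega>. \<Sum>i<k. (\<omega> i + (if i = 0 then sqrt l else 0))\<^sup>2)"

text \<open>\<open>\<Delta>\<^sub>0\<close>, \<open>\<Delta>\<^sub>S\<close> and \<open>\<delta>\<^sub>j\<close>; the term of index \<open>0\<close> has
  \<open>\<beta>\<^sub>0 = -1\<close>, whatever the value of the function \<open>\<beta>\<close> at \<open>0\<close>.\<close>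

definition Delta0 :: "nat \<Rightarrow> (nat \<Rightarrow> real) \<Rightarrow> real \<Rightarrow> real measure \<Rightarrow> real \<Rightarrow> real"
  where "Delta0 p \<beta> \<theta>\<^sub>0 Q u =
    (\<Sum>j=0..p. (\<integral>s. std_normal_cdf ((u + (if j = 0 then -1 else \<beta> j) * s) / \<theta>\<^sub>0) \<partial>Q)
               - std_normal_cdf (u / \<theta>\<^sub>0))"

definition DeltaS :: "nat \<Rightarrow> (nat \<Rightarrow> real) \<Rightarrow> real \<Rightarrow> real measure \<Rightarrow> real \<Rightarrow> real"
  where "DeltaS p \<beta> \<theta>\<^sub>0 Q u = (Delta0 p \<beta> \<theta>\<^sub>0 Q u - Delta0 p \<beta> \<theta>\<^sub>0 Q (- u)) / 2"

definition delta :: "(nat \<Rightarrow> ereal) \<Rightarrow> nat \<Rightarrow> (nat \<Rightarrow> real) \<Rightarrow> real \<Rightarrow> real measure \<Rightarrow> nat \<Rightarrow> real"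
  where "delta x p \<beta> \<theta>\<^sub>0 Q = sym_increment x (DeltaS p \<beta> \<theta>\<^sub>0 Q)"

definition b_vec :: "(nat \<Rightarrow> ereal) \<Rightarrow> real \<Rightarrow> nat \<Rightarrow> real"
  where "b_vec x \<theta>\<^sub>0 j = deriv (cell_prob x j) \<theta>\<^sub>0 / sqrt (cell_prob x j \<theta>\<^sub>0)"

definition alpha_vec :: "(nat \<Rightarrow> ereal) \<Rightarrow> nat \<Rightarrow> real \<Rightarrow> nat \<Rightarrow> real"
  where "alpha_vec x m \<theta>\<^sub>0 j = b_vec x \<theta>\<^sub>0 j / L2_set (b_vec x \<theta>\<^sub>0) {1..m}"

text \<open>\<open>|(E\<^sub>m - \<alpha>\<^sub>0 \<alpha>\<^sub>0\<^sup>T) P\<^sub>0\<^sup>-\<^sup>1\<^sup>/\<^sup>2 [\<rho> (p\<^sub>H - p\<^sub>0) + \<gamma> \<delta>(Q)]|\<^sup>2\<close>, with the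
  matrix product written out in coordinates.\<close>

definition noncentrality :: "(nat \<Rightarrow> ereal) \<Rightarrow> nat \<Rightarrow> nat \<Rightarrow> (nat \<Rightarrow> real) \<Rightarrow> real \<Rightarrow> real measure \<Rightarrow>
    real measure \<Rightarrow> real \<Rightarrow> real \<Rightarrow> real"
  where "noncentrality x m p \<beta> \<theta>\<^sub>0 H Q \<rho> \<gamma> =
    (L2_set (\<lambda>i. \<Sum>j=1..m.
        ((if i = j then 1 else 0) - alpha_vec x m \<theta>\<^sub>0 i * alpha_vec x m \<theta>\<^sub>0 j)
        * ((\<rho> * (sym_increment x (cdf H) j - cell_prob x j \<theta>\<^sub>0) + \<gamma> * delta x p \<beta> \<theta>\<^sub>0 Q j)
           / sqrt (cell_prob x j \<theta>\<^sub>0))) {1..m})\<^sup>2"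

end

theory Submission
  imports Defs "HOL-Complex_Analysis.Complex_Analysis"
begin

text \<open>
  Replace the estimators by deterministic values and let \<open>c\<close> be an edge. Given the past, the residual with index \<open>t\<close> is the innovation \<open>\<epsilon>\<^sub>t\<close> shifted by a
  contamination term and by an estimation error of order \<open>n\<^sup>-\<^sup>1\<^sup>/\<^sup>2\<close>. The number of residuals below \<open>c\<close> minus the
  number of innovations below \<open>c\<close> is a sum of martingale differences, which is \<open>o\<^sub>P(n\<^sup>1\<^sup>/\<^sup>2)\<close> because the shifts
  are small with high probability, plus its compensator. A Taylor expansion of the compensator gives
  \<open>n\<^sup>1\<^sup>/\<^sup>2 \<gamma> \<Delta>\<^sub>0(c)\<close> from single contaminations and \<open>n\<^sup>1\<^sup>/\<^sup>2 G'(c) K\<close>, with \<open>K\<close> independent of \<open>c\<close>, from the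
  estimators. As \<open>G'\<close> is even, the latter cancels in the symmetrized cells, so the normalized cell counts are
  those of i.i.d. innovations with the drift \<open>\<rho> (p\<^sub>H - p\<^sub>0) + \<gamma> \<delta>\<close>. The scale equation projects them onto the
  orthogonal complement of \<open>b\<^sub>0\<close>, and their sum is zero, which leaves \<open>m - 2\<close> asymptotically independent normal
  coordinates with unit variance. Uniformity follows by applying this along arbitrary convergent
  sequences of parameters.
\<close>

section \<open>The moving average expansion of an autoregression\<close>

text \<open>The obstacles are dependence and missing moments. The estimators see all the data, so no
  conditioning is possible with them inside; their rescaled errors are rounded to a finite grid, on
  which they are constants, and a margin in the shift pays for the rounding. The stationary solution
  is given only by its equation and its stationarity, hence not visibly as a function of past
  innovations. It is replaced by a finite moving average, found by running the equation backwards,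
  whose length depends on n without any rate; all bounds must therefore be independent of that
  length. The contaminating variables may have no mean, so they enter through bounded functions
  only. Errors in the autoregressive coefficients leave no first order trace, because they multiply
  centred moving averages, whose sums over n terms are of order n^(1/2) only. The limit law is
  reached through Laplace transforms: they turn the squared length of a random vector into a
  Gaussian average of characteristic functions of its linear combinations, and in the limit they
  depend on the mean vector only through its length.\<close>

lemma AR_poly_nonzero:
  fixes \<beta> :: "nat \<Rightarrow> real" and z :: complex
  assumes p: "1 \<le> p" and roots: "char_roots_inside p \<beta>" and z: "cmod z \<le> 1"
  shows "1 - (\<Sum>j=1..p. complex_of_real (\<beta> j) * z ^ j) \<noteq> 0"
proof
  assume 0: "1 - (\<Sum>j=1..p. complex_of_real (\<beta> j) * z ^ j) = 0"
  have z0: "z \<noteq> 0"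
  proof
    assume "z = 0"
    then have "(\<Sum>j=1..p. complex_of_real (\<beta> j) * z ^ j) = 0"
      by (intro sum.neutral) (auto simp: power_0_left)
    with 0 show False by simp
  qed
  \<comment> \<open>The two polynomials are reciprocal to each other: a zero \<open>z\<close> here
    makes \<open>inverse z\<close> a root of the characteristic equation, hence less than one in
    modulus.\<close>
  have "inverse z ^ p = inverse z ^ p * (\<Sum>j=1..p. complex_of_real (\<beta> j) * z ^ j)"
    using 0 by simp
  also have "\<dots> = (\<Sum>j=1..p. complex_of_real (\<beta> j) * inverse z ^ (p - j))"
    unfolding sum_distrib_left
  proof (intro sum.cong refl)
    fix j assume "j \<in> {1..p}"
    then have "inverse z ^ p = inverse z ^ (p - j) * inverse z ^ j"
      by (simp flip: power_add)
    then show "inverse z ^ p * (complex_of_real (\<beta> j) * z ^ j) = complex_of_real (\<beta> j) * inverse z ^ (p - j)"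
      using z0 by (simp add: power_mult_distrib[symmetric] field_simps)
  qed
  finally have "cmod (inverse z) < 1"
    using roots unfolding char_roots_inside_def by blast
  then show False using z z0 by (simp add: norm_inverse one_less_inverse_iff inverse_less_1_iff)
qed

text \<open>The reciprocal of the polynomial has finitely many poles, all outside the closed unit
  disc, so its power series converges beyond radius one and its coefficients are absolutely
  summable. The recursion compares coefficients in \<open>F * inverse F = 1\<close>; it passes to
  real parts because the \<beta> are real.\<close>

lemma AR_psi_exists:
  fixes \<beta> :: "nat \<Rightarrow> real"
  assumes p: "1 \<le> p" and roots: "char_roots_inside p \<beta>"
  obtains \<psi> :: "nat \<Rightarrow> real" where "\<psi> 0 = 1" "summable (\<lambda>k. \<bar>\<psi> k\<bar>)"
    "\<And>k. 1 \<le> k \<Longrightarrow> \<psi> k = (\<Sum>l=1..p. if l \<le> k then \<beta> l * \<psi> (k - l) else 0)"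
proof -
  define P :: "complex poly" where "P = 1 - (\<Sum>j=1..p. monom (complex_of_real (\<beta> j)) j)"
  have polyP: "poly P z = 1 - (\<Sum>j=1..p. complex_of_real (\<beta> j) * z ^ j)" for z
    by (simp add: P_def poly_sum poly_monom)
  have Pnz: "poly P z \<noteq> 0" if "cmod z \<le> 1" for z
    using AR_poly_nonzero[OF p roots that] by (simp add: polyP)
  have P0: "P \<noteq> 0" using Pnz[of 0] by auto
  \<comment> \<open>The value \<open>2\<close> keeps the minimum defined and above one when
    \<open>P\<close> has no zeros.\<close>
  define r where "r = Min (insert 2 (cmod ` {z. poly P z = 0}))"
  have fin: "finite (insert 2 (cmod ` {z. poly P z = 0}))" using poly_roots_finite[OF P0] by simp
  have r1: "1 < r" unfolding r_def using fin Pnz by (subst Min_gr_iff) (auto simp: not_le[symmetric])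
  have rP: "poly P z \<noteq> 0" if "z \<in> ball 0 r" for z
  proof
    assume "poly P z = 0"
    then have "r \<le> cmod z" unfolding r_def using fin by (intro Min_le) auto
    then show False using that by simp
  qed
  define F where "F = fps_of_poly P"
  have F: "(\<lambda>z. poly P z) has_fps_expansion F"
  proof -
    have "eval_fps F has_fps_expansion F" by (rule eval_fps_has_fps_expansion) (simp add: F_def)
    then show ?thesis by (simp add: F_def eval_fps_of_poly[abs_def] poly_def[symmetric] eta_contract_eq)
  qed
  have F0: "fps_nth F 0 \<noteq> 0" using Pnz[of 0] by (simp add: F_def poly_0_coeff_0)
  have inv: "(\<lambda>z. inverse (poly P z)) has_fps_expansion inverse F"
    using F F0 by (rule has_fps_expansion_inverse)
  have "(\<lambda>z. inverse (poly P z)) holomorphic_on eball 0 (ereal r)"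
    using rP by (intro holomorphic_intros) (auto simp: eball_def)
  then have "ereal r \<le> fps_conv_radius (inverse F)"
    using inv holomorphic_on_imp_fps_conv_radius_ge by blast
  then have "ereal (norm (1::complex)) < fps_conv_radius (inverse F)" using r1
    by (metis ereal_less(2) less_le_trans less_ereal.simps(1) norm_one)
  then have sm: "summable (\<lambda>k. norm (fps_nth (inverse F) k))"
    using abs_summable_in_conv_radius[of 1 "fps_nth (inverse F)"] by (simp add: fps_conv_radius_def)
  have one: "F * inverse F = 1" using F0 by (rule inverse_mult_eq_1')
  have Fn: "fps_nth F l = (if l = 0 then 1 else if l \<le> p then - complex_of_real (\<beta> l) else 0)" for l
  proof -
    have "fps_nth F l = (if l = 0 then 1 else 0) - (\<Sum>j=1..p. if j = l then complex_of_real (\<beta> j) else 0)"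
      by (simp add: F_def P_def coeff_diff coeff_sum)
    also have "(\<Sum>j=1..p. if j = l then complex_of_real (\<beta> j) else 0) = (if l \<in> {1..p} then complex_of_real (\<beta> l) else 0)"
      by (subst sum.delta) auto
    finally show ?thesis by auto
  qed
  define \<psi> where "\<psi> k = Re (fps_nth (inverse F) k)" for k
  have "fps_nth F 0 * fps_nth (inverse F) 0 = 1" using one by (metis fps_mult_nth_0 fps_one_nth)
  then have "\<psi> 0 = 1" by (simp add: Fn \<psi>_def)
  moreover have "summable (\<lambda>k. \<bar>\<psi> k\<bar>)"
    by (rule summable_comparison_test[OF _ sm]) (auto simp: \<psi>_def abs_Re_le_cmod)
  moreover have "\<psi> k = (\<Sum>l=1..p. if l \<le> k then \<beta> l * \<psi> (k - l) else 0)" if k: "1 \<le> k" for k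
  proof -
    have "0 = fps_nth (F * inverse F) k" using one k by simp
    also have "\<dots> = (\<Sum>i=0..k. fps_nth F i * fps_nth (inverse F) (k - i))" by (simp add: fps_mult_nth)
    also have "\<dots> = fps_nth (inverse F) k + (\<Sum>i=1..k. fps_nth F i * fps_nth (inverse F) (k - i))"
      using Fn by (subst sum.atLeast_Suc_atMost) auto
    finally have "0 = Re (fps_nth (inverse F) k + (\<Sum>i=1..k. fps_nth F i * fps_nth (inverse F) (k - i)))" by simp
    then have "\<psi> k = (\<Sum>i=1..k. if i \<le> p then \<beta> i * \<psi> (k - i) else 0)"
      by (simp add: \<psi>_def Fn sum_negf[symmetric] eq_neg_iff_add_eq_0 add_eq_0_iff2) (intro sum.cong, auto simp: \<psi>_def)
    also have "\<dots> = (\<Sum>i\<in>{1..k}\<inter>{1..p}. \<beta> i * \<psi> (k - i))"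
      by (intro sum.mono_neutral_cong_right) auto
    also have "\<dots> = (\<Sum>l=1..p. if l \<le> k then \<beta> l * \<psi> (k - l) else 0)"
      by (intro sum.mono_neutral_cong_left) auto
    finally show ?thesis .
  qed
  ultimately show thesis using that by blast
qed

text \<open>\<open>c k j\<close> collects what multiplies \<open>w (t - k - j)\<close> after the
  equation has been used \<open>k\<close> times. It contains \<psi> only at the indices
  \<open>k + j - l\<close> with \<open>l \<le> p\<close>, so all coefficients of the remainder
  vanish as \<open>k\<close> grows.\<close>

lemma AR_backward:
  fixes \<beta> \<psi> :: "nat \<Rightarrow> real" and w e :: "int \<Rightarrow> real"
  assumes p: "1 \<le> p" and w: "\<And>t. w t = (\<Sum>l=1..p. \<beta> l * w (t - int l)) + e t"
    and \<psi>0: "\<psi> 0 = 1"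
    and \<psi>: "\<And>k. 1 \<le> k \<Longrightarrow> \<psi> k = (\<Sum>l=1..p. if l \<le> k then \<beta> l * \<psi> (k - l) else 0)"
    and k: "1 \<le> k"
  defines "c \<equiv> \<lambda>k j. \<Sum>l=1..p. if j < l \<and> l \<le> k + j then \<beta> l * \<psi> (k + j - l) else 0"
  shows "w t - (\<Sum>i<k. \<psi> i * e (t - int i)) = (\<Sum>j<p. c k j * w (t - int k - int j))"
  using k
proof (induction k rule: nat_induct_at_least)
  have sh: "(\<Sum>l=1..p. \<beta> l * w (s - int l)) = (\<Sum>j<p. \<beta> (Suc j) * w (s - 1 - int j))" for s
    by (rule sum.reindex_bij_witness[of _ Suc "\<lambda>l. l - 1"]) (auto simp: algebra_simps)
  {
    case base
    have "c 1 j = \<beta> (Suc j)" if "j < p" for j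
    proof -
      have "c 1 j = (\<Sum>l=1..p. if l = Suc j then \<beta> l else 0)"
        unfolding c_def by (intro sum.cong) (auto simp: \<psi>0)
      then show ?thesis using that by (simp add: sum.delta)
    qed
    then show ?case using w[of t] sh[of t] by (simp add: \<psi>0)
  next
    case (Suc k)
    have cS: "c (Suc k) j = \<beta> (Suc j) * \<psi> k + c k (Suc j)" if "j < p" for j
    proof -
      have "c (Suc k) j = (\<Sum>l=1..p. (if l = Suc j then \<beta> (Suc j) * \<psi> k else 0) +
          (if Suc j < l \<and> l \<le> k + Suc j then \<beta> l * \<psi> (k + Suc j - l) else 0))"
        unfolding c_def by (intro sum.cong) auto
      then show ?thesis using that by (simp add: c_def sum.distrib sum.delta)
    qed
    \<comment> \<open>The coefficient of \<open>w (t - k)\<close> is the next moving average weight,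
      so expanding this value once more releases exactly the term
      \<open>\<psi> k * e (t - k)\<close>.\<close>
    have c0: "c k 0 = \<psi> k" using \<psi>[OF \<open>1 \<le> k\<close>] unfolding c_def by (auto intro!: sum.cong)
    have cp: "c k p = 0" unfolding c_def by (intro sum.neutral) auto
    obtain q where q: "p = Suc q" using p by (cases p) auto
    have "(\<Sum>j<p. c k j * w (t - int k - int j)) =
        c k 0 * w (t - int k) + (\<Sum>j<q. c k (Suc j) * w (t - int k - 1 - int j))"
      unfolding q by (subst sum.lessThan_Suc_shift) (simp add: algebra_simps)
    also have "(\<Sum>j<q. c k (Suc j) * w (t - int k - 1 - int j)) = (\<Sum>j<p. c k (Suc j) * w (t - int k - 1 - int j))"
      using cp by (simp add: q)
    also have "c k 0 * w (t - int k) = \<psi> k * e (t - int k) + (\<Sum>j<p. \<beta> (Suc j) * \<psi> k * w (t - int k - 1 - int j))"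
      unfolding w[of "t - int k"] c0 sh by (simp add: algebra_simps sum_distrib_left)
    finally have "(\<Sum>j<p. c k j * w (t - int k - int j)) = \<psi> k * e (t - int k) + (\<Sum>j<p. c (Suc k) j * w (t - int (Suc k) - int j))"
      by (simp add: cS sum.distrib algebra_simps)
    then show ?case using Suc by (simp add: algebra_simps)
  }
qed

section \<open>Convergence to the noncentral chi-square law\<close>

lemma std_normal_exp_tilt:
  fixes s x :: real assumes s: "0 \<le> s"
  defines "\<tau> \<equiv> 1 / sqrt (1 + 2 * s)"
  shows "std_normal_density (\<tau> * x) * exp (- s * (\<tau> * x)\<^sup>2) = std_normal_density x"
proof -
  \<comment> \<open>This relation makes the quadratic exponential factor a mere change of scale, by
    \<tau>, of the normal density.\<close>
  have t2: "\<tau>\<^sup>2 * (1 + 2 * s) = 1" using s by (simp add: \<tau>_def power_divide)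
  have "- (\<tau> * x)\<^sup>2 / 2 + - s * (\<tau> * x)\<^sup>2 = - x\<^sup>2 / 2 * (\<tau>\<^sup>2 * (1 + 2 * s))"
    by (simp add: field_simps)
  then have "- (\<tau> * x)\<^sup>2 / 2 + - s * (\<tau> * x)\<^sup>2 = - x\<^sup>2 / 2" by (simp only: t2 mult_1_right)
  then have "exp (- (\<tau> * x)\<^sup>2 / 2) * exp (- s * (\<tau> * x)\<^sup>2) = exp (- x\<^sup>2 / 2)"
    by (simp only: exp_add[symmetric])
  then show ?thesis by (simp add: std_normal_density_def)
qed

text \<open>Substituting \<open>g = \<tau> * x\<close> absorbs the quadratic factor and leaves the
  characteristic function at \<open>t * \<tau>\<close>. The case \<open>s = 0\<close> is the
  ordinary characteristic function and is used as well.\<close>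

lemma std_normal_fourier_tilt:
  fixes s t :: real assumes s: "0 \<le> s"
  shows "(CLINT g|std_normal_distribution. iexp (t * g) * complex_of_real (exp (- s * g\<^sup>2)))
    = complex_of_real (1 / sqrt (1 + 2 * s) * exp (- t\<^sup>2 / (2 * (1 + 2 * s))))"
proof -
  define \<tau> where "\<tau> = 1 / sqrt (1 + 2 * s)"
  have \<tau>: "0 < \<tau>" "\<tau>\<^sup>2 = 1 / (1 + 2 * s)" using s by (simp_all add: \<tau>_def power_divide)
  have "(CLINT g|std_normal_distribution. iexp (t * g) * complex_of_real (exp (- s * g\<^sup>2)))
     = (CLINT g|lborel. std_normal_density g *\<^sub>R (iexp (t * g) * complex_of_real (exp (- s * g\<^sup>2))))"
    by (subst integral_density) auto
  also have "\<dots> = \<tau> *\<^sub>R (CLINT x|lborel. std_normal_density (\<tau> * x) *\<^sub>R (iexp (t * (\<tau> * x)) * complex_of_real (exp (- s * (\<tau> * x)\<^sup>2))))"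
    using \<tau> by (subst lborel_integral_real_affine[where c = \<tau> and t = 0]) auto
  also have "(CLINT x|lborel. std_normal_density (\<tau> * x) *\<^sub>R (iexp (t * (\<tau> * x)) * complex_of_real (exp (- s * (\<tau> * x)\<^sup>2))))
      = (CLINT x|lborel. std_normal_density x *\<^sub>R iexp ((t * \<tau>) * x))"
  proof (intro Bochner_Integration.integral_cong refl)
    fix x :: real
    have "std_normal_density (\<tau> * x) *\<^sub>R (iexp (t * (\<tau> * x)) * complex_of_real (exp (- s * (\<tau> * x)\<^sup>2)))
      = complex_of_real (std_normal_density (\<tau> * x) * exp (- s * (\<tau> * x)\<^sup>2)) * iexp (t * (\<tau> * x))"
      by (simp add: scaleR_conv_of_real)
    also have "std_normal_density (\<tau> * x) * exp (- s * (\<tau> * x)\<^sup>2) = std_normal_density x"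
      unfolding \<tau>_def using s by (rule std_normal_exp_tilt)
    finally show "std_normal_density (\<tau> * x) *\<^sub>R (iexp (t * (\<tau> * x)) * complex_of_real (exp (- s * (\<tau> * x)\<^sup>2)))
      = std_normal_density x *\<^sub>R iexp ((t * \<tau>) * x)"
      by (simp add: scaleR_conv_of_real mult.assoc)
  qed
  also have "\<dots> = char std_normal_distribution (t * \<tau>)"
    unfolding char_def by (subst integral_density) auto
  also have "\<dots> = complex_of_real (exp (- (t * \<tau>)\<^sup>2 / 2))" by (simp add: char_std_normal_distribution)
  finally show ?thesis using \<tau> by (simp add: scaleR_conv_of_real \<tau>_def[symmetric] power_mult_distrib)
qed

text \<open>Completing the square: the integrand is a constant times the normal density with mean
  \<open>c\<close> and standard deviation \<tau>.\<close>

lemma std_normal_laplace_shift: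
  fixes s a :: real assumes s: "0 \<le> s"
  shows "(\<integral>x. exp (- s * (x + a)\<^sup>2) \<partial>std_normal_distribution) = 1 / sqrt (1 + 2 * s) * exp (- s * a\<^sup>2 / (1 + 2 * s))"
proof -
  define \<tau> where "\<tau> = 1 / sqrt (1 + 2 * s)"
  define c where "c = - 2 * s * a / (1 + 2 * s)"
  have \<tau>: "0 < \<tau>" "\<tau>\<^sup>2 = 1 / (1 + 2 * s)" using s by (simp_all add: \<tau>_def power_divide)
  have key: "std_normal_density x * exp (- s * (x + a)\<^sup>2) = \<tau> * exp (- s * a\<^sup>2 / (1 + 2 * s)) * normal_density c \<tau> x" for x
  proof -
    have "- x\<^sup>2 / 2 + - s * (x + a)\<^sup>2 = - s * a\<^sup>2 / (1 + 2 * s) + - (x - c)\<^sup>2 / (2 * \<tau>\<^sup>2)"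
    proof -
      have "(1 + 2 * s) \<noteq> 0" using s by simp
      then show ?thesis unfolding \<tau> c_def
        by (simp add: divide_simps) (simp add: algebra_simps power2_eq_square)
    qed
    then have "exp (- x\<^sup>2 / 2) * exp (- s * (x + a)\<^sup>2) = exp (- s * a\<^sup>2 / (1 + 2 * s)) * exp (- (x - c)\<^sup>2 / (2 * \<tau>\<^sup>2))"
      by (simp only: exp_add[symmetric])
    moreover have "sqrt (2 * pi * \<tau>\<^sup>2) = sqrt (2 * pi) * \<tau>" using \<tau>(1) by (simp add: real_sqrt_mult)
    ultimately show ?thesis using \<tau>(1) by (simp add: std_normal_density_def normal_density_def field_simps)
  qed
  have "(\<integral>x. exp (- s * (x + a)\<^sup>2) \<partial>std_normal_distribution) = (\<integral>x. std_normal_density x * exp (- s * (x + a)\<^sup>2) \<partial>lborel)"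
    by (subst integral_density) auto
  also have "\<dots> = \<tau> * exp (- s * a\<^sup>2 / (1 + 2 * s))"
    unfolding key using \<tau>(1) by simp
  finally show ?thesis by (simp add: \<tau>_def)
qed

lemma prob_space_std_normal: "prob_space std_normal_distribution"
  by (rule prob_space_normal_density) simp

interpretation std_normal: prob_space std_normal_distribution by (rule prob_space_std_normal)
interpretation std_normal_prod: product_prob_space "\<lambda>_::nat. std_normal_distribution" UNIV
  by unfold_locales

lemma real_distribution_noncentral_chi_square: "real_distribution (noncentral_chi_square k l)"
  unfolding noncentral_chi_square_def
  by (rule prob_space.real_distribution_distr)
    (auto intro!: prob_space_PiM prob_space_std_normal borel_measurable_sum)

text \<open>The transform factorizes over the coordinates and sees the shift only through its
  squared length \<open>l\<close>. A standard Gaussian vector shifted by any vector of that length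
  has the same transform, which is why the whole shift may sit in coordinate
  \<open>0\<close>.\<close>

lemma noncentral_chi_square_laplace:
  assumes s: "0 \<le> s" and l: "0 \<le> l" and k: "1 \<le> k"
  shows "(\<integral>t. exp (- s * t) \<partial>noncentral_chi_square k l) = (1 / sqrt (1 + 2 * s)) ^ k * exp (- s * l / (1 + 2 * s))"
proof -
  let ?a = "\<lambda>i::nat. if i = 0 then sqrt l else 0"
  have "(\<integral>t. exp (- s * t) \<partial>noncentral_chi_square k l) =
    (\<integral>\<omega>. exp (- s * (\<Sum>i<k. (\<omega> i + ?a i)\<^sup>2)) \<partial>Pi\<^sub>M {..<k} (\<lambda>_. std_normal_distribution))"
    unfolding noncentral_chi_square_def by (subst integral_distr) (auto intro!: borel_measurable_sum)
  also have "\<dots> = (\<integral>\<omega>. (\<Prod>i<k. exp (- s * (\<omega> i + ?a i)\<^sup>2)) \<partial>Pi\<^sub>M {..<k} (\<lambda>_. std_normal_distribution))"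
    by (simp add: exp_sum sum_distrib_left sum_negf[symmetric])
  also have "\<dots> = (\<Prod>i<k. \<integral>x. exp (- s * (x + ?a i)\<^sup>2) \<partial>std_normal_distribution)"
  proof (rule std_normal_prod.product_integral_prod)
    show "integrable std_normal_distribution (\<lambda>x. exp (- s * (x + ?a i)\<^sup>2))" for i
      by (rule std_normal.integrable_const_bound[of _ 1]) (use s in auto)
  qed simp
  also have "\<dots> = (\<Prod>i<k. 1 / sqrt (1 + 2 * s) * exp (- s * (?a i)\<^sup>2 / (1 + 2 * s)))"
    by (simp only: std_normal_laplace_shift[OF s])
  also have "\<dots> = (1 / sqrt (1 + 2 * s)) ^ k * exp (\<Sum>i<k. - s * (?a i)\<^sup>2 / (1 + 2 * s))"
    by (simp only: prod.distrib prod_constant card_lessThan exp_sum[OF finite_lessThan])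
  also have "(\<Sum>i<k. - s * (?a i)\<^sup>2 / (1 + 2 * s)) = (\<Sum>i<k. if i = 0 then - s * l / (1 + 2 * s) else 0)"
    using l by (intro sum.cong) auto
  also have "\<dots> = - s * l / (1 + 2 * s)" using k by (simp add: sum.delta)
  finally show ?thesis .
qed

text \<open>Integrate over coordinate \<open>0\<close> first: with the others fixed, the sum of
  squares equals \<open>u\<close> for at most two of its values, a Lebesgue null set. Hence the law
  has no atoms.\<close>

lemma isCont_cdf_noncentral_chi_square:
  assumes k: "1 \<le> k" shows "isCont (cdf (noncentral_chi_square k l)) u"
proof -
  interpret L: real_distribution "noncentral_chi_square k l" by (rule real_distribution_noncentral_chi_square)
  let ?a = "\<lambda>i::nat. if i = 0 then sqrt l else 0"
  let ?P = "\<lambda>I. Pi\<^sub>M I (\<lambda>_::nat. std_normal_distribution)"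
  let ?F = "\<lambda>\<omega>. \<Sum>i<k. (\<omega> i + ?a i)\<^sup>2"
  have ins: "{..<k} = insert 0 {1..<k}" using k by auto
  have meas[measurable]: "?F \<in> borel_measurable (?P {..<k})" by (auto intro!: borel_measurable_sum)
  have "emeasure (noncentral_chi_square k l) {u} = emeasure (?P {..<k}) {\<omega> \<in> space (?P {..<k}). ?F \<omega> = u}"
    unfolding noncentral_chi_square_def
    by (subst emeasure_distr) (auto intro!: arg_cong[where f = "emeasure _"] meas)
  also have "\<dots> = (\<integral>\<^sup>+\<omega>. indicator {\<omega> \<in> space (?P {..<k}). ?F \<omega> = u} \<omega> \<partial>?P {..<k})"
    by (rule nn_integral_indicator[symmetric]) measurable
  also have "\<dots> = (\<integral>\<^sup>+\<omega>. indicator {u} (?F \<omega>) \<partial>?P {..<k})"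
    by (intro nn_integral_cong) (auto split: split_indicator)
  also have "\<dots> = (\<integral>\<^sup>+x. \<integral>\<^sup>+y. indicator {u} (?F (x(0 := y))) \<partial>std_normal_distribution \<partial>?P {1..<k})"
  proof -
    have "(\<lambda>\<omega>. indicator {u} (?F \<omega>) :: ennreal) \<in> borel_measurable (?P {..<k})" by measurable
    then show ?thesis unfolding ins by (intro std_normal_prod.product_nn_integral_insert) auto
  qed
  also have "\<dots> = (\<integral>\<^sup>+x. 0 \<partial>?P {1..<k})"
  proof (intro nn_integral_cong)
    fix x :: "nat \<Rightarrow> real"
    have F: "?F (x(0 := y)) = (y + sqrt l)\<^sup>2 + (\<Sum>i=1..<k. (x i)\<^sup>2)" for y
      unfolding ins by (subst sum.insert) auto
    \<comment> \<open>For a negative radicand \<open>?r\<close> is negative and there is no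
      solution; the two points only have to include every solution.\<close>
    let ?r = "sqrt (u - (\<Sum>i=1..<k. (x i)\<^sup>2))"
    have "AE y in lborel. y \<notin> {?r - sqrt l, - ?r - sqrt l}"
      by (intro AE_not_in countable_imp_null_set_lborel) auto
    then have "AE y in lborel. ennreal (std_normal_density y) * indicator {u} (?F (x(0 := y))) = 0"
    proof (rule AE_mp, intro AE_I2 impI)
      fix y assume y: "y \<notin> {?r - sqrt l, - ?r - sqrt l}"
      have "?F (x(0 := y)) \<noteq> u"
      proof
        assume "?F (x(0 := y)) = u"
        then have "(y + sqrt l)\<^sup>2 = u - (\<Sum>i=1..<k. (x i)\<^sup>2)" unfolding F by simp
        then have "\<bar>y + sqrt l\<bar> = ?r" by (metis real_sqrt_abs)
        then show False using y by (auto simp: abs_if split: if_splits)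
      qed
      then show "ennreal (std_normal_density y) * indicator {u} (?F (x(0 := y))) = 0" by simp
    qed
    then have "(\<integral>\<^sup>+y. ennreal (std_normal_density y) * indicator {u} (?F (x(0 := y))) \<partial>lborel) = 0"
      by (subst nn_integral_cong_AE[where v = "\<lambda>_. 0"]) auto
    then show "(\<integral>\<^sup>+y. indicator {u} (?F (x(0 := y))) \<partial>std_normal_distribution) = 0"
      unfolding F by (subst nn_integral_density) auto
  qed
  finally have "measure (noncentral_chi_square k l) {u} = 0" by (simp add: measure_def)
  then show ?thesis by (subst L.isCont_cdf)
qed

text \<open>Weierstrass: a continuous function of \<open>exp (-t)\<close> is uniformly approximated by linear combinations of the
  \<open>exp (-k t)\<close>, so Laplace transforms at integers suffice.\<close>

lemma laplace_conv_imp_integral_conv: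
  fixes T :: "nat \<Rightarrow> 'w \<Rightarrow> real" and M :: "nat \<Rightarrow> 'w measure" and f :: "real \<Rightarrow> real"
  assumes M: "\<And>n. prob_space (M n)" and T[measurable]: "\<And>n. T n \<in> borel_measurable (M n)"
    and T0: "\<And>n. AE \<omega> in M n. 0 \<le> T n \<omega>"
    and L: "prob_space L" "sets L = sets borel" and L0: "AE t in L. 0 \<le> t"
    and lap: "\<And>k::nat. (\<lambda>n. \<integral>\<omega>. exp (- real k * T n \<omega>) \<partial>M n) \<longlonglongrightarrow> (\<integral>t. exp (- real k * t) \<partial>L)"
    and f: "continuous_on UNIV f" and K: "\<And>x. \<bar>f x\<bar> \<le> K"
  shows "(\<lambda>n. \<integral>\<omega>. f (exp (- T n \<omega>)) \<partial>M n) \<longlonglongrightarrow> (\<integral>t. f (exp (- t)) \<partial>L)"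
proof (rule LIMSEQ_I)
  interpret L: prob_space L by (rule L)
  note L(2)[measurable_cong]
  have fm[measurable]: "f \<in> borel_measurable borel" using f by (rule borel_measurable_continuous_onI)
  fix e :: real assume e: "0 < e"
  \<comment> \<open>The interval is the range of \<open>exp (- t)\<close> for nonnegative
    \<open>t\<close>. Two polynomial approximations and one limit, at \<open>e / 4\<close> each,
    stay below \<open>e\<close>.\<close>
  obtain g where g: "real_polynomial_function g" "\<And>x. x \<in> {0..1} \<Longrightarrow> \<bar>f x - g x\<bar> < e / 4"
    by (rule Stone_Weierstrass_real_polynomial_function[of "{0..1}" f "e/4"])
      (use e continuous_on_subset[OF f] in auto)
  obtain a d where a: "g = (\<lambda>x. \<Sum>i\<le>d. a i * x ^ i)"
    using g(1) by (auto simp: real_polynomial_function_iff_sum)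
  have pw: "exp (- t) ^ i = exp (- real i * t)" for t :: real and i
    by (simp add: exp_of_nat_mult[symmetric])
  have fg: "\<bar>f (exp (- t)) - g (exp (- t))\<bar> \<le> e / 4" if "0 \<le> t" for t
    using g(2)[of "exp (- t)"] that by (auto intro: less_imp_le)
  \<comment> \<open>Stated for an arbitrary space and variable, so that it serves both the
    \<open>T n\<close> and the identity on \<open>L\<close>.\<close>
  have close: "\<bar>(\<integral>\<omega>. f (exp (- X \<omega>)) \<partial>N) - (\<integral>\<omega>. g (exp (- X \<omega>)) \<partial>N)\<bar> \<le> e / 4"
      "(\<integral>\<omega>. g (exp (- X \<omega>)) \<partial>N) = (\<Sum>i\<le>d. a i * (\<integral>\<omega>. exp (- real i * X \<omega>) \<partial>N))"
    if N: "prob_space N" and X[measurable]: "X \<in> borel_measurable N" and X0: "AE \<omega> in N. 0 \<le> X \<omega>"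
    for N :: "'c measure" and X
  proof -
    interpret prob_space N by (rule N)
    have i: "integrable N (\<lambda>\<omega>. exp (- real i * X \<omega>))" for i
      by (rule integrable_const_bound[of _ 1]) (use X0 in auto)
    show "(\<integral>\<omega>. g (exp (- X \<omega>)) \<partial>N) = (\<Sum>i\<le>d. a i * (\<integral>\<omega>. exp (- real i * X \<omega>) \<partial>N))"
      unfolding a pw using i by (subst Bochner_Integration.integral_sum) auto
    have ig: "integrable N (\<lambda>\<omega>. g (exp (- X \<omega>)))" unfolding a pw using i by auto
    have iff: "integrable N (\<lambda>\<omega>. f (exp (- X \<omega>)))"
      by (rule integrable_const_bound[of _ K]) (auto simp: K)
    have "\<bar>(\<integral>\<omega>. f (exp (- X \<omega>)) \<partial>N) - (\<integral>\<omega>. g (exp (- X \<omega>)) \<partial>N)\<bar> \<le>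
      (\<integral>\<omega>. \<bar>f (exp (- X \<omega>)) - g (exp (- X \<omega>))\<bar> \<partial>N)"
      by (subst Bochner_Integration.integral_diff[symmetric, OF iff ig]) (rule integral_abs_bound)
    also have "\<dots> \<le> (\<integral>\<omega>. e / 4 \<partial>N)"
    proof (intro integral_mono_AE integrable_abs Bochner_Integration.integrable_diff iff ig)
      show "AE \<omega> in N. \<bar>f (exp (- X \<omega>)) - g (exp (- X \<omega>))\<bar> \<le> e / 4"
        using X0 by (rule eventually_mono) (rule fg)
    qed simp
    finally show "\<bar>(\<integral>\<omega>. f (exp (- X \<omega>)) \<partial>N) - (\<integral>\<omega>. g (exp (- X \<omega>)) \<partial>N)\<bar> \<le> e / 4"
      by (simp add: prob_space)
  qed
  have n: "\<And>n. prob_space (M n)" "\<And>n. T n \<in> borel_measurable (M n)" "\<And>n. AE \<omega> in M n. 0 \<le> T n \<omega>"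
    using M T T0 by auto
  have Lid: "(\<lambda>t. t) \<in> borel_measurable L" by measurable
  have "(\<lambda>n. \<integral>\<omega>. g (exp (- T n \<omega>)) \<partial>M n) \<longlonglongrightarrow> (\<integral>t. g (exp (- t)) \<partial>L)"
    unfolding close(2)[OF n] close(2)[OF L(1) Lid L0]
    by (intro tendsto_sum tendsto_mult tendsto_const lap)
  then obtain N where N: "\<And>n. N \<le> n \<Longrightarrow> \<bar>(\<integral>\<omega>. g (exp (- T n \<omega>)) \<partial>M n) - (\<integral>t. g (exp (- t)) \<partial>L)\<bar> < e / 4"
    using LIMSEQ_D[of _ _ "e/4"] e by fastforce
  show "\<exists>no. \<forall>n\<ge>no. norm ((\<integral>\<omega>. f (exp (- T n \<omega>)) \<partial>M n) - (\<integral>t. f (exp (- t)) \<partial>L)) < e"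
  proof (intro exI allI impI)
    fix k assume "N \<le> k"
    then show "norm ((\<integral>\<omega>. f (exp (- T k \<omega>)) \<partial>M k) - (\<integral>t. f (exp (- t)) \<partial>L)) < e"
      unfolding real_norm_def using N[of k] close(1)[OF n[of k]] close(1)[OF L(1) Lid L0] by linarith
  qed
qed

lemma noncentral_chi_square_nonneg: "AE t in noncentral_chi_square k l. 0 \<le> t"
proof -
  let ?P = "Pi\<^sub>M {..<k} (\<lambda>_. std_normal_distribution)"
  have "(\<lambda>\<omega>. \<Sum>i<k. (\<omega> i + (if i = 0 then sqrt l else 0))\<^sup>2) \<in> borel_measurable ?P"
    by (auto intro!: borel_measurable_sum)
  then show ?thesis unfolding noncentral_chi_square_def
    by (subst AE_distr_iff) (auto intro!: sum_nonneg)
qed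

text \<open>The squared length of an asymptotically standard Gaussian vector is tested against
  \<open>exp (-s |.|\<^sup>2)\<close>, which is itself the Fourier transform of a Gaussian; this reduces the
  multivariate limit theorem to characteristic functions of linear combinations.\<close>

lemma gaussian_limit_laplace:
  fixes X :: "nat \<Rightarrow> nat \<Rightarrow> 'w \<Rightarrow> real" and M :: "nat \<Rightarrow> 'w measure" and s :: real
  assumes M: "\<And>n. prob_space (M n)"
    and X[measurable]: "\<And>n i. i < k \<Longrightarrow> X n i \<in> borel_measurable (M n)"
    and cf: "\<And>g :: nat \<Rightarrow> real. (\<lambda>n. CLINT \<omega>|M n. iexp (\<Sum>i<k. g i * X n i \<omega>)) \<longlonglongrightarrow>
        complex_of_real (exp (- (\<Sum>i<k. (g i)\<^sup>2) / 2))"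
    and a: "\<And>i. i < k \<Longrightarrow> (\<lambda>n. a n i) \<longlonglongrightarrow> a' i"
    and s: "0 \<le> s"
  shows "(\<lambda>n. \<integral>\<omega>. exp (- s * (\<Sum>i<k. (X n i \<omega> + a n i)\<^sup>2)) \<partial>M n) \<longlonglongrightarrow>
     (1 / sqrt (1 + 2 * s)) ^ k * exp (- s * (\<Sum>i<k. (a' i)\<^sup>2) / (1 + 2 * s))"
proof -
  let ?P = "Pi\<^sub>M {..<k} (\<lambda>_. std_normal_distribution)"
  interpret P: prob_space ?P by (intro prob_space_PiM prob_space_std_normal)
  \<comment> \<open>With this \<open>r\<close> the function \<open>exp (- s * y\<^sup>2)\<close> is
    the standard normal characteristic function at \<open>r * y\<close>.\<close>
  define r where "r = sqrt (2 * s)"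
  have r2: "r\<^sup>2 = 2 * s" using s by (simp add: r_def)
  have fourier: "(CLINT g|?P. \<Prod>i<k. iexp (t i * g i) * complex_of_real (exp (- q * (g i)\<^sup>2)))
      = complex_of_real ((1 / sqrt (1 + 2 * q)) ^ k * exp (- (\<Sum>i<k. (t i)\<^sup>2) / (2 * (1 + 2 * q))))"
    if q: "0 \<le> q" for q :: real and t :: "nat \<Rightarrow> real"
  proof -
    have "(CLINT g|?P. \<Prod>i<k. iexp (t i * g i) * complex_of_real (exp (- q * (g i)\<^sup>2)))
      = (\<Prod>i<k. CLINT x|std_normal_distribution. iexp (t i * x) * complex_of_real (exp (- q * x\<^sup>2)))"
    proof (rule std_normal_prod.product_integral_prod)
      show "complex_integrable std_normal_distribution (\<lambda>x. iexp (t i * x) * complex_of_real (exp (- q * x\<^sup>2)))" for i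
        by (rule std_normal.integrable_const_bound[of _ 1]) (use q in \<open>auto simp: norm_mult\<close>)
    qed simp
    also have "\<dots> = (\<Prod>i<k. complex_of_real (1 / sqrt (1 + 2 * q) * exp (- (t i)\<^sup>2 / (2 * (1 + 2 * q)))))"
      by (simp only: std_normal_fourier_tilt[OF q])
    also have "\<dots> = complex_of_real ((1 / sqrt (1 + 2 * q)) ^ k * exp (\<Sum>i<k. - (t i)\<^sup>2 / (2 * (1 + 2 * q))))"
      by (simp only: of_real_prod[symmetric] prod.distrib prod_constant card_lessThan exp_sum[OF finite_lessThan])
    also have "(\<Sum>i<k. - (t i)\<^sup>2 / (2 * (1 + 2 * q))) = - (\<Sum>i<k. (t i)\<^sup>2) / (2 * (1 + 2 * q))"
      by (simp add: sum_divide_distrib sum_negf)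
    finally show ?thesis .
  qed
  \<comment> \<open>In this form the expectations over \<open>M n\<close> and over the auxiliary
    Gaussian \<open>g\<close> can be exchanged, after which only characteristic functions of linear
    combinations of the \<open>X n i\<close> remain.\<close>
  have split: "complex_of_real (exp (- s * (\<Sum>i<k. (y i)\<^sup>2))) = (CLINT g|?P. iexp (\<Sum>i<k. r * y i * g i))" for y
  proof -
    have "(CLINT g|?P. iexp (\<Sum>i<k. r * y i * g i)) = (CLINT g|?P. \<Prod>i<k. iexp ((r * y i) * g i) * complex_of_real (exp (- 0 * (g i)\<^sup>2)))"
      by (simp add: exp_sum sum_distrib_left)
    also have "\<dots> = complex_of_real ((1 / sqrt (1 + 2 * 0)) ^ k * exp (- (\<Sum>i<k. (r * y i)\<^sup>2) / (2 * (1 + 2 * 0))))"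
      by (rule fourier) simp
    also have "- (\<Sum>i<k. (r * y i)\<^sup>2) / (2 * (1 + 2 * 0)) = - s * (\<Sum>i<k. (y i)\<^sup>2)"
      by (simp add: power_mult_distrib r2 sum_distrib_left[symmetric])
    finally show ?thesis by simp
  qed
  define \<phi> where "\<phi> n g = (CLINT \<omega>|M n. iexp (\<Sum>i<k. r * g i * X n i \<omega>))" for n and g :: "nat \<Rightarrow> real"
  have eq: "complex_of_real (\<integral>\<omega>. exp (- s * (\<Sum>i<k. (X n i \<omega> + a n i)\<^sup>2)) \<partial>M n) =
      (CLINT g|?P. iexp (\<Sum>i<k. r * a n i * g i) * \<phi> n g)" and \<phi>m: "\<phi> n \<in> borel_measurable ?P"
      and \<phi>1: "norm (\<phi> n g) \<le> 1" for n g
  proof -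
    interpret Mn: prob_space "M n" by (rule M)
    interpret pair_sigma_finite "M n" ?P ..
    interpret MP: prob_space "M n \<Otimes>\<^sub>M ?P" by (intro prob_space_pair M P.prob_space_axioms)
    have comp: "(\<lambda>x. x i) \<in> borel_measurable ?P" if "i < k" for i using that by simp
    have [measurable]: "(\<lambda>x. snd x i) \<in> borel_measurable (M n \<Otimes>\<^sub>M ?P)" if "i < k" for i
      by (rule measurable_compose[OF measurable_snd comp[OF that]])
    have [measurable]: "(\<lambda>x. fst x i) \<in> borel_measurable (?P \<Otimes>\<^sub>M M n)" if "i < k" for i
      by (rule measurable_compose[OF measurable_fst comp[OF that]])
    have [measurable]: "(\<lambda>x. \<Sum>i<k. r * (X n i (fst x) + a n i) * snd x i) \<in> borel_measurable (M n \<Otimes>\<^sub>M ?P)"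
      by (intro borel_measurable_sum) auto
    have [measurable]: "(\<lambda>x. \<Sum>i<k. r * fst x i * X n i (snd x)) \<in> borel_measurable (?P \<Otimes>\<^sub>M M n)"
      by (intro borel_measurable_sum) auto
    have int: "complex_integrable (M n \<Otimes>\<^sub>M ?P) (\<lambda>(\<omega>, g). iexp (\<Sum>i<k. r * (X n i \<omega> + a n i) * g i))"
      unfolding case_prod_beta by (rule MP.integrable_const_bound[of _ 1]) auto
    have "complex_of_real (\<integral>\<omega>. exp (- s * (\<Sum>i<k. (X n i \<omega> + a n i)\<^sup>2)) \<partial>M n) =
       (CLINT \<omega>|M n. CLINT g|?P. iexp (\<Sum>i<k. r * (X n i \<omega> + a n i) * g i))"
      unfolding integral_complex_of_real[symmetric] split ..
    also have "\<dots> = (CLINT g|?P. CLINT \<omega>|M n. iexp (\<Sum>i<k. r * (X n i \<omega> + a n i) * g i))"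
      using Fubini_integral[OF int] by simp
    also have "\<dots> = (CLINT g|?P. iexp (\<Sum>i<k. r * a n i * g i) * \<phi> n g)"
    proof (intro Bochner_Integration.integral_cong refl)
      fix g :: "nat \<Rightarrow> real"
      have "iexp (\<Sum>i<k. r * (X n i \<omega> + a n i) * g i) = iexp (\<Sum>i<k. r * a n i * g i) * iexp (\<Sum>i<k. r * g i * X n i \<omega>)" for \<omega>
        by (simp add: exp_add[symmetric] algebra_simps sum.distrib)
      then show "(CLINT \<omega>|M n. iexp (\<Sum>i<k. r * (X n i \<omega> + a n i) * g i)) = iexp (\<Sum>i<k. r * a n i * g i) * \<phi> n g"
        unfolding \<phi>_def by simp
    qed
    finally show "complex_of_real (\<integral>\<omega>. exp (- s * (\<Sum>i<k. (X n i \<omega> + a n i)\<^sup>2)) \<partial>M n) =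
      (CLINT g|?P. iexp (\<Sum>i<k. r * a n i * g i) * \<phi> n g)" .
    show "\<phi> n \<in> borel_measurable ?P" unfolding \<phi>_def
      by (rule Mn.borel_measurable_lebesgue_integral) (simp add: case_prod_beta)
    have "norm (\<phi> n g) \<le> (\<integral>\<omega>. norm (iexp (\<Sum>i<k. r * g i * X n i \<omega>)) \<partial>M n)"
      unfolding \<phi>_def by (rule integral_norm_bound)
    then show "norm (\<phi> n g) \<le> 1" by (simp add: Mn.prob_space)
  qed
  \<comment> \<open>Convergence of \<open>\<phi> n g\<close> for each fixed \<open>g\<close> is
    enough, since everything is bounded by one.\<close>
  have "(\<lambda>n. CLINT g|?P. iexp (\<Sum>i<k. r * a n i * g i) * \<phi> n g) \<longlonglongrightarrow>
      (CLINT g|?P. iexp (\<Sum>i<k. r * a' i * g i) * complex_of_real (exp (- (\<Sum>i<k. (r * g i)\<^sup>2) / 2)))"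
  proof (rule integral_dominated_convergence[where w = "\<lambda>_. 1"])
    have sm[measurable]: "(\<lambda>g. \<Sum>i<k. r * c i * g i) \<in> borel_measurable ?P" for c :: "nat \<Rightarrow> real"
      by (intro borel_measurable_sum) auto
    have [measurable]: "(\<lambda>g. \<Sum>i<k. (r * g i)\<^sup>2) \<in> borel_measurable ?P"
      by (intro borel_measurable_sum) auto
    note \<phi>m[measurable]
    show "(\<lambda>g. iexp (\<Sum>i<k. r * a' i * g i) * complex_of_real (exp (- (\<Sum>i<k. (r * g i)\<^sup>2) / 2))) \<in> borel_measurable ?P"
      by measurable
    show "(\<lambda>g. iexp (\<Sum>i<k. r * a n i * g i) * \<phi> n g) \<in> borel_measurable ?P" for n by measurable
    have "(\<lambda>n. \<phi> n g) \<longlonglongrightarrow> complex_of_real (exp (- (\<Sum>i<k. (r * g i)\<^sup>2) / 2))" for g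
      unfolding \<phi>_def by (rule cf)
    moreover have "(\<lambda>n. iexp (\<Sum>i<k. r * a n i * g i)) \<longlonglongrightarrow> iexp (\<Sum>i<k. r * a' i * g i)" for g :: "nat \<Rightarrow> real"
      by (intro tendsto_intros a) auto
    ultimately show "AE g in ?P. (\<lambda>n. iexp (\<Sum>i<k. r * a n i * g i) * \<phi> n g) \<longlonglongrightarrow>
        iexp (\<Sum>i<k. r * a' i * g i) * complex_of_real (exp (- (\<Sum>i<k. (r * g i)\<^sup>2) / 2))"
      by (intro AE_I2 tendsto_mult)
    show "AE g in ?P. norm (iexp (\<Sum>i<k. r * a n i * g i) * \<phi> n g) \<le> 1" for n
      by (auto simp: norm_mult intro!: \<phi>1)
  qed auto
  also have "(CLINT g|?P. iexp (\<Sum>i<k. r * a' i * g i) * complex_of_real (exp (- (\<Sum>i<k. (r * g i)\<^sup>2) / 2))) =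
     (CLINT g|?P. \<Prod>i<k. iexp (r * a' i * g i) * complex_of_real (exp (- s * (g i)\<^sup>2)))"
  proof (intro Bochner_Integration.integral_cong refl)
    fix g :: "nat \<Rightarrow> real"
    have "- (\<Sum>i<k. (r * g i)\<^sup>2) / 2 = (\<Sum>i<k. - s * (g i)\<^sup>2)"
      by (simp add: power_mult_distrib r2 sum_distrib_left sum_negf sum_divide_distrib)
    then show "iexp (\<Sum>i<k. r * a' i * g i) * complex_of_real (exp (- (\<Sum>i<k. (r * g i)\<^sup>2) / 2)) =
       (\<Prod>i<k. iexp (r * a' i * g i) * complex_of_real (exp (- s * (g i)\<^sup>2)))"
      by (simp only: prod.distrib of_real_prod[symmetric] exp_sum[OF finite_lessThan, symmetric] of_real_sum sum_distrib_left)
  qed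
  also have "\<dots> = complex_of_real ((1 / sqrt (1 + 2 * s)) ^ k * exp (- (\<Sum>i<k. (r * a' i)\<^sup>2) / (2 * (1 + 2 * s))))"
    by (rule fourier[OF s])
  also have "- (\<Sum>i<k. (r * a' i)\<^sup>2) / (2 * (1 + 2 * s)) = - s * (\<Sum>i<k. (a' i)\<^sup>2) / (1 + 2 * s)"
    using s by (simp add: power_mult_distrib r2 sum_distrib_left[symmetric] field_simps)
  finally show ?thesis unfolding eq[symmetric] by (rule tendsto_of_real_iff[THEN iffD1])
qed

text \<open>Laplace transforms give the limit of expectations of continuous functions of
  \<open>T\<close>. The piecewise linear steps \<open>cts_step\<close> are Lipschitz, so for them
  the limit carries over to \<open>T'\<close>, and they suffice for weak convergence.\<close>

lemma laplace_conv_imp_cdf_conv: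
  fixes T T' :: "nat \<Rightarrow> 'w \<Rightarrow> real" and M :: "nat \<Rightarrow> 'w measure"
  assumes M: "\<And>n. prob_space (M n)" and T[measurable]: "\<And>n. T n \<in> borel_measurable (M n)"
    and T0: "\<And>n. AE \<omega> in M n. 0 \<le> T n \<omega>"
    and L: "real_distribution L" and L0: "AE t in L. 0 \<le> t"
    and lap: "\<And>k::nat. (\<lambda>n. \<integral>\<omega>. exp (- real k * T n \<omega>) \<partial>M n) \<longlonglongrightarrow> (\<integral>t. exp (- real k * t) \<partial>L)"
    and T'[measurable]: "\<And>n. T' n \<in> borel_measurable (M n)"
    and diff: "\<And>e. 0 < e \<Longrightarrow> (\<lambda>n. measure (M n) {\<omega> \<in> space (M n). e < \<bar>T' n \<omega> - T n \<omega>\<bar>}) \<longlonglongrightarrow> 0"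
    and u: "isCont (cdf L) u"
  shows "(\<lambda>n. measure (M n) {\<omega> \<in> space (M n). T' n \<omega> \<le> u}) \<longlonglongrightarrow> cdf L u"
proof -
  interpret L: real_distribution L by (rule L)
  have stepm[measurable]: "cts_step a b \<in> borel_measurable borel" for a b
    unfolding cts_step_def[abs_def] by measurable
  have step01: "0 \<le> cts_step a b t" "cts_step a b t \<le> 1" if "a < b" for a b t
    using that by (auto simp: cts_step_def)
  have lip: "\<bar>cts_step a b s - cts_step a b t\<bar> \<le> \<bar>s - t\<bar> / (b - a)" if "a < b" for a b s t
    using that by (auto simp: cts_step_def divide_simps abs_if)
  have conv: "(\<lambda>n. \<integral>\<omega>. cts_step a b (T n \<omega>) \<partial>M n) \<longlonglongrightarrow> (\<integral>t. cts_step a b t \<partial>L)" if ab: "a < b" for a b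
  proof -
    \<comment> \<open>The step as a function of \<open>y = exp (- t)\<close>. Cutting
      \<open>y\<close> below at \<open>exp (- b)\<close> makes it continuous on the whole line and
      changes no value, as the step is zero beyond \<open>b\<close>.\<close>
    define f where "f y = cts_step a b (- ln (max y (exp (- b))))" for y
    have f: "f (exp (- t)) = cts_step a b t" for t
    proof (cases "t \<le> b")
      case True then show ?thesis by (simp add: f_def max_absorb1)
    next
      case False then show ?thesis using ab by (simp add: f_def max_absorb2 cts_step_def)
    qed
    have pos: "max y (exp (- b)) \<noteq> 0" for y :: real by (metis exp_gt_zero less_max_iff_disj order_less_irrefl)
    have "continuous_on UNIV f" unfolding f_def
      by (rule continuous_on_compose2[OF uniformly_continuous_imp_continuous[OF cts_step_uniformly_continuous[OF ab]]])
        (use pos in \<open>auto intro!: continuous_on_minus continuous_on_ln continuous_on_max continuous_on_id continuous_on_const\<close>)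
    moreover have "\<bar>f y\<bar> \<le> 1" for y using step01[OF ab] by (simp add: f_def)
    ultimately have "(\<lambda>n. \<integral>\<omega>. f (exp (- T n \<omega>)) \<partial>M n) \<longlonglongrightarrow> (\<integral>t. f (exp (- t)) \<partial>L)"
      by (intro laplace_conv_imp_integral_conv[OF M T T0 _ _ L0 lap]) (auto simp: L.prob_space_axioms)
    then show ?thesis by (simp add: f)
  qed
  have conv': "(\<lambda>n. \<integral>\<omega>. cts_step a b (T' n \<omega>) \<partial>M n) \<longlonglongrightarrow> (\<integral>t. cts_step a b t \<partial>L)" if ab: "a < b" for a b
  proof (rule Lim_transform[OF conv[OF ab]], rule LIMSEQ_I)
    fix r :: real assume r: "0 < r"
    \<comment> \<open>Chosen so that a change of the argument by at most \<open>d\<close> moves the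
      step by at most \<open>r / 2\<close>.\<close>
    define d where "d = r / 2 * (b - a)"
    have d: "0 < d" using r ab by (simp add: d_def)
    obtain N where N: "\<And>n. N \<le> n \<Longrightarrow> measure (M n) {\<omega> \<in> space (M n). d < \<bar>T' n \<omega> - T n \<omega>\<bar>} < r / 2"
      using LIMSEQ_D[OF diff[OF d], of "r/2"] r by auto
    have "norm ((\<integral>\<omega>. cts_step a b (T' n \<omega>) \<partial>M n) - (\<integral>\<omega>. cts_step a b (T n \<omega>) \<partial>M n)) < r" if n: "N \<le> n" for n
    proof -
      interpret Mn: prob_space "M n" by (rule M)
      let ?B = "{\<omega> \<in> space (M n). d < \<bar>T' n \<omega> - T n \<omega>\<bar>}"
      have B: "?B \<in> sets (M n)" by measurable
      have i: "integrable (M n) (\<lambda>\<omega>. cts_step a b (X \<omega>))" if "X \<in> borel_measurable (M n)" for X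
        by (rule Mn.integrable_const_bound[of _ 1]) (use step01[OF ab] that in auto)
      have "\<bar>(\<integral>\<omega>. cts_step a b (T' n \<omega>) \<partial>M n) - (\<integral>\<omega>. cts_step a b (T n \<omega>) \<partial>M n)\<bar>
        \<le> (\<integral>\<omega>. \<bar>cts_step a b (T' n \<omega>) - cts_step a b (T n \<omega>)\<bar> \<partial>M n)"
        by (subst Bochner_Integration.integral_diff[symmetric, OF i[OF T'] i[OF T]]) (rule integral_abs_bound)
      also have "\<dots> \<le> (\<integral>\<omega>. r / 2 + indicator ?B \<omega> \<partial>M n)"
      proof (intro integral_mono)
        fix \<omega> assume \<omega>: "\<omega> \<in> space (M n)"
        show "\<bar>cts_step a b (T' n \<omega>) - cts_step a b (T n \<omega>)\<bar> \<le> r / 2 + indicator ?B \<omega>"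
        proof (cases "\<omega> \<in> ?B")
          case True then show ?thesis using step01[OF ab, of "T' n \<omega>"] step01[OF ab, of "T n \<omega>"] r by auto
        next
          case False
          then have "\<bar>T' n \<omega> - T n \<omega>\<bar> / (b - a) \<le> r / 2" using \<omega> ab by (auto simp: d_def field_simps)
          then have "\<bar>cts_step a b (T' n \<omega>) - cts_step a b (T n \<omega>)\<bar> \<le> r / 2"
            using lip[OF ab, of "T' n \<omega>" "T n \<omega>"] by linarith
          then show ?thesis using False by simp
        qed
      next
        show "integrable (M n) (\<lambda>\<omega>. r / 2 + indicator ?B \<omega>)"
          by (intro Bochner_Integration.integrable_add integrable_real_indicator B) (simp_all add: less_top[symmetric])
      qed (use i[OF T'] i[OF T] in auto)
      also have "\<dots> = r / 2 + measure (M n) ?B"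
      proof -
        have "integrable (M n) (indicator ?B :: _ \<Rightarrow> real)"
          by (intro integrable_real_indicator B) (simp add: less_top[symmetric])
        moreover have "?B \<inter> space (M n) = ?B" by auto
        ultimately show ?thesis
          by (subst Bochner_Integration.integral_add) (simp_all add: Mn.prob_space)
      qed
      finally show ?thesis using N[OF n] by simp
    qed
    then show "\<exists>N. \<forall>n\<ge>N. norm ((\<integral>\<omega>. cts_step a b (T' n \<omega>) \<partial>M n) - (\<integral>\<omega>. cts_step a b (T n \<omega>) \<partial>M n) - 0) < r"
      by auto
  qed
  have "weak_conv_m (\<lambda>n. distr (M n) borel (T' n)) L"
  proof (rule integral_cts_step_conv_imp_weak_conv)
    show "real_distribution (distr (M n) borel (T' n))" for n
      using M T' by (rule prob_space.real_distribution_distr)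
    show "(\<lambda>n. integral\<^sup>L (distr (M n) borel (T' n)) (cts_step x y)) \<longlonglongrightarrow> integral\<^sup>L L (cts_step x y)" if "x < y" for x y
      using conv'[OF that] by (simp add: integral_distr)
  qed (rule L)
  then have "(\<lambda>n. cdf (distr (M n) borel (T' n)) u) \<longlonglongrightarrow> cdf L u"
    using u by (simp add: weak_conv_m_def weak_conv_def)
  moreover have "cdf (distr (M n) borel (T' n)) u = measure (M n) {\<omega> \<in> space (M n). T' n \<omega> \<le> u}" for n
    unfolding cdf_def by (subst measure_distr) (auto intro!: arg_cong[where f = "measure _"])
  ultimately show ?thesis by simp
qed

text \<open>Polya's theorem: convergence at finitely many quantiles of the continuous limit, and
  monotonicity between them.\<close>

lemma monotone_conv_imp_uniform_conv:
  fixes F :: "nat \<Rightarrow> real \<Rightarrow> real" and G :: "real \<Rightarrow> real"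
  assumes mono: "\<And>n. mono (F n)" and F01: "\<And>n u. 0 \<le> F n u" "\<And>n u. F n u \<le> 1"
    and conv: "\<And>u. (\<lambda>n. F n u) \<longlonglongrightarrow> G u"
    and G: "continuous_on UNIV G" "(G \<longlongrightarrow> 0) at_bot" "(G \<longlongrightarrow> 1) at_top" and e: "0 < e"
  shows "\<forall>\<^sub>F n in sequentially. \<forall>u. \<bar>F n u - G u\<bar> < e"
proof -
  have Gm: "G u \<le> G v" if "u \<le> v" for u v
    by (rule LIMSEQ_le[OF conv conv]) (use mono that in \<open>auto simp: mono_def\<close>)
  have G0: "0 \<le> G u" for u by (rule LIMSEQ_le_const[OF conv]) (use F01 in auto)
  have G1: "G u \<le> 1" for u by (rule LIMSEQ_le_const2[OF conv]) (use F01 in auto)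
  \<comment> \<open>Neighbouring quantile levels differ by less than \<open>e / 4\<close>, so two
    gaps and an error \<open>e / 2\<close> at the quantiles stay below \<open>e\<close>.\<close>
  obtain K :: nat where K: "4 / e < real K" using reals_Archimedean2 by blast
  have K0: "0 < K" using K e by (metis divide_pos_pos gr0I of_nat_0 order_less_asym zero_less_numeral)
  have quant: "\<exists>u. G u = real i / real K" if "0 < i" "i < K" for i
  proof -
    have q: "0 < real i / real K" "real i / real K < 1" using that by auto
    obtain a where a: "G a < real i / real K"
      using order_tendstoD(2)[OF G(2) q(1)] eventually_happens'[OF trivial_limit_at_bot_linorder] by blast
    obtain b where b: "real i / real K < G b"
      using order_tendstoD(1)[OF G(3) q(2)] eventually_happens'[OF trivial_limit_at_top_linorder] by blast
    have "a \<le> b" using a b Gm[of b a] by (meson le_cases less_trans not_le)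
    then show ?thesis
      using IVT'[of G a "real i / real K" b] a b continuous_on_subset[OF G(1)] by (metis less_imp_le subset_UNIV)
  qed
  then obtain q where q: "\<And>i. 0 < i \<Longrightarrow> i < K \<Longrightarrow> G (q i) = real i / real K" by metis
  have "\<forall>\<^sub>F n in sequentially. \<forall>i\<in>{..<K}. \<bar>F n (q i) - G (q i)\<bar> < e / 2"
  proof (rule eventually_ball_finite[OF finite_lessThan], rule ballI)
    fix i
    show "\<forall>\<^sub>F n in sequentially. \<bar>F n (q i) - G (q i)\<bar> < e / 2"
      using tendstoD[OF conv[of "q i"], of "e/2"] e by (simp add: dist_real_def)
  qed
  then show ?thesis
  proof (rule eventually_mono, intro allI)
    fix n u assume n: "\<forall>i\<in>{..<K}. \<bar>F n (q i) - G (q i)\<bar> < e / 2"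
    define i where "i = nat \<lfloor>G u * real K\<rfloor>"
    have i: "real i \<le> G u * real K" "G u * real K < real i + 1"
      using G0[of u] by (simp_all add: i_def)
    have Ke: "1 / real K < e / 4" using K e K0 by (simp add: field_simps)
    have iG: "real i / real K \<le> G u" "G u < real (Suc i) / real K" using i K0 by (simp_all add: field_simps)
    have S: "real (Suc i) / real K = real i / real K + 1 / real K" by (simp add: add_divide_distrib)
    have up: "F n u \<le> real (Suc i) / real K + e / 2"
    proof (cases "Suc i < K")
      case True
      have "u \<le> q (Suc i)"
      proof (rule ccontr)
        assume "\<not> u \<le> q (Suc i)"
        then have "G (q (Suc i)) \<le> G u" by (intro Gm) simp
        then show False using q[of "Suc i"] True iG by simp
      qed
      then have "F n u \<le> F n (q (Suc i))" using mono by (simp add: mono_def)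
      moreover have "\<bar>F n (q (Suc i)) - G (q (Suc i))\<bar> < e / 2" using n True by auto
      ultimately show ?thesis using q[of "Suc i"] True by linarith
    next
      case False
      then have "1 \<le> real (Suc i) / real K" using K0 by (simp add: field_simps)
      then show ?thesis using F01(2)[of n u] e by simp
    qed
    have iK: "i \<le> K"
    proof -
      have "G u * real K \<le> real K" using G1[of u] by (simp add: mult_left_le_one_le G0)
      then show ?thesis using i by simp
    qed
    have S': "(real i - 1) / real K = real i / real K - 1 / real K" by (simp add: diff_divide_distrib)
    \<comment> \<open>The quantile of index \<open>i - 1\<close> is used because
      \<open>G (q i) \<le> G u\<close> does not force \<open>q i \<le> u\<close> when the two values
      are equal; a strict inequality does.\<close>
    have lo: "(real i - 1) / real K - e / 2 \<le> F n u"
    proof (cases "2 \<le> i")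
      case True
      then have j: "0 < i - 1" "i - 1 < K" "real (i - 1) = real i - 1" using iK by auto
      have Gq: "G (q (i - 1)) = (real i - 1) / real K" using q[OF j(1,2)] j(3) by simp
      have "q (i - 1) \<le> u"
      proof (rule ccontr)
        assume "\<not> q (i - 1) \<le> u"
        then have "G u \<le> G (q (i - 1))" by (intro Gm) simp
        moreover have "0 < 1 / real K" using K0 by simp
        ultimately show False using Gq iG(1) S' by linarith
      qed
      then have "F n (q (i - 1)) \<le> F n u" using mono by (simp add: mono_def)
      moreover have "\<bar>F n (q (i - 1)) - G (q (i - 1))\<bar> < e / 2" using n j by auto
      ultimately show ?thesis unfolding Gq by linarith
    next
      case False
      then have "(real i - 1) / real K \<le> 0" by (intro divide_nonpos_nonneg) auto
      then show ?thesis using F01(1)[of n u] e by linarith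
    qed
    show "\<bar>F n u - G u\<bar> < e" using up lo iG Ke unfolding S S' abs_less_iff by linarith
  qed
qed

section \<open>The Pearson statistic as a quadratic form\<close>

definition orthonormal :: "'a set \<Rightarrow> (nat \<Rightarrow> 'a \<Rightarrow> real) \<Rightarrow> nat \<Rightarrow> bool"
  where "orthonormal J u k \<longleftrightarrow> (\<forall>i<k. \<forall>i'<k. (\<Sum>j\<in>J. u i j * u i' j) = (if i = i' then 1 else 0))"

text \<open>\<open>r\<close> is the \<open>j\<close>-th coordinate vector minus its projection onto
  the span of the \<open>u i\<close>; Pythagoras gives its length.\<close>

lemma orthonormal_residual:
  fixes u :: "nat \<Rightarrow> 'a \<Rightarrow> real"
  assumes J: "finite J" and u: "orthonormal J u k" and j: "j \<in> J"
  defines "r \<equiv> \<lambda>l. (if l = j then 1 else 0) - (\<Sum>i<k. u i j * u i l)"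
  shows "i < k \<Longrightarrow> (\<Sum>l\<in>J. r l * u i l) = 0" and "(\<Sum>l\<in>J. (r l)\<^sup>2) = 1 - (\<Sum>i<k. (u i j)\<^sup>2)"
proof -
  have d: "(\<Sum>l\<in>J. (if l = j then 1 else 0) * f l) = f j" for f :: "'a \<Rightarrow> real"
  proof -
    have "(\<Sum>l\<in>J. (if l = j then 1 else 0) * f l) = (\<Sum>l\<in>J. if l = j then f l else 0)"
      by (intro sum.cong) auto
    then show ?thesis using J j by simp
  qed
  have o: "(\<Sum>l\<in>J. (\<Sum>i'<k. u i' j * u i' l) * u i l) = u i j" if "i < k" for i
  proof -
    have "(\<Sum>l\<in>J. (\<Sum>i'<k. u i' j * u i' l) * u i l) = (\<Sum>i'<k. u i' j * (\<Sum>l\<in>J. u i' l * u i l))"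
      unfolding sum_distrib_right sum_distrib_left by (subst sum.swap) (simp add: mult.assoc)
    also have "\<dots> = (\<Sum>i'<k. if i' = i then u i' j else 0)"
      using u that by (intro sum.cong) (auto simp: orthonormal_def)
    finally show ?thesis using that by simp
  qed
  show 1: "(\<Sum>l\<in>J. r l * u i l) = 0" if "i < k" for i
    unfolding r_def left_diff_distrib sum_subtractf d o[OF that] by simp
  have "(\<Sum>l\<in>J. (r l)\<^sup>2) = (\<Sum>l\<in>J. (if l = j then 1 else 0) * r l) - (\<Sum>l\<in>J. \<Sum>i<k. u i j * (r l * u i l))"
    unfolding sum_subtractf[symmetric] power2_eq_square
  proof (intro sum.cong refl)
    fix l
    have "r l * r l = ((if l = j then 1 else 0) - (\<Sum>i<k. u i j * u i l)) * r l" by (simp only: r_def)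
    also have "\<dots> = (if l = j then 1 else 0) * r l - (\<Sum>i<k. u i j * u i l) * r l" by (rule left_diff_distrib)
    also have "(\<Sum>i<k. u i j * u i l) * r l = (\<Sum>i<k. u i j * (r l * u i l))"
      unfolding sum_distrib_right by (intro sum.cong) (auto simp: mult_ac)
    finally show "r l * r l = (if l = j then 1 else 0) * r l - (\<Sum>i<k. u i j * (r l * u i l))" .
  qed
  also have "(\<Sum>l\<in>J. \<Sum>i<k. u i j * (r l * u i l)) = 0"
    by (subst sum.swap) (simp add: sum_distrib_left[symmetric] 1)
  finally show "(\<Sum>l\<in>J. (r l)\<^sup>2) = 1 - (\<Sum>i<k. (u i j)\<^sup>2)"
    unfolding d by (simp add: r_def power2_eq_square)
qed

lemma orthonormal_trace:
  assumes "orthonormal J u k"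
  shows "(\<Sum>j\<in>J. \<Sum>i<k. (u i j)\<^sup>2) = real k"
  using assms by (subst sum.swap) (simp add: orthonormal_def power2_eq_square)

text \<open>With as many vectors as coordinates, the squared lengths of the residuals are
  nonnegative and, by the trace, add up to zero. So every coordinate vector lies in the span, which
  means that the columns are orthonormal too.\<close>

lemma orthonormal_parseval:
  fixes u :: "nat \<Rightarrow> 'a \<Rightarrow> real"
  assumes J: "finite J" and u: "orthonormal J u (card J)"
  shows "(\<Sum>i<card J. (\<Sum>j\<in>J. u i j * x j)\<^sup>2) = (\<Sum>j\<in>J. (x j)\<^sup>2)"
proof -
  let ?r = "\<lambda>j l. (if l = j then 1 else 0) - (\<Sum>i<card J. u i j * u i l)"
  have n: "(\<Sum>l\<in>J. (?r j l)\<^sup>2) = 1 - (\<Sum>i<card J. (u i j)\<^sup>2)" if "j \<in> J" for j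
    by (rule orthonormal_residual(2)[OF J u that])
  have "(\<Sum>j\<in>J. 1 - (\<Sum>i<card J. (u i j)\<^sup>2)) = 0"
    using orthonormal_trace[OF u] by (simp add: sum_subtractf)
  then have "(\<Sum>j\<in>J. \<Sum>l\<in>J. (?r j l)\<^sup>2) = 0" using n by simp
  then have "\<forall>j\<in>J. (\<Sum>l\<in>J. (?r j l)\<^sup>2) = 0"
    by (subst (asm) sum_nonneg_eq_0_iff[OF J]) (auto intro!: sum_nonneg)
  then have "\<forall>j\<in>J. \<forall>l\<in>J. (?r j l)\<^sup>2 = 0"
    using sum_nonneg_eq_0_iff[OF J] by (metis (no_types, lifting) zero_le_power2)
  then have id: "(\<Sum>i<card J. u i j * u i l) = (if l = j then 1 else 0)" if "j \<in> J" "l \<in> J" for j l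
  proof -
    have "(?r j l)\<^sup>2 = 0" using \<open>\<forall>j\<in>J. \<forall>l\<in>J. (?r j l)\<^sup>2 = 0\<close> that by blast
    then have "?r j l = 0" by (simp only: zero_eq_power2)
    then show ?thesis by (simp only: right_minus_eq)
  qed
  have "(\<Sum>i<card J. (\<Sum>j\<in>J. u i j * x j)\<^sup>2) = (\<Sum>i<card J. \<Sum>j\<in>J. \<Sum>l\<in>J. x j * x l * (u i j * u i l))"
    unfolding power2_eq_square sum_product by (simp add: mult_ac)
  also have "\<dots> = (\<Sum>j\<in>J. \<Sum>l\<in>J. x j * x l * (\<Sum>i<card J. u i j * u i l))"
    unfolding sum_distrib_left by (subst sum.swap, rule sum.cong[OF refl], subst sum.swap) simp
  also have "\<dots> = (\<Sum>j\<in>J. \<Sum>l\<in>J. if l = j then x j * x l else 0)"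
    by (intro sum.cong refl) (simp add: id)
  also have "\<dots> = (\<Sum>j\<in>J. (x j)\<^sup>2)" using J by (simp add: power2_eq_square)
  finally show ?thesis .
qed

text \<open>One Gram-Schmidt step at a time: as long as the trace is smaller than the dimension,
  some coordinate vector has a nonzero residual.\<close>

lemma orthonormal_extend:
  fixes u :: "nat \<Rightarrow> 'a \<Rightarrow> real"
  assumes J: "finite J" and u: "orthonormal J u k" and k: "k \<le> card J"
  obtains v where "orthonormal J v (card J)" "\<And>i. i < k \<Longrightarrow> v i = u i"
proof -
  have "\<exists>v. orthonormal J v (k + d) \<and> (\<forall>i<k. v i = u i)" if "k + d \<le> card J" for d
    using that
  proof (induction d)
    case 0 then show ?case using u by auto
  next
    case (Suc d)
    then obtain v where v: "orthonormal J v (k + d)" "\<forall>i<k. v i = u i" by auto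
    let ?K = "k + d"
    have "\<exists>j\<in>J. (\<Sum>i<?K. (v i j)\<^sup>2) < 1"
    proof (rule ccontr)
      assume "\<not> ?thesis"
      then have "(\<Sum>j\<in>J. 1) \<le> (\<Sum>j\<in>J. \<Sum>i<?K. (v i j)\<^sup>2)" by (intro sum_mono) auto
      then show False using orthonormal_trace[OF v(1)] Suc.prems by simp
    qed
    then obtain j where j: "j \<in> J" "(\<Sum>i<?K. (v i j)\<^sup>2) < 1" by auto
    define r where "r l = (if l = j then 1 else 0) - (\<Sum>i<?K. v i j * v i l)" for l
    define N where "N = sqrt (\<Sum>l\<in>J. (r l)\<^sup>2)"
    have r: "(\<Sum>l\<in>J. r l * v i l) = 0" if "i < ?K" for i
      unfolding r_def by (rule orthonormal_residual(1)[OF J v(1) j(1) that])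
    have "(\<Sum>l\<in>J. (r l)\<^sup>2) = 1 - (\<Sum>i<?K. (v i j)\<^sup>2)"
      unfolding r_def by (rule orthonormal_residual(2)[OF J v(1) j(1)])
    then have N: "0 < N" "(\<Sum>l\<in>J. (r l)\<^sup>2) = N\<^sup>2" using j(2) by (auto simp: N_def)
    define v' where "v' = v(?K := (\<lambda>l. r l / N))"
    have 1: "(\<Sum>l\<in>J. r l / N * v i l) = 0" "(\<Sum>l\<in>J. v i l * (r l / N)) = 0" if "i < ?K" for i
      using r[OF that] by (simp_all add: sum_divide_distrib[symmetric] mult.commute)
    have 2: "(\<Sum>l\<in>J. r l / N * (r l / N)) = 1"
      using N by (simp add: sum_divide_distrib[symmetric] power2_eq_square)
    have "orthonormal J v' (k + Suc d)"
      unfolding orthonormal_def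
    proof (intro allI impI)
      fix i i' assume "i < k + Suc d" "i' < k + Suc d"
      then show "(\<Sum>l\<in>J. v' i l * v' i' l) = (if i = i' then 1 else 0)"
        using 1[of i] 1[of i'] 2 v(1) by (cases "i = ?K"; cases "i' = ?K") (auto simp: v'_def orthonormal_def)
    qed
    moreover have "\<forall>i<k. v' i = u i" using v(2) by (auto simp: v'_def)
    ultimately show ?case by blast
  qed
  from this[of "card J - k"] k that show thesis by auto
qed

lemma null_mult_bounded:
  fixes a b :: "nat \<Rightarrow> real"
  assumes "\<And>i. \<bar>a i\<bar> \<le> K" "b \<longlonglongrightarrow> 0"
  shows "(\<lambda>i. a i * b i) \<longlonglongrightarrow> 0"
proof (rule tendsto_0_le[OF assms(2), of _ K])
  show "\<forall>\<^sub>F i in sequentially. norm (a i * b i) \<le> norm (b i) * K"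
    using assms(1) by (auto simp: abs_mult mult.commute[of "\<bar>b _\<bar>"] intro!: mult_right_mono always_eventually)
qed

text \<open>Eliminating \<open>T = sqrt n (\<theta> - \<theta>\<^sub>0)\<close> from the scale equation projects the normalized
  counts onto the orthogonal complement of \<open>b\<close>.\<close>

lemma pearson_expansion:
  fixes P :: "nat \<Rightarrow> real \<Rightarrow> real" and P' :: "nat \<Rightarrow> real \<Rightarrow> real" and \<theta>\<^sub>0 K e :: real
  assumes \<theta>0: "0 < \<theta>\<^sub>0"
    and P': "\<And>j \<theta>. j \<in> J \<Longrightarrow> 0 < \<theta> \<Longrightarrow> (P j has_real_derivative P' j \<theta>) (at \<theta>)"
    and P'c: "\<And>j. j \<in> J \<Longrightarrow> isCont (P' j) \<theta>\<^sub>0"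
    and Pp: "\<And>j \<theta>. j \<in> J \<Longrightarrow> 0 < \<theta> \<Longrightarrow> 0 < P j \<theta>"
    and P'0: "\<And>\<theta>. 0 < \<theta> \<Longrightarrow> (\<Sum>j\<in>J. P' j \<theta>) = 0"
    and J: "finite J" and B: "0 < (\<Sum>j\<in>J. (P' j \<theta>\<^sub>0)\<^sup>2 / P j \<theta>\<^sub>0)" and e: "0 < e"
  shows "\<exists>N0. \<forall>n\<ge>N0. \<forall>\<nu> \<theta>. 0 < \<theta> \<longrightarrow> (\<forall>j\<in>J. \<bar>\<nu> j - real n * P j \<theta>\<^sub>0\<bar> \<le> K * sqrt n) \<longrightarrow>
     \<bar>sqrt n * (\<theta> - \<theta>\<^sub>0)\<bar> \<le> K \<longrightarrow> (\<Sum>j\<in>J. \<nu> j / P j \<theta> * P' j \<theta>) = 0 \<longrightarrow>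
     \<bar>(\<Sum>j\<in>J. (\<nu> j - n * P j \<theta>)\<^sup>2 / (n * P j \<theta>)) -
       ((\<Sum>j\<in>J. ((\<nu> j - n * P j \<theta>\<^sub>0) / sqrt n)\<^sup>2 / P j \<theta>\<^sub>0) -
        (\<Sum>j\<in>J. (\<nu> j - n * P j \<theta>\<^sub>0) / sqrt n * (P' j \<theta>\<^sub>0 / P j \<theta>\<^sub>0))\<^sup>2 / (\<Sum>j\<in>J. (P' j \<theta>\<^sub>0)\<^sup>2 / P j \<theta>\<^sub>0))\<bar> < e"
\<comment> \<open>A failure would give counterexamples with arbitrarily large \<open>n\<close>.
  Along such a sequence the uniform estimates become ordinary limits.\<close>
proof (rule ccontr)
  define Bq where "Bq = (\<Sum>j\<in>J. (P' j \<theta>\<^sub>0)\<^sup>2 / P j \<theta>\<^sub>0)"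
  define Bad where "Bad i n \<nu> \<theta> \<longleftrightarrow> i \<le> n \<and> 0 < \<theta> \<and> (\<forall>j\<in>J. \<bar>\<nu> j - real n * P j \<theta>\<^sub>0\<bar> \<le> K * sqrt n) \<and>
     \<bar>sqrt n * (\<theta> - \<theta>\<^sub>0)\<bar> \<le> K \<and> (\<Sum>j\<in>J. \<nu> j / P j \<theta> * P' j \<theta>) = 0 \<and>
     e \<le> \<bar>(\<Sum>j\<in>J. (\<nu> j - n * P j \<theta>)\<^sup>2 / (n * P j \<theta>)) -
       ((\<Sum>j\<in>J. ((\<nu> j - n * P j \<theta>\<^sub>0) / sqrt n)\<^sup>2 / P j \<theta>\<^sub>0) -
        (\<Sum>j\<in>J. (\<nu> j - n * P j \<theta>\<^sub>0) / sqrt n * (P' j \<theta>\<^sub>0 / P j \<theta>\<^sub>0))\<^sup>2 / Bq)\<bar>" for i n :: nat and \<nu> \<theta>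
  assume "\<not> ?thesis"
  then have "\<forall>i. \<exists>n \<nu> \<theta>. Bad i n \<nu> \<theta>"
    unfolding Bq_def[symmetric] Bad_def by (simp add: not_less)
  then obtain n \<nu> \<theta> where Bad: "\<And>i. Bad i (n i) (\<nu> i) (\<theta> i)" by metis
  have n: "\<And>i. i \<le> n i" and \<theta>: "\<And>i. 0 < \<theta> i"
    and \<nu>: "\<And>i j. j \<in> J \<Longrightarrow> \<bar>\<nu> i j - real (n i) * P j \<theta>\<^sub>0\<bar> \<le> K * sqrt (n i)"
    and T: "\<And>i. \<bar>sqrt (n i) * (\<theta> i - \<theta>\<^sub>0)\<bar> \<le> K"
    and eq: "\<And>i. (\<Sum>j\<in>J. \<nu> i j / P j (\<theta> i) * P' j (\<theta> i)) = 0"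
    and bad: "\<And>i. e \<le> \<bar>(\<Sum>j\<in>J. (\<nu> i j - n i * P j (\<theta> i))\<^sup>2 / (n i * P j (\<theta> i))) -
       ((\<Sum>j\<in>J. ((\<nu> i j - n i * P j \<theta>\<^sub>0) / sqrt (n i))\<^sup>2 / P j \<theta>\<^sub>0) -
        (\<Sum>j\<in>J. (\<nu> i j - n i * P j \<theta>\<^sub>0) / sqrt (n i) * (P' j \<theta>\<^sub>0 / P j \<theta>\<^sub>0))\<^sup>2 / Bq)\<bar>"
    using Bad unfolding Bad_def by blast+
  \<comment> \<open>The shift to \<open>Suc i\<close> excludes \<open>n = 0\<close>, so that
    \<open>q\<close> is positive.\<close>
  define q where "q i = sqrt (n (Suc i))" for i
  have nq: "real (n (Suc i)) = q i * q i" for i by (simp add: q_def)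
  have q0: "0 < q i" for i using n[of "Suc i"] by (simp add: q_def)
  have K0: "0 \<le> K" using T[of 0] by linarith
  define t where "t i = \<theta> (Suc i)" for i
  define X where "X j i = (\<nu> (Suc i) j - q i * q i * P j \<theta>\<^sub>0) / q i" for j i
  define Tn where "Tn i = q i * (t i - \<theta>\<^sub>0)" for i
  define Y where "Y j i = (\<nu> (Suc i) j - q i * q i * P j (t i)) / q i" for j i
  define c where "c j s = P' j s / P j s" for j s
  have t0: "0 < t i" for i by (simp add: t_def \<theta>)
  have Xb: "\<bar>X j i\<bar> \<le> K" if "j \<in> J" for j i
    using \<nu>[OF that, of "Suc i"] q0[of i] by (simp add: X_def nq q_def[symmetric] field_simps abs_divide)
  have Tb: "\<bar>Tn i\<bar> \<le> K" for i using T[of "Suc i"] by (simp add: Tn_def t_def q_def)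
  have qinf: "filterlim q at_top sequentially"
    unfolding q_def
    by (rule filterlim_compose[OF sqrt_at_top filterlim_compose[OF filterlim_real_sequentially]])
      (rule filterlim_at_top_mono[OF filterlim_Suc], use n in auto)
  have "(\<lambda>i. Tn i * inverse (q i)) \<longlonglongrightarrow> 0"
    by (rule null_mult_bounded[OF Tb tendsto_inverse_0_at_top[OF qinf]])
  moreover have "Tn i * inverse (q i) = t i - \<theta>\<^sub>0" for i using q0[of i] by (simp add: Tn_def)
  ultimately have tl: "t \<longlonglongrightarrow> \<theta>\<^sub>0" by (simp add: LIM_zero_iff)
  have Pc: "isCont (P j) \<theta>\<^sub>0" if "j \<in> J" for j using P'[OF that \<theta>0] by (rule DERIV_isCont)
  have Pl: "(\<lambda>i. P j (t i)) \<longlonglongrightarrow> P j \<theta>\<^sub>0" if "j \<in> J" for j by (rule isCont_tendsto_compose[OF Pc[OF that] tl])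
  have P'l: "(\<lambda>i. P' j (t i)) \<longlonglongrightarrow> P' j \<theta>\<^sub>0" if "j \<in> J" for j by (rule isCont_tendsto_compose[OF P'c[OF that] tl])
  have P0: "P j \<theta>\<^sub>0 \<noteq> 0" if "j \<in> J" for j using Pp[OF that \<theta>0] by simp
  have cl: "(\<lambda>i. c j (t i)) \<longlonglongrightarrow> c j \<theta>\<^sub>0" if "j \<in> J" for j
    unfolding c_def by (intro tendsto_divide P'l Pl P0 that)
  \<comment> \<open>The error of linearizing \<open>P j\<close> at \<open>\<theta>\<^sub>0\<close>:
    it equals \<open>Tn\<close> times the increment of the Caratheodory slope, which is continuous
    at \<open>\<theta>\<^sub>0\<close>.\<close>
  define W where "W j i = X j i - P' j \<theta>\<^sub>0 * Tn i - Y j i" for j i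
  have W: "W j \<longlonglongrightarrow> 0" if j: "j \<in> J" for j
  proof -
    obtain g where g: "\<And>z. P j z - P j \<theta>\<^sub>0 = g z * (z - \<theta>\<^sub>0)" "isCont g \<theta>\<^sub>0" "g \<theta>\<^sub>0 = P' j \<theta>\<^sub>0"
      using P'[OF j \<theta>0] unfolding CARAT_DERIV by blast
    have "W j i = Tn i * (g (t i) - g \<theta>\<^sub>0)" for i
    proof -
      have "X j i - Y j i = q i * (P j (t i) - P j \<theta>\<^sub>0)" using q0[of i] by (simp add: X_def Y_def field_simps)
      then show ?thesis unfolding W_def g(1) Tn_def g(3) by (simp add: algebra_simps)
    qed
    moreover have "(\<lambda>i. g (t i) - g \<theta>\<^sub>0) \<longlonglongrightarrow> 0"
      using isCont_tendsto_compose[OF g(2) tl] by (simp add: LIM_zero_iff)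
    ultimately show ?thesis using null_mult_bounded[OF Tb] by presburger
  qed
  define V where "V j i = X j i - P' j \<theta>\<^sub>0 * Tn i" for j i
  have Vb: "\<bar>V j i\<bar> \<le> K + \<bar>P' j \<theta>\<^sub>0\<bar> * K" if "j \<in> J" for j i
  proof -
    have "\<bar>P' j \<theta>\<^sub>0 * Tn i\<bar> \<le> \<bar>P' j \<theta>\<^sub>0\<bar> * K" unfolding abs_mult by (intro mult_left_mono Tb) simp
    then show ?thesis using Xb[OF that, of i] unfolding V_def by linarith
  qed
  have YV: "Y j i = V j i - W j i" for j i by (simp add: W_def V_def)
  \<comment> \<open>The scale equation for the centred counts; centring is free because the
    derivatives \<open>P'\<close> add up to zero.\<close>
  have Yc: "(\<Sum>j\<in>J. Y j i * c j (t i)) = 0" for i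
  proof -
    have "(\<Sum>j\<in>J. Y j i * c j (t i)) = (\<Sum>j\<in>J. \<nu> (Suc i) j / P j (t i) * P' j (t i) / q i - q i * P' j (t i))"
    proof (intro sum.cong refl)
      fix j assume "j \<in> J"
      then have "P j (t i) \<noteq> 0" using Pp[OF _ t0] by (metis less_irrefl)
      then show "Y j i * c j (t i) = \<nu> (Suc i) j / P j (t i) * P' j (t i) / q i - q i * P' j (t i)"
        using q0[of i] by (simp add: Y_def c_def field_simps)
    qed
    also have "\<dots> = 0"
      unfolding sum_subtractf sum_divide_distrib[symmetric] sum_distrib_left[symmetric] P'0[OF t0]
      using eq[of "Suc i"] by (simp only: t_def)
    finally show ?thesis .
  qed
  \<comment> \<open>Up to this null sequence, the scale equation says that \<open>Tn\<close> is the
    coefficient of the projection of \<open>X\<close> onto the direction of the derivatives.\<close>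
  define Rn where "Rn i = (\<Sum>j\<in>J. V j i * c j \<theta>\<^sub>0)" for i
  have R: "Rn \<longlonglongrightarrow> 0"
  proof -
    have Rn_eq: "Rn i = (\<Sum>j\<in>J. V j i * (c j \<theta>\<^sub>0 - c j (t i)) + W j i * c j (t i))" for i
    proof -
      have Rn_eq: "Rn i = (\<Sum>j\<in>J. V j i * c j \<theta>\<^sub>0) - (\<Sum>j\<in>J. Y j i * c j (t i))" using Yc by (simp add: Rn_def)
      then show ?thesis unfolding sum_subtractf[symmetric] YV by (simp add: algebra_simps)
    qed
    have "(\<lambda>i. \<Sum>j\<in>J. V j i * (c j \<theta>\<^sub>0 - c j (t i)) + W j i * c j (t i)) \<longlonglongrightarrow> (\<Sum>j\<in>J. 0 + 0 * c j \<theta>\<^sub>0)"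
    proof (intro tendsto_sum tendsto_add tendsto_mult W cl)
      fix j assume j: "j \<in> J"
      have "(\<lambda>i. c j \<theta>\<^sub>0 - c j (t i)) \<longlonglongrightarrow> c j \<theta>\<^sub>0 - c j \<theta>\<^sub>0" by (intro tendsto_intros cl j)
      then show "(\<lambda>i. V j i * (c j \<theta>\<^sub>0 - c j (t i))) \<longlonglongrightarrow> 0"
        using Vb[OF j] by (intro null_mult_bounded) auto
    qed
    then show ?thesis unfolding Rn_eq[symmetric] by simp
  qed
  have chi: "(\<lambda>i. (\<Sum>j\<in>J. (Y j i)\<^sup>2 / P j (t i)) - (\<Sum>j\<in>J. (V j i)\<^sup>2 / P j \<theta>\<^sub>0)) \<longlonglongrightarrow> 0"
  proof -
    have "(\<Sum>j\<in>J. (Y j i)\<^sup>2 / P j (t i)) - (\<Sum>j\<in>J. (V j i)\<^sup>2 / P j \<theta>\<^sub>0) =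
      (\<Sum>j\<in>J. (V j i)\<^sup>2 * (inverse (P j (t i)) - inverse (P j \<theta>\<^sub>0)) - 2 * (V j i * (W j i * inverse (P j (t i)))) + W j i * W j i * inverse (P j (t i)))" for i
      unfolding sum_subtractf[symmetric] YV by (intro sum.cong refl) (simp add: power2_eq_square divide_inverse algebra_simps)
    moreover have "(\<lambda>i. \<Sum>j\<in>J. (V j i)\<^sup>2 * (inverse (P j (t i)) - inverse (P j \<theta>\<^sub>0)) - 2 * (V j i * (W j i * inverse (P j (t i)))) + W j i * W j i * inverse (P j (t i)))
      \<longlonglongrightarrow> (\<Sum>j\<in>J. 0 - 2 * 0 + 0 * 0 * inverse (P j \<theta>\<^sub>0))"
    proof (intro tendsto_sum tendsto_add tendsto_diff tendsto_mult tendsto_const W Pl tendsto_inverse P0)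
      fix j assume j: "j \<in> J"
      have "(\<lambda>i. inverse (P j (t i)) - inverse (P j \<theta>\<^sub>0)) \<longlonglongrightarrow> inverse (P j \<theta>\<^sub>0) - inverse (P j \<theta>\<^sub>0)"
        by (intro tendsto_intros Pl P0 j)
      moreover have "\<bar>(V j i)\<^sup>2\<bar> \<le> (K + \<bar>P' j \<theta>\<^sub>0\<bar> * K)\<^sup>2" for i
        using power_mono[OF Vb[OF j, of i], of 2] by simp
      ultimately show "(\<lambda>i. (V j i)\<^sup>2 * (inverse (P j (t i)) - inverse (P j \<theta>\<^sub>0))) \<longlonglongrightarrow> 0"
        by (intro null_mult_bounded) auto
      have "(\<lambda>i. W j i * inverse (P j (t i))) \<longlonglongrightarrow> 0 * inverse (P j \<theta>\<^sub>0)" by (intro tendsto_intros W Pl P0 j)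
      then show "(\<lambda>i. V j i * (W j i * inverse (P j (t i)))) \<longlonglongrightarrow> 0"
        by (intro null_mult_bounded[OF Vb[OF j]]) simp
    qed
    ultimately show ?thesis by simp
  qed
  have Bq0: "0 < Bq" using B by (simp add: Bq_def)
  \<comment> \<open>Pythagoras with the approximate coefficient \<open>Tn\<close> in place of the
    exact one; the discrepancy is the square of \<open>Rn\<close> over \<open>Bq\<close>.\<close>
  have alg: "(\<Sum>j\<in>J. (V j i)\<^sup>2 / P j \<theta>\<^sub>0) - ((\<Sum>j\<in>J. (X j i)\<^sup>2 / P j \<theta>\<^sub>0) - (\<Sum>j\<in>J. X j i * c j \<theta>\<^sub>0)\<^sup>2 / Bq) = (Rn i)\<^sup>2 / Bq" for i
  proof -
    have cc: "(\<Sum>j\<in>J. P' j \<theta>\<^sub>0 * c j \<theta>\<^sub>0) = Bq" by (simp add: Bq_def c_def power2_eq_square)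
    have Xc: "(\<Sum>j\<in>J. X j i * c j \<theta>\<^sub>0) = Rn i + Tn i * Bq"
      unfolding Rn_def V_def cc[symmetric] by (simp add: algebra_simps sum_subtractf sum_distrib_left)
    have "(\<Sum>j\<in>J. (V j i)\<^sup>2 / P j \<theta>\<^sub>0) = (\<Sum>j\<in>J. (X j i)\<^sup>2 / P j \<theta>\<^sub>0 - 2 * Tn i * (X j i * c j \<theta>\<^sub>0) + (Tn i)\<^sup>2 * (P' j \<theta>\<^sub>0 * c j \<theta>\<^sub>0))"
      by (intro sum.cong refl) (simp add: V_def c_def power2_eq_square field_simps diff_divide_distrib add_divide_distrib)
    also have "\<dots> = (\<Sum>j\<in>J. (X j i)\<^sup>2 / P j \<theta>\<^sub>0) - 2 * Tn i * (Rn i + Tn i * Bq) + (Tn i)\<^sup>2 * Bq"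
      by (simp add: sum.distrib sum_subtractf sum_distrib_left[symmetric] cc Xc)
    finally have V: "(\<Sum>j\<in>J. (V j i)\<^sup>2 / P j \<theta>\<^sub>0) = (\<Sum>j\<in>J. (X j i)\<^sup>2 / P j \<theta>\<^sub>0) - 2 * Tn i * (Rn i + Tn i * Bq) + (Tn i)\<^sup>2 * Bq" .
    have "(Rn i + Tn i * Bq)\<^sup>2 / Bq = (Rn i)\<^sup>2 / Bq + 2 * Tn i * Rn i + (Tn i)\<^sup>2 * Bq"
      using Bq0 by (simp add: power2_eq_square field_simps)
    then show ?thesis unfolding Xc V by (simp add: algebra_simps power2_eq_square)
  qed
  have lim: "(\<lambda>i. (\<Sum>j\<in>J. (Y j i)\<^sup>2 / P j (t i)) - ((\<Sum>j\<in>J. (X j i)\<^sup>2 / P j \<theta>\<^sub>0) - (\<Sum>j\<in>J. X j i * c j \<theta>\<^sub>0)\<^sup>2 / Bq)) \<longlonglongrightarrow> 0"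
  proof -
    have "(\<lambda>i. ((\<Sum>j\<in>J. (Y j i)\<^sup>2 / P j (t i)) - (\<Sum>j\<in>J. (V j i)\<^sup>2 / P j \<theta>\<^sub>0)) + (Rn i)\<^sup>2 / Bq) \<longlonglongrightarrow> 0 + 0\<^sup>2 / Bq"
      by (intro tendsto_intros chi R) (use Bq0 in auto)
    then show ?thesis unfolding alg[symmetric] by (simp add: algebra_simps)
  qed
  have "e \<le> \<bar>(\<Sum>j\<in>J. (Y j i)\<^sup>2 / P j (t i)) - ((\<Sum>j\<in>J. (X j i)\<^sup>2 / P j \<theta>\<^sub>0) - (\<Sum>j\<in>J. X j i * c j \<theta>\<^sub>0)\<^sup>2 / Bq)\<bar>" for i
  proof -
    have "(\<nu> (Suc i) j - q i * q i * P j (t i))\<^sup>2 / (q i * q i * P j (t i)) = (Y j i)\<^sup>2 / P j (t i)" for j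
      using q0[of i] by (simp add: Y_def power_divide power2_eq_square)
    then show ?thesis using bad[of "Suc i"]
      unfolding q_def[symmetric] unfolding t_def[symmetric] nq X_def[symmetric] c_def[symmetric] by simp
  qed
  moreover obtain i where "\<bar>(\<Sum>j\<in>J. (Y j i)\<^sup>2 / P j (t i)) - ((\<Sum>j\<in>J. (X j i)\<^sup>2 / P j \<theta>\<^sub>0) - (\<Sum>j\<in>J. X j i * c j \<theta>\<^sub>0)\<^sup>2 / Bq)\<bar> < e"
    using LIMSEQ_D[OF lim e] by auto
  ultimately show False by (simp add: not_less[symmetric])
qed

section \<open>Cell probabilities\<close>

interpretation std_normal_real: real_distribution std_normal_distribution
  by (rule real_dist_normal_dist)

text \<open>The fundamental theorem of calculus on an interval around \<open>u\<close>, with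
  \<open>u - 1\<close> as base point in place of minus infinity.\<close>

lemma DERIV_std_normal_cdf: "(std_normal_cdf has_real_derivative std_normal_density u) (at u)"
proof -
  have cont: "continuous_on A std_normal_density" for A :: "real set"
    unfolding std_normal_density_def by (intro continuous_intros) auto
  have diff: "std_normal_cdf y = std_normal_cdf (u - 1) + integral {u - 1..y} std_normal_density" if y: "u - 1 < y" for y
  proof -
    have "std_normal_cdf y - std_normal_cdf (u - 1) = measure std_normal_distribution {u - 1<..y}"
      unfolding std_normal_cdf_def using y by (rule std_normal_real.cdf_diff_eq)
    also have "\<dots> = (\<integral>v. indicator {u - 1<..y} v \<partial>std_normal_distribution)" by simp
    also have "\<dots> = (\<integral>v. std_normal_density v * indicator {u - 1<..y} v \<partial>lborel)"
      by (subst integral_density) auto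
    also have "\<dots> = (LINT v:{u - 1..y}|lborel. std_normal_density v)"
      unfolding set_lebesgue_integral_def
    proof (rule integral_cong_AE)
      show "AE v in lborel. std_normal_density v * indicator {u - 1<..y} v = indicator {u - 1..y} v *\<^sub>R std_normal_density v"
        using AE_lborel_singleton[of "u - 1"] by eventually_elim (auto split: split_indicator)
    qed auto
    also have "\<dots> = integral {u - 1..y} std_normal_density"
      by (rule set_borel_integral_eq_integral(2)) (rule borel_integrable_atLeastAtMost', rule cont)
    finally show ?thesis by simp
  qed
  have "((\<lambda>y. integral {u - 1..y} std_normal_density) has_real_derivative std_normal_density u) (at u within {u - 1..u + 1})"
    by (rule integral_has_real_derivative) (auto intro: cont)
  then have "((\<lambda>y. integral {u - 1..y} std_normal_density) has_real_derivative std_normal_density u) (at u)"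
    by (subst (asm) at_within_interior) (auto simp: interior_atLeastAtMost_real)
  then have "((\<lambda>y. std_normal_cdf (u - 1) + integral {u - 1..y} std_normal_density) has_real_derivative std_normal_density u) (at u)"
    by (auto intro!: derivative_eq_intros)
  then show ?thesis
  proof (rule DERIV_cong_ev[THEN iffD1, OF refl _ refl, rotated])
    show "\<forall>\<^sub>F y in nhds u. std_normal_cdf (u - 1) + integral {u - 1..y} std_normal_density = std_normal_cdf y"
      using eventually_nhds_in_open[of "{u - 1<..}" u] by (auto elim!: eventually_mono simp: diff)
  qed
qed

lemma std_normal_density_minus: "std_normal_density (- u) = std_normal_density u"
  by (simp add: std_normal_density_def)

lemma std_normal_cdf_at_top: "(std_normal_cdf \<longlongrightarrow> 1) at_top"
  unfolding std_normal_cdf_def by (rule std_normal_real.cdf_lim_at_top_prob)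

lemma std_normal_cdf_at_bot: "(std_normal_cdf \<longlongrightarrow> 0) at_bot"
  unfolding std_normal_cdf_def by (rule std_normal_real.cdf_lim_at_bot)

text \<open>The sum of the two values has derivative zero, the density being even, and tends to one
  at infinity.\<close>

lemma std_normal_cdf_minus: "std_normal_cdf (- u) = 1 - std_normal_cdf u"
proof -
  let ?f = "\<lambda>u. std_normal_cdf u + std_normal_cdf (- u)"
  have d: "(?f has_real_derivative 0) (at v)" for v
    by (rule derivative_eq_intros DERIV_std_normal_cdf DERIV_chain2[OF DERIV_std_normal_cdf] | simp add: std_normal_density_minus)+
  have c: "?f v = ?f u" for v by (rule DERIV_isconst_all[OF allI[OF d]])
  have fc: "?f = (\<lambda>_. ?f u)" by (rule ext) (rule c)
  have "(?f \<longlongrightarrow> 1 + 0) at_top"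
    by (intro tendsto_add std_normal_cdf_at_top filterlim_compose[OF std_normal_cdf_at_bot] filterlim_uminus_at_bot_at_top)
  then have "((\<lambda>_. ?f u) \<longlongrightarrow> 1) (at_top :: real filter)"
    by (simp only: fc add_0_right)
  then have "?f u = 1" by (intro tendsto_unique[OF _ tendsto_const]) auto
  then show ?thesis by simp
qed

lemma std_normal_cdf_0: "std_normal_cdf 0 = 1 / 2"
  using std_normal_cdf_minus[of 0] by simp

lemma std_normal_cdf_strict_mono: "u < v \<Longrightarrow> std_normal_cdf u < std_normal_cdf v"
  by (rule DERIV_pos_imp_increasing) (auto intro!: DERIV_std_normal_cdf exI[of _ "std_normal_density _"] normal_density_pos)

lemma std_normal_cdf_bounds: "0 < std_normal_cdf u" "std_normal_cdf u < 1"
proof -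
  have "0 \<le> std_normal_cdf (u - 1)" "std_normal_cdf (u + 1) \<le> 1"
    unfolding std_normal_cdf_def by (rule std_normal_real.cdf_nonneg std_normal_real.cdf_bounded_prob)+
  then show "0 < std_normal_cdf u" "std_normal_cdf u < 1"
    using std_normal_cdf_strict_mono[of "u - 1" u] std_normal_cdf_strict_mono[of u "u + 1"] by auto
qed

locale cells =
  fixes x :: "nat \<Rightarrow> ereal" and m :: nat
  assumes m: "2 < m"
    and edge_0: "x 0 = 0" and edge_less: "\<And>j. j < m \<Longrightarrow> x j < x (Suc j)" and edge_m: "x m = \<infinity>"
begin

text \<open>For \<open>j = m\<close> this is the default value \<open>0\<close>; it is meaningful
  for \<open>j < m\<close> only.\<close>

definition edge :: "nat \<Rightarrow> real" where "edge j = real_of_ereal (x j)"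

lemma x_mono: "i < j \<Longrightarrow> j \<le> m \<Longrightarrow> x i < x j"
proof (induction j)
  case (Suc j)
  then have "x j < x (Suc j)" by (intro edge_less) simp
  moreover have "i = j \<or> x i < x j" using Suc by (cases "i = j") auto
  ultimately show ?case by auto
qed simp

lemma x_eq_edge: "j < m \<Longrightarrow> x j = ereal (edge j)"
proof -
  assume "j < m"
  then have "x j < \<infinity>" using x_mono[of j m] edge_m by simp
  moreover have "0 \<le> x j" using x_mono[of 0 j] \<open>j < m\<close> edge_0 by (cases "j = 0") auto
  ultimately show ?thesis by (cases "x j") (auto simp: edge_def)
qed

lemma edge_0': "edge 0 = 0" by (simp add: edge_def edge_0)

lemma edge_mono: "i < j \<Longrightarrow> j < m \<Longrightarrow> edge i < edge j"
  using x_mono[of i j] x_eq_edge[of i] x_eq_edge[of j] by simp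

lemma edge_pos: "0 < j \<Longrightarrow> j < m \<Longrightarrow> 0 < edge j"
  using edge_mono[of 0 j] by (simp add: edge_0')

lemma val_at_edge: "j < m \<Longrightarrow> val_at F (x j) = F (edge j)"
  by (simp add: val_at_def x_eq_edge)

lemma val_at_top: "(F \<longlongrightarrow> l) at_top \<Longrightarrow> val_at F (x m) = l"
  by (simp add: val_at_def edge_m tendsto_Lim)

lemma sum_increment: "(\<Sum>j=1..m. sym_increment x F j) = 2 * (val_at F (x m) - F 0)"
proof -
  have "(\<Sum>j=1..k. sym_increment x F j) = 2 * (val_at F (x k) - val_at F (x 0))" for k
    by (induction k) (auto simp: sym_increment_def)
  then show ?thesis using val_at_edge[of 0 F] m by (simp add: edge_0')
qed

lemma scaled_cdf_at_top: "0 < \<theta> \<Longrightarrow> ((\<lambda>u. std_normal_cdf (u / \<theta>)) \<longlongrightarrow> 1) at_top"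
  by (rule filterlim_compose[OF std_normal_cdf_at_top])
    (simp add: divide_inverse filterlim_at_top_mult_tendsto_pos[OF tendsto_const _ filterlim_ident] mult.commute)

lemma cell_prob_pos: assumes "j \<in> {1..m}" "0 < \<theta>" shows "0 < cell_prob x j \<theta>"
proof -
  have a: "val_at (\<lambda>u. std_normal_cdf (u / \<theta>)) (x (j - 1)) = std_normal_cdf (edge (j - 1) / \<theta>)"
    using assms by (intro val_at_edge) auto
  have "std_normal_cdf (edge (j - 1) / \<theta>) < val_at (\<lambda>u. std_normal_cdf (u / \<theta>)) (x j)"
  proof (cases "j = m")
    case True
    then show ?thesis using val_at_top[OF scaled_cdf_at_top[OF assms(2)]] std_normal_cdf_bounds(2) by simp
  next
    case False
    then have "edge (j - 1) / \<theta> < edge j / \<theta>" using edge_mono[of "j - 1" j] assms by (auto simp: divide_strict_right_mono)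
    then show ?thesis using val_at_edge[of j] False assms std_normal_cdf_strict_mono by auto
  qed
  then show ?thesis unfolding cell_prob_def sym_increment_def a by simp
qed

lemma sum_cell_prob: "0 < \<theta> \<Longrightarrow> (\<Sum>j=1..m. cell_prob x j \<theta>) = 1"
  unfolding cell_prob_def using sum_increment[of "\<lambda>u. std_normal_cdf (u / \<theta>)"] val_at_top[OF scaled_cdf_at_top]
  by (simp add: std_normal_cdf_0)

text \<open>The derivative in \<theta> of the scaled normal distribution function at the edge; at
  the last edge that function is the constant one.\<close>

definition edge_deriv :: "nat \<Rightarrow> real \<Rightarrow> real"
  where "edge_deriv j \<theta> = (if j = m then 0 else std_normal_density (edge j / \<theta>) * (- edge j / \<theta>\<^sup>2))"

definition cell_deriv :: "nat \<Rightarrow> real \<Rightarrow> real"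
  where "cell_deriv j \<theta> = 2 * (edge_deriv j \<theta> - edge_deriv (j - 1) \<theta>)"

lemma DERIV_cell_prob:
  assumes j: "j \<in> {1..m}" and \<theta>: "0 < \<theta>"
  shows "(cell_prob x j has_real_derivative cell_deriv j \<theta>) (at \<theta>)"
proof -
  have V: "((\<lambda>\<theta>. val_at (\<lambda>u. std_normal_cdf (u / \<theta>)) (x i)) has_real_derivative edge_deriv i \<theta>) (at \<theta>)" if i: "i \<le> m" for i
  proof (cases "i = m")
    case True
    have "((\<lambda>\<theta>. 1) has_real_derivative edge_deriv i \<theta>) (at \<theta>)" using True by (simp add: edge_deriv_def)
    then show ?thesis
    proof (rule DERIV_cong_ev[THEN iffD1, OF refl _ refl, rotated])
      show "\<forall>\<^sub>F y in nhds \<theta>. 1 = val_at (\<lambda>u. std_normal_cdf (u / y)) (x i)"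
        using eventually_nhds_in_open[of "{0<..}" \<theta>] \<theta> True
        by (auto elim!: eventually_mono simp: val_at_top[OF scaled_cdf_at_top])
    qed
  next
    case False
    then have i: "i < m" using i by simp
    have "((\<lambda>\<theta>. edge i / \<theta>) has_real_derivative (- edge i / \<theta>\<^sup>2)) (at \<theta>)"
      using \<theta> by (auto intro!: derivative_eq_intros simp: power2_eq_square field_simps)
    from DERIV_chain2[OF DERIV_std_normal_cdf this] show ?thesis
      unfolding val_at_edge[OF i] edge_deriv_def using i by simp
  qed
  show ?thesis
    unfolding cell_prob_def[abs_def] sym_increment_def cell_deriv_def
    using j by (intro DERIV_cmult DERIV_diff V) auto
qed

lemma deriv_cell_prob: "j \<in> {1..m} \<Longrightarrow> 0 < \<theta> \<Longrightarrow> deriv (cell_prob x j) \<theta> = cell_deriv j \<theta>"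
  by (intro DERIV_imp_deriv DERIV_cell_prob)

text \<open>Telescopes between two edges at which the derivative is zero. As a consequence
  \<open>b_vec\<close> is orthogonal to the vector of the roots of the cell probabilities.\<close>

lemma sum_cell_deriv: "(\<Sum>j=1..m. cell_deriv j \<theta>) = 0"
proof -
  have "(\<Sum>j=1..k. cell_deriv j \<theta>) = 2 * (edge_deriv k \<theta> - edge_deriv 0 \<theta>)" for k
    by (induction k) (auto simp: cell_deriv_def)
  then show ?thesis using m by (simp add: edge_deriv_def edge_0')
qed

lemma isCont_cell_deriv: "0 < \<theta> \<Longrightarrow> isCont (cell_deriv j) \<theta>"
proof -
  assume \<theta>: "0 < \<theta>"
  have "isCont (edge_deriv i) \<theta>" for i
    unfolding edge_deriv_def[abs_def] std_normal_density_def
    using \<theta> by (cases "i = m") (auto intro!: continuous_intros)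
  then show ?thesis unfolding cell_deriv_def[abs_def] by (intro continuous_intros)
qed

text \<open>The sum is the squared length of \<open>b_vec\<close>, the Fisher information on the
  scale in the grouped data. The first cell contributes because its outer edge is positive and
  finite.\<close>

lemma fisher_pos: assumes "0 < \<theta>" shows "0 < (\<Sum>j=1..m. (cell_deriv j \<theta>)\<^sup>2 / cell_prob x j \<theta>)"
proof (rule sum_pos2[of _ 1])
  have "cell_deriv 1 \<theta> \<noteq> 0"
    using m edge_pos[of 1] assms normal_density_pos[of 1 0 "edge 1 / \<theta>"]
    by (auto simp: cell_deriv_def edge_deriv_def edge_0')
  then show "0 < (cell_deriv 1 \<theta>)\<^sup>2 / cell_prob x 1 \<theta>"
    using cell_prob_pos[of 1 \<theta>] m assms by simp
  show "0 \<le> (cell_deriv j \<theta>)\<^sup>2 / cell_prob x j \<theta>" if "j \<in> {1..m}" for j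
    using cell_prob_pos[OF that assms] by simp
qed (use m in auto)

end

section \<open>Counts of perturbed innovations\<close>

context contaminated_ar
begin

abbreviation window :: "int set" where "window \<equiv> {1 - int p..int n}"

text \<open>All variables form one independent family over a sum type, so that independence of two
  disjoint groups of any kind can be read off from it.\<close>

definition src :: "int + int + int \<Rightarrow> 'w \<Rightarrow> real"
  where "src i = (case i of Inl t \<Rightarrow> \<epsilon> t | Inr (Inl t) \<Rightarrow> z t | Inr (Inr t) \<Rightarrow> \<xi> t)"

abbreviation srcs :: "(int + int + int) set" where "srcs \<equiv> UNIV <+> (window <+> window)"

lemma src_simps [simp]: "src (Inl t) = \<epsilon> t" "src (Inr (Inl t)) = z t" "src (Inr (Inr t)) = \<xi> t"
  by (simp_all add: src_def)

lemma indep_src: "indep_vars (\<lambda>_. borel) src srcs"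
  using indep unfolding src_def[abs_def] .

lemma src_measurable: "i \<in> srcs \<Longrightarrow> src i \<in> borel_measurable M"
  using indep_src unfolding indep_vars_def by blast

lemma eps_measurable [measurable]: "\<epsilon> t \<in> borel_measurable M"
  using src_measurable[of "Inl t"] by (simp add: InlI)

lemma z_measurable: "t \<in> window \<Longrightarrow> z t \<in> borel_measurable M"
  using src_measurable[of "Inr (Inl t)"] by (simp add: InrI InlI)

lemma xi_measurable: "t \<in> window \<Longrightarrow> \<xi> t \<in> borel_measurable M"
  using src_measurable[of "Inr (Inr t)"] by (simp add: InrI)

text \<open>The \<sigma>-algebra generated by the sources in \<open>A\<close>, encoded as a measure
  space of which only the measurable sets matter.\<close>

definition gen :: "(int + int + int) set \<Rightarrow> 'w measure"
  where "gen A = vimage_algebra (space M) (\<lambda>\<omega>. \<lambda>i\<in>A. src i \<omega>) (Pi\<^sub>M A (\<lambda>_. borel))"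

lemma space_gen [simp]: "space (gen A) = space M" by (simp add: gen_def)

lemma src_gen: "i \<in> A \<Longrightarrow> src i \<in> borel_measurable (gen A)"
proof -
  assume i: "i \<in> A"
  have 1: "(\<lambda>\<omega>. \<lambda>i\<in>A. src i \<omega>) \<in> gen A \<rightarrow>\<^sub>M Pi\<^sub>M A (\<lambda>_. borel)"
    unfolding gen_def by (rule measurable_vimage_algebra1) (auto simp: space_PiM)
  have "(\<lambda>\<omega>. (\<lambda>i\<in>A. src i \<omega>) i) \<in> borel_measurable (gen A)"
    by (rule measurable_compose[OF 1 measurable_component_singleton[OF i]])
  then show ?thesis using i by simp
qed

lemma gen_subset: assumes "A \<subseteq> srcs" shows "sets (gen A) \<subseteq> sets M"
proof -
  have "(\<lambda>\<omega>. \<lambda>i\<in>A. src i \<omega>) \<in> M \<rightarrow>\<^sub>M Pi\<^sub>M A (\<lambda>_. borel)"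
    using assms by (intro measurable_restrict src_measurable) auto
  then show ?thesis unfolding gen_def
    by (subst sets_vimage_algebra2) (auto simp: space_PiM intro: measurable_sets)
qed

lemma gen_measurable: "A \<subseteq> srcs \<Longrightarrow> f \<in> gen A \<rightarrow>\<^sub>M N \<Longrightarrow> f \<in> M \<rightarrow>\<^sub>M N"
  using gen_subset[of A] unfolding measurable_def by auto

lemma gen_mono: assumes "A \<subseteq> B" "f \<in> gen A \<rightarrow>\<^sub>M N" shows "f \<in> gen B \<rightarrow>\<^sub>M N"
proof -
  have "(\<lambda>\<omega>. \<lambda>i\<in>A. src i \<omega>) \<in> gen B \<rightarrow>\<^sub>M Pi\<^sub>M A (\<lambda>_. borel)"
    using assms(1) by (intro measurable_restrict src_gen) auto
  then have "sets (gen A) \<subseteq> sets (gen B)"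
    unfolding gen_def[of A]
    by (subst sets_vimage_algebra2) (auto simp: space_PiM dest: measurable_sets)
  then show ?thesis using assms(2) unfolding measurable_def by auto
qed

text \<open>Restrictions of an independent family to disjoint index sets are independent, and
  independence passes to the smaller \<sigma>-algebras generated by \<open>f\<close> and
  \<open>h\<close>.\<close>

lemma indep_gen:
  assumes AB: "A \<subseteq> srcs" "B \<subseteq> srcs" "A \<inter> B = {}" and f: "f \<in> gen A \<rightarrow>\<^sub>M S" and h: "h \<in> gen B \<rightarrow>\<^sub>M T"
  shows "indep_var S f T h"
proof -
  let ?R = "\<lambda>A \<omega>. \<lambda>i\<in>A. src i \<omega>"
  have R: "?R A \<in> space M \<rightarrow> space (Pi\<^sub>M A (\<lambda>_. borel))" for A by (auto simp: space_PiM)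
  have "indep_var (Pi\<^sub>M A (\<lambda>_. borel)) (?R A) (Pi\<^sub>M B (\<lambda>_. borel)) (?R B)"
    using indep_var_restrict[OF indep_src AB(3,1,2)] .
  then have ind: "indep_set (sigma_sets (space M) {?R A -` X \<inter> space M | X. X \<in> sets (Pi\<^sub>M A (\<lambda>_. borel))})
     (sigma_sets (space M) {?R B -` X \<inter> space M | X. X \<in> sets (Pi\<^sub>M B (\<lambda>_. borel))})"
    unfolding indep_var_eq by blast
  have sub: "sigma_sets (space M) {q -` X \<inter> space M | X. X \<in> sets N} \<subseteq>
      sigma_sets (space M) {?R C -` X \<inter> space M | X. X \<in> sets (Pi\<^sub>M C (\<lambda>_. borel))}"
    if q: "q \<in> gen C \<rightarrow>\<^sub>M N" for q C and N :: "'z measure"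
  proof (rule sigma_sets_mono)
    show "{q -` X \<inter> space M | X. X \<in> sets N} \<subseteq> sigma_sets (space M) {?R C -` X \<inter> space M | X. X \<in> sets (Pi\<^sub>M C (\<lambda>_. borel))}"
      using measurable_sets[OF q] sets_vimage_algebra2[OF R, of C] unfolding gen_def by auto
  qed
  show ?thesis unfolding indep_var_eq
  proof (intro conjI)
    show "f \<in> M \<rightarrow>\<^sub>M S" "h \<in> M \<rightarrow>\<^sub>M T" using gen_measurable AB f h by auto
    show "indep_set (sigma_sets (space M) {f -` X \<inter> space M | X. X \<in> sets S})
        (sigma_sets (space M) {h -` X \<inter> space M | X. X \<in> sets T})"
      using ind sub[OF f] sub[OF h] unfolding indep_set_def
      by (elim indep_sets_mono_sets) (auto split: bool.split)
  qed
qed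

lemma expectation_mult_gen:
  assumes "A \<subseteq> srcs" "B \<subseteq> srcs" "A \<inter> B = {}" "f \<in> borel_measurable (gen A)" "h \<in> borel_measurable (gen B)"
    "integrable M f" "integrable M h"
  shows "expectation (\<lambda>\<omega>. f \<omega> * h \<omega>) = expectation f * expectation h"
    "integrable M (\<lambda>\<omega>. f \<omega> * h \<omega> :: real)"
  using indep_gen[OF assms(1-5)] assms(6,7) by (rule indep_var_lebesgue_integral indep_var_integrable)+

text \<open>This takes the place of conditioning: given the sources in \<open>A\<close>, among which
  \<open>\<epsilon> t\<close> is absent, the event has probability \<open>G (h \<omega>)\<close>.
  \<open>D\<close> is an arbitrary bounded test factor, and the proof is Fubini for the joint
  law.\<close>

lemma expectation_indicator_eps:
  assumes A: "A \<subseteq> srcs" "Inl t \<notin> A" and D: "D \<in> borel_measurable (gen A)" and h: "h \<in> borel_measurable (gen A)"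
    and K: "\<And>\<omega>. \<bar>D \<omega>\<bar> \<le> K" and Gm: "G \<in> borel_measurable borel"
  shows "expectation (\<lambda>\<omega>. D \<omega> * (if \<epsilon> t \<omega> \<le> h \<omega> then 1 else 0)) = expectation (\<lambda>\<omega>. D \<omega> * G (h \<omega>))"
proof -
  have [measurable]: "D \<in> borel_measurable M" "h \<in> borel_measurable M" using gen_measurable[OF A(1)] D h by auto
  note Gm[measurable]
  \<comment> \<open>Clipping leaves \<open>D\<close> unchanged but bounds the integrand on the whole
    product space. The dummy coordinate of \<open>?X\<close> gives both maps the same type, as
    \<open>indep_var\<close> demands.\<close>
  let ?Y = "\<lambda>\<omega>. (max (- K) (min K (D \<omega>)), h \<omega>)"
  let ?X = "\<lambda>\<omega>. (\<epsilon> t \<omega>, 0 :: real)"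
  let ?E = "distr M (borel \<Otimes>\<^sub>M borel) ?X" and ?L = "distr M (borel \<Otimes>\<^sub>M borel) ?Y"
  have Y: "?Y \<in> gen A \<rightarrow>\<^sub>M borel \<Otimes>\<^sub>M borel" using D h by measurable
  have DK: "max (- K) (min K (D \<omega>)) = D \<omega>" for \<omega> using K[of \<omega>] by auto
  have K0: "0 \<le> K" using K by (meson abs_ge_zero order_trans)
  interpret E: prob_space ?E by (rule prob_space_distr) measurable
  interpret L: prob_space ?L by (rule prob_space_distr) measurable
  interpret EL: pair_prob_space ?L ?E ..
  have "\<epsilon> t \<in> borel_measurable (gen {Inl t})" using src_gen[of "Inl t" "{Inl t}"] by simp
  then have X: "?X \<in> gen {Inl t} \<rightarrow>\<^sub>M borel \<Otimes>\<^sub>M borel" by measurable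
  have "indep_var (borel \<Otimes>\<^sub>M borel) ?Y (borel \<Otimes>\<^sub>M borel) ?X"
    by (rule indep_gen[OF A(1) _ _ Y X]) (use A in auto)
  then have prod: "?L \<Otimes>\<^sub>M ?E = distr M ((borel \<Otimes>\<^sub>M borel) \<Otimes>\<^sub>M (borel \<Otimes>\<^sub>M borel)) (\<lambda>\<omega>. (?Y \<omega>, ?X \<omega>))"
    unfolding indep_var_distribution_eq by simp
  let ?f = "\<lambda>x :: (real \<times> real) \<times> (real \<times> real). max (- K) (min K (fst (fst x))) * (if fst (snd x) \<le> snd (fst x) then 1 else 0 :: real)"
  have fm[measurable]: "?f \<in> borel_measurable ((borel \<Otimes>\<^sub>M borel) \<Otimes>\<^sub>M (borel \<Otimes>\<^sub>M borel))" by measurable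
  have "expectation (\<lambda>\<omega>. D \<omega> * (if \<epsilon> t \<omega> \<le> h \<omega> then 1 else 0)) = expectation (\<lambda>\<omega>. ?f (?Y \<omega>, ?X \<omega>))"
    by (intro Bochner_Integration.integral_cong refl) (simp add: DK indicator_def)
  also have "\<dots> = integral\<^sup>L (?L \<Otimes>\<^sub>M ?E) ?f"
    unfolding prod by (subst integral_distr[OF _ fm]) auto
  also have "\<dots> = (\<integral>y. (\<integral>e. ?f (y, e) \<partial>?E) \<partial>?L)"
  proof (rule EL.integral_fst'[symmetric])
    show "integrable (?L \<Otimes>\<^sub>M ?E) ?f"
    proof (rule EL.integrable_const_bound[of _ K])
      show "?f \<in> borel_measurable (?L \<Otimes>\<^sub>M ?E)" by measurable
    qed (use K0 in auto)
  qed
  also have "\<dots> = (\<integral>y. max (- K) (min K (fst y)) * G (snd y) \<partial>?L)"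
  proof (intro Bochner_Integration.integral_cong refl)
    fix y :: "real \<times> real"
    have "(\<integral>e. (if fst e \<le> snd y then 1 else 0 :: real) \<partial>?E) = expectation (\<lambda>\<omega>. if \<epsilon> t \<omega> \<le> snd y then 1 else 0)"
      by (subst integral_distr) auto
    also have "\<dots> = expectation (indicator (\<epsilon> t -` {..snd y} \<inter> space M))"
      by (intro Bochner_Integration.integral_cong refl) (auto simp: indicator_def)
    also have "\<dots> = cdf (distr M borel (\<epsilon> t)) (snd y)"
      unfolding cdf_def by (subst measure_distr) auto
    finally show "(\<integral>e. ?f (y, e) \<partial>?E) = max (- K) (min K (fst y)) * G (snd y)" by (simp add: eps_law)
  qed
  also have "\<dots> = expectation (\<lambda>\<omega>. D \<omega> * G (h \<omega>))"
    by (subst integral_distr) (auto simp: DK)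
  finally show ?thesis .
qed

text \<open>By orthogonality the second moment of the sum is the sum of the second moments; a
  nonnegative variance then bounds the first absolute moment.\<close>

lemma abs_sum_orthogonal_le:
  fixes D :: "'i \<Rightarrow> 'w \<Rightarrow> real"
  assumes T: "finite T" and Dm: "\<And>t. t \<in> T \<Longrightarrow> D t \<in> borel_measurable M"
    and int: "\<And>s t. s \<in> T \<Longrightarrow> t \<in> T \<Longrightarrow> integrable M (\<lambda>\<omega>. D s \<omega> * D t \<omega>)"
    and orth: "\<And>s t. s \<in> T \<Longrightarrow> t \<in> T \<Longrightarrow> s \<noteq> t \<Longrightarrow> expectation (\<lambda>\<omega>. D s \<omega> * D t \<omega>) = 0"
    and sq: "(\<Sum>t\<in>T. expectation (\<lambda>\<omega>. D t \<omega> * D t \<omega>)) \<le> V"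
  shows "expectation (\<lambda>\<omega>. \<bar>\<Sum>t\<in>T. D t \<omega>\<bar>) \<le> sqrt V" "integrable M (\<lambda>\<omega>. \<Sum>t\<in>T. D t \<omega>)"
proof -
  let ?S = "\<lambda>\<omega>. \<Sum>t\<in>T. D t \<omega>"
  have Sm: "?S \<in> borel_measurable M" using Dm by auto
  have S2: "(?S \<omega>)\<^sup>2 = (\<Sum>s\<in>T. \<Sum>t\<in>T. D s \<omega> * D t \<omega>)" for \<omega>
    by (simp add: power2_eq_square sum_product)
  have iS2: "integrable M (\<lambda>\<omega>. (?S \<omega>)\<^sup>2)" unfolding S2 using int by auto
  show iS: "integrable M ?S" using Sm iS2 by (rule square_integrable_imp_integrable)
  have "expectation (\<lambda>\<omega>. (?S \<omega>)\<^sup>2) = (\<Sum>s\<in>T. \<Sum>t\<in>T. expectation (\<lambda>\<omega>. D s \<omega> * D t \<omega>))"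
    unfolding S2 using int by (simp add: Bochner_Integration.integral_sum)
  also have "\<dots> = (\<Sum>s\<in>T. \<Sum>t\<in>T. if t = s then expectation (\<lambda>\<omega>. D s \<omega> * D s \<omega>) else 0)"
    using orth by (intro sum.cong) auto
  also have "\<dots> = (\<Sum>s\<in>T. expectation (\<lambda>\<omega>. D s \<omega> * D s \<omega>))" using T by simp
  finally have "expectation (\<lambda>\<omega>. (?S \<omega>)\<^sup>2) \<le> V" using sq by simp
  moreover have "(expectation (\<lambda>\<omega>. \<bar>?S \<omega>\<bar>))\<^sup>2 \<le> expectation (\<lambda>\<omega>. \<bar>?S \<omega>\<bar>\<^sup>2)"
  proof -
    have "0 \<le> variance (\<lambda>\<omega>. \<bar>?S \<omega>\<bar>)" by (rule variance_positive)
    also have "\<dots> = expectation (\<lambda>\<omega>. \<bar>?S \<omega>\<bar>\<^sup>2) - (expectation (\<lambda>\<omega>. \<bar>?S \<omega>\<bar>))\<^sup>2"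
      using iS iS2 by (intro variance_eq) auto
    finally show ?thesis by simp
  qed
  ultimately show "expectation (\<lambda>\<omega>. \<bar>?S \<omega>\<bar>) \<le> sqrt V"
    by (intro real_le_rsqrt) simp
qed

end

text \<open>Terms with two or more \<open>y\<^sub>i = 1\<close> are negligible, and the right hand side counts them.\<close>

lemma single_jump_approx:
  fixes F :: "real \<Rightarrow> real" and y a x :: "nat \<Rightarrow> real"
  assumes F: "\<And>u. 0 \<le> F u" "\<And>u. F u \<le> 1" and y: "\<And>i. i \<le> p \<Longrightarrow> y i \<in> {0, 1}"
  shows "\<bar>F (c + (\<Sum>i\<le>p. a i * (y i * x i))) - F c - (\<Sum>i\<le>p. y i * (F (c + a i * x i) - F c))\<bar>
    \<le> (real p + 2) * (\<Sum>i\<le>p. \<Sum>j\<in>{..p} - {i}. y i * y j)"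
proof -
  have F1: "\<bar>F u - F v\<bar> \<le> 1" for u v using F(1)[of u] F(2)[of u] F(1)[of v] F(2)[of v] by linarith
  have y01: "0 \<le> y i" "y i \<le> 1" if "i \<le> p" for i using y[OF that] by auto
  have nn: "0 \<le> (\<Sum>j\<in>{..p} - {i}. y i * y j)" if "i \<le> p" for i
    using that by (intro sum_nonneg mult_nonneg_nonneg y01) auto
  show ?thesis
  proof (cases "\<exists>i\<le>p. y i \<noteq> 0 \<and> (\<exists>j\<le>p. j \<noteq> i \<and> y j \<noteq> 0)")
    case True
    then obtain i j where ij: "i \<le> p" "j \<le> p" "j \<noteq> i" "y i = 1" "y j = 1" using y by fastforce
    have "\<bar>\<Sum>i\<le>p. y i * (F (c + a i * x i) - F c)\<bar> \<le> (\<Sum>i\<le>p. 1)"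
    proof (rule order_trans[OF sum_abs], rule sum_mono)
      fix i assume "i \<in> {..p}"
      then show "\<bar>y i * (F (c + a i * x i) - F c)\<bar> \<le> 1"
        using y01[of i] F1 by (auto simp: abs_mult intro!: mult_le_one)
    qed
    \<comment> \<open>One unit comes from the leading difference of \<open>F\<close>, and
      \<open>p + 1\<close> units from the sum.\<close>
    then have "\<bar>F (c + (\<Sum>i\<le>p. a i * (y i * x i))) - F c - (\<Sum>i\<le>p. y i * (F (c + a i * x i) - F c))\<bar> \<le> (real p + 2) * 1"
      using F1[of "c + (\<Sum>i\<le>p. a i * (y i * x i))" c] by (simp add: abs_le_iff)
    also have "1 = y i * y j" using ij by simp
    also have "y i * y j \<le> (\<Sum>j\<in>{..p} - {i}. y i * y j)"
      by (rule member_le_sum[of j]) (use ij y01 in auto)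
    also have "\<dots> \<le> (\<Sum>i\<le>p. \<Sum>j\<in>{..p} - {i}. y i * y j)"
      by (rule member_le_sum[of i "{..p}" "\<lambda>i. \<Sum>j\<in>{..p} - {i}. y i * y j"]) (use ij nn in auto)
    finally show ?thesis by (simp add: mult_left_mono)
  next
    case False
    have "F (c + (\<Sum>i\<le>p. a i * (y i * x i))) - F c = (\<Sum>i\<le>p. y i * (F (c + a i * x i) - F c))"
    proof (cases "\<exists>i\<le>p. y i \<noteq> 0")
      case True
      then obtain i where i: "i \<le> p" "y i = 1" using y by fastforce
      have z: "y j = 0" if "j \<le> p" "j \<noteq> i" for j using False i that by auto
      have "(\<Sum>j\<le>p. a j * (y j * x j)) = (\<Sum>j\<le>p. if j = i then a i * x i else 0)"
        using i z by (intro sum.cong) auto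
      moreover have "(\<Sum>j\<le>p. y j * (F (c + a j * x j) - F c)) = (\<Sum>j\<le>p. if j = i then F (c + a i * x i) - F c else 0)"
        using i z by (intro sum.cong) auto
      ultimately show ?thesis using i by simp
    next
      case False
      then show ?thesis by simp
    qed
    moreover have "0 \<le> (\<Sum>i\<le>p. \<Sum>j\<in>{..p} - {i}. y i * y j)" by (rule sum_nonneg) (rule nn, simp)
    ultimately show ?thesis by simp
  qed
qed

section \<open>Bounds in mean absolute value\<close>

context prob_space begin

text \<open>Error terms are added up in mean and turned into probabilities by Markov's inequality
  only at the end.\<close>

definition l1 :: "('a \<Rightarrow> real) \<Rightarrow> real \<Rightarrow> bool"
  where "l1 f b \<longleftrightarrow> integrable M f \<and> expectation (\<lambda>\<omega>. \<bar>f \<omega>\<bar>) \<le> b"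

lemma l1_dom:
  assumes "f \<in> borel_measurable M" "integrable M h" "\<And>\<omega>. \<omega> \<in> space M \<Longrightarrow> \<bar>f \<omega>\<bar> \<le> h \<omega>" "expectation h \<le> b"
  shows "l1 f b"
proof -
  have "integrable M f"
    by (rule Bochner_Integration.integrable_bound[OF assms(2,1)]) (use assms(3) in fastforce)
  moreover from this have "expectation (\<lambda>\<omega>. \<bar>f \<omega>\<bar>) \<le> expectation h"
    using assms by (intro integral_mono) auto
  ultimately show ?thesis using assms(4) by (simp add: l1_def)
qed

lemma l1_add: assumes "l1 f b" "l1 h b'" shows "l1 (\<lambda>\<omega>. f \<omega> + h \<omega>) (b + b')"
proof (rule l1_dom[of _ "\<lambda>\<omega>. \<bar>f \<omega>\<bar> + \<bar>h \<omega>\<bar>"])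
  show "(\<lambda>\<omega>. f \<omega> + h \<omega>) \<in> borel_measurable M" using assms by (auto simp: l1_def)
qed (use assms in \<open>auto simp: l1_def\<close>)

lemma l1_cmult: assumes "l1 f b" shows "l1 (\<lambda>\<omega>. c * f \<omega>) (\<bar>c\<bar> * b)"
  using assms by (auto simp: l1_def abs_mult mult_left_mono)

lemma l1_mono: "l1 f b \<Longrightarrow> b \<le> b' \<Longrightarrow> l1 f b'"
  by (auto simp: l1_def)

lemma l1_sum:
  assumes "\<And>t. t \<in> T \<Longrightarrow> l1 (f t) (b t)" shows "l1 (\<lambda>\<omega>. \<Sum>t\<in>T. f t \<omega>) (\<Sum>t\<in>T. b t)"
proof (cases "finite T")
  case True
  then show ?thesis using assms
  proof (induction T)
    case (insert t T)
    then have "l1 (\<lambda>\<omega>. f t \<omega> + (\<Sum>t\<in>T. f t \<omega>)) (b t + (\<Sum>t\<in>T. b t))" by (intro l1_add) auto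
    then show ?case using insert by simp
  qed (simp add: l1_def)
qed (simp add: l1_def)

lemma l1_cong: "l1 f b \<Longrightarrow> (\<And>\<omega>. \<omega> \<in> space M \<Longrightarrow> f \<omega> = h \<omega>) \<Longrightarrow> l1 h b"
  unfolding l1_def by (metis (mono_tags, lifting) Bochner_Integration.integrable_cong Bochner_Integration.integral_cong)

lemma l1_markov:
  assumes "l1 f b" "0 < e" shows "prob {\<omega> \<in> space M. e < \<bar>f \<omega>\<bar>} \<le> b / e"
proof -
  have [measurable]: "f \<in> borel_measurable M" using assms by (auto simp: l1_def)
  have "prob {\<omega> \<in> space M. e < \<bar>f \<omega>\<bar>} \<le> prob {\<omega> \<in> space M. e \<le> \<bar>f \<omega>\<bar>}"
    by (intro finite_measure_mono) auto
  also have "\<dots> \<le> expectation (\<lambda>\<omega>. \<bar>f \<omega>\<bar>) / e"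
    using assms by (intro integral_Markov_inequality_measure[where A = "{}"]) (auto simp: l1_def)
  also have "\<dots> \<le> b / e" using assms by (auto simp: l1_def divide_right_mono)
  finally show ?thesis .
qed

end

text \<open>The situation for one sample size: \<psi> and \<open>k\<close> give the truncated moving
  average, \<sigma> bounds the second moment of the innovations, \<open>S\<close> the absolute sum
  of the weights, \<open>C\<close> the density and \<open>L\<close> its Lipschitz constant. These
  four bounds will be chosen independently of the sample size, and no error bound involves
  \<open>k\<close>.\<close>

locale ar_bounds = contaminated_ar +
  fixes \<psi> :: "nat \<Rightarrow> real" and k :: nat and \<sigma> S C L :: real and G' :: "real \<Rightarrow> real"
  assumes n1: "1 \<le> n"
    and G_deriv: "\<And>u. (G has_real_derivative G' u) (at u)"
    and G'_lipschitz: "\<And>u v. \<bar>G' u - G' v\<bar> \<le> L * \<bar>u - v\<bar>"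
    and G'_bound: "\<And>u. \<bar>G' u\<bar> \<le> C"
    and \<sigma>: "0 \<le> \<sigma>" "\<And>t. expectation (\<lambda>\<omega>. (\<epsilon> t \<omega>)\<^sup>2) \<le> \<sigma>\<^sup>2"
    and S: "(\<Sum>i<k. \<bar>\<psi> i\<bar>) \<le> S"
    and Q: "real_distribution Q"
begin

lemma C0: "0 \<le> C" using G'_bound[of 0] by linarith
lemma S0: "0 \<le> S" using S by (meson abs_ge_zero order_trans sum_nonneg)
lemma L0: "0 \<le> L" using order_trans[OF abs_ge_zero G'_lipschitz[of 1 0]] by simp

lemma G_cdf: "G = cdf (distr M borel (\<epsilon> t))" using eps_law by simp

lemma G01: "0 \<le> G u" "G u \<le> 1"
proof -
  interpret E: real_distribution "distr M borel (\<epsilon> 0)" by (rule real_distribution_distr) simp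
  show "0 \<le> G u" "G u \<le> 1" unfolding G_cdf[of 0] by (rule E.cdf_nonneg E.cdf_bounded_prob)+
qed

lemma G_mono: "u \<le> y \<Longrightarrow> G u \<le> G y"
proof -
  assume uy: "u \<le> y"
  interpret E: real_distribution "distr M borel (\<epsilon> 0)" by (rule real_distribution_distr) simp
  show ?thesis unfolding G_cdf[of 0] by (rule E.cdf_nondecreasing[OF uy])
qed

lemma G_measurable [measurable]: "G \<in> borel_measurable borel"
  by (intro borel_measurable_continuous_onI continuous_at_imp_continuous_on ballI) (rule DERIV_isCont[OF G_deriv])

lemma G_diff1: "\<bar>G u - G y\<bar> \<le> 1" using G01[of u] G01[of y] by linarith

lemma G_mvt: obtains s where "\<bar>s - u\<bar> \<le> \<bar>y - u\<bar>" "G y - G u = (y - u) * G' s"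
proof (cases u y rule: linorder_cases)
  case less
  obtain s where s: "u < s" "s < y" "G y - G u = (y - u) * G' s"
    using MVT2[OF less, of G G'] G_deriv by blast
  show thesis by (rule that[of s]) (use s in auto)
next
  case greater
  obtain s where s: "y < s" "s < u" "G u - G y = (u - y) * G' s"
    using MVT2[OF greater, of G G'] G_deriv by blast
  show thesis by (rule that[of s]) (use s in \<open>auto simp: algebra_simps\<close>)
qed (use that[of u] in auto)

lemma G_lip: "\<bar>G y - G u\<bar> \<le> C * \<bar>y - u\<bar>"
proof -
  obtain s where "G y - G u = (y - u) * G' s" by (rule G_mvt)
  then show ?thesis using G'_bound[of s] by (simp add: abs_mult mult.commute mult_right_mono)
qed

lemma G_taylor: "\<bar>G (u + h) - G u - G' u * h\<bar> \<le> L * h\<^sup>2"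
proof -
  obtain s where s: "\<bar>s - u\<bar> \<le> \<bar>(u + h) - u\<bar>" "G (u + h) - G u = ((u + h) - u) * G' s" by (rule G_mvt)
  have "\<bar>G (u + h) - G u - G' u * h\<bar> = \<bar>h\<bar> * \<bar>G' s - G' u\<bar>"
    using s(2) by (simp add: abs_mult[symmetric] algebra_simps)
  also have "\<dots> \<le> \<bar>h\<bar> * (L * \<bar>h\<bar>)"
  proof (intro mult_left_mono)
    have "\<bar>G' s - G' u\<bar> \<le> L * \<bar>s - u\<bar>" by (rule G'_lipschitz)
    also have "\<dots> \<le> L * \<bar>h\<bar>" using s(1) L0 by (intro mult_left_mono) auto
    finally show "\<bar>G' s - G' u\<bar> \<le> L * \<bar>h\<bar>" .
  qed simp
  also have "\<dots> = L * (\<bar>h\<bar> * \<bar>h\<bar>)" by simp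
  finally show ?thesis by (simp add: power2_eq_square)
qed

text \<open>Stands in for \<open>v t - \<mu>\<close>, which satisfies its equation only almost
  surely and is not known to be measurable with respect to past innovations; this finite sum
  is.\<close>

definition wt :: "int \<Rightarrow> 'a \<Rightarrow> real" where "wt t \<omega> = (\<Sum>i<k. \<psi> i * \<epsilon> (t - int i) \<omega>)"

definition Yt :: "int \<Rightarrow> 'a \<Rightarrow> real" where "Yt t \<omega> = wt t \<omega> + z t \<omega> * \<xi> t \<omega>"

definition bb :: "nat \<Rightarrow> real" where "bb j = (if j = 0 then -1 else \<beta> j)"

text \<open>The contribution of the contamination, with the sign for which a residual is at most
  \<open>c\<close> exactly if the innovation is at most \<open>c\<close> plus \<open>eta\<close>
  plus the estimation error.\<close>

definition eta :: "int \<Rightarrow> 'a \<Rightarrow> real"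
  where "eta t \<omega> = (\<Sum>j\<le>p. bb j * (z (t - int j) \<omega> * \<xi> (t - int j) \<omega>))"

text \<open>With \<open>Y = v - \<mu> + z \<xi>\<close> and \<open>\<kappa>\<close> the normalized estimation error this is the perturbation of the
  \<open>t\<close>-th residual; the summand with \<open>\<kappa>'\<close> leaves room for rounding \<open>\<kappa>\<close> to a deterministic grid and
  for the truncation \<open>wt\<close> of the moving average.\<close>

definition shift :: "(int \<Rightarrow> 'a \<Rightarrow> real) \<Rightarrow> (nat \<Rightarrow> real) \<Rightarrow> real \<Rightarrow> int \<Rightarrow> 'a \<Rightarrow> real"
  where "shift Y \<kappa> \<kappa>' t \<omega> = (\<kappa> 0 + (\<Sum>j=1..p. \<kappa> j * Y (t - int j) \<omega>)
    + \<kappa>' * (1 + (\<Sum>j=1..p. \<bar>Y (t - int j) \<omega>\<bar>))) / sqrt n"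

text \<open>Innovations before \<open>t\<close>, but the contamination of the whole window: since it
  is independent of the innovations, including its future costs nothing. What matters is that
  \<open>\<epsilon> t\<close> is absent.\<close>

definition past :: "int \<Rightarrow> (int + int + int) set" where "past t = {..<t} <+> (window <+> window)"

lemma past_srcs: "past t \<subseteq> srcs" by (auto simp: past_def)

lemma past_mono: "s \<le> t \<Longrightarrow> past s \<subseteq> past t" by (auto simp: past_def)

lemma eps_gen: "s < t \<Longrightarrow> \<epsilon> s \<in> borel_measurable (gen (past t))"
  using src_gen[of "Inl s" "past t"] by (simp add: past_def InlI)

lemma z_gen: "s \<in> window \<Longrightarrow> z s \<in> borel_measurable (gen (past t))"
  using src_gen[of "Inr (Inl s)" "past t"] by (simp add: past_def InlI InrI)

lemma xi_gen: "s \<in> window \<Longrightarrow> \<xi> s \<in> borel_measurable (gen (past t))"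
  using src_gen[of "Inr (Inr s)" "past t"] by (simp add: past_def InrI)

lemma wt_gen: "s < t \<Longrightarrow> wt s \<in> borel_measurable (gen (past t))"
  unfolding wt_def by (intro borel_measurable_sum borel_measurable_times borel_measurable_const eps_gen) auto

lemma in_window: "t \<in> {1..int n} \<Longrightarrow> j \<le> p \<Longrightarrow> t - int j \<in> window" by auto

lemma eta_gen: "t \<in> {1..int n} \<Longrightarrow> eta t \<in> borel_measurable (gen (past t))"
  unfolding eta_def
  by (intro borel_measurable_sum borel_measurable_times borel_measurable_const z_gen xi_gen in_window) auto

lemma Yt_gen: "s < t \<Longrightarrow> s \<in> window \<Longrightarrow> Yt s \<in> borel_measurable (gen (past t))"
  unfolding Yt_def by (intro borel_measurable_add borel_measurable_times wt_gen z_gen xi_gen) auto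

lemma shift_gen:
  assumes "\<And>s. s < t \<Longrightarrow> s \<in> window \<Longrightarrow> Y s \<in> borel_measurable N" "t \<in> {1..int n}"
  shows "shift Y \<kappa> \<kappa>' t \<in> borel_measurable N"
proof -
  have [measurable]: "Y (t - int j) \<in> borel_measurable N" if "j \<in> {1..p}" for j
    using assms that by (intro assms(1)) auto
  show ?thesis unfolding shift_def by measurable
qed

lemma z01: "t \<in> window \<Longrightarrow> \<omega> \<in> space M \<Longrightarrow> z t \<omega> = 0 \<or> z t \<omega> = 1"
  using z_values[of t \<omega>] by auto

lemma integrable_z: "t \<in> window \<Longrightarrow> integrable M (z t)"
  using z01[of t] by (intro integrable_const_bound[of _ 1] z_measurable) fastforce+

lemma expectation_z: assumes t: "t \<in> window" shows "expectation (z t) = g"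
proof -
  note z_measurable[OF t, measurable]
  have "expectation (z t) = expectation (indicator {\<omega> \<in> space M. z t \<omega> = 1})"
    using z01[OF t] by (intro Bochner_Integration.integral_cong refl) (auto split: split_indicator)
  also have "\<dots> = prob {\<omega> \<in> space M. z t \<omega> = 1}" by (simp add: Int_def conj_commute cong: conj_cong)
  finally show ?thesis using z_law[OF t] by simp
qed

lemma g0: "0 \<le> g"
proof -
  have "int n \<in> window" using n1 by auto
  from z_law[OF this] show ?thesis by (metis measure_nonneg)
qed

lemma eps_prod_bound: "integrable M (\<lambda>\<omega>. \<epsilon> s \<omega> * \<epsilon> t \<omega>)" "expectation (\<lambda>\<omega>. \<bar>\<epsilon> s \<omega> * \<epsilon> t \<omega>\<bar>) \<le> \<sigma>\<^sup>2"
proof -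
  have "l1 (\<lambda>\<omega>. \<epsilon> s \<omega> * \<epsilon> t \<omega>) (\<sigma>\<^sup>2)"
  proof (rule l1_dom[of _ "\<lambda>\<omega>. ((\<epsilon> s \<omega>)\<^sup>2 + (\<epsilon> t \<omega>)\<^sup>2) / 2"])
    show "integrable M (\<lambda>\<omega>. ((\<epsilon> s \<omega>)\<^sup>2 + (\<epsilon> t \<omega>)\<^sup>2) / 2)" by (auto intro!: eps_square_integrable)
    show "\<bar>\<epsilon> s \<omega> * \<epsilon> t \<omega>\<bar> \<le> ((\<epsilon> s \<omega>)\<^sup>2 + (\<epsilon> t \<omega>)\<^sup>2) / 2" for \<omega>
    proof -
      have "0 \<le> (\<bar>\<epsilon> s \<omega>\<bar> - \<bar>\<epsilon> t \<omega>\<bar>)\<^sup>2" by simp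
      then show ?thesis by (simp add: power2_diff abs_mult)
    qed
    show "expectation (\<lambda>\<omega>. ((\<epsilon> s \<omega>)\<^sup>2 + (\<epsilon> t \<omega>)\<^sup>2) / 2) \<le> \<sigma>\<^sup>2"
      using \<sigma>(2)[of s] \<sigma>(2)[of t] eps_square_integrable by simp
  qed simp
  then show "integrable M (\<lambda>\<omega>. \<epsilon> s \<omega> * \<epsilon> t \<omega>)" "expectation (\<lambda>\<omega>. \<bar>\<epsilon> s \<omega> * \<epsilon> t \<omega>\<bar>) \<le> \<sigma>\<^sup>2" by (auto simp: l1_def)
qed

lemma eps_orth: "s \<noteq> t \<Longrightarrow> expectation (\<lambda>\<omega>. \<epsilon> s \<omega> * \<epsilon> t \<omega>) = 0"
proof -
  assume st: "s \<noteq> t"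
  have i: "integrable M (\<epsilon> r)" for r by (rule square_integrable_imp_integrable[OF _ eps_square_integrable]) simp
  have "expectation (\<lambda>\<omega>. \<epsilon> s \<omega> * \<epsilon> t \<omega>) = expectation (\<epsilon> s) * expectation (\<epsilon> t)"
    by (rule expectation_mult_gen[of "{Inl s}" "{Inl t}"])
      (use st i src_gen[of "Inl s" "{Inl s}"] src_gen[of "Inl t" "{Inl t}"] in auto)
  then show ?thesis by (simp add: eps_mean)
qed

lemma l1_sum_eps: assumes "finite T" shows "l1 (\<lambda>\<omega>. \<Sum>t\<in>T. \<epsilon> (t - d) \<omega>) (sqrt (real (card T)) * \<sigma>)"
proof -
  have "(\<Sum>t\<in>T. expectation (\<lambda>\<omega>. \<epsilon> (t - d) \<omega> * \<epsilon> (t - d) \<omega>)) \<le> (\<Sum>t\<in>T. \<sigma>\<^sup>2)"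
    by (intro sum_mono) (use \<sigma>(2) in \<open>simp add: power2_eq_square\<close>)
  then have "(\<Sum>t\<in>T. expectation (\<lambda>\<omega>. \<epsilon> (t - d) \<omega> * \<epsilon> (t - d) \<omega>)) \<le> real (card T) * \<sigma>\<^sup>2" by simp
  from abs_sum_orthogonal_le[OF assms _ _ _ this] show ?thesis
    using \<sigma>(1) by (simp add: l1_def eps_prod_bound eps_orth real_sqrt_mult)
qed

lemma l1_eps: "l1 (\<epsilon> t) \<sigma>"
  using l1_sum_eps[of "{t}" 0] by simp

lemma l1_wt: "l1 (wt t) (S * \<sigma>)"
proof -
  have "l1 (wt t) (\<Sum>i<k. \<bar>\<psi> i\<bar> * \<sigma>)"
    unfolding wt_def by (intro l1_sum l1_cmult l1_eps)
  then show ?thesis using S \<sigma>(1) by (elim l1_mono) (simp add: sum_distrib_right[symmetric] mult_right_mono)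
qed

text \<open>Interchanging the sums gives, for each weight, a sum of \<open>n\<close> uncorrelated
  innovations of mean size at most \<open>sqrt n * \<sigma>\<close>; the weights add up to at most
  \<open>S\<close>, whatever the length \<open>k\<close>.\<close>

lemma l1_mean_wt: "l1 (\<lambda>\<omega>. \<Sum>t\<in>{1..int n}. wt (t - d) \<omega>) (sqrt n * (S * \<sigma>))"
proof -
  have "l1 (\<lambda>\<omega>. \<Sum>i<k. \<psi> i * (\<Sum>t\<in>{1..int n}. \<epsilon> (t - (d + int i)) \<omega>)) (\<Sum>i<k. \<bar>\<psi> i\<bar> * (sqrt n * \<sigma>))"
    using l1_sum_eps[of "{1..int n}"] by (intro l1_sum l1_cmult) simp
  then have "l1 (\<lambda>\<omega>. \<Sum>t\<in>{1..int n}. wt (t - d) \<omega>) (\<Sum>i<k. \<bar>\<psi> i\<bar> * (sqrt n * \<sigma>))"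
    by (rule l1_cong) (simp add: wt_def sum_distrib_left algebra_simps sum.swap[of _ "{..<k}"])
  then show ?thesis
  proof (rule l1_mono)
    have "(\<Sum>i<k. \<bar>\<psi> i\<bar>) * (sqrt n * \<sigma>) \<le> S * (sqrt n * \<sigma>)" using S \<sigma>(1) by (intro mult_right_mono) auto
    then show "(\<Sum>i<k. \<bar>\<psi> i\<bar> * (sqrt n * \<sigma>)) \<le> sqrt n * (S * \<sigma>)"
      unfolding sum_distrib_right[symmetric] by (simp only: mult_ac)
  qed
qed

text \<open>Expanded into products of innovations, so that the bound depends on the weights through
  \<open>S\<close> only.\<close>

lemma wt_square: "integrable M (\<lambda>\<omega>. (wt t \<omega>)\<^sup>2)" "expectation (\<lambda>\<omega>. (wt t \<omega>)\<^sup>2) \<le> S\<^sup>2 * \<sigma>\<^sup>2"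
proof -
  have "l1 (\<lambda>\<omega>. \<Sum>i<k. \<psi> i * (\<Sum>j<k. \<psi> j * (\<epsilon> (t - int i) \<omega> * \<epsilon> (t - int j) \<omega>))) (\<Sum>i<k. \<bar>\<psi> i\<bar> * (\<Sum>j<k. \<bar>\<psi> j\<bar> * \<sigma>\<^sup>2))"
    by (intro l1_sum l1_cmult) (simp add: l1_def eps_prod_bound)
  then have "l1 (\<lambda>\<omega>. (wt t \<omega>)\<^sup>2) (\<Sum>i<k. \<bar>\<psi> i\<bar> * (\<Sum>j<k. \<bar>\<psi> j\<bar> * \<sigma>\<^sup>2))"
    by (rule l1_cong) (simp add: wt_def power2_eq_square sum_product sum_distrib_left mult_ac)
  moreover have "(\<Sum>i<k. \<bar>\<psi> i\<bar> * (\<Sum>j<k. \<bar>\<psi> j\<bar> * \<sigma>\<^sup>2)) = (\<Sum>i<k. \<bar>\<psi> i\<bar>)\<^sup>2 * \<sigma>\<^sup>2"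
    unfolding sum_distrib_right[symmetric] by (simp add: power2_eq_square mult_ac)
  moreover have "(\<Sum>i<k. \<bar>\<psi> i\<bar>)\<^sup>2 * \<sigma>\<^sup>2 \<le> S\<^sup>2 * \<sigma>\<^sup>2" using S by (intro mult_right_mono power_mono sum_nonneg) auto
  ultimately show "integrable M (\<lambda>\<omega>. (wt t \<omega>)\<^sup>2)" "expectation (\<lambda>\<omega>. (wt t \<omega>)\<^sup>2) \<le> S\<^sup>2 * \<sigma>\<^sup>2" by (auto simp: l1_def)
qed

end

text \<open>Truncation at one is subadditive. It is used on the contaminating variables, which may
  have no mean while their truncations always have one.\<close>

lemma min_one_add_sum_le:
  fixes a :: real and b :: "'i \<Rightarrow> real"
  assumes "0 \<le> a" "\<And>j. j \<in> J \<Longrightarrow> 0 \<le> b j"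
  shows "min 1 (a + (\<Sum>j\<in>J. b j)) \<le> a + (\<Sum>j\<in>J. min 1 (b j))"
proof (cases "finite J")
  case True
  then show ?thesis using assms(2)
  proof (induction J)
    case (insert j J)
    have "min 1 (s + t) \<le> min 1 s + min 1 t" if "0 \<le> s" "0 \<le> t" for s t :: real
      using that by (auto simp: min_def)
    from this[of "b j" "a + (\<Sum>j\<in>J. b j)"]
    have "min 1 (a + (\<Sum>j\<in>insert j J. b j)) \<le> min 1 (b j) + min 1 (a + (\<Sum>j\<in>J. b j))"
      using insert assms(1) by (simp add: sum_nonneg add.left_commute)
    also have "\<dots> \<le> min 1 (b j) + (a + (\<Sum>j\<in>J. min 1 (b j)))" using insert by simp
    finally show ?case using insert by simp
  qed (use assms in simp)
qed (use assms in simp)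

lemma abs_mult_le_one: "\<bar>a\<bar> \<le> 1 \<Longrightarrow> \<bar>b\<bar> \<le> 1 \<Longrightarrow> \<bar>a * b\<bar> \<le> 1" for a b :: real
  by (simp add: abs_mult mult_le_one)

section \<open>The count at a fixed threshold for a fixed estimation error\<close>

locale ar_shift = ar_bounds +
  fixes \<kappa> :: "nat \<Rightarrow> real" and \<kappa>' B c :: real
  assumes \<kappa>: "\<And>j. j \<le> p \<Longrightarrow> \<bar>\<kappa> j\<bar> \<le> B" and \<kappa>': "\<bar>\<kappa>'\<bar> \<le> B"
begin

lemma B0: "0 \<le> B" using \<kappa>' by linarith

text \<open>The factor \<open>2 * B / sqrt n\<close> comes from \<open>shift_bound\<close>;
  \<open>C\<close> converts a shift into a change of \<open>G\<close>.\<close>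

definition K1 :: real where "K1 = 2 * C * B / sqrt n"

lemma K10: "0 \<le> K1" using B0 C0 by (simp add: K1_def)

abbreviation "s1 \<equiv> shift Yt \<kappa> \<kappa>'"
abbreviation "s0 \<equiv> shift wt \<kappa> \<kappa>'"

definition W :: "int \<Rightarrow> 'a \<Rightarrow> real" where "W t \<omega> = 1 + (\<Sum>j=1..p. \<bar>wt (t - int j) \<omega>\<bar>)"

text \<open>Tends to zero with \<open>K\<close> by dominated convergence, for every law
  \<open>Q\<close>.\<close>

definition mQ :: "real \<Rightarrow> real" where "mQ K = (\<integral>s. min 1 (K * \<bar>s\<bar>) \<partial>Q)"

lemma shift_bound: "\<bar>shift Y \<kappa> \<kappa>' t \<omega>\<bar> \<le> 2 * B / sqrt n * (1 + (\<Sum>j=1..p. \<bar>Y (t - int j) \<omega>\<bar>))"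
proof -
  have "\<bar>\<kappa> 0 + (\<Sum>j=1..p. \<kappa> j * Y (t - int j) \<omega>)\<bar> \<le> B + (\<Sum>j=1..p. B * \<bar>Y (t - int j) \<omega>\<bar>)"
  proof (rule order_trans[OF abs_triangle_ineq], rule add_mono)
    show "\<bar>\<Sum>j=1..p. \<kappa> j * Y (t - int j) \<omega>\<bar> \<le> (\<Sum>j=1..p. B * \<bar>Y (t - int j) \<omega>\<bar>)"
      by (rule order_trans[OF sum_abs], rule sum_mono) (use \<kappa> in \<open>auto simp: abs_mult mult_right_mono\<close>)
  qed (use \<kappa> in simp)
  moreover have "\<bar>\<kappa>' * (1 + (\<Sum>j=1..p. \<bar>Y (t - int j) \<omega>\<bar>))\<bar> \<le> B * (1 + (\<Sum>j=1..p. \<bar>Y (t - int j) \<omega>\<bar>))"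
    using \<kappa>' by (simp add: abs_mult sum_nonneg mult_right_mono)
  ultimately have "\<bar>\<kappa> 0 + (\<Sum>j=1..p. \<kappa> j * Y (t - int j) \<omega>) + \<kappa>' * (1 + (\<Sum>j=1..p. \<bar>Y (t - int j) \<omega>\<bar>))\<bar>
      \<le> 2 * B * (1 + (\<Sum>j=1..p. \<bar>Y (t - int j) \<omega>\<bar>))"
    by (simp add: sum_distrib_left[symmetric] algebra_simps)
  then show ?thesis unfolding shift_def by (simp add: abs_divide divide_right_mono)
qed

lemma W1: "1 \<le> W t \<omega>" by (simp add: W_def sum_nonneg)

lemma s0_bound: "C * \<bar>s0 t \<omega>\<bar> \<le> K1 * W t \<omega>"
  using mult_left_mono[OF shift_bound[of wt t \<omega>] C0] by (simp add: K1_def W_def mult_ac)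

lemma s1_bound:
  assumes t: "t \<in> {1..int n}" and \<omega>: "\<omega> \<in> space M"
  shows "min 1 (C * \<bar>s1 t \<omega>\<bar>) \<le> K1 * W t \<omega> + (\<Sum>j=1..p. min 1 (K1 * \<bar>\<xi> (t - int j) \<omega>\<bar>))"
proof -
  have Y: "\<bar>Yt (t - int j) \<omega>\<bar> \<le> \<bar>wt (t - int j) \<omega>\<bar> + \<bar>\<xi> (t - int j) \<omega>\<bar>" if "j \<in> {1..p}" for j
  proof -
    have "t - int j \<in> window" using t that by auto
    then have "\<bar>z (t - int j) \<omega> * \<xi> (t - int j) \<omega>\<bar> \<le> \<bar>\<xi> (t - int j) \<omega>\<bar>" using z01[of "t - int j" \<omega>] \<omega> by auto
    then show ?thesis unfolding Yt_def by linarith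
  qed
  have "C * \<bar>s1 t \<omega>\<bar> \<le> K1 * (1 + (\<Sum>j=1..p. \<bar>Yt (t - int j) \<omega>\<bar>))"
    using mult_left_mono[OF shift_bound[of Yt t \<omega>] C0] by (simp add: K1_def mult_ac)
  also have "\<dots> \<le> K1 * (1 + (\<Sum>j=1..p. \<bar>wt (t - int j) \<omega>\<bar> + \<bar>\<xi> (t - int j) \<omega>\<bar>))"
    by (intro mult_left_mono K10 add_left_mono sum_mono Y)
  also have "\<dots> = K1 * W t \<omega> + (\<Sum>j=1..p. K1 * \<bar>\<xi> (t - int j) \<omega>\<bar>)"
    by (simp add: W_def sum.distrib algebra_simps sum_distrib_left)
  finally have "min 1 (C * \<bar>s1 t \<omega>\<bar>) \<le> min 1 (K1 * W t \<omega> + (\<Sum>j=1..p. K1 * \<bar>\<xi> (t - int j) \<omega>\<bar>))" by linarith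
  also have "\<dots> \<le> K1 * W t \<omega> + (\<Sum>j=1..p. min 1 (K1 * \<bar>\<xi> (t - int j) \<omega>\<bar>))"
    using K10 W1[of t \<omega>] by (intro min_one_add_sum_le) auto
  finally show ?thesis .
qed

lemma wt_measurable [measurable]: "wt t \<in> borel_measurable M"
  unfolding wt_def[abs_def] by measurable

lemma W_measurable [measurable]: "W t \<in> borel_measurable M"
  unfolding W_def[abs_def] by measurable

lemma l1_W: "l1 (W t) (1 + real p * (S * \<sigma>))"
proof -
  have "l1 (\<lambda>\<omega>. 1 + (\<Sum>j=1..p. \<bar>wt (t - int j) \<omega>\<bar>)) (1 + (\<Sum>j=1..p. S * \<sigma>))"
  proof (intro l1_add l1_sum)
    show "l1 (\<lambda>\<omega>. \<bar>wt (t - int j) \<omega>\<bar>) (S * \<sigma>)" for j using l1_wt[of "t - int j"] by (auto simp: l1_def)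
  qed (simp add: l1_def prob_space)
  then show ?thesis by (simp add: W_def[abs_def])
qed

lemma expectation_W: "integrable M (W t)" "expectation (W t) \<le> 1 + real p * (S * \<sigma>)"
proof -
  show "integrable M (W t)" using l1_W[of t] by (simp add: l1_def)
  have "\<bar>W t \<omega>\<bar> = W t \<omega>" for \<omega> using W1[of t \<omega>] by simp
  then show "expectation (W t) \<le> 1 + real p * (S * \<sigma>)" using l1_W[of t] by (simp add: l1_def)
qed

text \<open>Conditionally on \<open>past t\<close> the probability of the event \<open>\<epsilon> t \<le> c + (eta t + s1 t)\<close> is \<open>G c + q t\<close>, so the \<open>D t\<close>
  are martingale differences; \<open>q\<close> is then split into \<open>f\<close> (contamination) and \<open>l\<close> (estimation error).\<close>

definition q :: "int \<Rightarrow> 'a \<Rightarrow> real" where "q t \<omega> = G (c + (eta t \<omega> + s1 t \<omega>)) - G c"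
definition f :: "int \<Rightarrow> 'a \<Rightarrow> real" where "f t \<omega> = G (c + eta t \<omega>) - G c"
definition l :: "int \<Rightarrow> 'a \<Rightarrow> real" where "l t \<omega> = G (c + s0 t \<omega>) - G c"
definition Z :: "int \<Rightarrow> 'a \<Rightarrow> real" where "Z t \<omega> = (\<Sum>i\<le>p. z (t - int i) \<omega>)"
definition D :: "int \<Rightarrow> 'a \<Rightarrow> real"
  where "D t \<omega> = (if \<epsilon> t \<omega> \<le> c + (eta t \<omega> + s1 t \<omega>) then 1 else 0) - (if \<epsilon> t \<omega> \<le> c then 1 else 0) - q t \<omega>"

lemma h_gen: "t \<in> {1..int n} \<Longrightarrow> (\<lambda>\<omega>. eta t \<omega> + s1 t \<omega>) \<in> borel_measurable (gen (past t))"
  by (intro borel_measurable_add eta_gen shift_gen Yt_gen) auto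

lemma q_gen: "t \<in> {1..int n} \<Longrightarrow> q t \<in> borel_measurable (gen (past t))"
  unfolding q_def using h_gen[of t] by measurable

lemma D_gen: assumes "t \<in> {1..int n}" "t < s" shows "D t \<in> borel_measurable (gen (past s))"
proof -
  note gen_mono[OF past_mono[OF less_imp_le[OF assms(2)]] h_gen[OF assms(1)], measurable]
  note gen_mono[OF past_mono[OF less_imp_le[OF assms(2)]] q_gen[OF assms(1)], measurable]
  note eps_gen[OF assms(2), measurable]
  show ?thesis unfolding D_def[abs_def] by measurable
qed

lemma h_measurable: "t \<in> {1..int n} \<Longrightarrow> (\<lambda>\<omega>. eta t \<omega> + s1 t \<omega>) \<in> borel_measurable M"
  by (rule gen_measurable[OF past_srcs h_gen])

lemma q_measurable: "t \<in> {1..int n} \<Longrightarrow> q t \<in> borel_measurable M"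
  by (rule gen_measurable[OF past_srcs q_gen])

lemma D_measurable: assumes "t \<in> {1..int n}" shows "D t \<in> borel_measurable M"
  using gen_measurable[OF past_srcs D_gen[OF assms, of "t + 1"]] by simp

lemma q1: "\<bar>q t \<omega>\<bar> \<le> 1" unfolding q_def by (rule G_diff1)

lemma D2: "\<bar>D t \<omega>\<bar> \<le> 2" using q1[of t \<omega>] by (auto simp: D_def)

lemma past_not: "Inl t \<notin> past t" by (auto simp: past_def)

lemma integrable_bounded: "X \<in> borel_measurable M \<Longrightarrow> (\<And>\<omega>. \<bar>X \<omega>\<bar> \<le> K) \<Longrightarrow> integrable M X" for X :: "'a \<Rightarrow> real"
  by (rule integrable_const_bound[of _ K]) auto

text \<open>The martingale property tested against a bounded function of the past: the difference of
  the indicators has conditional mean \<open>q t\<close>.\<close>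

lemma expectation_step:
  assumes t: "t \<in> {1..int n}" and X: "X \<in> borel_measurable (gen (past t))" "\<And>\<omega>. \<bar>X \<omega>\<bar> \<le> K"
  shows "expectation (\<lambda>\<omega>. X \<omega> * ((if \<epsilon> t \<omega> \<le> c + (eta t \<omega> + s1 t \<omega>) then 1 else 0) - (if \<epsilon> t \<omega> \<le> c then 1 else 0)))
    = expectation (\<lambda>\<omega>. X \<omega> * q t \<omega>)"
proof -
  have [measurable]: "X \<in> borel_measurable M" using X(1) by (rule gen_measurable[OF past_srcs])
  note h_measurable[OF t, measurable]
  have ch: "(\<lambda>\<omega>. c + (eta t \<omega> + s1 t \<omega>)) \<in> borel_measurable (gen (past t))" using h_gen[OF t] by measurable
  have K0: "0 \<le> K" using X(2) by (meson abs_ge_zero order_trans)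
  have i: "integrable M (\<lambda>\<omega>. X \<omega> * (if \<epsilon> t \<omega> \<le> Y \<omega> then 1 else 0))" "integrable M (\<lambda>\<omega>. X \<omega> * G (Y \<omega>))"
    if [measurable]: "Y \<in> borel_measurable M" for Y
  proof -
    show "integrable M (\<lambda>\<omega>. X \<omega> * (if \<epsilon> t \<omega> \<le> Y \<omega> then 1 else 0))"
      by (rule integrable_bounded[of _ K]) (use X(2) K0 in auto)
    have "\<bar>X \<omega> * G (Y \<omega>)\<bar> \<le> K * 1" for \<omega>
      unfolding abs_mult using X(2) G01 K0 by (intro mult_mono) auto
    then show "integrable M (\<lambda>\<omega>. X \<omega> * G (Y \<omega>))"
      by (intro integrable_bounded[of _ K]) auto
  qed
  have "expectation (\<lambda>\<omega>. X \<omega> * ((if \<epsilon> t \<omega> \<le> c + (eta t \<omega> + s1 t \<omega>) then 1 else 0) - (if \<epsilon> t \<omega> \<le> c then 1 else 0)))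
    = expectation (\<lambda>\<omega>. X \<omega> * (if \<epsilon> t \<omega> \<le> c + (eta t \<omega> + s1 t \<omega>) then 1 else 0)) - expectation (\<lambda>\<omega>. X \<omega> * (if \<epsilon> t \<omega> \<le> c then 1 else 0))"
    unfolding right_diff_distrib by (intro Bochner_Integration.integral_diff i) measurable
  also have "\<dots> = expectation (\<lambda>\<omega>. X \<omega> * G (c + (eta t \<omega> + s1 t \<omega>))) - expectation (\<lambda>\<omega>. X \<omega> * G c)"
    by (simp only: expectation_indicator_eps[OF past_srcs past_not X(1) ch X(2) G_measurable]
       expectation_indicator_eps[OF past_srcs past_not X(1) borel_measurable_const X(2) G_measurable])
  also have "\<dots> = expectation (\<lambda>\<omega>. X \<omega> * q t \<omega>)"
    unfolding q_def right_diff_distrib by (intro Bochner_Integration.integral_diff[symmetric] i) measurable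
  finally show ?thesis .
qed

lemma D_orth_less: assumes s: "s \<in> {1..int n}" and t: "t \<in> {1..int n}" and st: "s < t"
  shows "expectation (\<lambda>\<omega>. D s \<omega> * D t \<omega>) = 0"
proof -
  note D_measurable[OF s, measurable] h_measurable[OF t, measurable] q_measurable[OF t, measurable]
  have "expectation (\<lambda>\<omega>. D s \<omega> * D t \<omega>) = expectation (\<lambda>\<omega>. D s \<omega> * ((if \<epsilon> t \<omega> \<le> c + (eta t \<omega> + s1 t \<omega>) then 1 else 0) - (if \<epsilon> t \<omega> \<le> c then 1 else 0)))
    - expectation (\<lambda>\<omega>. D s \<omega> * q t \<omega>)"
    unfolding D_def[of t] right_diff_distrib[of _ _ "q t _"]
  proof (intro Bochner_Integration.integral_diff)
    show "integrable M (\<lambda>\<omega>. D s \<omega> * ((if \<epsilon> t \<omega> \<le> c + (eta t \<omega> + s1 t \<omega>) then 1 else 0) - (if \<epsilon> t \<omega> \<le> c then 1 else 0)))"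
      by (rule integrable_bounded[of _ 2]) (use D2[of s] in auto)
    have "\<bar>D s \<omega> * q t \<omega>\<bar> \<le> 2 * 1" for \<omega> unfolding abs_mult using D2 q1 by (intro mult_mono) auto
    then show "integrable M (\<lambda>\<omega>. D s \<omega> * q t \<omega>)" by (intro integrable_bounded[of _ 2]) auto
  qed
  then show ?thesis using expectation_step[OF t D_gen[OF s st] D2] by simp
qed

text \<open>The difference of the indicators has values in \<open>-1\<close>, \<open>0\<close>,
  \<open>1\<close> and the sign of the shift. So its square is that sign times itself, with
  conditional mean \<open>\<bar>q t \<omega>\<bar>\<close>, and subtracting the compensator only
  lowers the second moment.\<close>

lemma D_square: assumes t: "t \<in> {1..int n}"
  shows "expectation (\<lambda>\<omega>. D t \<omega> * D t \<omega>) \<le> expectation (\<lambda>\<omega>. \<bar>q t \<omega>\<bar>)"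
proof -
  note h_measurable[OF t, measurable] q_measurable[OF t, measurable]
  define Y where "Y \<omega> = (if \<epsilon> t \<omega> \<le> c + (eta t \<omega> + s1 t \<omega>) then 1 else 0 :: real) - (if \<epsilon> t \<omega> \<le> c then 1 else 0)" for \<omega>
  have [measurable]: "Y \<in> borel_measurable M" unfolding Y_def by measurable
  have Y1: "\<bar>Y \<omega>\<bar> \<le> 1" for \<omega> by (simp add: Y_def)
  define h where "h \<omega> = sgn (eta t \<omega> + s1 t \<omega>)" for \<omega>
  have hg: "h \<in> borel_measurable (gen (past t))" unfolding h_def using h_gen[OF t] by measurable
  have h1: "\<bar>h \<omega>\<bar> \<le> 1" for \<omega> by (simp add: h_def sgn_if)
  have hq: "h \<omega> * q t \<omega> = \<bar>q t \<omega>\<bar>" for \<omega>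
    using G_mono[of c "c + (eta t \<omega> + s1 t \<omega>)"] G_mono[of "c + (eta t \<omega> + s1 t \<omega>)" c]
    by (auto simp: h_def q_def sgn_if)
  have DD: "D t \<omega> * D t \<omega> = h \<omega> * Y \<omega> - (2 * (q t \<omega> * Y \<omega>) - q t \<omega> * q t \<omega>)" for \<omega>
  proof -
    have "h \<omega> * Y \<omega> = Y \<omega> * Y \<omega>" by (auto simp: h_def Y_def sgn_if)
    moreover have "D t \<omega> = Y \<omega> - q t \<omega>" by (simp add: D_def Y_def)
    ultimately show ?thesis by (simp only:) (simp add: algebra_simps)
  qed
  have qY: "\<bar>q t \<omega> * Y \<omega>\<bar> \<le> 1" "\<bar>q t \<omega> * q t \<omega>\<bar> \<le> 1" for \<omega>
    by (intro abs_mult_le_one q1 Y1)+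
  have iq: "integrable M (\<lambda>\<omega>. q t \<omega> * Y \<omega>)" "integrable M (\<lambda>\<omega>. q t \<omega> * q t \<omega>)"
    using qY by (auto intro!: integrable_bounded[of _ 1])
  have hm: "h \<in> borel_measurable M" using hg by (rule gen_measurable[OF past_srcs])
  have ih: "integrable M (\<lambda>\<omega>. h \<omega> * Y \<omega>)"
  proof (rule integrable_bounded[of _ 1])
    show "\<bar>h \<omega> * Y \<omega>\<bar> \<le> 1" for \<omega> by (intro abs_mult_le_one h1 Y1)
  qed (use hm in measurable)
  have "expectation (\<lambda>\<omega>. D t \<omega> * D t \<omega>) = expectation (\<lambda>\<omega>. h \<omega> * Y \<omega>) - (2 * expectation (\<lambda>\<omega>. q t \<omega> * Y \<omega>) - expectation (\<lambda>\<omega>. q t \<omega> * q t \<omega>))"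
    unfolding DD using iq ih by simp
  also have "expectation (\<lambda>\<omega>. h \<omega> * Y \<omega>) = expectation (\<lambda>\<omega>. \<bar>q t \<omega>\<bar>)"
    unfolding Y_def using expectation_step[OF t hg h1] by (simp add: hq)
  also have "expectation (\<lambda>\<omega>. q t \<omega> * Y \<omega>) = expectation (\<lambda>\<omega>. q t \<omega> * q t \<omega>)"
    unfolding Y_def by (rule expectation_step[OF t q_gen[OF t] q1])
  finally show ?thesis by simp
qed

lemma eta_zero: "(\<And>i. i \<le> p \<Longrightarrow> z (t - int i) \<omega> = 0) \<Longrightarrow> eta t \<omega> = 0 \<and> s1 t \<omega> = s0 t \<omega>"
  by (simp add: eta_def shift_def Yt_def)

text \<open>Either the residual sees no contamination, and the perturbation is that of the clean
  process, or \<open>Z t\<close> is at least one and trivial bounds may be multiplied by it.\<close>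

lemma Z_cases:
  assumes t: "t \<in> {1..int n}" and \<omega>: "\<omega> \<in> space M"
  obtains "eta t \<omega> = 0" "s1 t \<omega> = s0 t \<omega>" "0 \<le> Z t \<omega>" | "1 \<le> Z t \<omega>"
proof (cases "\<forall>i\<le>p. z (t - int i) \<omega> = 0")
  case True
  then show ?thesis using that(1) eta_zero[of t \<omega>] by (simp add: Z_def)
next
  case False
  have z: "z (t - int i) \<omega> = 0 \<or> z (t - int i) \<omega> = 1" if "i \<le> p" for i using z01[OF in_window[OF t that] \<omega>] .
  then obtain i where i: "i \<le> p" "z (t - int i) \<omega> = 1" using False by blast
  have "z (t - int i) \<omega> \<le> Z t \<omega>" unfolding Z_def
  proof (rule member_le_sum)
    fix j assume "j \<in> {..p} - {i}"
    then show "0 \<le> z (t - int j) \<omega>" using z[of j] by auto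
  qed (use i in auto)
  then show ?thesis using that(2) i by simp
qed

lemma expectation_Z: assumes "t \<in> {1..int n}"
  shows "integrable M (Z t)" "expectation (Z t) = (real p + 1) * g"
  unfolding Z_def using integrable_z[OF in_window[OF assms]] expectation_z[OF in_window[OF assms]]
  by (auto simp: Bochner_Integration.integral_sum algebra_simps)

lemma q_mean: assumes t: "t \<in> {1..int n}"
  shows "expectation (\<lambda>\<omega>. \<bar>q t \<omega>\<bar>) \<le> (real p + 1) * g + K1 * (1 + real p * (S * \<sigma>))"
proof -
  have "l1 (q t) ((real p + 1) * g + K1 * (1 + real p * (S * \<sigma>)))"
  proof (rule l1_dom[of _ "\<lambda>\<omega>. Z t \<omega> + K1 * W t \<omega>"])
    show "\<bar>q t \<omega>\<bar> \<le> Z t \<omega> + K1 * W t \<omega>" if \<omega>: "\<omega> \<in> space M" for \<omega>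
    proof (rule Z_cases[OF t \<omega>])
      assume "eta t \<omega> = 0" "s1 t \<omega> = s0 t \<omega>" "0 \<le> Z t \<omega>"
      moreover have "\<bar>G (c + s0 t \<omega>) - G c\<bar> \<le> K1 * W t \<omega>"
        using G_lip[of "c + s0 t \<omega>" c] s0_bound[of t \<omega>] by simp
      ultimately show ?thesis by (simp add: q_def)
    next
      assume "1 \<le> Z t \<omega>"
      moreover have "0 \<le> K1 * W t \<omega>" using K10 W1[of t \<omega>] by simp
      ultimately show ?thesis using q1[of t \<omega>] by linarith
    qed
    show "integrable M (\<lambda>\<omega>. Z t \<omega> + K1 * W t \<omega>)" using expectation_Z[OF t] expectation_W by simp
    show "expectation (\<lambda>\<omega>. Z t \<omega> + K1 * W t \<omega>) \<le> (real p + 1) * g + K1 * (1 + real p * (S * \<sigma>))"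
      using expectation_Z[OF t] expectation_W[of t] K10 by (simp add: mult_left_mono)
  qed (rule q_measurable[OF t])
  then show ?thesis by (simp add: l1_def)
qed

text \<open>The variance is at most \<open>n\<close> times a bound for the mean of
  \<open>\<bar>q t \<omega>\<bar>\<close>. For \<open>g\<close> and \<open>K1\<close> of order
  \<open>n^(-1/2)\<close> the sum is of order \<open>n^(1/4)\<close>, below the scale
  \<open>n^(1/2)\<close>.\<close>

lemma err_U: "l1 (\<lambda>\<omega>. \<Sum>t\<in>{1..int n}. D t \<omega>) (sqrt (real n * ((real p + 1) * g + K1 * (1 + real p * (S * \<sigma>)))))"
proof -
  have "(\<Sum>t\<in>{1..int n}. expectation (\<lambda>\<omega>. D t \<omega> * D t \<omega>)) \<le> (\<Sum>t\<in>{1..int n}. (real p + 1) * g + K1 * (1 + real p * (S * \<sigma>)))"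
    by (intro sum_mono order_trans[OF D_square q_mean])
  then have V: "(\<Sum>t\<in>{1..int n}. expectation (\<lambda>\<omega>. D t \<omega> * D t \<omega>)) \<le> real n * ((real p + 1) * g + K1 * (1 + real p * (S * \<sigma>)))" by simp
  have int: "integrable M (\<lambda>\<omega>. D s \<omega> * D t \<omega>)" if "s \<in> {1..int n}" "t \<in> {1..int n}" for s t
  proof (rule integrable_bounded[of _ 4])
    have "\<bar>D s \<omega> * D t \<omega>\<bar> \<le> 2 * 2" for \<omega> unfolding abs_mult using D2 by (intro mult_mono) auto
    then show "\<bar>D s \<omega> * D t \<omega>\<bar> \<le> 4" for \<omega> by simp
  qed (use D_measurable[OF that(1)] D_measurable[OF that(2)] in measurable)
  have orth: "expectation (\<lambda>\<omega>. D s \<omega> * D t \<omega>) = 0" if "s \<in> {1..int n}" "t \<in> {1..int n}" "s \<noteq> t" for s t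
    using D_orth_less[of s t] D_orth_less[of t s] that by (cases s t rule: linorder_cases) (auto simp: mult.commute)
  show ?thesis using abs_sum_orthogonal_le[OF _ D_measurable int orth V] by (simp add: l1_def)
qed

text \<open>All sources except the Bernoulli variables.\<close>

definition noz :: "(int + int + int) set" where "noz = UNIV <+> ({} <+> window)"

lemma noz: "noz \<subseteq> srcs" by (auto simp: noz_def)

lemma z_indep:
  assumes s: "s \<in> window" and X: "X \<in> borel_measurable (gen noz)" "integrable M X"
  shows "expectation (\<lambda>\<omega>. z s \<omega> * X \<omega>) = g * expectation X" "integrable M (\<lambda>\<omega>. z s \<omega> * X \<omega>)"
proof -
  have "{Inr (Inl s)} \<subseteq> srcs" "{Inr (Inl s)} \<inter> noz = {}" using s by (auto simp: noz_def)
  moreover have "z s \<in> borel_measurable (gen {Inr (Inl s)})"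
    using src_gen[of "Inr (Inl s)" "{Inr (Inl s)}"] by simp
  ultimately show "expectation (\<lambda>\<omega>. z s \<omega> * X \<omega>) = g * expectation X" "integrable M (\<lambda>\<omega>. z s \<omega> * X \<omega>)"
    using expectation_mult_gen[OF _ noz _ _ X(1) integrable_z[OF s] X(2), of "{Inr (Inl s)}"]
    by (simp_all add: expectation_z[OF s])
qed

lemma xi_mean: assumes s: "s \<in> window" shows "integrable M (\<lambda>\<omega>. min 1 (K1 * \<bar>\<xi> s \<omega>\<bar>))" "expectation (\<lambda>\<omega>. min 1 (K1 * \<bar>\<xi> s \<omega>\<bar>)) = mQ K1"
proof -
  note xi_measurable[OF s, measurable]
  show "integrable M (\<lambda>\<omega>. min 1 (K1 * \<bar>\<xi> s \<omega>\<bar>))"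
    by (rule integrable_bounded[of _ 1]) (use K10 in auto)
  show "expectation (\<lambda>\<omega>. min 1 (K1 * \<bar>\<xi> s \<omega>\<bar>)) = mQ K1"
    unfolding mQ_def by (simp add: xi_law[OF s, symmetric] integral_distr)
qed

text \<open>Contamination and estimation error interact only if \<open>Z t\<close> is at least one.
  The interaction is then bounded by a variable built without the Bernoulli variables, so the mean
  of the product factorizes into a term of order \<open>g\<close> and one that tends to
  zero.\<close>

lemma err_cross:
  "l1 (\<lambda>\<omega>. \<Sum>t\<in>{1..int n}. q t \<omega> - f t \<omega> - l t \<omega>)
    (real n * ((real p + 1) * g * (2 * K1 * (1 + real p * (S * \<sigma>)) + real p * mQ K1)))"
proof -
  have "l1 (\<lambda>\<omega>. q t \<omega> - f t \<omega> - l t \<omega>) ((real p + 1) * g * (2 * K1 * (1 + real p * (S * \<sigma>)) + real p * mQ K1))"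
    if t: "t \<in> {1..int n}" for t
  proof -
    \<comment> \<open>It contains \<open>\<xi>\<close> without the factor \<open>z\<close>, which
      enlarges the bound but makes it independent of \<open>Z t\<close>.\<close>
    define X where "X \<omega> = 2 * K1 * W t \<omega> + (\<Sum>j=1..p. min 1 (K1 * \<bar>\<xi> (t - int j) \<omega>\<bar>))" for \<omega>
    have X0: "0 \<le> X \<omega>" for \<omega> unfolding X_def using K10 W1[of t \<omega>] by (intro add_nonneg_nonneg sum_nonneg) auto
    have xg: "\<xi> (t - int j) \<in> borel_measurable (gen noz)" if "j \<in> {1..p}" for j
    proof -
      have "Inr (Inr (t - int j)) \<in> noz" using t that by (auto simp: noz_def intro!: InrI)
      then show ?thesis using src_gen by fastforce
    qed
    have eg: "\<epsilon> s \<in> borel_measurable (gen noz)" for s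
      using src_gen[of "Inl s" noz] by (simp add: noz_def InlI)
    have Xg: "X \<in> borel_measurable (gen noz)"
      unfolding X_def W_def wt_def
      by (intro borel_measurable_add borel_measurable_times borel_measurable_sum borel_measurable_const
           borel_measurable_min borel_measurable_abs eg xg) auto
    have win: "t - int j \<in> window" if "j \<in> {1..p}" for j using t that by auto
    have iX: "integrable M X" unfolding X_def
      by (intro Bochner_Integration.integrable_add Bochner_Integration.integrable_sum integrable_mult_right expectation_W xi_mean win)
    have EX: "expectation X \<le> 2 * K1 * (1 + real p * (S * \<sigma>)) + real p * mQ K1"
    proof -
      have "expectation X = 2 * K1 * expectation (W t) + (\<Sum>j=1..p. mQ K1)"
        unfolding X_def using expectation_W(1) xi_mean win
        by (subst Bochner_Integration.integral_add)
          (auto intro!: Bochner_Integration.integrable_sum simp: Bochner_Integration.integral_sum)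
      then show ?thesis using expectation_W(2)[of t] K10 by (simp add: mult_left_mono)
    qed
    note [measurable] = q_measurable[OF t] gen_measurable[OF past_srcs eta_gen[OF t]]
    have [measurable]: "s0 t \<in> borel_measurable M" by (rule shift_gen) (use t in auto)
    show ?thesis
    proof (rule l1_dom[of _ "\<lambda>\<omega>. Z t \<omega> * X \<omega>"])
      show "(\<lambda>\<omega>. q t \<omega> - f t \<omega> - l t \<omega>) \<in> borel_measurable M" unfolding f_def l_def by measurable
      show "\<bar>q t \<omega> - f t \<omega> - l t \<omega>\<bar> \<le> Z t \<omega> * X \<omega>" if \<omega>: "\<omega> \<in> space M" for \<omega>
      proof (rule Z_cases[OF t \<omega>])
        assume "eta t \<omega> = 0" "s1 t \<omega> = s0 t \<omega>" "0 \<le> Z t \<omega>"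
        then show ?thesis using X0[of \<omega>] by (simp add: q_def f_def l_def)
      next
        assume Z1: "1 \<le> Z t \<omega>"
        have "\<bar>q t \<omega> - f t \<omega>\<bar> \<le> min 1 (C * \<bar>s1 t \<omega>\<bar>)"
          using G_diff1[of "c + (eta t \<omega> + s1 t \<omega>)" "c + eta t \<omega>"] G_lip[of "c + (eta t \<omega> + s1 t \<omega>)" "c + eta t \<omega>"]
          by (simp add: q_def f_def algebra_simps)
        moreover have "\<bar>l t \<omega>\<bar> \<le> K1 * W t \<omega>"
          unfolding l_def using G_lip[of "c + s0 t \<omega>" c] s0_bound[of t \<omega>] by simp
        ultimately have "\<bar>q t \<omega> - f t \<omega> - l t \<omega>\<bar> \<le> X \<omega>"
          using s1_bound[OF t \<omega>] unfolding X_def by linarith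
        also have "\<dots> \<le> Z t \<omega> * X \<omega>" using mult_right_mono[OF Z1 X0[of \<omega>]] by simp
        finally show ?thesis .
      qed
      have zi: "expectation (\<lambda>\<omega>. z (t - int i) \<omega> * X \<omega>) = g * expectation X" "integrable M (\<lambda>\<omega>. z (t - int i) \<omega> * X \<omega>)"
        if "i \<le> p" for i using z_indep[OF in_window[OF t that] Xg iX] .
      show "integrable M (\<lambda>\<omega>. Z t \<omega> * X \<omega>)"
        unfolding Z_def sum_distrib_right using zi by (intro Bochner_Integration.integrable_sum) auto
      have "expectation (\<lambda>\<omega>. Z t \<omega> * X \<omega>) = (\<Sum>i\<le>p. g * expectation X)"
        unfolding Z_def sum_distrib_right using zi by (subst Bochner_Integration.integral_sum) auto
      also have "\<dots> = (real p + 1) * g * expectation X" by (simp add: algebra_simps)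
      also have "\<dots> \<le> (real p + 1) * g * (2 * K1 * (1 + real p * (S * \<sigma>)) + real p * mQ K1)"
        using EX g0 by (intro mult_left_mono) auto
      finally show "expectation (\<lambda>\<omega>. Z t \<omega> * X \<omega>) \<le> (real p + 1) * g * (2 * K1 * (1 + real p * (S * \<sigma>)) + real p * mQ K1)" .
    qed
  qed
  then have "l1 (\<lambda>\<omega>. \<Sum>t\<in>{1..int n}. q t \<omega> - f t \<omega> - l t \<omega>)
     (\<Sum>t\<in>{1..int n}. (real p + 1) * g * (2 * K1 * (1 + real p * (S * \<sigma>)) + real p * mQ K1))"
    by (rule l1_sum)
  then show ?thesis by simp
qed

lemma z_prod: assumes "s \<in> window" "t \<in> window" "s \<noteq> t"
  shows "integrable M (\<lambda>\<omega>. z s \<omega> * z t \<omega>)" "expectation (\<lambda>\<omega>. z s \<omega> * z t \<omega>) = g * g"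
proof -
  have "{Inr (Inl s)} \<subseteq> srcs" "{Inr (Inl t)} \<subseteq> srcs" "{Inr (Inl s)} \<inter> {Inr (Inl t)} = {}" using assms by auto
  moreover have "z r \<in> borel_measurable (gen {Inr (Inl r)})" for r
    using src_gen[of "Inr (Inl r)" "{Inr (Inl r)}"] by simp
  ultimately show "integrable M (\<lambda>\<omega>. z s \<omega> * z t \<omega>)" "expectation (\<lambda>\<omega>. z s \<omega> * z t \<omega>) = g * g"
    using expectation_mult_gen[of "{Inr (Inl s)}" "{Inr (Inl t)}" "z s" "z t"] integrable_z assms expectation_z
    by simp_all
qed

definition \<phi> :: "nat \<Rightarrow> real \<Rightarrow> real" where "\<phi> i s = G (c + bb i * s) - G c"

lemma \<phi>_measurable [measurable]: "\<phi> i \<in> borel_measurable borel"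
  unfolding \<phi>_def[abs_def] by measurable

lemma \<phi>1: "\<bar>\<phi> i s\<bar> \<le> 1" unfolding \<phi>_def by (rule G_diff1)

text \<open>Two distinct observations are both contaminated with probability \<open>g * g\<close>,
  and \<open>n * g * g\<close> stays bounded for \<open>g\<close> of order
  \<open>n^(-1/2)\<close>.\<close>

lemma err_jump:
  "l1 (\<lambda>\<omega>. \<Sum>t\<in>{1..int n}. f t \<omega> - (\<Sum>i\<le>p. z (t - int i) \<omega> * \<phi> i (\<xi> (t - int i) \<omega>)))
    (real n * ((real p + 2) * ((real p + 1) * real p * (g * g))))"
proof -
  have "l1 (\<lambda>\<omega>. f t \<omega> - (\<Sum>i\<le>p. z (t - int i) \<omega> * \<phi> i (\<xi> (t - int i) \<omega>)))
     ((real p + 2) * ((real p + 1) * real p * (g * g)))" if t: "t \<in> {1..int n}" for t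
  proof (rule l1_dom[of _ "\<lambda>\<omega>. (real p + 2) * (\<Sum>i\<le>p. \<Sum>j\<in>{..p} - {i}. z (t - int i) \<omega> * z (t - int j) \<omega>)"])
    note [measurable] = gen_measurable[OF past_srcs eta_gen[OF t]]
    have [measurable]: "z (t - int i) \<in> borel_measurable M" "\<xi> (t - int i) \<in> borel_measurable M" if "i \<in> {..p}" for i
      using z_measurable[OF in_window[OF t, of i]] xi_measurable[OF in_window[OF t, of i]] that by auto
    show "(\<lambda>\<omega>. f t \<omega> - (\<Sum>i\<le>p. z (t - int i) \<omega> * \<phi> i (\<xi> (t - int i) \<omega>))) \<in> borel_measurable M"
      unfolding f_def by measurable
    have zz: "integrable M (\<lambda>\<omega>. z (t - int i) \<omega> * z (t - int j) \<omega>)" "expectation (\<lambda>\<omega>. z (t - int i) \<omega> * z (t - int j) \<omega>) = g * g"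
      if "i \<in> {..p}" "j \<in> {..p} - {i}" for i j
      using that z_prod[OF in_window[OF t, of i] in_window[OF t, of j]] by auto
    show "integrable M (\<lambda>\<omega>. (real p + 2) * (\<Sum>i\<le>p. \<Sum>j\<in>{..p} - {i}. z (t - int i) \<omega> * z (t - int j) \<omega>))"
      using zz by (intro integrable_mult_right Bochner_Integration.integrable_sum)
    have "expectation (\<lambda>\<omega>. (real p + 2) * (\<Sum>i\<le>p. \<Sum>j\<in>{..p} - {i}. z (t - int i) \<omega> * z (t - int j) \<omega>))
      = (real p + 2) * (\<Sum>i\<le>p. \<Sum>j\<in>{..p} - {i}. expectation (\<lambda>\<omega>. z (t - int i) \<omega> * z (t - int j) \<omega>))"
      using zz by (subst integral_mult_right_zero, subst Bochner_Integration.integral_sum)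
        (auto intro!: Bochner_Integration.integrable_sum sum.cong Bochner_Integration.integral_sum)
    also have "\<dots> = (real p + 2) * (\<Sum>i\<le>p. \<Sum>j\<in>{..p} - {i}. g * g)" using zz by simp
    also have "\<dots> = (real p + 2) * ((real p + 1) * real p * (g * g))" by (simp add: card_Diff_singleton)
    finally show "expectation (\<lambda>\<omega>. (real p + 2) * (\<Sum>i\<le>p. \<Sum>j\<in>{..p} - {i}. z (t - int i) \<omega> * z (t - int j) \<omega>))
      \<le> (real p + 2) * ((real p + 1) * real p * (g * g))" by simp
    show "\<bar>f t \<omega> - (\<Sum>i\<le>p. z (t - int i) \<omega> * \<phi> i (\<xi> (t - int i) \<omega>))\<bar> \<le>
       (real p + 2) * (\<Sum>i\<le>p. \<Sum>j\<in>{..p} - {i}. z (t - int i) \<omega> * z (t - int j) \<omega>)" if \<omega>: "\<omega> \<in> space M" for \<omega>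
      unfolding f_def eta_def \<phi>_def
      by (rule single_jump_approx[of G p "\<lambda>i. z (t - int i) \<omega>", OF G01]) (use z_values[OF in_window[OF t] \<omega>] in auto)
  qed
  then have "l1 (\<lambda>\<omega>. \<Sum>t\<in>{1..int n}. f t \<omega> - (\<Sum>i\<le>p. z (t - int i) \<omega> * \<phi> i (\<xi> (t - int i) \<omega>)))
     (\<Sum>t\<in>{1..int n}. (real p + 2) * ((real p + 1) * real p * (g * g)))" by (rule l1_sum)
  then show ?thesis by simp
qed

definition E\<phi> :: "nat \<Rightarrow> real" where "E\<phi> i = (\<integral>s. \<phi> i s \<partial>Q)"

text \<open>For fixed \<open>i\<close> the summands with different \<open>t\<close> use disjoint
  sources, hence are uncorrelated, and each has second moment at most \<open>g\<close> because
  \<open>z * z = z\<close>. Summands with different \<open>i\<close> share sources, so the sum over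
  \<open>i\<close> is left to the triangle inequality.\<close>

lemma err_bernoulli:
  assumes i: "i \<le> p"
  shows "l1 (\<lambda>\<omega>. \<Sum>t\<in>{1..int n}. z (t - int i) \<omega> * \<phi> i (\<xi> (t - int i) \<omega>) - g * E\<phi> i) (sqrt (real n * g))"
proof -
  define X where "X t \<omega> = z (t - int i) \<omega> * \<phi> i (\<xi> (t - int i) \<omega>) - g * E\<phi> i" for t \<omega>
  have win: "t - int i \<in> window" if "t \<in> {1..int n}" for t using in_window[OF that i] .
  have xim: "\<xi> (t - int i) \<in> borel_measurable M" if "t \<in> {1..int n}" for t by (rule xi_measurable[OF win[OF that]])
  have zm: "z (t - int i) \<in> borel_measurable M" if "t \<in> {1..int n}" for t by (rule z_measurable[OF win[OF that]])
  have i\<phi>: "integrable M (\<lambda>\<omega>. \<phi> i (\<xi> (t - int i) \<omega>))" if "t \<in> {1..int n}" for t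
    by (rule integrable_bounded[of _ 1]) (use xim[OF that] \<phi>1 in auto)
  have E: "expectation (\<lambda>\<omega>. z (t - int i) \<omega> * \<phi> i (\<xi> (t - int i) \<omega>)) = g * E\<phi> i"
     "integrable M (\<lambda>\<omega>. z (t - int i) \<omega> * \<phi> i (\<xi> (t - int i) \<omega>))" if t: "t \<in> {1..int n}" for t
  proof -
    have "Inr (Inr (t - int i)) \<in> noz" using win[OF t] by (auto simp: noz_def intro!: InrI)
    then have "\<xi> (t - int i) \<in> borel_measurable (gen noz)" using src_gen by fastforce
    then have g: "(\<lambda>\<omega>. \<phi> i (\<xi> (t - int i) \<omega>)) \<in> borel_measurable (gen noz)" by measurable
    have "expectation (\<lambda>\<omega>. \<phi> i (\<xi> (t - int i) \<omega>)) = E\<phi> i"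
      unfolding E\<phi>_def using xim[OF t] by (simp add: xi_law[OF win[OF t], symmetric] integral_distr)
    then show "expectation (\<lambda>\<omega>. z (t - int i) \<omega> * \<phi> i (\<xi> (t - int i) \<omega>)) = g * E\<phi> i"
     "integrable M (\<lambda>\<omega>. z (t - int i) \<omega> * \<phi> i (\<xi> (t - int i) \<omega>))"
      using z_indep[OF win[OF t] g i\<phi>[OF t]] by simp_all
  qed
  have EX: "expectation (X t) = 0" "integrable M (X t)" if "t \<in> {1..int n}" for t
    unfolding X_def using E[OF that] by (simp_all add: prob_space)
  have Xm: "X t \<in> borel_measurable M" if "t \<in> {1..int n}" for t using EX(2)[OF that] by auto
  have Xgen: "X t \<in> borel_measurable (gen {Inr (Inl (t - int i)), Inr (Inr (t - int i))})" for t
  proof -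
    let ?A = "{Inr (Inl (t - int i)), Inr (Inr (t - int i))} :: (int + int + int) set"
    have [measurable]: "z (t - int i) \<in> borel_measurable (gen ?A)" "\<xi> (t - int i) \<in> borel_measurable (gen ?A)"
      using src_gen[of "Inr (Inl (t - int i))" ?A] src_gen[of "Inr (Inr (t - int i))" ?A] by auto
    show ?thesis unfolding X_def[abs_def] by measurable
  qed
  have prod: "expectation (\<lambda>\<omega>. X s \<omega> * X t \<omega>) = 0" "integrable M (\<lambda>\<omega>. X s \<omega> * X t \<omega>)"
    if "s \<in> {1..int n}" "t \<in> {1..int n}" "s \<noteq> t" for s t
  proof -
    have sub: "{Inr (Inl (r - int i)), Inr (Inr (r - int i))} \<subseteq> srcs" if "r \<in> {1..int n}" for r
      using win[OF that] by (auto intro!: InrI InlI)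
    have disj: "{Inr (Inl (s - int i)), Inr (Inr (s - int i))} \<inter> {Inr (Inl (t - int i)), Inr (Inr (t - int i))} = ({} :: (int + int + int) set)"
      using that(3) by auto
    show "expectation (\<lambda>\<omega>. X s \<omega> * X t \<omega>) = 0" "integrable M (\<lambda>\<omega>. X s \<omega> * X t \<omega>)"
      using expectation_mult_gen[OF sub[OF that(1)] sub[OF that(2)] disj Xgen Xgen EX(2)[OF that(1)] EX(2)[OF that(2)]]
        EX(1)[OF that(1)] by simp_all
  qed
  have zz: "z (t - int i) \<omega> * z (t - int i) \<omega> = z (t - int i) \<omega>" "0 \<le> z (t - int i) \<omega>"
    if "t \<in> {1..int n}" "\<omega> \<in> space M" for t \<omega>
    using z01[OF win[OF that(1)] that(2)] by auto
  have sq: "integrable M (\<lambda>\<omega>. X t \<omega> * X t \<omega>)" "expectation (\<lambda>\<omega>. X t \<omega> * X t \<omega>) \<le> g" if t: "t \<in> {1..int n}" for t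
  proof -
    let ?Y = "\<lambda>\<omega>. z (t - int i) \<omega> * \<phi> i (\<xi> (t - int i) \<omega>)"
    have Y2: "l1 (\<lambda>\<omega>. ?Y \<omega> * ?Y \<omega>) g"
    proof (rule l1_dom[of _ "z (t - int i)"])
      show "(\<lambda>\<omega>. ?Y \<omega> * ?Y \<omega>) \<in> borel_measurable M" using zm[OF t] xim[OF t] by measurable
      show "\<bar>?Y \<omega> * ?Y \<omega>\<bar> \<le> z (t - int i) \<omega>" if \<omega>: "\<omega> \<in> space M" for \<omega>
      proof -
        have e: "?Y \<omega> * ?Y \<omega> = z (t - int i) \<omega> * (\<phi> i (\<xi> (t - int i) \<omega>) * \<phi> i (\<xi> (t - int i) \<omega>))"
        proof -
          have "(a * b) * (a * b) = (a * a) * (b * b)" for a b :: real by simp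
          then show ?thesis by (simp only: zz(1)[OF t \<omega>])
        qed
        have "\<bar>?Y \<omega> * ?Y \<omega>\<bar> = z (t - int i) \<omega> * \<bar>\<phi> i (\<xi> (t - int i) \<omega>) * \<phi> i (\<xi> (t - int i) \<omega>)\<bar>"
          unfolding e abs_mult[of "z (t - int i) \<omega>"] using zz(2)[OF t \<omega>] by (simp only: abs_of_nonneg)
        also have "\<dots> \<le> z (t - int i) \<omega> * 1"
          by (intro mult_left_mono abs_mult_le_one \<phi>1 zz(2)[OF t \<omega>])
        finally show ?thesis by simp
      qed
    qed (use integrable_z[OF win[OF t]] expectation_z[OF win[OF t]] in auto)
    have XX: "X t \<omega> * X t \<omega> = ?Y \<omega> * ?Y \<omega> - 2 * (g * E\<phi> i) * ?Y \<omega> + (g * E\<phi> i)\<^sup>2" for \<omega>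
      by (simp add: X_def power2_eq_square algebra_simps)
    show "integrable M (\<lambda>\<omega>. X t \<omega> * X t \<omega>)" unfolding XX using Y2 E(2)[OF t] by (simp add: l1_def)
    have "expectation (\<lambda>\<omega>. X t \<omega> * X t \<omega>) = expectation (\<lambda>\<omega>. ?Y \<omega> * ?Y \<omega>) - 2 * (g * E\<phi> i) * (g * E\<phi> i) + (g * E\<phi> i)\<^sup>2"
    proof -
      have i1: "integrable M (\<lambda>\<omega>. ?Y \<omega> * ?Y \<omega>)" using Y2 by (simp add: l1_def)
      have i2: "integrable M (\<lambda>\<omega>. 2 * (g * E\<phi> i) * ?Y \<omega>)" by (rule integrable_mult_right) (rule E(2)[OF t])
      have e2: "expectation (\<lambda>\<omega>. 2 * (g * E\<phi> i) * ?Y \<omega>) = 2 * (g * E\<phi> i) * (g * E\<phi> i)"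
        by (subst integral_mult_right_zero) (simp only: E(1)[OF t])
      have "expectation (\<lambda>\<omega>. X t \<omega> * X t \<omega>) = expectation (\<lambda>\<omega>. ?Y \<omega> * ?Y \<omega> - 2 * (g * E\<phi> i) * ?Y \<omega>) + expectation (\<lambda>\<omega>. (g * E\<phi> i)\<^sup>2)"
        unfolding XX by (intro Bochner_Integration.integral_add Bochner_Integration.integrable_diff i1 i2) simp
      also have "expectation (\<lambda>\<omega>. ?Y \<omega> * ?Y \<omega> - 2 * (g * E\<phi> i) * ?Y \<omega>) = expectation (\<lambda>\<omega>. ?Y \<omega> * ?Y \<omega>) - expectation (\<lambda>\<omega>. 2 * (g * E\<phi> i) * ?Y \<omega>)"
        by (intro Bochner_Integration.integral_diff i1 i2)
      finally show ?thesis unfolding e2 by (simp add: prob_space)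
    qed
    also have "\<dots> \<le> expectation (\<lambda>\<omega>. ?Y \<omega> * ?Y \<omega>)"
    proof -
      have "y - 2 * a * a + a\<^sup>2 \<le> y" for y a :: real using zero_le_power2[of a] by (simp add: power2_eq_square)
      then show ?thesis .
    qed
    also have "\<dots> \<le> expectation (\<lambda>\<omega>. \<bar>?Y \<omega> * ?Y \<omega>\<bar>)" using Y2 by (intro integral_mono) (auto simp: l1_def)
    also have "\<dots> \<le> g" using Y2 by (simp add: l1_def)
    finally show "expectation (\<lambda>\<omega>. X t \<omega> * X t \<omega>) \<le> g" .
  qed
  have V: "(\<Sum>t\<in>{1..int n}. expectation (\<lambda>\<omega>. X t \<omega> * X t \<omega>)) \<le> real n * g"
    using sum_mono[of "{1..int n}", OF sq(2)] by simp
  have int: "integrable M (\<lambda>\<omega>. X s \<omega> * X t \<omega>)" if "s \<in> {1..int n}" "t \<in> {1..int n}" for s t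
    using prod(2)[of s t] sq(1)[of t] that by (cases "s = t") auto
  show ?thesis using abs_sum_orthogonal_le[OF _ Xm int prod(1) V] by (simp add: l1_def X_def)
qed

text \<open>The remainder is \<open>L\<close> times the squared shift, of order \<open>1 / n\<close>
  in mean. It is taken for the clean shift \<open>s0\<close>, whose moving averages have second
  moments.\<close>

lemma err_taylor:
  "l1 (\<lambda>\<omega>. \<Sum>t\<in>{1..int n}. l t \<omega> - G' c * s0 t \<omega>)
    (real n * (L * (2 * B / sqrt n)\<^sup>2 * ((real p + 1) * (1 + real p * (S\<^sup>2 * \<sigma>\<^sup>2)))))"
proof -
  have "l1 (\<lambda>\<omega>. l t \<omega> - G' c * s0 t \<omega>) (L * (2 * B / sqrt n)\<^sup>2 * ((real p + 1) * (1 + real p * (S\<^sup>2 * \<sigma>\<^sup>2))))"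
    if t: "t \<in> {1..int n}" for t
  proof (rule l1_dom[of _ "\<lambda>\<omega>. L * (2 * B / sqrt n)\<^sup>2 * ((real p + 1) * (1 + (\<Sum>j=1..p. (wt (t - int j) \<omega>)\<^sup>2)))"])
    have [measurable]: "s0 t \<in> borel_measurable M" by (rule shift_gen) (use t in auto)
    show "(\<lambda>\<omega>. l t \<omega> - G' c * s0 t \<omega>) \<in> borel_measurable M" unfolding l_def by measurable
    show "integrable M (\<lambda>\<omega>. L * (2 * B / sqrt n)\<^sup>2 * ((real p + 1) * (1 + (\<Sum>j=1..p. (wt (t - int j) \<omega>)\<^sup>2))))"
      using wt_square(1) by auto
    have "expectation (\<lambda>\<omega>. 1 + (\<Sum>j=1..p. (wt (t - int j) \<omega>)\<^sup>2)) = 1 + (\<Sum>j=1..p. expectation (\<lambda>\<omega>. (wt (t - int j) \<omega>)\<^sup>2))"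
      using wt_square(1) by (subst Bochner_Integration.integral_add) (auto simp: prob_space Bochner_Integration.integral_sum)
    also have "\<dots> \<le> 1 + (\<Sum>j=1..p. S\<^sup>2 * \<sigma>\<^sup>2)" by (intro add_left_mono sum_mono wt_square)
    finally have "expectation (\<lambda>\<omega>. 1 + (\<Sum>j=1..p. (wt (t - int j) \<omega>)\<^sup>2)) \<le> 1 + real p * (S\<^sup>2 * \<sigma>\<^sup>2)" by simp
    then show "expectation (\<lambda>\<omega>. L * (2 * B / sqrt n)\<^sup>2 * ((real p + 1) * (1 + (\<Sum>j=1..p. (wt (t - int j) \<omega>)\<^sup>2))))
      \<le> L * (2 * B / sqrt n)\<^sup>2 * ((real p + 1) * (1 + real p * (S\<^sup>2 * \<sigma>\<^sup>2)))"
      unfolding integral_mult_right_zero using L0 by (intro mult_left_mono) auto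
    show "\<bar>l t \<omega> - G' c * s0 t \<omega>\<bar> \<le> L * (2 * B / sqrt n)\<^sup>2 * ((real p + 1) * (1 + (\<Sum>j=1..p. (wt (t - int j) \<omega>)\<^sup>2)))" for \<omega>
    proof -
      have "\<bar>l t \<omega> - G' c * s0 t \<omega>\<bar> \<le> L * (s0 t \<omega>)\<^sup>2" unfolding l_def by (rule G_taylor)
      also have "\<dots> \<le> L * (2 * B / sqrt n * W t \<omega>)\<^sup>2"
      proof (intro mult_left_mono L0)
        have "\<bar>s0 t \<omega>\<bar>\<^sup>2 \<le> (2 * B / sqrt n * W t \<omega>)\<^sup>2"
          using shift_bound[of wt t \<omega>] by (intro power_mono) (auto simp: W_def)
        then show "(s0 t \<omega>)\<^sup>2 \<le> (2 * B / sqrt n * W t \<omega>)\<^sup>2" by simp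
      qed
      also have "\<dots> = L * (2 * B / sqrt n)\<^sup>2 * (W t \<omega>)\<^sup>2" by (simp only: power_mult_distrib mult.assoc)
      also have "\<dots> \<le> L * (2 * B / sqrt n)\<^sup>2 * ((real p + 1) * (1 + (\<Sum>j=1..p. (wt (t - int j) \<omega>)\<^sup>2)))"
      proof (intro mult_left_mono)
        \<comment> \<open>The summand \<open>1\<close> of \<open>W\<close> becomes the value at
          index \<open>0\<close>, so that Cauchy-Schwarz has \<open>p + 1\<close> terms.\<close>
        let ?h = "\<lambda>j. if j = 0 then 1 else \<bar>wt (t - int j) \<omega>\<bar>"
        have e: "{0..p} = insert 0 {1..p}" by auto
        have "(W t \<omega>) = (\<Sum>j\<in>{0..p}. ?h j)" unfolding W_def e by (subst sum.insert) auto
        then have "(W t \<omega>)\<^sup>2 \<le> (\<Sum>j\<in>{0..p}. (?h j)\<^sup>2) * real (card {0..p})"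
          using sum_squared_le_sum_of_squares[of ?h "{0..p}"] by simp
        also have "(\<Sum>j\<in>{0..p}. (?h j)\<^sup>2) = 1 + (\<Sum>j=1..p. (wt (t - int j) \<omega>)\<^sup>2)"
          unfolding e by (subst sum.insert) auto
        finally show "(W t \<omega>)\<^sup>2 \<le> (real p + 1) * (1 + (\<Sum>j=1..p. (wt (t - int j) \<omega>)\<^sup>2))" by (simp add: mult.commute add.commute)
      qed (use L0 in simp)
      finally show ?thesis .
    qed
  qed
  then have "l1 (\<lambda>\<omega>. \<Sum>t\<in>{1..int n}. l t \<omega> - G' c * s0 t \<omega>)
     (\<Sum>t\<in>{1..int n}. L * (2 * B / sqrt n)\<^sup>2 * ((real p + 1) * (1 + real p * (S\<^sup>2 * \<sigma>\<^sup>2))))" by (rule l1_sum)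
  then show ?thesis by simp
qed

text \<open>The errors of the autoregressive coefficients multiply centred sums of order
  \<open>sqrt n\<close>, which the factor \<open>1 / sqrt n\<close> reduces to order one. Only
  \<open>\<kappa> 0\<close> and the rounding allowance \<open>\<kappa>'\<close> act at the full
  order \<open>sqrt n\<close>.\<close>

lemma err_linear:
  "l1 (\<lambda>\<omega>. (\<Sum>t\<in>{1..int n}. s0 t \<omega>) - sqrt n * (\<kappa> 0 + \<kappa>' * ((\<Sum>t\<in>{1..int n}. W t \<omega>) / n))) (real p * (B * (S * \<sigma>)))"
proof -
  have rn: "0 < sqrt n" "sqrt n * sqrt n = real n" using n1 by auto
  have "l1 (\<lambda>\<omega>. (1 / sqrt n) * (\<Sum>j=1..p. \<kappa> j * (\<Sum>t\<in>{1..int n}. wt (t - int j) \<omega>)))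
    (\<bar>1 / sqrt n\<bar> * (\<Sum>j=1..p. \<bar>\<kappa> j\<bar> * (sqrt n * (S * \<sigma>))))"
    by (intro l1_cmult l1_sum l1_mean_wt)
  then have "l1 (\<lambda>\<omega>. (\<Sum>t\<in>{1..int n}. s0 t \<omega>) - sqrt n * (\<kappa> 0 + \<kappa>' * ((\<Sum>t\<in>{1..int n}. W t \<omega>) / n)))
    (\<bar>1 / sqrt n\<bar> * (\<Sum>j=1..p. \<bar>\<kappa> j\<bar> * (sqrt n * (S * \<sigma>))))"
  proof (rule l1_cong)
    fix \<omega>
    have "(\<Sum>t\<in>{1..int n}. s0 t \<omega>) = (\<Sum>t\<in>{1..int n}. \<kappa> 0 + (\<Sum>j=1..p. \<kappa> j * wt (t - int j) \<omega>) + \<kappa>' * W t \<omega>) / sqrt n"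
      unfolding shift_def sum_divide_distrib W_def ..
    also have "\<dots> = (real n * \<kappa> 0 + (\<Sum>j=1..p. \<kappa> j * (\<Sum>t\<in>{1..int n}. wt (t - int j) \<omega>)) + \<kappa>' * (\<Sum>t\<in>{1..int n}. W t \<omega>)) / sqrt n"
      by (simp add: sum.distrib sum_distrib_left sum.swap[of _ "{1..int n}"])
    also have "\<dots> = sqrt n * (\<kappa> 0 + \<kappa>' * ((\<Sum>t\<in>{1..int n}. W t \<omega>) / n)) + (1 / sqrt n) * (\<Sum>j=1..p. \<kappa> j * (\<Sum>t\<in>{1..int n}. wt (t - int j) \<omega>))"
    proof -
      have "(r * r * a + b + d * e) / r = r * (a + d * (e / (r * r))) + 1 / r * b" if "0 < r" for r a b d e :: real
        using that by (simp add: field_simps)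
      from this[OF rn(1)] show ?thesis unfolding rn(2) .
    qed
    finally show "(1 / sqrt n) * (\<Sum>j=1..p. \<kappa> j * (\<Sum>t\<in>{1..int n}. wt (t - int j) \<omega>)) =
      (\<Sum>t\<in>{1..int n}. s0 t \<omega>) - sqrt n * (\<kappa> 0 + \<kappa>' * ((\<Sum>t\<in>{1..int n}. W t \<omega>) / n))" by simp
  qed
  then show ?thesis
  proof (rule l1_mono)
    have "(\<Sum>j=1..p. \<bar>\<kappa> j\<bar> * (sqrt n * (S * \<sigma>))) \<le> (\<Sum>j=1..p. B * (sqrt n * (S * \<sigma>)))"
      using \<kappa> S0 \<sigma>(1) by (intro sum_mono mult_right_mono) auto
    then have "\<bar>1 / sqrt n\<bar> * (\<Sum>j=1..p. \<bar>\<kappa> j\<bar> * (sqrt n * (S * \<sigma>)))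
      \<le> \<bar>1 / sqrt n\<bar> * (real p * (B * (sqrt n * (S * \<sigma>))))"
      by (intro mult_left_mono) auto
    also have "\<dots> = real p * (B * (S * \<sigma>))"
    proof -
      have "\<bar>1 / r\<bar> * (a * (b * (r * d))) = a * (b * d)" if "0 < r" for r a b d :: real
        using that by (simp add: field_simps)
      from this[OF rn(1)] show ?thesis .
    qed
    finally show "\<bar>1 / sqrt n\<bar> * (\<Sum>j=1..p. \<bar>\<kappa> j\<bar> * (sqrt n * (S * \<sigma>))) \<le> real p * (B * (S * \<sigma>))" .
  qed
qed

lemma l1_mean_W: "l1 (\<lambda>\<omega>. (\<Sum>t\<in>{1..int n}. W t \<omega>) / n) (1 + real p * (S * \<sigma>))"
proof -
  have "l1 (\<lambda>\<omega>. (1 / real n) * (\<Sum>t\<in>{1..int n}. W t \<omega>)) (\<bar>1 / real n\<bar> * (\<Sum>t\<in>{1..int n}. 1 + real p * (S * \<sigma>)))"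
    by (intro l1_cmult l1_sum l1_W)
  then show ?thesis using n1 by simp
qed

text \<open>The bounds of \<open>err_U\<close>, \<open>err_cross\<close>, \<open>err_jump\<close>,
  \<open>err_bernoulli\<close>, \<open>err_taylor\<close> and \<open>err_linear\<close>, in this
  order, divided by \<open>sqrt n\<close>.\<close>

definition rem :: real where
  "rem = sqrt ((real p + 1) * g + K1 * (1 + real p * (S * \<sigma>)))
    + sqrt n * g * ((real p + 1) * (2 * K1 * (1 + real p * (S * \<sigma>)) + real p * mQ K1))
    + sqrt n * g * g * ((real p + 2) * (real p + 1) * real p) + (real p + 1) * sqrt g
    + 4 * L * B\<^sup>2 * (real p + 1) * (1 + real p * (S\<^sup>2 * \<sigma>\<^sup>2)) / sqrt n + C * (real p * (B * (S * \<sigma>))) / sqrt n"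

text \<open>The difference of the indicators is \<open>D + (q - f - l) + f + l\<close>. Here
  \<open>f\<close> is replaced by single jumps and these by their mean, \<open>l\<close> by its
  linear part, whose sum is evaluated last; the errors are the six terms of
  \<open>rem\<close>.\<close>

lemma shifted_counts:
  "l1 (\<lambda>\<omega>. (\<Sum>t\<in>{1..int n}. (if \<epsilon> t \<omega> \<le> c + (eta t \<omega> + s1 t \<omega>) then 1 else 0) - (if \<epsilon> t \<omega> \<le> c then 1 else 0)) / sqrt n
      - sqrt n * g * (\<Sum>i\<le>p. E\<phi> i) - G' c * (\<kappa> 0 + \<kappa>' * ((\<Sum>t\<in>{1..int n}. W t \<omega>) / n))) rem"
proof -
  define r where "r = sqrt n"
  have r: "0 < r" "real n = r * r" using n1 by (auto simp: r_def)
  let ?T = "{1..int n}"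
  let ?w = "1 + real p * (S * \<sigma>)"
  have "l1 (\<lambda>\<omega>. (1 / r) * ((\<Sum>t\<in>?T. D t \<omega>) + ((\<Sum>t\<in>?T. q t \<omega> - f t \<omega> - l t \<omega>)
      + ((\<Sum>t\<in>?T. f t \<omega> - (\<Sum>i\<le>p. z (t - int i) \<omega> * \<phi> i (\<xi> (t - int i) \<omega>)))
      + ((\<Sum>i\<le>p. \<Sum>t\<in>?T. z (t - int i) \<omega> * \<phi> i (\<xi> (t - int i) \<omega>) - g * E\<phi> i)
      + ((\<Sum>t\<in>?T. l t \<omega> - G' c * s0 t \<omega>)
      + G' c * ((\<Sum>t\<in>?T. s0 t \<omega>) - sqrt n * (\<kappa> 0 + \<kappa>' * ((\<Sum>t\<in>?T. W t \<omega>) / n)))))))))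
    (\<bar>1 / r\<bar> * (sqrt (real n * ((real p + 1) * g + K1 * ?w)) + (real n * ((real p + 1) * g * (2 * K1 * ?w + real p * mQ K1))
     + (real n * ((real p + 2) * ((real p + 1) * real p * (g * g))) + ((\<Sum>i\<le>p. sqrt (real n * g))
     + (real n * (L * (2 * B / sqrt n)\<^sup>2 * ((real p + 1) * (1 + real p * (S\<^sup>2 * \<sigma>\<^sup>2))))
     + \<bar>G' c\<bar> * (real p * (B * (S * \<sigma>)))))))))"
    by (intro l1_cmult[of _ _ "1 / r"] l1_add err_U err_cross err_jump err_taylor l1_sum err_bernoulli l1_cmult[OF err_linear]) simp
  then have "l1 (\<lambda>\<omega>. (\<Sum>t\<in>?T. (if \<epsilon> t \<omega> \<le> c + (eta t \<omega> + s1 t \<omega>) then 1 else 0) - (if \<epsilon> t \<omega> \<le> c then 1 else 0)) / r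
      - r * g * (\<Sum>i\<le>p. E\<phi> i) - G' c * (\<kappa> 0 + \<kappa>' * ((\<Sum>t\<in>?T. W t \<omega>) / n)))
    (\<bar>1 / r\<bar> * (sqrt (real n * ((real p + 1) * g + K1 * ?w)) + (real n * ((real p + 1) * g * (2 * K1 * ?w + real p * mQ K1))
     + (real n * ((real p + 2) * ((real p + 1) * real p * (g * g))) + ((\<Sum>i\<le>p. sqrt (real n * g))
     + (real n * (L * (2 * B / sqrt n)\<^sup>2 * ((real p + 1) * (1 + real p * (S\<^sup>2 * \<sigma>\<^sup>2))))
     + \<bar>G' c\<bar> * (real p * (B * (S * \<sigma>)))))))))"
  proof (rule l1_cong)
    fix \<omega>
    have Y: "(if \<epsilon> t \<omega> \<le> c + (eta t \<omega> + s1 t \<omega>) then 1 else 0) - (if \<epsilon> t \<omega> \<le> c then 1 else 0) = D t \<omega> + q t \<omega>" for t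
      by (simp add: D_def)
    have sw: "(\<Sum>i\<le>p. \<Sum>t\<in>?T. z (t - int i) \<omega> * \<phi> i (\<xi> (t - int i) \<omega>) - g * E\<phi> i)
       = (\<Sum>t\<in>?T. \<Sum>i\<le>p. z (t - int i) \<omega> * \<phi> i (\<xi> (t - int i) \<omega>)) - r * (r * g * (\<Sum>i\<le>p. E\<phi> i))"
    proof -
      have "(\<Sum>i\<le>p. \<Sum>t\<in>?T. z (t - int i) \<omega> * \<phi> i (\<xi> (t - int i) \<omega>) - g * E\<phi> i)
        = (\<Sum>i\<le>p. \<Sum>t\<in>?T. z (t - int i) \<omega> * \<phi> i (\<xi> (t - int i) \<omega>)) - (\<Sum>i\<le>p. real n * (g * E\<phi> i))"
        by (simp add: sum_subtractf)
      also have "(\<Sum>i\<le>p. real n * (g * E\<phi> i)) = r * (r * g * (\<Sum>i\<le>p. E\<phi> i))"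
        unfolding r(2) sum_distrib_left by (intro sum.cong) auto
      finally show ?thesis by (subst (2) sum.swap)
    qed
    show "(1 / r) * ((\<Sum>t\<in>?T. D t \<omega>) + ((\<Sum>t\<in>?T. q t \<omega> - f t \<omega> - l t \<omega>)
      + ((\<Sum>t\<in>?T. f t \<omega> - (\<Sum>i\<le>p. z (t - int i) \<omega> * \<phi> i (\<xi> (t - int i) \<omega>)))
      + ((\<Sum>i\<le>p. \<Sum>t\<in>?T. z (t - int i) \<omega> * \<phi> i (\<xi> (t - int i) \<omega>) - g * E\<phi> i)
      + ((\<Sum>t\<in>?T. l t \<omega> - G' c * s0 t \<omega>)
      + G' c * ((\<Sum>t\<in>?T. s0 t \<omega>) - sqrt n * (\<kappa> 0 + \<kappa>' * ((\<Sum>t\<in>?T. W t \<omega>) / n))))))))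
      = (\<Sum>t\<in>?T. (if \<epsilon> t \<omega> \<le> c + (eta t \<omega> + s1 t \<omega>) then 1 else 0) - (if \<epsilon> t \<omega> \<le> c then 1 else 0)) / r
      - r * g * (\<Sum>i\<le>p. E\<phi> i) - G' c * (\<kappa> 0 + \<kappa>' * ((\<Sum>t\<in>?T. W t \<omega>) / n))"
    proof -
      have e: "(\<Sum>t\<in>?T. q t \<omega> - f t \<omega> - l t \<omega>) = (\<Sum>t\<in>?T. q t \<omega>) - (\<Sum>t\<in>?T. f t \<omega>) - (\<Sum>t\<in>?T. l t \<omega>)"
        "(\<Sum>t\<in>?T. f t \<omega> - (\<Sum>i\<le>p. z (t - int i) \<omega> * \<phi> i (\<xi> (t - int i) \<omega>)))
          = (\<Sum>t\<in>?T. f t \<omega>) - (\<Sum>t\<in>?T. \<Sum>i\<le>p. z (t - int i) \<omega> * \<phi> i (\<xi> (t - int i) \<omega>))"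
        "(\<Sum>t\<in>?T. l t \<omega> - G' c * s0 t \<omega>) = (\<Sum>t\<in>?T. l t \<omega>) - G' c * (\<Sum>t\<in>?T. s0 t \<omega>)"
        "(\<Sum>t\<in>?T. D t \<omega> + q t \<omega>) = (\<Sum>t\<in>?T. D t \<omega>) + (\<Sum>t\<in>?T. q t \<omega>)"
        by (simp_all add: sum_subtractf sum.distrib sum_distrib_left)
      have "1 / r * (d + (u - a - b + (a - x + (x - r * y + (b - w * s + w * (s - r * k)))))) = (d + u) / r - y - w * k"
        for d u a b x y w s k :: real using r(1) by (simp add: field_simps)
      then show ?thesis unfolding Y sw e r_def[symmetric] .
    qed
  qed
  then show ?thesis unfolding r_def[symmetric]
  proof (rule l1_mono)
    have s: "sqrt (r * r * a) = r * sqrt a" for a using r(1) by (simp add: real_sqrt_mult)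
    have "\<bar>1 / r\<bar> * (sqrt (real n * ((real p + 1) * g + K1 * ?w)) + (real n * ((real p + 1) * g * (2 * K1 * ?w + real p * mQ K1))
     + (real n * ((real p + 2) * ((real p + 1) * real p * (g * g))) + ((\<Sum>i\<le>p. sqrt (real n * g))
     + (real n * (L * (2 * B / r)\<^sup>2 * ((real p + 1) * (1 + real p * (S\<^sup>2 * \<sigma>\<^sup>2))))
     + \<bar>G' c\<bar> * (real p * (B * (S * \<sigma>))))))))
     \<le> \<bar>1 / r\<bar> * (sqrt (real n * ((real p + 1) * g + K1 * ?w)) + (real n * ((real p + 1) * g * (2 * K1 * ?w + real p * mQ K1))
     + (real n * ((real p + 2) * ((real p + 1) * real p * (g * g))) + ((\<Sum>i\<le>p. sqrt (real n * g))
     + (real n * (L * (2 * B / r)\<^sup>2 * ((real p + 1) * (1 + real p * (S\<^sup>2 * \<sigma>\<^sup>2))))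
     + C * (real p * (B * (S * \<sigma>))))))))"
      using G'_bound S0 B0 \<sigma>(1) r(1)
      by (intro mult_left_mono add_left_mono mult_right_mono add_nonneg_nonneg mult_nonneg_nonneg) auto
    also have "\<dots> = rem"
    proof -
      have "\<bar>1 / r\<bar> * (r * A + (r * r * (P * g * E) + (r * r * (H * (N * I * (g * g))) + (P * (r * J)
        + (r * r * (L * (2 * B / r)\<^sup>2 * (P * K)) + C * F))))) =
        (A + r * g * (P * E) + r * g * g * (H * N * I) + P * J + 4 * L * B\<^sup>2 * P * K / r + C * F / r)"
        for A P E H N I J K F :: real
        using r(1) by (simp add: field_simps power2_eq_square)
      moreover have "(\<Sum>i\<le>p. r * sqrt g) = (real p + 1) * (r * sqrt g)" by (simp add: algebra_simps)
      ultimately show ?thesis unfolding rem_def unfolding r_def[symmetric] unfolding r(2) s by (simp only:)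
    qed
    finally show "\<bar>1 / r\<bar> * (sqrt (real n * ((real p + 1) * g + K1 * ?w)) + (real n * ((real p + 1) * g * (2 * K1 * ?w + real p * mQ K1))
     + (real n * ((real p + 2) * ((real p + 1) * real p * (g * g))) + ((\<Sum>i\<le>p. sqrt (real n * g))
     + (real n * (L * (2 * B / r)\<^sup>2 * ((real p + 1) * (1 + real p * (S\<^sup>2 * \<sigma>\<^sup>2))))
     + \<bar>G' c\<bar> * (real p * (B * (S * \<sigma>))))))))
     \<le> rem" .
  qed
qed

end

section \<open>Moving average approximation and the local alternative\<close>

context contaminated_ar begin

lemma v_identically_distributed: "distr M borel (v t) = distr M borel (v 0)"
proof -
  note v_measurable[measurable]
  have P: "(\<lambda>\<omega> s. v (s + k) \<omega>) \<in> M \<rightarrow>\<^sub>M Pi\<^sub>M UNIV (\<lambda>_. borel)" for k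
    by (rule measurable_PiM_single') (auto simp: space_PiM)
  have d: "distr M borel (v k) = distr (distr M (Pi\<^sub>M UNIV (\<lambda>_. borel)) (\<lambda>\<omega> s. v (s + k) \<omega>)) borel (\<lambda>f. f 0)" for k
    by (subst distr_distr[OF _ P]) (auto simp: comp_def)
  have "distr M (Pi\<^sub>M UNIV (\<lambda>_. borel)) (\<lambda>\<omega> s. v (s + k) \<omega>) = distr M (Pi\<^sub>M UNIV (\<lambda>_. borel)) (\<lambda>\<omega> s. v s \<omega>)" for k
    using v_stationary unfolding strictly_stationary_def by blast
  then show ?thesis unfolding d[of t] d[of 0] by simp
qed

text \<open>Running the equation back \<open>k\<close> steps leaves a remainder whose coefficients
  tend to zero, applied to values of \<open>v\<close> at remote times. By stationarity these all
  have one law, hence a common level \<open>A\<close> that they rarely exceed, and some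
  \<open>k\<close> will do. The number \<open>e\<close> bounds both the error and the
  probability.\<close>

lemma ma_approximation:
  fixes \<mu> e :: real and \<psi> :: "nat \<Rightarrow> real"
  assumes p: "1 \<le> p" and mu: "\<nu> = (1 - (\<Sum>j=1..p. \<beta> j)) * \<mu>"
    and \<psi>0: "\<psi> 0 = 1" and sm: "summable (\<lambda>k. \<bar>\<psi> k\<bar>)"
    and \<psi>: "\<And>k. 1 \<le> k \<Longrightarrow> \<psi> k = (\<Sum>l=1..p. if l \<le> k then \<beta> l * \<psi> (k - l) else 0)"
    and e: "0 < e"
  obtains k where "prob {\<omega> \<in> space M. \<exists>t\<in>window. e < \<bar>v t \<omega> - \<mu> - (\<Sum>i<k. \<psi> i * \<epsilon> (t - int i) \<omega>)\<bar>} < e"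
proof -
  note v_measurable[measurable]
  define c where "c k j = (\<Sum>l=1..p. if j < l \<and> l \<le> k + j then \<beta> l * \<psi> (k + j - l) else 0)" for k j :: nat
  have \<psi>lim: "\<psi> \<longlonglongrightarrow> 0" using summable_LIMSEQ_zero[OF sm] by (simp add: tendsto_rabs_zero_iff)
  have clim: "(\<lambda>k. c k j) \<longlonglongrightarrow> 0" if "j < p" for j
  proof -
    have "(\<lambda>k. if j < l \<and> l \<le> k + j then \<beta> l * \<psi> (k + j - l) else 0) \<longlonglongrightarrow> 0" if l: "l \<in> {1..p}" for l
    proof (cases "j < l")
      case True
      have "(\<lambda>k. \<beta> l * \<psi> (k + j)) \<longlonglongrightarrow> \<beta> l * 0"
        by (intro tendsto_intros LIMSEQ_ignore_initial_segment \<psi>lim)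
      have "(\<lambda>k. if j < l \<and> l \<le> (k + l) + j then \<beta> l * \<psi> ((k + l) + j - l) else 0) \<longlonglongrightarrow> 0"
        using \<open>(\<lambda>k. \<beta> l * \<psi> (k + j)) \<longlonglongrightarrow> \<beta> l * 0\<close> True by simp
      then show ?thesis by (rule LIMSEQ_offset)
    qed simp
    then have "(\<lambda>k. c k j) \<longlonglongrightarrow> (\<Sum>l=1..p. 0)" unfolding c_def by (intro tendsto_sum)
    then show ?thesis by simp
  qed
  \<comment> \<open>The number of events in the union bound: one for each time in the window and
    each of the \<open>p\<close> remainder terms.\<close>
  define N where "N = real (card window) * real p"
  have "int n \<in> window \<or> 0 \<in> window" using p by auto
  then have "card window \<noteq> 0" by auto
  then have N: "0 < N" using p by (simp add: N_def)
  interpret V: real_distribution "distr M borel (v 0)" by (rule real_distribution_distr) simp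
  obtain A where A: "0 < A" "\<And>t. prob {\<omega> \<in> space M. A < \<bar>v t \<omega> - \<mu>\<bar>} < e / (2 * N)"
  proof -
    have "(\<lambda>a::nat. measure (distr M borel (v 0)) {x. real a < \<bar>x - \<mu>\<bar>}) \<longlonglongrightarrow> measure (distr M borel (v 0)) (\<Inter>a. {x. real a < \<bar>x - \<mu>\<bar>})"
      by (rule V.finite_Lim_measure_decseq) (auto simp: decseq_def)
    also have "(\<Inter>a. {x. real a < \<bar>x - \<mu>\<bar>}) = {}"
    proof -
      have "x \<notin> (\<Inter>a. {x. real a < \<bar>x - \<mu>\<bar>})" for x
        using reals_Archimedean2[of "\<bar>x - \<mu>\<bar>"] by (auto simp: not_less intro: less_imp_le)
      then show ?thesis by blast
    qed
    finally have "(\<lambda>a::nat. measure (distr M borel (v 0)) {x. real a < \<bar>x - \<mu>\<bar>}) \<longlonglongrightarrow> 0" by simp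
    then obtain a0 where a0: "\<And>a. a0 \<le> a \<Longrightarrow> measure (distr M borel (v 0)) {x. real a < \<bar>x - \<mu>\<bar>} < e / (2 * N)"
      using LIMSEQ_D[of _ _ "e / (2 * N)"] e N by fastforce
    have "prob {\<omega> \<in> space M. real (Suc a0) < \<bar>v t \<omega> - \<mu>\<bar>} = measure (distr M borel (v 0)) {x. real (Suc a0) < \<bar>x - \<mu>\<bar>}" for t
      unfolding v_identically_distributed[of t, symmetric]
      by (subst measure_distr) (auto intro!: arg_cong[where f = prob])
    then show thesis using a0[of "Suc a0"] by (intro that[of "real (Suc a0)"]) auto
  qed
  have "(\<lambda>k. (\<Sum>j<p. \<bar>c k j\<bar>) * A) \<longlonglongrightarrow> (\<Sum>j<p. \<bar>0\<bar>) * A"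
    by (intro tendsto_mult tendsto_sum tendsto_rabs clim tendsto_const) simp
  then obtain k0 where k0: "\<And>k. k0 \<le> k \<Longrightarrow> (\<Sum>j<p. \<bar>c k j\<bar>) * A < e"
    using LIMSEQ_D[of "\<lambda>k. (\<Sum>j<p. \<bar>c k j\<bar>) * A" 0 e] e A(1) by (fastforce simp: abs_mult sum_nonneg)
  define k where "k = Suc k0"
  define Bad where "Bad = {\<omega> \<in> space M. \<exists>t\<in>window. e < \<bar>v t \<omega> - \<mu> - (\<Sum>i<k. \<psi> i * \<epsilon> (t - int i) \<omega>)\<bar>}"
  define T where "T t j = {\<omega> \<in> space M. A < \<bar>v (t - int k - int j) \<omega> - \<mu>\<bar>}" for t j
  have Tm: "T t j \<in> sets M" for t j unfolding T_def by measurable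
  have Um: "(\<Union>t\<in>window. \<Union>j<p. T t j) \<in> sets M" using Tm by (intro sets.finite_UN) auto
  \<comment> \<open>Countably many almost sure equations hold outside one null set, so the recursion
    can be run pathwise.\<close>
  have "AE \<omega> in M. \<forall>t. v t \<omega> = (\<Sum>j=1..p. \<beta> j * v (t - int j) \<omega>) + \<nu> + \<epsilon> t \<omega>"
    using v_equation by (simp add: AE_all_countable)
  then have AE: "AE \<omega> in M. \<omega> \<in> Bad \<longrightarrow> \<omega> \<in> (\<Union>t\<in>window. \<Union>j<p. T t j)"
  proof (rule AE_mp, intro AE_I2 impI)
    fix \<omega> assume \<omega>: "\<omega> \<in> space M" and eqn: "\<forall>t. v t \<omega> = (\<Sum>j=1..p. \<beta> j * v (t - int j) \<omega>) + \<nu> + \<epsilon> t \<omega>"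
      and bad: "\<omega> \<in> Bad"
    define w where "w t = v t \<omega> - \<mu>" for t
    have w: "w t = (\<Sum>l=1..p. \<beta> l * w (t - int l)) + \<epsilon> t \<omega>" for t
    proof -
      have "(\<Sum>l=1..p. \<beta> l * w (t - int l)) = (\<Sum>l=1..p. \<beta> l * v (t - int l) \<omega>) - (\<Sum>l=1..p. \<beta> l) * \<mu>"
        by (simp add: w_def algebra_simps sum_subtractf sum_distrib_left)
      moreover have "w t = (\<Sum>l=1..p. \<beta> l * v (t - int l) \<omega>) + \<nu> + \<epsilon> t \<omega> - \<mu>" using eqn unfolding w_def by metis
      ultimately show ?thesis using mu by (simp add: algebra_simps)
    qed
    obtain t where t: "t \<in> window" "e < \<bar>w t - (\<Sum>i<k. \<psi> i * \<epsilon> (t - int i) \<omega>)\<bar>"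
      using bad by (auto simp: Bad_def w_def)
    have "w t - (\<Sum>i<k. \<psi> i * \<epsilon> (t - int i) \<omega>) = (\<Sum>j<p. c k j * w (t - int k - int j))"
      unfolding c_def by (rule AR_backward[OF p w \<psi>0 \<psi>]) (simp_all add: k_def)
    have "\<exists>j<p. A < \<bar>w (t - int k - int j)\<bar>"
    proof (rule ccontr)
      assume "\<not> ?thesis"
      then have "\<forall>j<p. \<bar>w (t - int k - int j)\<bar> \<le> A" by (meson not_less)
      then have "\<bar>\<Sum>j<p. c k j * w (t - int k - int j)\<bar> \<le> (\<Sum>j<p. \<bar>c k j\<bar> * A)"
        by (intro order_trans[OF sum_abs] sum_mono) (auto simp: abs_mult intro!: mult_left_mono)
      also have "\<dots> < e" using k0[of k] by (simp add: k_def sum_distrib_right)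
      finally show False using t(2) \<open>w t - _ = _\<close> by simp
    qed
    then show "\<omega> \<in> (\<Union>t\<in>window. \<Union>j<p. T t j)" using t(1) \<omega> by (auto simp: T_def w_def)
  qed
  have "prob Bad \<le> prob (\<Union>t\<in>window. \<Union>j<p. T t j)" using AE Um by (rule finite_measure_mono_AE)
  also have "\<dots> \<le> (\<Sum>t\<in>window. prob (\<Union>j<p. T t j))"
    using Tm by (intro finite_measure_subadditive_finite) auto
  also have "\<dots> \<le> (\<Sum>t\<in>window. \<Sum>j<p. prob (T t j))"
    using Tm by (intro sum_mono finite_measure_subadditive_finite) auto
  also have "\<dots> \<le> (\<Sum>t\<in>window. \<Sum>j<p. e / (2 * N))"
    unfolding T_def by (intro sum_mono less_imp_le A)
  also have "\<dots> = N * (e / (2 * N))" unfolding N_def by (simp only: sum_constant card_lessThan mult.assoc)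
  also have "\<dots> = e / 2" using N by simp
  also have "\<dots> < e" using e by simp
  finally show thesis unfolding Bad_def by (rule that)
qed

end

section \<open>Second moment and smoothness of the local alternative\<close>

lemma local_rate_bounds: "0 \<le> \<rho> \<Longrightarrow> 0 \<le> local_rate \<rho> n" "local_rate \<rho> n \<le> 1"
  by (auto simp: local_rate_def)

lemma cdf_scaled_std_normal:
  assumes "0 < \<theta>" shows "cdf (distr std_normal_distribution borel (\<lambda>x. \<theta> * x)) u = std_normal_cdf (u / \<theta>)"
proof -
  have "(\<lambda>x. \<theta> * x) -` {..u} \<inter> space std_normal_distribution = {..u / \<theta>}"
    using assms by (auto simp: field_simps)
  then show ?thesis unfolding cdf_def std_normal_cdf_def by (subst measure_distr) auto
qed

text \<open>The distribution function determines the law, so \<open>E\<close> is the mixture that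
  chooses between \<open>H\<close> and a centred normal law by a Bernoulli variable. Its second
  moment is a convex combination, bounded by the sum.\<close>

lemma local_alt_second_moment:
  assumes E: "real_distribution E" "cdf E = local_alt \<theta> H \<rho> n" and \<theta>: "0 < \<theta>" and \<rho>: "0 \<le> \<rho>"
    and H: "real_distribution H" "integrable H (\<lambda>u. u\<^sup>2)"
  shows "(\<integral>u. u\<^sup>2 \<partial>E) \<le> \<theta>\<^sup>2 + (\<integral>u. u\<^sup>2 \<partial>H)"
proof -
  define a where "a = local_rate \<rho> n"
  have a: "0 \<le> a" "a \<le> 1" using local_rate_bounds(1)[OF \<rho>] local_rate_bounds(2) by (auto simp: a_def)
  define N where "N = distr std_normal_distribution borel (\<lambda>x. \<theta> * x)"
  interpret H: real_distribution H by (rule H)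
  interpret N: real_distribution N unfolding N_def by (rule std_normal.real_distribution_distr) simp
  define mix where "mix = measure_pmf (bernoulli_pmf a) \<bind> (\<lambda>b. if b then H else N)"
  have k: "(\<lambda>b. if b then H else N) \<in> measure_pmf (bernoulli_pmf a) \<rightarrow>\<^sub>M subprob_algebra borel"
    by (auto simp: space_subprob_algebra N.prob_space_axioms H.prob_space_axioms intro!: prob_space_imp_subprob_space split: if_splits)
  have sets: "sets mix = sets borel" unfolding mix_def by (rule sets_bind[OF sets_kernel[OF k]]) auto
  have em: "emeasure mix A = ennreal a * emeasure H A + ennreal (1 - a) * emeasure N A" if "A \<in> sets borel" for A
    unfolding mix_def using a by (subst emeasure_bind[OF _ k that]) (auto simp: nn_integral_bernoulli_pmf mult.commute)
  have nn: "(\<integral>\<^sup>+u. f u \<partial>mix) = ennreal a * (\<integral>\<^sup>+u. f u \<partial>H) + ennreal (1 - a) * (\<integral>\<^sup>+u. f u \<partial>N)"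
    if "f \<in> borel_measurable borel" for f
    unfolding mix_def using a by (subst nn_integral_bind[OF that k]) (auto simp: nn_integral_bernoulli_pmf mult.commute)
  have "prob_space mix"
    unfolding mix_def by (rule measure_pmf.prob_space_bind[OF _ k]) (auto simp: N.prob_space_axioms H.prob_space_axioms)
  then interpret mix: prob_space mix .
  have mix: "real_distribution mix"
    by unfold_locales (use sets sets_eq_imp_space_eq[OF sets] in auto)
  have "cdf mix u = local_alt \<theta> H \<rho> n u" for u
  proof -
    have "ennreal (cdf mix u) = ennreal a * ennreal (cdf H u) + ennreal (1 - a) * ennreal (cdf N u)"
      unfolding cdf_def mix.emeasure_eq_measure[symmetric] H.emeasure_eq_measure[symmetric] N.emeasure_eq_measure[symmetric]
      by (rule em) simp
    also have "\<dots> = ennreal (a * cdf H u + (1 - a) * cdf N u)"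
      using a by (simp add: ennreal_mult[symmetric] ennreal_plus[symmetric] H.cdf_nonneg N.cdf_nonneg del: ennreal_plus)
    finally have "cdf mix u = a * cdf H u + (1 - a) * cdf N u"
      using a by (subst (asm) ennreal_inj) (auto simp: H.cdf_nonneg N.cdf_nonneg cdf_def)
    then show ?thesis unfolding N_def cdf_scaled_std_normal[OF \<theta>] by (simp add: local_alt_def a_def)
  qed
  then have "E = mix" using E mix by (intro cdf_unique) auto
  have N2: "(\<integral>\<^sup>+u. ennreal (u\<^sup>2) \<partial>N) = ennreal (\<theta>\<^sup>2)"
  proof -
    have "(\<integral>\<^sup>+u. ennreal (u\<^sup>2) \<partial>N) = (\<integral>\<^sup>+u. ennreal ((\<theta> * u)\<^sup>2) \<partial>std_normal_distribution)"
      unfolding N_def by (subst nn_integral_distr) auto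
    also have "\<dots> = ennreal (\<integral>u. (\<theta> * u)\<^sup>2 \<partial>std_normal_distribution)"
      using integrable_std_normal_distribution_moment[of 2] by (intro nn_integral_eq_integral) (auto simp: power_mult_distrib)
    also have "(\<integral>u. (\<theta> * u)\<^sup>2 \<partial>std_normal_distribution) = \<theta>\<^sup>2"
      using std_normal_distribution_even_moments[of 1] by (simp add: power_mult_distrib)
    finally show ?thesis .
  qed
  have H2: "(\<integral>\<^sup>+u. ennreal (u\<^sup>2) \<partial>H) = ennreal (\<integral>u. u\<^sup>2 \<partial>H)"
    by (rule nn_integral_eq_integral[OF H(2)]) auto
  have "(\<integral>\<^sup>+u. ennreal (u\<^sup>2) \<partial>E) = ennreal (a * (\<integral>u. u\<^sup>2 \<partial>H) + (1 - a) * \<theta>\<^sup>2)"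
    unfolding \<open>E = mix\<close> using a
    by (subst nn) (auto simp: N2 H2 ennreal_mult[symmetric] ennreal_plus[symmetric] simp del: ennreal_plus)
  then have "(\<integral>u. u\<^sup>2 \<partial>E) = a * (\<integral>u. u\<^sup>2 \<partial>H) + (1 - a) * \<theta>\<^sup>2"
  proof -
    note nn2 = \<open>(\<integral>\<^sup>+u. ennreal (u\<^sup>2) \<partial>E) = ennreal (a * (\<integral>u. u\<^sup>2 \<partial>H) + (1 - a) * \<theta>\<^sup>2)\<close>
    have m: "(\<lambda>u. u\<^sup>2) \<in> borel_measurable E" unfolding \<open>E = mix\<close> measurable_cong_sets[OF sets refl] by simp
    have "(\<integral>u. u\<^sup>2 \<partial>E) = enn2real (\<integral>\<^sup>+u. ennreal (u\<^sup>2) \<partial>E)" by (rule integral_eq_nn_integral[OF m]) simp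
    also have "\<dots> = a * (\<integral>u. u\<^sup>2 \<partial>H) + (1 - a) * \<theta>\<^sup>2"
      unfolding nn2 using a by (intro enn2real_ennreal add_nonneg_nonneg mult_nonneg_nonneg) auto
    finally show ?thesis .
  qed
  also have "\<dots> \<le> 1 * (\<integral>u. u\<^sup>2 \<partial>H) + 1 * \<theta>\<^sup>2" using a by (intro add_mono mult_right_mono) auto
  finally show ?thesis by simp
qed

lemma lipschitz_of_deriv_bound:
  fixes f f' :: "real \<Rightarrow> real"
  assumes "\<And>u. (f has_real_derivative f' u) (at u)" "\<And>u. \<bar>f' u\<bar> \<le> K"
  shows "\<bar>f u - f w\<bar> \<le> K * \<bar>u - w\<bar>"
proof -
  have "\<bar>f b - f a\<bar> \<le> K * \<bar>b - a\<bar>" if ab: "a < b" for a b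
  proof -
    obtain s where "f b - f a = (b - a) * f' s" using MVT2[OF ab, of f f'] assms(1) by blast
    then show ?thesis using assms(2)[of s] ab by (simp add: abs_mult mult.commute)
  qed
  from this[of u w] this[of w u] show ?thesis by (cases u w rule: linorder_cases) (auto simp: abs_minus_commute)
qed

lemma abs_mult_exp_le_one: "\<bar>x * exp (- x\<^sup>2 / 2)\<bar> \<le> 1" for x :: real
proof -
  have "\<bar>x\<bar> \<le> 1 + x\<^sup>2 / 2"
  proof -
    have "0 \<le> (\<bar>x\<bar> - 1)\<^sup>2" by simp
    then show ?thesis by (simp add: power2_diff)
  qed
  also have "\<dots> \<le> exp (x\<^sup>2 / 2)" using exp_ge_add_one_self[of "x\<^sup>2 / 2"] by simp
  finally have "\<bar>x\<bar> * exp (- x\<^sup>2 / 2) \<le> exp (x\<^sup>2 / 2) * exp (- x\<^sup>2 / 2)" by (intro mult_right_mono) auto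
  also have "\<dots> = 1" by (simp add: exp_add[symmetric])
  finally show ?thesis by (simp add: abs_mult)
qed

text \<open>The derivative is a convex combination of the normal density and of \<open>h\<close>, so
  constants that suit both components serve all \<rho> and \<open>n\<close>. Evenness of
  \<open>h\<close> is the derivative of the symmetry of \<open>H\<close>.\<close>

lemma local_alt_smooth:
  fixes H :: "real measure"
  assumes \<theta>: "0 < \<theta>" and H: "real_distribution H"
    and d1: "\<And>u. cdf H differentiable (at u)" and d2: "\<And>u. deriv (cdf H) differentiable (at u)"
    and b: "bounded (range (deriv (deriv (cdf H))))"
    and sym: "\<And>u. cdf H (- u) = 1 - cdf H u"
  obtains C L where "\<And>\<rho> n. 0 \<le> \<rho> \<Longrightarrow> \<exists>G'. (\<forall>u. (local_alt \<theta> H \<rho> n has_real_derivative G' u) (at u)) \<and>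
     (\<forall>u w. \<bar>G' u - G' w\<bar> \<le> L * \<bar>u - w\<bar>) \<and> (\<forall>u. \<bar>G' u\<bar> \<le> C) \<and> (\<forall>u. G' (- u) = G' u)"
proof -
  interpret H: real_distribution H by (rule H)
  define h where "h = deriv (cdf H)"
  have h: "(cdf H has_real_derivative h u) (at u)" for u
    using d1[of u] unfolding h_def by (simp add: DERIV_deriv_iff_real_differentiable)
  have h': "(h has_real_derivative deriv h u) (at u)" for u
    using d2[of u] unfolding h_def by (simp add: DERIV_deriv_iff_real_differentiable)
  obtain K where K: "\<And>u. \<bar>deriv h u\<bar> \<le> K" using b unfolding bounded_iff h_def by auto
  have hl: "\<bar>h u - h w\<bar> \<le> K * \<bar>u - w\<bar>" for u w by (rule lipschitz_of_deriv_bound[OF h' K])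
  \<comment> \<open>In every unit interval the mean value theorem finds a point where
    \<open>h\<close> is an increment of \<open>cdf H\<close>, at most one in size; the Lipschitz
    bound of \<open>h\<close> covers the distance to it.\<close>
  have hb: "\<bar>h u\<bar> \<le> 1 + K" for u
  proof -
    obtain s where s: "u < s" "s < u + 1" "cdf H (u + 1) - cdf H u = h s"
      using MVT2[of u "u + 1" "cdf H" h] h by auto
    have "\<bar>h s\<bar> \<le> 1" using s(3) H.cdf_nonneg[of u] H.cdf_nonneg[of "u + 1"] H.cdf_bounded_prob[of u] H.cdf_bounded_prob[of "u + 1"] by linarith
    moreover have "\<bar>h u - h s\<bar> \<le> K * 1"
    proof (rule order_trans[OF hl], rule mult_left_mono)
      show "0 \<le> K" using K[of 0] by linarith
    qed (use s in auto)
    ultimately show ?thesis by linarith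
  qed
  have hs: "h (- u) = h u" for u
  proof -
    have "((\<lambda>u. cdf H (- u)) has_real_derivative h (- u) * - 1) (at u)"
      by (rule DERIV_chain2[where g = "\<lambda>u. - u", OF h]) (auto intro!: derivative_eq_intros)
    moreover have "((\<lambda>u. 1 - cdf H u) has_real_derivative - h u) (at u)"
      using h by (auto intro!: derivative_eq_intros)
    ultimately show ?thesis unfolding sym using DERIV_unique by fastforce
  qed
  define k where "k u = std_normal_density (u / \<theta>) / \<theta>" for u
  have k: "((\<lambda>u. std_normal_cdf (u / \<theta>)) has_real_derivative k u) (at u)" for u
  proof -
    have "((\<lambda>u. std_normal_cdf (u / \<theta>)) has_real_derivative std_normal_density (u / \<theta>) * (1 / \<theta>)) (at u)"
      by (rule DERIV_chain2[where g = "\<lambda>u. u / \<theta>", OF DERIV_std_normal_cdf])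
        (use \<theta> in \<open>auto intro!: derivative_eq_intros\<close>)
    then show ?thesis by (simp add: k_def)
  qed
  have pi1: "1 / sqrt (2 * pi) \<le> 1" using pi_gt3 by simp
  have k': "(k has_real_derivative - (u / \<theta>) * std_normal_density (u / \<theta>) / \<theta>\<^sup>2) (at u)" for u
    unfolding k_def[abs_def] std_normal_density_def using \<theta>
    by (auto intro!: derivative_eq_intros simp: power2_eq_square field_simps)
  have k'b: "\<bar>- (u / \<theta>) * std_normal_density (u / \<theta>) / \<theta>\<^sup>2\<bar> \<le> 1 / \<theta>\<^sup>2" for u
  proof -
    have "\<bar>- (u / \<theta>) * std_normal_density (u / \<theta>) / \<theta>\<^sup>2\<bar> = (1 / sqrt (2 * pi)) * \<bar>u / \<theta> * exp (- (u / \<theta>)\<^sup>2 / 2)\<bar> / \<theta>\<^sup>2"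
      by (simp add: std_normal_density_def abs_mult)
    also have "\<dots> \<le> 1 * 1 / \<theta>\<^sup>2" using pi1 by (intro divide_right_mono mult_mono abs_mult_exp_le_one) auto
    finally show ?thesis by simp
  qed
  have kl: "\<bar>k u - k w\<bar> \<le> 1 / \<theta>\<^sup>2 * \<bar>u - w\<bar>" for u w by (rule lipschitz_of_deriv_bound[OF k' k'b])
  have kb: "\<bar>k u\<bar> \<le> 1 / \<theta>" for u
  proof -
    have "(1 / sqrt (2 * pi)) * exp (- (u / \<theta>)\<^sup>2 / 2) \<le> 1 * 1" using pi1 by (intro mult_mono) auto
    from divide_right_mono[OF this, of \<theta>] show ?thesis using \<theta> by (simp add: k_def std_normal_density_def)
  qed
  have ks: "k (- u) = k u" for u using std_normal_density_minus[of "u / \<theta>"] by (simp add: k_def)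
  show thesis
  proof (rule that[of "1 / \<theta>\<^sup>2 + K" "1 / \<theta> + (1 + K)"])
    fix \<rho> :: real and n :: nat assume \<rho>: "0 \<le> \<rho>"
    define a where "a = local_rate \<rho> n"
    have a: "0 \<le> a" "a \<le> 1" using local_rate_bounds(1)[OF \<rho>] local_rate_bounds(2) by (auto simp: a_def)
    have conv: "\<bar>(1 - a) * s + a * t\<bar> \<le> b + d" if "\<bar>s\<bar> \<le> b" "\<bar>t\<bar> \<le> d" for s t b d :: real
    proof -
      have "\<bar>1 - a\<bar> * \<bar>s\<bar> \<le> \<bar>s\<bar>" "\<bar>a\<bar> * \<bar>t\<bar> \<le> \<bar>t\<bar>" using a by (intro mult_left_le_one_le; simp)+
      then have "\<bar>(1 - a) * s\<bar> \<le> b" "\<bar>a * t\<bar> \<le> d" unfolding abs_mult using that by linarith+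
      then show ?thesis by linarith
    qed
    have "local_alt \<theta> H \<rho> n = (\<lambda>u. (1 - a) * std_normal_cdf (u / \<theta>) + a * cdf H u)"
      by (auto simp: local_alt_def a_def)
    then have "(local_alt \<theta> H \<rho> n has_real_derivative (1 - a) * k u + a * h u) (at u)" for u
      using k[of u] h[of u] by (auto intro!: derivative_eq_intros)
    moreover have "\<bar>((1 - a) * k u + a * h u) - ((1 - a) * k w + a * h w)\<bar> \<le> (1 / \<theta>\<^sup>2 + K) * \<bar>u - w\<bar>" for u w
      using conv[OF kl[of u w] hl[of u w]] by (simp add: algebra_simps)
    moreover have "\<bar>(1 - a) * k u + a * h u\<bar> \<le> 1 / \<theta> + (1 + K)" for u by (rule conv[OF kb hb])
    ultimately show "\<exists>G'. (\<forall>u. (local_alt \<theta> H \<rho> n has_real_derivative G' u) (at u)) \<and>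
     (\<forall>u w. \<bar>G' u - G' w\<bar> \<le> (1 / \<theta>\<^sup>2 + K) * \<bar>u - w\<bar>) \<and> (\<forall>u. \<bar>G' u\<bar> \<le> 1 / \<theta> + (1 + K)) \<and> (\<forall>u. G' (- u) = G' u)"
      using hs ks by (intro exI[of _ "\<lambda>u. (1 - a) * k u + a * h u"]) auto
  qed
qed

section \<open>Events of high probability and tightness\<close>

text \<open>Events are allowed to be non-measurable; they are tested by measurable subsets.\<close>

definition likely :: "(nat \<Rightarrow> 'w measure) \<Rightarrow> real \<Rightarrow> (nat \<Rightarrow> 'w \<Rightarrow> bool) \<Rightarrow> bool"
  where "likely M \<eta> P \<longleftrightarrow> (\<forall>\<^sub>F n in sequentially. \<exists>B\<in>sets (M n). (\<forall>\<omega>\<in>B. P n \<omega>) \<and> 1 - \<eta> < measure (M n) B)"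

definition asure :: "(nat \<Rightarrow> 'w measure) \<Rightarrow> (nat \<Rightarrow> 'w \<Rightarrow> bool) \<Rightarrow> bool"
  where "asure M P \<longleftrightarrow> (\<forall>\<eta>>0. likely M \<eta> P)"

definition tight :: "(nat \<Rightarrow> 'w measure) \<Rightarrow> (nat \<Rightarrow> 'w \<Rightarrow> real) \<Rightarrow> bool"
  where "tight M X \<longleftrightarrow> (\<forall>\<eta>>0. \<exists>K. likely M \<eta> (\<lambda>n \<omega>. \<bar>X n \<omega>\<bar> \<le> K))"

text \<open>As in the model, the spaces are constrained for \<open>n \<ge> 1\<close> only; the
  asymptotic notions ignore \<open>n = 0\<close>.\<close>

locale prob_seq =
  fixes M :: "nat \<Rightarrow> 'w measure"
  assumes M_prob: "\<And>n. 1 \<le> n \<Longrightarrow> prob_space (M n)"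
begin

lemma likely_mono:
  assumes "likely M \<eta> P" "\<forall>\<^sub>F n in sequentially. \<forall>\<omega>\<in>space (M n). P n \<omega> \<longrightarrow> P' n \<omega>" "\<eta> \<le> \<eta>'"
  shows "likely M \<eta>' P'"
  using assms(1,2) unfolding likely_def
proof eventually_elim
  case (elim n)
  then obtain B where B: "B \<in> sets (M n)" "\<forall>\<omega>\<in>B. P n \<omega>" "1 - \<eta> < measure (M n) B" by blast
  then show ?case using elim(2) sets.sets_into_space[OF B(1)] assms(3) by (intro bexI[of _ B]) auto
qed

lemma likely_conj:
  assumes "likely M \<eta> P" "likely M \<eta>' P'"
  shows "likely M (\<eta> + \<eta>') (\<lambda>n \<omega>. P n \<omega> \<and> P' n \<omega>)"
  using assms(1)[unfolded likely_def] assms(2)[unfolded likely_def] eventually_ge_at_top[of 1] unfolding likely_def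
proof eventually_elim
  case (elim n)
  interpret prob_space "M n" using elim by (intro M_prob) simp
  obtain B where B: "B \<in> sets (M n)" "\<forall>\<omega>\<in>B. P n \<omega>" "1 - \<eta> < prob B" using elim by blast
  obtain B' where B': "B' \<in> sets (M n)" "\<forall>\<omega>\<in>B'. P' n \<omega>" "1 - \<eta>' < prob B'" using elim by blast
  have "prob (B \<union> B') = prob B + prob B' - prob (B \<inter> B')"
    using B B' by (intro measure_Un3) (auto simp: fmeasurable_eq_sets)
  moreover have "prob (B \<union> B') \<le> 1" by (rule prob_le_1)
  ultimately show ?case using B B' by (intro bexI[of _ "B \<inter> B'"]) auto
qed

lemma asure_likely: "asure M P \<Longrightarrow> 0 < \<eta> \<Longrightarrow> likely M \<eta> P" by (simp add: asure_def)

lemma asure_mono: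
  "asure M P \<Longrightarrow> \<forall>\<^sub>F n in sequentially. \<forall>\<omega>\<in>space (M n). P n \<omega> \<longrightarrow> P' n \<omega> \<Longrightarrow> asure M P'"
  unfolding asure_def using likely_mono by blast

lemma asure_conj: assumes "asure M P" "asure M P'" shows "asure M (\<lambda>n \<omega>. P n \<omega> \<and> P' n \<omega>)"
  unfolding asure_def
proof (intro allI impI)
  fix \<eta> :: real assume "0 < \<eta>"
  then show "likely M \<eta> (\<lambda>n \<omega>. P n \<omega> \<and> P' n \<omega>)"
    using likely_conj[OF asure_likely[OF assms(1), of "\<eta>/2"] asure_likely[OF assms(2), of "\<eta>/2"]] by simp
qed

lemma asure_true: "asure M (\<lambda>n \<omega>. True)"
  unfolding asure_def likely_def
proof (intro allI impI)
  fix \<eta> :: real assume "0 < \<eta>"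
  then show "\<forall>\<^sub>F n in sequentially. \<exists>B\<in>sets (M n). (\<forall>\<omega>\<in>B. True) \<and> 1 - \<eta> < measure (M n) B"
    using eventually_ge_at_top[of 1]
    by (rule_tac eventually_mono[OF eventually_ge_at_top[of 1]])
      (auto intro!: bexI[of _ "space (M _)"] simp: prob_space.prob_space[OF M_prob])
qed

lemma asure_ball: assumes "finite I" "\<And>i. i \<in> I \<Longrightarrow> asure M (P i)" shows "asure M (\<lambda>n \<omega>. \<forall>i\<in>I. P i n \<omega>)"
  using assms
proof (induction I)
  case empty then show ?case by (simp add: asure_true)
next
  case (insert i I)
  then have "asure M (\<lambda>n \<omega>. P i n \<omega> \<and> (\<forall>i\<in>I. P i n \<omega>))" by (intro asure_conj) auto
  then show ?case by (rule asure_mono) auto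
qed

lemma likely_compl:
  assumes "\<forall>\<^sub>F n in sequentially. {\<omega> \<in> space (M n). \<not> P n \<omega>} \<in> sets (M n) \<and> measure (M n) {\<omega> \<in> space (M n). \<not> P n \<omega>} < \<eta>"
  shows "likely M \<eta> P"
  using assms eventually_ge_at_top[of 1] unfolding likely_def
proof eventually_elim
  case (elim n)
  interpret prob_space "M n" using elim by (intro M_prob) simp
  let ?N = "{\<omega> \<in> space (M n). \<not> P n \<omega>}"
  have "prob (space (M n) - ?N) = 1 - prob ?N" using elim by (intro prob_compl) auto
  then show ?case using elim by (intro bexI[of _ "space (M n) - ?N"]) auto
qed

lemma asure_measure_compl:
  assumes "asure M P" and "\<And>n. 1 \<le> n \<Longrightarrow> {\<omega> \<in> space (M n). \<not> P n \<omega>} \<in> sets (M n)" and \<eta>: "0 < \<eta>"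
  shows "\<forall>\<^sub>F n in sequentially. measure (M n) {\<omega> \<in> space (M n). \<not> P n \<omega>} < \<eta>"
  using asure_likely[OF assms(1) \<eta>, unfolded likely_def] eventually_ge_at_top[of 1]
proof eventually_elim
  case (elim n)
  interpret prob_space "M n" using elim by (intro M_prob) simp
  obtain B where B: "B \<in> sets (M n)" "\<forall>\<omega>\<in>B. P n \<omega>" "1 - \<eta> < prob B" using elim by blast
  have "prob {\<omega> \<in> space (M n). \<not> P n \<omega>} \<le> prob (space (M n) - B)"
    using B by (intro finite_measure_mono) auto
  also have "\<dots> = 1 - prob B" using B by (intro prob_compl)
  finally show ?case using B by simp
qed

lemma asure_l1:
  assumes "\<And>n. 1 \<le> n \<Longrightarrow> prob_space.l1 (M n) (X n) (b n)" "b \<longlonglongrightarrow> 0" "0 < e"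
  shows "asure M (\<lambda>n \<omega>. \<bar>X n \<omega>\<bar> \<le> e)"
  unfolding asure_def
proof (intro allI impI likely_compl)
  fix \<eta> :: real assume \<eta>: "0 < \<eta>"
  have "\<forall>\<^sub>F n in sequentially. b n < \<eta> * e"
    using order_tendstoD(2)[OF assms(2), of "\<eta> * e"] \<eta> assms(3) by simp
  then show "\<forall>\<^sub>F n in sequentially. {\<omega> \<in> space (M n). \<not> \<bar>X n \<omega>\<bar> \<le> e} \<in> sets (M n) \<and>
      measure (M n) {\<omega> \<in> space (M n). \<not> \<bar>X n \<omega>\<bar> \<le> e} < \<eta>"
    using eventually_ge_at_top[of 1]
  proof eventually_elim
    case (elim n)
    interpret prob_space "M n" using elim by (intro M_prob) simp
    have l: "l1 (X n) (b n)" using elim assms(1) by simp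
    then have [measurable]: "X n \<in> borel_measurable (M n)" by (auto simp: l1_def)
    have "prob {\<omega> \<in> space (M n). e < \<bar>X n \<omega>\<bar>} \<le> b n / e" by (rule l1_markov[OF l assms(3)])
    also have "\<dots> < \<eta>" using elim assms(3) by (simp add: field_simps)
    finally show ?case by (simp add: not_le)
  qed
qed

lemma tight_l1:
  assumes "\<And>n. 1 \<le> n \<Longrightarrow> prob_space.l1 (M n) (X n) b"
  shows "tight M X"
  unfolding tight_def
proof (intro allI impI)
  fix \<eta> :: real assume \<eta>: "0 < \<eta>"
  have b: "0 \<le> b"
  proof -
    interpret prob_space "M 1" by (intro M_prob) simp
    show ?thesis using assms[of 1] unfolding l1_def by (meson Bochner_Integration.integral_nonneg abs_ge_zero order_refl order_trans)
  qed
  define K where "K = (b + 1) / \<eta>"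
  have K: "0 < K" "b / K < \<eta>" using b \<eta> by (auto simp: K_def field_simps)
  show "\<exists>K. likely M \<eta> (\<lambda>n \<omega>. \<bar>X n \<omega>\<bar> \<le> K)"
  proof (intro exI[of _ K] likely_compl eventually_mono[OF eventually_ge_at_top[of 1]] conjI)
    fix n :: nat assume n: "1 \<le> n"
    interpret prob_space "M n" using n by (intro M_prob)
    have l: "l1 (X n) b" using n assms by simp
    then have [measurable]: "X n \<in> borel_measurable (M n)" by (auto simp: l1_def)
    show "{\<omega> \<in> space (M n). \<not> \<bar>X n \<omega>\<bar> \<le> K} \<in> sets (M n)" by measurable
    show "measure (M n) {\<omega> \<in> space (M n). \<not> \<bar>X n \<omega>\<bar> \<le> K} < \<eta>"
      using l1_markov[OF l K(1)] K(2) by (simp add: not_le)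
  qed
qed

lemma tight_add: assumes "tight M X" "tight M Y" shows "tight M (\<lambda>n \<omega>. X n \<omega> + Y n \<omega>)"
  unfolding tight_def
proof (intro allI impI)
  fix \<eta> :: real assume \<eta>: "0 < \<eta>"
  obtain K K' where "likely M (\<eta>/2) (\<lambda>n \<omega>. \<bar>X n \<omega>\<bar> \<le> K)" "likely M (\<eta>/2) (\<lambda>n \<omega>. \<bar>Y n \<omega>\<bar> \<le> K')"
    using assms \<eta> unfolding tight_def by (meson half_gt_zero)
  from likely_conj[OF this] show "\<exists>K. likely M \<eta> (\<lambda>n \<omega>. \<bar>X n \<omega> + Y n \<omega>\<bar> \<le> K)"
    by (intro exI[of _ "K + K'"]) (auto elim!: likely_mono intro!: always_eventually)
qed

lemma tight_mult: assumes "tight M X" "tight M Y" shows "tight M (\<lambda>n \<omega>. X n \<omega> * Y n \<omega>)"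
  unfolding tight_def
proof (intro allI impI)
  fix \<eta> :: real assume \<eta>: "0 < \<eta>"
  obtain K K' where "likely M (\<eta>/2) (\<lambda>n \<omega>. \<bar>X n \<omega>\<bar> \<le> K)" "likely M (\<eta>/2) (\<lambda>n \<omega>. \<bar>Y n \<omega>\<bar> \<le> K')"
    using assms \<eta> unfolding tight_def by (meson half_gt_zero)
  from likely_conj[OF this] show "\<exists>K. likely M \<eta> (\<lambda>n \<omega>. \<bar>X n \<omega> * Y n \<omega>\<bar> \<le> K)"
  proof (intro exI[of _ "K * K'"], elim likely_mono)
    show "\<forall>\<^sub>F n in sequentially. \<forall>\<omega>\<in>space (M n). \<bar>X n \<omega>\<bar> \<le> K \<and> \<bar>Y n \<omega>\<bar> \<le> K' \<longrightarrow> \<bar>X n \<omega> * Y n \<omega>\<bar> \<le> K * K'"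
      by (intro always_eventually allI ballI impI) (auto simp: abs_mult intro!: mult_mono)
  qed simp
qed

lemma tight_dominated:
  assumes "tight M Y" "\<forall>\<^sub>F n in sequentially. \<forall>\<omega>\<in>space (M n). \<bar>X n \<omega>\<bar> \<le> \<bar>Y n \<omega>\<bar>"
  shows "tight M X"
  unfolding tight_def
proof (intro allI impI)
  fix \<eta> :: real assume \<eta>: "0 < \<eta>"
  obtain K where K: "likely M \<eta> (\<lambda>n \<omega>. \<bar>Y n \<omega>\<bar> \<le> K)" using assms(1) \<eta> unfolding tight_def by blast
  show "\<exists>K. likely M \<eta> (\<lambda>n \<omega>. \<bar>X n \<omega>\<bar> \<le> K)"
    by (rule exI[of _ K], rule likely_mono[OF K])
      (use assms(2) in \<open>auto elim!: eventually_mono intro: order_trans\<close>)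
qed

lemma tight_const: "tight M (\<lambda>n \<omega>. c)"
  unfolding tight_def using asure_true by (auto simp: asure_def intro!: exI[of _ "\<bar>c\<bar>"])

lemma tight_sum: assumes "finite I" "\<And>i. i \<in> I \<Longrightarrow> tight M (X i)" shows "tight M (\<lambda>n \<omega>. \<Sum>i\<in>I. X i n \<omega>)"
  using assms by (induction I) (auto intro!: tight_add tight_const)

lemma tight_abs: "tight M X \<Longrightarrow> tight M (\<lambda>n \<omega>. \<bar>X n \<omega>\<bar>)"
  by (erule tight_dominated) auto

lemma tight_ball:
  assumes "finite I" "\<And>i. i \<in> I \<Longrightarrow> tight M (X i)" "0 < \<eta>"
  obtains K where "0 < K" "likely M \<eta> (\<lambda>n \<omega>. \<forall>i\<in>I. \<bar>X i n \<omega>\<bar> \<le> K)"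
proof -
  have "tight M (\<lambda>n \<omega>. \<Sum>i\<in>I. \<bar>X i n \<omega>\<bar>)" using assms by (intro tight_sum tight_abs)
  then obtain K where K: "likely M \<eta> (\<lambda>n \<omega>. \<bar>\<Sum>i\<in>I. \<bar>X i n \<omega>\<bar>\<bar> \<le> K)" using assms(3) unfolding tight_def by blast
  have "likely M \<eta> (\<lambda>n \<omega>. \<forall>i\<in>I. \<bar>X i n \<omega>\<bar> \<le> \<bar>K\<bar> + 1)"
  proof (rule likely_mono[OF K], intro always_eventually allI ballI impI)
    fix n \<omega> i assume "\<bar>\<Sum>i\<in>I. \<bar>X i n \<omega>\<bar>\<bar> \<le> K" "i \<in> I"
    moreover have "\<bar>X i n \<omega>\<bar> \<le> (\<Sum>i\<in>I. \<bar>X i n \<omega>\<bar>)" using assms(1) \<open>i \<in> I\<close> by (intro member_le_sum) auto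
    ultimately show "\<bar>X i n \<omega>\<bar> \<le> \<bar>K\<bar> + 1" by linarith
  qed simp
  then show thesis by (intro that[of "\<bar>K\<bar> + 1"]) auto
qed

end

section \<open>Residuals as perturbed innovations\<close>

lemma residual_expansion:
  fixes v z \<xi> e :: "int \<Rightarrow> real" and b \<beta> :: "nat \<Rightarrow> real"
  assumes v: "v t = (\<Sum>j=1..p. \<beta> j * v (t - int j)) + \<nu> + e t" and mu: "\<nu> = (1 - (\<Sum>j=1..p. \<beta> j)) * \<mu>"
    and r: "0 < r"
  defines "Y \<equiv> \<lambda>s. v s - \<mu> + z s * \<xi> s"
  shows "residual p (\<lambda>t. v t + z t * \<xi> t) mh b t = e t - ((\<Sum>j\<le>p. (if j = 0 then -1 else \<beta> j) * (z (t - int j) * \<xi> (t - int j)))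
     + (r * (mh - \<mu>) * (1 - (\<Sum>j=1..p. b j)) + (\<Sum>j=1..p. r * (b j - \<beta> j) * Y (t - int j))) / r)"
proof -
  have e: "{..p} = insert 0 {1..p}" by auto
  have 1: "(\<Sum>j\<le>p. (if j = 0 then -1 else \<beta> j) * (z (t - int j) * \<xi> (t - int j))) =
     - (z t * \<xi> t) + (\<Sum>j=1..p. \<beta> j * (z (t - int j) * \<xi> (t - int j)))"
    unfolding e by (subst sum.insert) (auto intro!: sum.cong)
  have 2: "(r * (mh - \<mu>) * (1 - (\<Sum>j=1..p. b j)) + (\<Sum>j=1..p. r * (b j - \<beta> j) * Y (t - int j))) / r
     = (mh - \<mu>) * (1 - (\<Sum>j=1..p. b j)) + (\<Sum>j=1..p. (b j - \<beta> j) * Y (t - int j))"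
  proof -
    have "(\<Sum>j=1..p. r * (b j - \<beta> j) * Y (t - int j)) = r * (\<Sum>j=1..p. (b j - \<beta> j) * Y (t - int j))"
      by (simp add: sum_distrib_left mult.assoc)
    then show ?thesis using r by (simp add: field_simps)
  qed
  \<comment> \<open>In the centred observations \<open>Y\<close> the residual is an autoregression
    with the estimated coefficients, minus the effect of the error in the mean. Comparing with the
    true coefficients leaves the coefficient errors and the contamination.\<close>
  have 3: "residual p (\<lambda>t. v t + z t * \<xi> t) mh b t = Y t - (\<Sum>j=1..p. b j * Y (t - int j)) - (mh - \<mu>) * (1 - (\<Sum>j=1..p. b j))"
    unfolding residual_def Y_def
    by (simp add: algebra_simps sum.distrib sum_subtractf sum_distrib_left)
  have 4: "Y t - (\<Sum>j=1..p. \<beta> j * Y (t - int j)) = e t + z t * \<xi> t - (\<Sum>j=1..p. \<beta> j * (z (t - int j) * \<xi> (t - int j)))"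
    unfolding Y_def v mu by (simp add: algebra_simps sum.distrib sum_subtractf sum_distrib_left)
  have 5: "(\<Sum>j=1..p. (b j - \<beta> j) * Y (t - int j)) = (\<Sum>j=1..p. b j * Y (t - int j)) - (\<Sum>j=1..p. \<beta> j * Y (t - int j))"
    by (simp add: left_diff_distrib sum_subtractf)
  show ?thesis unfolding 1 2 3 5 using 4 by simp
qed

text \<open>Rounding the coefficients costs at most \<delta> times one plus the sum of the
  \<open>\<bar>Y\<bar>\<close>, and exchanging \<open>Y'\<close> for \<open>Y\<close> at most
  another \<delta>. The total has the shape of the margin term of \<open>shift\<close>, with
  \<open>\<kappa>' = 2 * \<delta>\<close>.\<close>

lemma shift_perturbation:
  fixes \<tau> \<kappa> :: "nat \<Rightarrow> real" and Y Y' :: "int \<Rightarrow> real"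
  assumes \<tau>\<kappa>: "\<And>j. j \<le> p \<Longrightarrow> \<bar>\<tau> j - \<kappa> j\<bar> \<le> \<delta>" and \<tau>: "\<And>j. j \<le> p \<Longrightarrow> \<bar>\<tau> j\<bar> \<le> K"
    and Y: "\<And>j. j \<in> {1..p} \<Longrightarrow> \<bar>Y' (t - int j) - Y (t - int j)\<bar> \<le> d" and d: "real p * (K * d) \<le> \<delta>" and \<delta>: "0 \<le> \<delta>"
  shows "\<bar>(\<tau> 0 + (\<Sum>j=1..p. \<tau> j * Y' (t - int j))) - (\<kappa> 0 + (\<Sum>j=1..p. \<kappa> j * Y (t - int j)))\<bar>
    \<le> 2 * \<delta> * (1 + (\<Sum>j=1..p. \<bar>Y (t - int j)\<bar>))"
proof -
  have "(\<tau> 0 + (\<Sum>j=1..p. \<tau> j * Y' (t - int j))) - (\<kappa> 0 + (\<Sum>j=1..p. \<kappa> j * Y (t - int j)))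
    = (\<tau> 0 - \<kappa> 0) + (\<Sum>j=1..p. \<tau> j * (Y' (t - int j) - Y (t - int j)) + (\<tau> j - \<kappa> j) * Y (t - int j))"
    by (simp add: algebra_simps sum.distrib sum_subtractf)
  moreover have "\<bar>\<Sum>j=1..p. \<tau> j * (Y' (t - int j) - Y (t - int j)) + (\<tau> j - \<kappa> j) * Y (t - int j)\<bar> \<le>
     (\<Sum>j=1..p. K * d + \<delta> * \<bar>Y (t - int j)\<bar>)"
  proof (rule order_trans[OF sum_abs], rule sum_mono)
    fix j assume j: "j \<in> {1..p}"
    have "\<bar>\<tau> j * (Y' (t - int j) - Y (t - int j))\<bar> \<le> K * d" unfolding abs_mult
      using \<tau>[of j] Y[OF j] j order_trans[OF abs_ge_zero \<tau>, of j] by (intro mult_mono) auto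
    moreover have "\<bar>(\<tau> j - \<kappa> j) * Y (t - int j)\<bar> \<le> \<delta> * \<bar>Y (t - int j)\<bar>" unfolding abs_mult
      using \<tau>\<kappa>[of j] j by (intro mult_right_mono) auto
    ultimately show "\<bar>\<tau> j * (Y' (t - int j) - Y (t - int j)) + (\<tau> j - \<kappa> j) * Y (t - int j)\<bar> \<le> K * d + \<delta> * \<bar>Y (t - int j)\<bar>" by linarith
  qed
  moreover have "(\<Sum>j=1..p. K * d + \<delta> * \<bar>Y (t - int j)\<bar>) = real p * (K * d) + \<delta> * (\<Sum>j=1..p. \<bar>Y (t - int j)\<bar>)"
    by (simp add: sum.distrib sum_distrib_left)
  moreover have "0 \<le> \<delta> * (\<Sum>j=1..p. \<bar>Y (t - int j)\<bar>)" using \<delta> by (intro mult_nonneg_nonneg sum_nonneg) auto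
  moreover have "\<bar>\<tau> 0 - \<kappa> 0\<bar> \<le> \<delta>" using \<tau>\<kappa>[of 0] by simp
  ultimately have "\<bar>(\<tau> 0 + (\<Sum>j=1..p. \<tau> j * Y' (t - int j))) - (\<kappa> 0 + (\<Sum>j=1..p. \<kappa> j * Y (t - int j)))\<bar>
    \<le> \<delta> + (\<delta> + \<delta> * (\<Sum>j=1..p. \<bar>Y (t - int j)\<bar>))" using d by linarith
  also have "\<dots> \<le> 2 * \<delta> * (1 + (\<Sum>j=1..p. \<bar>Y (t - int j)\<bar>))"
    using \<open>0 \<le> \<delta> * (\<Sum>j=1..p. \<bar>Y (t - int j)\<bar>)\<close> by (simp add: algebra_simps)
  finally show ?thesis .
qed

text \<open>A convergent \<gamma> is bounded, so the truncation at one is eventually inactive and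
  the rate is \<open>\<gamma> n / sqrt n\<close>.\<close>

lemma local_rate_limits:
  assumes "\<gamma> \<longlonglongrightarrow> \<gamma>0"
  shows "(\<lambda>n. sqrt (real n) * local_rate (\<gamma> n) n) \<longlonglongrightarrow> \<gamma>0" "(\<lambda>n. local_rate (\<gamma> n) n) \<longlonglongrightarrow> 0"
proof -
  have s: "filterlim (\<lambda>n. sqrt (real n)) at_top sequentially"
    by (rule filterlim_compose[OF sqrt_at_top filterlim_real_sequentially])
  have "\<forall>\<^sub>F n in sequentially. \<gamma> n < \<gamma>0 + 1" using order_tendstoD(2)[OF assms, of "\<gamma>0 + 1"] by simp
  moreover have "\<forall>\<^sub>F n in sequentially. \<gamma>0 + 1 \<le> sqrt (real n)" using s by (simp add: filterlim_at_top)
  ultimately have ev: "\<forall>\<^sub>F n in sequentially. sqrt (real n) * local_rate (\<gamma> n) n = \<gamma> n"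
    using eventually_ge_at_top[of 1]
  proof eventually_elim
    case (elim n)
    then show ?case by (simp add: local_rate_def min_def field_simps)
  qed
  show 1: "(\<lambda>n. sqrt (real n) * local_rate (\<gamma> n) n) \<longlonglongrightarrow> \<gamma>0"
    by (rule Lim_transform_eventually[OF assms]) (use ev in \<open>auto elim!: eventually_mono\<close>)
  have "(\<lambda>n. (sqrt (real n) * local_rate (\<gamma> n) n) * inverse (sqrt (real n))) \<longlonglongrightarrow> \<gamma>0 * 0"
    by (intro tendsto_mult 1 tendsto_inverse_0_at_top s)
  then have "(\<lambda>n. (sqrt (real n) * local_rate (\<gamma> n) n) * inverse (sqrt (real n))) \<longlonglongrightarrow> 0" by simp
  then show "(\<lambda>n. local_rate (\<gamma> n) n) \<longlonglongrightarrow> 0"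
    by (rule Lim_transform_eventually) (auto intro!: eventually_mono[OF eventually_ge_at_top[of 1]])
qed

lemma truncated_mean_limit:
  fixes K :: "nat \<Rightarrow> real"
  assumes Q: "prob_space Q" "sets Q = sets borel" and K: "K \<longlonglongrightarrow> 0" "\<And>n. 0 \<le> K n"
  shows "(\<lambda>n. \<integral>s. min 1 (K n * \<bar>s\<bar>) \<partial>Q) \<longlonglongrightarrow> 0"
proof -
  interpret prob_space Q by (rule Q)
  note Q(2)[measurable_cong]
  have "(\<lambda>n. \<integral>s. min 1 (K n * \<bar>s\<bar>) \<partial>Q) \<longlonglongrightarrow> (\<integral>s. 0 \<partial>Q)"
  proof (rule integral_dominated_convergence[where w = "\<lambda>_. 1"])
    show "AE s in Q. (\<lambda>n. min 1 (K n * \<bar>s\<bar>)) \<longlonglongrightarrow> 0"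
    proof (rule AE_I2)
      fix s
      have "(\<lambda>n. min 1 (K n * \<bar>s\<bar>)) \<longlonglongrightarrow> min 1 (0 * \<bar>s\<bar>)" by (intro tendsto_intros K)
      then show "(\<lambda>n. min 1 (K n * \<bar>s\<bar>)) \<longlonglongrightarrow> 0" by simp
    qed
  qed (use K in auto)
  then show ?thesis by simp
qed

section \<open>Residual counts along convergent parameters\<close>

text \<open>One sequence of models with convergent parameters \<open>\<rho> n\<close> and
  \<open>\<gamma> n\<close>. Uniformity is recovered from such sequences by compactness, so the
  asymptotics need ordinary limits only, and the uniform conditions on the estimators become
  tightness along the sequence.\<close>

locale ar_array = cells x m + prob_seq M
  for x :: "nat \<Rightarrow> ereal" and m :: nat and M :: "nat \<Rightarrow> 'w measure" +
  fixes p :: nat and \<beta> :: "nat \<Rightarrow> real" and \<nu> \<mu> \<theta>\<^sub>0 :: real and Q H :: "real measure"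
    and \<rho> \<gamma> :: "nat \<Rightarrow> real" and \<rho>' \<gamma>' :: real
    and \<epsilon> v z \<xi> :: "nat \<Rightarrow> int \<Rightarrow> 'w \<Rightarrow> real"
    and \<mu>h \<theta>h :: "nat \<Rightarrow> 'w \<Rightarrow> real" and \<beta>h :: "nat \<Rightarrow> 'w \<Rightarrow> nat \<Rightarrow> real"
  assumes p: "1 \<le> p" and roots: "char_roots_inside p \<beta>"
    and mu: "\<nu> = (1 - (\<Sum>j=1..p. \<beta> j)) * \<mu>"
    and theta0: "0 < \<theta>\<^sub>0"
    and Q: "real_distribution Q" and H: "real_distribution H"
    and H_variance: "integrable H (\<lambda>u. u\<^sup>2)"
    and H_differentiable: "\<And>u. cdf H differentiable (at u)" "\<And>u. deriv (cdf H) differentiable (at u)"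
    and H_second_derivative: "bounded (range (deriv (deriv (cdf H))))"
    and H_symmetric: "\<And>u. cdf H (- u) = 1 - cdf H u"
    and rho: "\<And>n. 0 \<le> \<rho> n" "\<rho> \<longlonglongrightarrow> \<rho>'" and gamma: "\<And>n. 0 \<le> \<gamma> n" "\<gamma> \<longlonglongrightarrow> \<gamma>'"
    and model: "\<And>n. 1 \<le> n \<Longrightarrow> contaminated_ar (M n) p n \<beta> \<nu> (local_alt \<theta>\<^sub>0 H (\<rho> n) n) (local_rate (\<gamma> n) n) Q
        (\<epsilon> n) (v n) (z n) (\<xi> n)"
    and estimators_measurable: "\<And>n. 1 \<le> n \<Longrightarrow> \<mu>h n \<in> borel_measurable (M n)"
      "\<And>n j. 1 \<le> n \<Longrightarrow> j \<in> {1..p} \<Longrightarrow> (\<lambda>\<omega>. \<beta>h n \<omega> j) \<in> borel_measurable (M n)"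
      "\<And>n. 1 \<le> n \<Longrightarrow> \<theta>h n \<in> borel_measurable (M n)"
    and mu_hat: "tight M (\<lambda>n \<omega>. sqrt (real n) * (\<mu>h n \<omega> - \<mu>))"
    and beta_hat: "tight M (\<lambda>n \<omega>. sqrt (real n) * L2_set (\<lambda>j. \<beta>h n \<omega> j - \<beta> j) {1..p})"
    and theta_hat: "tight M (\<lambda>n \<omega>. sqrt (real n) * (\<theta>h n \<omega> - \<theta>\<^sub>0))"
    and solution: "asure M (\<lambda>n \<omega>. solves_scale_equation x m n
        (residual p (observation (v n) (z n) (\<xi> n) \<omega>) (\<mu>h n \<omega>) (\<beta>h n \<omega>)) (\<theta>h n \<omega>))"
begin

definition eh :: "nat \<Rightarrow> 'w \<Rightarrow> int \<Rightarrow> real"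
  where "eh n \<omega> = residual p (observation (v n) (z n) (\<xi> n) \<omega>) (\<mu>h n \<omega>) (\<beta>h n \<omega>)"

abbreviation Gn :: "nat \<Rightarrow> real \<Rightarrow> real" where "Gn n \<equiv> local_alt \<theta>\<^sub>0 H (\<rho> n) n"

abbreviation gm :: "nat \<Rightarrow> real" where "gm n \<equiv> local_rate (\<gamma> n) n"

definition bi :: "nat \<Rightarrow> real" where "bi i = (if i = 0 then -1 else \<beta> i)"

text \<open>The counterpart of \<open>Delta0\<close> at sample size \<open>n\<close>, with the local
  alternative in place of the normal law.\<close>

definition jump :: "nat \<Rightarrow> real \<Rightarrow> real"
  where "jump n c = (\<Sum>i\<le>p. \<integral>s. Gn n (c + bi i * s) - Gn n c \<partial>Q)"

text \<open>The rescaled estimation errors as \<open>residual_expansion\<close> delivers them; they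
  take the place of \<kappa> in \<open>shift\<close>.\<close>

definition dev :: "nat \<Rightarrow> 'w \<Rightarrow> nat \<Rightarrow> real"
  where "dev n \<omega> j = (if j = 0 then sqrt n * (\<mu>h n \<omega> - \<mu>) * (1 - (\<Sum>j=1..p. \<beta>h n \<omega> j))
     else sqrt n * (\<beta>h n \<omega> j - \<beta> j))"

text \<open>The Euclidean norm bounds each coordinate. Index \<open>0\<close> is a product of two
  tight factors, the second being a constant plus errors dominated by the rescaled ones.\<close>

lemma tight_dev: assumes "j \<le> p" shows "tight M (\<lambda>n \<omega>. dev n \<omega> j)"
proof -
  have b: "tight M (\<lambda>n \<omega>. sqrt n * (\<beta>h n \<omega> j - \<beta> j))" if j: "j \<in> {1..p}" for j
  proof (rule tight_dominated[OF beta_hat], intro always_eventually allI ballI)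
    fix n \<omega>
    have "\<bar>\<beta>h n \<omega> j - \<beta> j\<bar> = sqrt ((\<beta>h n \<omega> j - \<beta> j)\<^sup>2)" by simp
    also have "\<dots> \<le> L2_set (\<lambda>j. \<beta>h n \<omega> j - \<beta> j) {1..p}"
      unfolding L2_set_def using j by (intro real_sqrt_le_mono member_le_sum) auto
    finally show "\<bar>sqrt n * (\<beta>h n \<omega> j - \<beta> j)\<bar> \<le> \<bar>sqrt (real n) * L2_set (\<lambda>j. \<beta>h n \<omega> j - \<beta> j) {1..p}\<bar>"
      by (simp add: abs_mult mult_left_mono)
  qed
  show ?thesis
  proof (cases "j = 0")
    case True
    have "tight M (\<lambda>n \<omega>. \<bar>1 - (\<Sum>j=1..p. \<beta> j)\<bar> + (\<Sum>j=1..p. \<bar>sqrt n * (\<beta>h n \<omega> j - \<beta> j)\<bar>))"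
      by (intro tight_add tight_const tight_sum tight_abs b) auto
    then have "tight M (\<lambda>n \<omega>. 1 - (\<Sum>j=1..p. \<beta>h n \<omega> j))"
    proof (rule tight_dominated, intro eventually_mono[OF eventually_ge_at_top[of 1]] ballI)
      fix n \<omega> assume n: "1 \<le> (n::nat)"
      have "1 - (\<Sum>j=1..p. \<beta>h n \<omega> j) = (1 - (\<Sum>j=1..p. \<beta> j)) - (\<Sum>j=1..p. \<beta>h n \<omega> j - \<beta> j)"
        by (simp add: sum_subtractf)
      moreover have "\<bar>\<Sum>j=1..p. \<beta>h n \<omega> j - \<beta> j\<bar> \<le> (\<Sum>j=1..p. \<bar>sqrt n * (\<beta>h n \<omega> j - \<beta> j)\<bar>)"
      proof (rule order_trans[OF sum_abs], rule sum_mono)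
        fix j
        have "1 * \<bar>\<beta>h n \<omega> j - \<beta> j\<bar> \<le> sqrt n * \<bar>\<beta>h n \<omega> j - \<beta> j\<bar>" using n by (intro mult_right_mono) auto
        then show "\<bar>\<beta>h n \<omega> j - \<beta> j\<bar> \<le> \<bar>sqrt n * (\<beta>h n \<omega> j - \<beta> j)\<bar>" by (simp add: abs_mult)
      qed
      ultimately show "\<bar>1 - (\<Sum>j=1..p. \<beta>h n \<omega> j)\<bar> \<le> \<bar>\<bar>1 - (\<Sum>j=1..p. \<beta> j)\<bar> + (\<Sum>j=1..p. \<bar>sqrt n * (\<beta>h n \<omega> j - \<beta> j)\<bar>)\<bar>"
        by linarith
    qed
    from tight_mult[OF mu_hat this] show ?thesis using True by (simp add: dev_def)
  next
    case False
    then show ?thesis using b[of j] assms by (simp add: dev_def)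
  qed
qed

lemma eh_eq:
  assumes "v n t \<omega> = (\<Sum>j=1..p. \<beta> j * v n (t - int j) \<omega>) + \<nu> + \<epsilon> n t \<omega>" "1 \<le> n"
  shows "eh n \<omega> t = \<epsilon> n t \<omega> - ((\<Sum>j\<le>p. bi j * (z n (t - int j) \<omega> * \<xi> n (t - int j) \<omega>))
     + (dev n \<omega> 0 + (\<Sum>j=1..p. dev n \<omega> j * (v n (t - int j) \<omega> - \<mu> + z n (t - int j) \<omega> * \<xi> n (t - int j) \<omega>))) / sqrt n)"
proof -
  have r: "0 < sqrt (real n)" using assms by simp
  show ?thesis
    unfolding eh_def observation_def[abs_def] bi_def dev_def
    by (subst residual_expansion[where \<beta> = \<beta> and e = "\<lambda>t. \<epsilon> n t \<omega>", OF assms(1) mu r]) (auto intro!: sum.cong)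
qed

text \<open>The estimation error enters through \<open>G'\<close>, which is even, and therefore cancels from the symmetrized counts.
  As the estimators depend on all the data, their error is rounded to a finite grid, on which the counts are
  controlled simultaneously; monotonicity of the indicators in the shift handles the rounding.\<close>

lemma one_sided_counts:
  obtains G' :: "nat \<Rightarrow> real \<Rightarrow> real" where "\<And>n u. G' n (- u) = G' n u"
    "\<And>c e. 0 < e \<Longrightarrow> asure M (\<lambda>n \<omega>. \<bar>(\<Sum>t\<in>{1..int n}. (if eh n \<omega> t \<le> c then 1 else 0) - (if \<epsilon> n t \<omega> \<le> c then 1 else 0)) / sqrt n
       - sqrt n * gm n * jump n c - G' n c * dev n \<omega> 0\<bar> \<le> e)"
proof -
  obtain \<psi> where \<psi>: "\<psi> 0 = 1" "summable (\<lambda>k. \<bar>\<psi> k\<bar>)"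
      "\<And>k. 1 \<le> k \<Longrightarrow> \<psi> k = (\<Sum>l=1..p. if l \<le> k then \<beta> l * \<psi> (k - l) else 0)"
    by (rule AR_psi_exists[OF p roots]) blast
  define S where "S = (\<Sum>k. \<bar>\<psi> k\<bar>)"
  have S: "(\<Sum>i<k. \<bar>\<psi> i\<bar>) \<le> S" for k unfolding S_def by (rule sum_le_suminf[OF \<psi>(2)]) auto
  define \<sigma> where "\<sigma> = sqrt (\<theta>\<^sub>0\<^sup>2 + (\<integral>u. u\<^sup>2 \<partial>H))"
  have \<sigma>: "0 \<le> \<sigma>" "\<sigma>\<^sup>2 = \<theta>\<^sub>0\<^sup>2 + (\<integral>u. u\<^sup>2 \<partial>H)" by (auto simp: \<sigma>_def)
  obtain C L where CL: "\<And>\<rho> n. 0 \<le> \<rho> \<Longrightarrow> \<exists>G'. (\<forall>u. (local_alt \<theta>\<^sub>0 H \<rho> n has_real_derivative G' u) (at u)) \<and>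
     (\<forall>u w. \<bar>G' u - G' w\<bar> \<le> L * \<bar>u - w\<bar>) \<and> (\<forall>u. \<bar>G' u\<bar> \<le> C) \<and> (\<forall>u. G' (- u) = G' u)"
    by (rule local_alt_smooth[OF theta0 H H_differentiable H_second_derivative H_symmetric]) blast
  have "\<forall>n. \<exists>G'. (\<forall>u. (Gn n has_real_derivative G' u) (at u)) \<and>
     (\<forall>u w. \<bar>G' u - G' w\<bar> \<le> L * \<bar>u - w\<bar>) \<and> (\<forall>u. \<bar>G' u\<bar> \<le> C) \<and> (\<forall>u. G' (- u) = G' u)"
    using CL rho(1) by blast
  from choice[OF this] obtain G' where G': "\<And>n u. (Gn n has_real_derivative G' n u) (at u)"
     "\<And>n u w. \<bar>G' n u - G' n w\<bar> \<le> L * \<bar>u - w\<bar>" "\<And>n u. \<bar>G' n u\<bar> \<le> C" "\<And>n u. G' n (- u) = G' n u"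
    by blast
  have C0: "0 \<le> C" using G'(3)[of 0 0] by linarith
  \<comment> \<open>Accuracy and probability are both set to \<open>1 / n\<close>. The length
    \<open>k\<close> may grow with \<open>n\<close> in any way, because the bounds of
    \<open>ar_bounds\<close> do not involve it.\<close>
  have "\<forall>n. \<exists>k. 1 \<le> n \<longrightarrow> measure (M n) {\<omega> \<in> space (M n). \<exists>t\<in>{1 - int p..int n}. 1 / real n < \<bar>v n t \<omega> - \<mu> - (\<Sum>i<k. \<psi> i * \<epsilon> n (t - int i) \<omega>)\<bar>} < 1 / real n"
  proof
    fix n
    show "\<exists>k. 1 \<le> n \<longrightarrow> measure (M n) {\<omega> \<in> space (M n). \<exists>t\<in>{1 - int p..int n}. 1 / real n < \<bar>v n t \<omega> - \<mu> - (\<Sum>i<k. \<psi> i * \<epsilon> n (t - int i) \<omega>)\<bar>} < 1 / real n"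
    proof (cases "1 \<le> n")
      case True
      interpret A: contaminated_ar "M n" p n \<beta> \<nu> "Gn n" "gm n" Q "\<epsilon> n" "v n" "z n" "\<xi> n" by (rule model[OF True])
      show ?thesis
        by (rule A.ma_approximation[OF p mu \<psi>(1,2,3), of "1 / real n"]) (use True in auto)
    qed simp
  qed
  from choice[OF this] obtain k where k: "\<And>n. 1 \<le> n \<Longrightarrow> measure (M n) {\<omega> \<in> space (M n). \<exists>t\<in>{1 - int p..int n}. 1 / real n < \<bar>v n t \<omega> - \<mu> - (\<Sum>i<k n. \<psi> i * \<epsilon> n (t - int i) \<omega>)\<bar>} < 1 / real n"
    by blast
  \<comment> \<open>Copies of the locale constants with explicit \<open>n\<close>: the locale is
    interpreted anew for each sample size, whereas limits need one function of
    \<open>n\<close>.\<close>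
  define wt where "wt n t \<omega> = (\<Sum>i<k n. \<psi> i * \<epsilon> n (t - int i) \<omega>)" for n t \<omega>
  define Yt where "Yt n t \<omega> = wt n t \<omega> + z n t \<omega> * \<xi> n t \<omega>" for n t \<omega>
  define et where "et n t \<omega> = (\<Sum>j\<le>p. bi j * (z n (t - int j) \<omega> * \<xi> n (t - int j) \<omega>))" for n t \<omega>
  define sh where "sh n \<kappa> \<kappa>' t \<omega> = (\<kappa> 0 + (\<Sum>j=1..p. \<kappa> j * Yt n (t - int j) \<omega>) + \<kappa>' * (1 + (\<Sum>j=1..p. \<bar>Yt n (t - int j) \<omega>\<bar>))) / sqrt n"
    for n and \<kappa> :: "nat \<Rightarrow> real" and \<kappa>' t \<omega>
  define Wb where "Wb n \<omega> = (\<Sum>t\<in>{1..int n}. 1 + (\<Sum>j=1..p. \<bar>wt n (t - int j) \<omega>\<bar>)) / n" for n \<omega>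
  define w1 where "w1 = 1 + real p * (S * \<sigma>)"
  define K1 where "K1 B n = 2 * C * B / sqrt (real n)" for B and n :: nat
  define rm where "rm B n = sqrt ((real p + 1) * gm n + K1 B n * w1)
    + sqrt n * gm n * ((real p + 1) * (2 * K1 B n * w1 + real p * (\<integral>s. min 1 (K1 B n * \<bar>s\<bar>) \<partial>Q)))
    + sqrt n * gm n * gm n * ((real p + 2) * (real p + 1) * real p) + (real p + 1) * sqrt (gm n)
    + 4 * L * B\<^sup>2 * (real p + 1) * (1 + real p * (S\<^sup>2 * \<sigma>\<^sup>2)) / sqrt n + C * (real p * (B * (S * \<sigma>))) / sqrt n" for B n
  have bounds: "ar_bounds (M n) p n \<beta> \<nu> (Gn n) (gm n) Q (\<epsilon> n) (v n) (z n) (\<xi> n) \<psi> (k n) \<sigma> S C L (G' n)" if n: "1 \<le> n" for n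
  proof -
    interpret A: contaminated_ar "M n" p n \<beta> \<nu> "Gn n" "gm n" Q "\<epsilon> n" "v n" "z n" "\<xi> n" by (rule model[OF n])
    have E: "A.expectation (\<lambda>\<omega>. (\<epsilon> n t \<omega>)\<^sup>2) \<le> \<sigma>\<^sup>2" for t
    proof -
      have "A.expectation (\<lambda>\<omega>. (\<epsilon> n t \<omega>)\<^sup>2) = (\<integral>u. u\<^sup>2 \<partial>distr (M n) borel (\<epsilon> n t))"
        by (subst integral_distr) auto
      also have "\<dots> \<le> \<theta>\<^sub>0\<^sup>2 + (\<integral>u. u\<^sup>2 \<partial>H)"
        by (rule local_alt_second_moment[OF A.real_distribution_distr A.eps_law theta0 rho(1) H H_variance]) simp
      finally show ?thesis using \<sigma>(2) by simp
    qed
    show ?thesis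
      by (rule ar_bounds.intro[OF model[OF n] ar_bounds_axioms.intro]) (rule n G'(1) G'(2) G'(3) \<sigma>(1) E S Q)+
  qed
  have sc: "prob_space.l1 (M n) (\<lambda>\<omega>. (\<Sum>t\<in>{1..int n}. (if \<epsilon> n t \<omega> \<le> c + (et n t \<omega> + sh n \<kappa> \<kappa>' t \<omega>) then 1 else 0) - (if \<epsilon> n t \<omega> \<le> c then 1 else 0)) / sqrt n
      - sqrt n * gm n * jump n c - G' n c * (\<kappa> 0 + \<kappa>' * Wb n \<omega>)) (rm B n)"
    "prob_space.l1 (M n) (Wb n) w1"
    if n: "1 \<le> n" and \<kappa>: "\<And>j. j \<le> p \<Longrightarrow> \<bar>\<kappa> j\<bar> \<le> B" "\<bar>\<kappa>'\<bar> \<le> B" for n \<kappa> \<kappa>' B c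
  proof -
    interpret A: ar_bounds "M n" p n \<beta> \<nu> "Gn n" "gm n" Q "\<epsilon> n" "v n" "z n" "\<xi> n" \<psi> "k n" \<sigma> S C L "G' n"
      by (rule bounds[OF n])
    interpret A: ar_shift "M n" p n \<beta> \<nu> "Gn n" "gm n" Q "\<epsilon> n" "v n" "z n" "\<xi> n" \<psi> "k n" \<sigma> S C L "G' n" \<kappa> \<kappa>' B c
      by (rule ar_shift.intro[OF bounds[OF n] ar_shift_axioms.intro]) (rule \<kappa>, assumption?)+
    have defs: "A.eta = et n" "A.wt = wt n" "A.Yt = Yt n" "A.shift (Yt n) \<kappa> \<kappa>' = sh n \<kappa> \<kappa>'"
      "A.W = (\<lambda>t \<omega>. 1 + (\<Sum>j=1..p. \<bar>wt n (t - int j) \<omega>\<bar>))" "A.rem = rm B n" "(\<Sum>i\<le>p. A.E\<phi> i) = jump n c"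
      by (simp_all add: fun_eq_iff A.eta_def et_def A.bb_def bi_def A.wt_def wt_def A.Yt_def Yt_def A.shift_def sh_def
          A.W_def A.rem_def rm_def A.K1_def K1_def A.mQ_def w1_def A.E\<phi>_def A.\<phi>_def jump_def)
    show "A.l1 (\<lambda>\<omega>. (\<Sum>t\<in>{1..int n}. (if \<epsilon> n t \<omega> \<le> c + (et n t \<omega> + sh n \<kappa> \<kappa>' t \<omega>) then 1 else 0) - (if \<epsilon> n t \<omega> \<le> c then 1 else 0)) / sqrt n
      - sqrt n * gm n * jump n c - G' n c * (\<kappa> 0 + \<kappa>' * Wb n \<omega>)) (rm B n)"
      using A.shifted_counts unfolding defs Wb_def .
    show "A.l1 (Wb n) w1" using A.l1_mean_W unfolding defs Wb_def[abs_def] w1_def .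
  qed
  \<comment> \<open>Here \<open>sqrt n * gm n\<close> converges to \<open>\<gamma>'\<close> while
    \<open>gm n\<close> and \<open>K1 B n\<close> tend to zero, and every term contains a vanishing
    factor.\<close>
  have rm: "rm B \<longlonglongrightarrow> 0" if B: "0 \<le> B" for B
  proof -
    note g = local_rate_limits[OF gamma(2)]
    have s: "(\<lambda>n. inverse (sqrt (real n))) \<longlonglongrightarrow> 0"
      by (intro tendsto_inverse_0_at_top filterlim_compose[OF sqrt_at_top filterlim_real_sequentially])
    have K: "K1 B \<longlonglongrightarrow> 0"
      using tendsto_mult[OF tendsto_const[of "2 * C * B"] s] by (simp add: K1_def[abs_def] divide_inverse)
    interpret Q: real_distribution Q by (rule Q)
    have q: "(\<lambda>n. \<integral>s. min 1 (K1 B n * \<bar>s\<bar>) \<partial>Q) \<longlonglongrightarrow> 0"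
      by (rule truncated_mean_limit[OF Q.prob_space_axioms _ K]) (use C0 B in \<open>auto simp: K1_def\<close>)
    have "rm B \<longlonglongrightarrow> sqrt ((real p + 1) * 0 + 0 * w1) + \<gamma>' * ((real p + 1) * (2 * 0 * w1 + real p * 0))
      + \<gamma>' * 0 * ((real p + 2) * (real p + 1) * real p) + (real p + 1) * sqrt 0
      + 4 * L * B\<^sup>2 * (real p + 1) * (1 + real p * (S\<^sup>2 * \<sigma>\<^sup>2)) * 0 + C * (real p * (B * (S * \<sigma>))) * 0"
      unfolding rm_def[abs_def] divide_inverse by (intro tendsto_intros g s K q)
    then show ?thesis by simp
  qed
  have main: "asure M (\<lambda>n \<omega>. \<bar>(\<Sum>t\<in>{1..int n}. (if eh n \<omega> t \<le> c then 1 else 0) - (if \<epsilon> n t \<omega> \<le> c then 1 else 0)) / sqrt n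
       - sqrt n * gm n * jump n c - G' n c * dev n \<omega> 0\<bar> \<le> e)" if e: "0 < e" for c e
    unfolding asure_def
  proof (intro allI impI)
    fix \<eta> :: real assume \<eta>: "0 < \<eta>"
    define X where "X n \<kappa> \<kappa>' \<omega> = (\<Sum>t\<in>{1..int n}. (if \<epsilon> n t \<omega> \<le> c + (et n t \<omega> + sh n \<kappa> \<kappa>' t \<omega>) then 1 else 0) - (if \<epsilon> n t \<omega> \<le> c then 1 else 0)) / sqrt n
      - sqrt n * gm n * jump n c - G' n c * (\<kappa> 0 + \<kappa>' * Wb n \<omega>)" for n \<kappa> \<kappa>' \<omega>
    \<comment> \<open>The first of four events, of probability more than
      \<open>1 - \<eta> / 4\<close> each, that are intersected at the end.\<close>
    obtain K where K: "0 < K" "likely M (\<eta>/4) (\<lambda>n \<omega>. \<forall>j\<in>{..p}. \<bar>dev n \<omega> j\<bar> \<le> K)"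
      by (rule tight_ball[of "{..p}" "\<lambda>j n \<omega>. dev n \<omega> j" "\<eta>/4"]) (use \<eta> tight_dev in auto)
    have "tight M Wb" by (rule tight_l1[of _ w1]) (rule sc(2)[of _ "\<lambda>_. 0" 0 0], auto)
    then obtain A where A: "likely M (\<eta>/4) (\<lambda>n \<omega>. \<bar>Wb n \<omega>\<bar> \<le> A)" using \<eta> unfolding tight_def by (meson divide_pos_pos zero_less_numeral)
    \<comment> \<open>The grid width: rounding the error with index \<open>0\<close> costs at most
      \<open>e / 4\<close> and the margin times \<open>Wb\<close> at most \<open>e / 2\<close>; the
      counts on the grid use the remaining \<open>e / 4\<close>.\<close>
    define \<delta> where "\<delta> = e / (4 * (C * \<bar>A\<bar> + C + 1))"
    have CA: "0 \<le> C * \<bar>A\<bar>" using C0 by simp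
    have \<delta>: "0 < \<delta>" "C * \<delta> \<le> e / 4" "C * (2 * \<delta> * \<bar>A\<bar>) \<le> e / 2"
    proof -
      let ?d = "C * \<bar>A\<bar> + C + 1"
      have d: "0 < ?d" using C0 CA by linarith
      show "0 < \<delta>" using e d by (simp add: \<delta>_def)
      have "C * \<delta> = C / ?d * (e / 4)" by (simp add: \<delta>_def)
      also have "\<dots> \<le> 1 * (e / 4)" using d CA e by (intro mult_right_mono) auto
      finally show "C * \<delta> \<le> e / 4" by simp
      have "c * (2 * (e / (4 * d)) * a) = c * a / d * (e / 2)" if "0 < d" for c a d :: real
        using that by (simp add: field_simps)
      from this[OF d] have "C * (2 * \<delta> * \<bar>A\<bar>) = C * \<bar>A\<bar> / ?d * (e / 2)" unfolding \<delta>_def .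
      also have "\<dots> \<le> 1 * (e / 2)" using d C0 e by (intro mult_right_mono) auto
      finally show "C * (2 * \<delta> * \<bar>A\<bar>) \<le> e / 2" by simp
    qed
    \<comment> \<open>The extra one leaves room for rounding down at the lower end of the
      range.\<close>
    define N where "N = \<lceil>K / \<delta>\<rceil> + 1"
    define Gr where "Gr = PiE {..p} (\<lambda>_. (\<lambda>i. \<delta> * of_int i) ` {- N..N})"
    have fin: "finite Gr" unfolding Gr_def by (intro finite_PiE) auto
    have N0: "0 \<le> N"
    proof -
      have "0 \<le> K / \<delta>" using K(1) \<delta>(1) by simp
      then have "0 \<le> \<lceil>K / \<delta>\<rceil>" unfolding zero_le_ceiling by linarith
      then show ?thesis by (simp add: N_def)
    qed
    \<comment> \<open>Bounds the grid points and the margins \<open>2 * \<delta>\<close> at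
      once.\<close>
    define B where "B = \<delta> * of_int N + 2 * \<delta>"
    have B0: "0 \<le> B" using \<delta>(1) N0 by (simp add: B_def)
    have GrB: "\<bar>\<kappa> j\<bar> \<le> B" if "\<kappa> \<in> Gr" "j \<le> p" for \<kappa> j
    proof -
      obtain i where i: "i \<in> {- N..N}" "\<kappa> j = \<delta> * of_int i" using \<open>\<kappa> \<in> Gr\<close> \<open>j \<le> p\<close> by (auto simp: Gr_def PiE_def Pi_def)
      then have "\<bar>real_of_int i\<bar> \<le> of_int N" by auto
      then have "\<delta> * \<bar>real_of_int i\<bar> \<le> \<delta> * of_int N" using \<delta>(1) by (intro mult_left_mono) auto
      moreover have "\<bar>\<kappa> j\<bar> = \<delta> * \<bar>real_of_int i\<bar>" using i(2) \<delta>(1) by (simp add: abs_mult)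
      ultimately show ?thesis using \<delta>(1) unfolding B_def by linarith
    qed
    have "asure M (\<lambda>n \<omega>. \<forall>q\<in>Gr \<times> {2 * \<delta>, - (2 * \<delta>)}. \<bar>X n (fst q) (snd q) \<omega>\<bar> \<le> e / 4)"
    proof (rule asure_ball)
      fix q assume q: "q \<in> Gr \<times> {2 * \<delta>, - (2 * \<delta>)}"
      show "asure M (\<lambda>n \<omega>. \<bar>X n (fst q) (snd q) \<omega>\<bar> \<le> e / 4)"
      proof (rule asure_l1[OF _ rm[OF B0]])
        fix n :: nat assume n: "1 \<le> n"
        have "\<bar>snd q\<bar> \<le> B" using q \<delta>(1) N0 by (auto simp: B_def)
        then show "prob_space.l1 (M n) (X n (fst q) (snd q)) (rm B n)"
          unfolding X_def[abs_def] using q GrB by (intro sc(1)[OF n]) auto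
      qed (use e in simp)
    qed (use fin in auto)
    then have E1: "likely M (\<eta>/4) (\<lambda>n \<omega>. \<forall>q\<in>Gr \<times> {2 * \<delta>, - (2 * \<delta>)}. \<bar>X n (fst q) (snd q) \<omega>\<bar> \<le> e / 4)"
      using \<eta> by (intro asure_likely) auto
    have E2: "likely M (\<eta>/4) (\<lambda>n \<omega>. (\<forall>t\<in>{1 - int p..int n}. \<bar>v n t \<omega> - \<mu> - wt n t \<omega>\<bar> \<le> 1 / real n) \<and>
        (\<forall>t\<in>{1..int n}. v n t \<omega> = (\<Sum>j=1..p. \<beta> j * v n (t - int j) \<omega>) + \<nu> + \<epsilon> n t \<omega>))"
    proof (rule likely_compl)
      have "\<forall>\<^sub>F n in sequentially. 1 / real n < \<eta> / 4"
        using order_tendstoD(2)[OF lim_1_over_n, of "\<eta>/4"] \<eta> by simp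
      then show "\<forall>\<^sub>F n in sequentially. {\<omega> \<in> space (M n). \<not> ((\<forall>t\<in>{1 - int p..int n}. \<bar>v n t \<omega> - \<mu> - wt n t \<omega>\<bar> \<le> 1 / real n) \<and>
        (\<forall>t\<in>{1..int n}. v n t \<omega> = (\<Sum>j=1..p. \<beta> j * v n (t - int j) \<omega>) + \<nu> + \<epsilon> n t \<omega>))} \<in> sets (M n) \<and>
        measure (M n) {\<omega> \<in> space (M n). \<not> ((\<forall>t\<in>{1 - int p..int n}. \<bar>v n t \<omega> - \<mu> - wt n t \<omega>\<bar> \<le> 1 / real n) \<and>
        (\<forall>t\<in>{1..int n}. v n t \<omega> = (\<Sum>j=1..p. \<beta> j * v n (t - int j) \<omega>) + \<nu> + \<epsilon> n t \<omega>))} < \<eta> / 4"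
        using eventually_ge_at_top[of 1]
      proof eventually_elim
        case (elim n)
        interpret A: contaminated_ar "M n" p n \<beta> \<nu> "Gn n" "gm n" Q "\<epsilon> n" "v n" "z n" "\<xi> n" using elim by (intro model) simp
        note A.v_measurable[measurable] A.eps_measurable[measurable]
        have [measurable]: "wt n t \<in> borel_measurable (M n)" for t unfolding wt_def[abs_def] by measurable
        let ?D = "{\<omega> \<in> space (M n). \<not> ((\<forall>t\<in>{1 - int p..int n}. \<bar>v n t \<omega> - \<mu> - wt n t \<omega>\<bar> \<le> 1 / real n) \<and>
          (\<forall>t\<in>{1..int n}. v n t \<omega> = (\<Sum>j=1..p. \<beta> j * v n (t - int j) \<omega>) + \<nu> + \<epsilon> n t \<omega>))}"
        let ?D' = "{\<omega> \<in> space (M n). \<exists>t\<in>{1 - int p..int n}. 1 / real n < \<bar>v n t \<omega> - \<mu> - wt n t \<omega>\<bar>}"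
        have D: "?D \<in> sets (M n)" by measurable
        have D': "?D' \<in> sets (M n)" by measurable
        have "AE \<omega> in M n. \<forall>t\<in>{1..int n}. v n t \<omega> = (\<Sum>j=1..p. \<beta> j * v n (t - int j) \<omega>) + \<nu> + \<epsilon> n t \<omega>"
          using A.v_equation by (intro AE_finite_allI) auto
        then have "A.prob ?D \<le> A.prob ?D'"
          by (intro A.finite_measure_mono_AE D') (auto elim!: eventually_mono simp: not_le)
        also have "\<dots> < 1 / real n" using k[of n] elim unfolding wt_def by simp
        finally show ?case using D elim by auto
      qed
    qed
    have large: "\<forall>\<^sub>F n in sequentially. real p * (K * (1 / real n)) \<le> \<delta>"
    proof -
      have "(\<lambda>n. real p * (K * (1 / real n))) \<longlonglongrightarrow> real p * (K * 0)" by (intro tendsto_intros lim_1_over_n)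
      then show ?thesis using order_tendstoD(2)[of "\<lambda>n. real p * (K * (1 / real n))" "real p * (K * 0)" sequentially \<delta>] \<delta>(1)
        by (auto elim!: eventually_mono)
    qed
    show "likely M \<eta> (\<lambda>n \<omega>. \<bar>(\<Sum>t\<in>{1..int n}. (if eh n \<omega> t \<le> c then 1 else 0) - (if \<epsilon> n t \<omega> \<le> c then 1 else 0)) / sqrt n
       - sqrt n * gm n * jump n c - G' n c * dev n \<omega> 0\<bar> \<le> e)"
    proof (rule likely_mono[OF likely_conj[OF likely_conj[OF K(2) A] likely_conj[OF E1 E2]]])
      show "\<forall>\<^sub>F n in sequentially. \<forall>\<omega>\<in>space (M n). (((\<forall>j\<in>{..p}. \<bar>dev n \<omega> j\<bar> \<le> K) \<and> \<bar>Wb n \<omega>\<bar> \<le> A) \<and>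
         (\<forall>q\<in>Gr \<times> {2 * \<delta>, - (2 * \<delta>)}. \<bar>X n (fst q) (snd q) \<omega>\<bar> \<le> e / 4) \<and>
         (\<forall>t\<in>{1 - int p..int n}. \<bar>v n t \<omega> - \<mu> - wt n t \<omega>\<bar> \<le> 1 / real n) \<and>
         (\<forall>t\<in>{1..int n}. v n t \<omega> = (\<Sum>j=1..p. \<beta> j * v n (t - int j) \<omega>) + \<nu> + \<epsilon> n t \<omega>)) \<longrightarrow>
         \<bar>(\<Sum>t\<in>{1..int n}. (if eh n \<omega> t \<le> c then 1 else 0) - (if \<epsilon> n t \<omega> \<le> c then 1 else 0)) / sqrt n
       - sqrt n * gm n * jump n c - G' n c * dev n \<omega> 0\<bar> \<le> e"
        using large eventually_ge_at_top[of 1]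
      proof (eventually_elim, intro ballI impI, elim conjE)
        fix n \<omega> assume lg: "real p * (K * (1 / real n)) \<le> \<delta>" and n: "1 \<le> n"
          and dK: "\<forall>j\<in>{..p}. \<bar>dev n \<omega> j\<bar> \<le> K" and WA: "\<bar>Wb n \<omega>\<bar> \<le> A"
          and Xe: "\<forall>q\<in>Gr \<times> {2 * \<delta>, - (2 * \<delta>)}. \<bar>X n (fst q) (snd q) \<omega>\<bar> \<le> e / 4"
          and wv: "\<forall>t\<in>{1 - int p..int n}. \<bar>v n t \<omega> - \<mu> - wt n t \<omega>\<bar> \<le> 1 / real n"
          and eqn: "\<forall>t\<in>{1..int n}. v n t \<omega> = (\<Sum>j=1..p. \<beta> j * v n (t - int j) \<omega>) + \<nu> + \<epsilon> n t \<omega>"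
        have rn: "0 < sqrt (real n)" using n by simp
        \<comment> \<open>The grid point depends on \<omega>, but on the event at hand the counts
          are controlled at all grid points together.\<close>
        define \<kappa> where "\<kappa> = restrict (\<lambda>j. \<delta> * of_int \<lfloor>dev n \<omega> j / \<delta>\<rfloor>) {..p}"
        have \<kappa>d: "\<bar>dev n \<omega> j - \<kappa> j\<bar> \<le> \<delta>" if "j \<le> p" for j
        proof -
          let ?y = "dev n \<omega> j / \<delta>"
          have "dev n \<omega> j - \<kappa> j = \<delta> * (?y - of_int \<lfloor>?y\<rfloor>)" using \<open>j \<le> p\<close> \<delta>(1) by (simp add: \<kappa>_def algebra_simps)
          moreover have "0 \<le> ?y - of_int \<lfloor>?y\<rfloor>" "?y - of_int \<lfloor>?y\<rfloor> \<le> 1" by linarith+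
          moreover from this have "0 \<le> \<delta> * (?y - of_int \<lfloor>?y\<rfloor>)" "\<delta> * (?y - of_int \<lfloor>?y\<rfloor>) \<le> \<delta> * 1"
            using \<delta>(1) by (auto intro!: mult_nonneg_nonneg mult_left_mono simp del: mult_1_right)
          ultimately show ?thesis by linarith
        qed
        have \<kappa>G: "\<kappa> \<in> Gr"
        proof -
          have "\<lfloor>dev n \<omega> j / \<delta>\<rfloor> \<in> {- N..N}" if "j \<le> p" for j
          proof -
            have "\<bar>dev n \<omega> j / \<delta>\<bar> \<le> K / \<delta>" using dK that \<delta>(1) by (simp add: abs_divide divide_right_mono)
            then have "of_int \<lfloor>dev n \<omega> j / \<delta>\<rfloor> \<le> real_of_int N" "real_of_int (- N) \<le> of_int \<lfloor>dev n \<omega> j / \<delta>\<rfloor>"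
              using of_int_floor_le[of "dev n \<omega> j / \<delta>"] real_of_int_floor_add_one_gt[of "dev n \<omega> j / \<delta>"] le_of_int_ceiling[of "K / \<delta>"]
              unfolding N_def of_int_minus of_int_add of_int_1 by linarith+
            then show ?thesis unfolding of_int_le_iff by simp
          qed
          then show ?thesis unfolding Gr_def \<kappa>_def by auto
        qed
        define Cnt where "Cnt \<kappa>' = (\<Sum>t\<in>{1..int n}. (if \<epsilon> n t \<omega> \<le> c + (et n t \<omega> + sh n \<kappa> \<kappa>' t \<omega>) then 1 else 0) - (if \<epsilon> n t \<omega> \<le> c then 1 else 0 :: real))" for \<kappa>'
        define Ch where "Ch = (\<Sum>t\<in>{1..int n}. (if eh n \<omega> t \<le> c then 1 else 0) - (if \<epsilon> n t \<omega> \<le> c then 1 else 0 :: real))"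
        \<comment> \<open>\<open>T\<close> is the exact perturbation of the residual; it lies
          between the shifts of the rounded error with the two opposite margins.\<close>
        have sandwich: "sh n \<kappa> (- (2 * \<delta>)) t \<omega> \<le> T \<and> T \<le> sh n \<kappa> (2 * \<delta>) t \<omega> \<and> (eh n \<omega> t \<le> c \<longleftrightarrow> \<epsilon> n t \<omega> \<le> c + (et n t \<omega> + T))"
          if t: "t \<in> {1..int n}" and T: "T = (dev n \<omega> 0 + (\<Sum>j=1..p. dev n \<omega> j * (v n (t - int j) \<omega> - \<mu> + z n (t - int j) \<omega> * \<xi> n (t - int j) \<omega>))) / sqrt n" for t T
        proof -
          have "\<bar>(dev n \<omega> 0 + (\<Sum>j=1..p. dev n \<omega> j * (v n (t - int j) \<omega> - \<mu> + z n (t - int j) \<omega> * \<xi> n (t - int j) \<omega>)))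
             - (\<kappa> 0 + (\<Sum>j=1..p. \<kappa> j * Yt n (t - int j) \<omega>))\<bar> \<le> 2 * \<delta> * (1 + (\<Sum>j=1..p. \<bar>Yt n (t - int j) \<omega>\<bar>))"
          proof (rule shift_perturbation[where Y' = "\<lambda>s. v n s \<omega> - \<mu> + z n s \<omega> * \<xi> n s \<omega>" and Y = "\<lambda>s. Yt n s \<omega>" and d = "1 / real n" and K = K])
            fix j assume "j \<in> {1..p}"
            then have "t - int j \<in> {1 - int p..int n}" using t by auto
            then show "\<bar>(v n (t - int j) \<omega> - \<mu> + z n (t - int j) \<omega> * \<xi> n (t - int j) \<omega>) - Yt n (t - int j) \<omega>\<bar> \<le> 1 / real n"
              using wv unfolding Yt_def by (simp add: algebra_simps)
          qed (use \<kappa>d dK lg \<delta>(1) in auto)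
          then have "\<kappa> 0 + (\<Sum>j=1..p. \<kappa> j * Yt n (t - int j) \<omega>) + - (2 * \<delta>) * (1 + (\<Sum>j=1..p. \<bar>Yt n (t - int j) \<omega>\<bar>))
               \<le> dev n \<omega> 0 + (\<Sum>j=1..p. dev n \<omega> j * (v n (t - int j) \<omega> - \<mu> + z n (t - int j) \<omega> * \<xi> n (t - int j) \<omega>))"
            "dev n \<omega> 0 + (\<Sum>j=1..p. dev n \<omega> j * (v n (t - int j) \<omega> - \<mu> + z n (t - int j) \<omega> * \<xi> n (t - int j) \<omega>))
              \<le> \<kappa> 0 + (\<Sum>j=1..p. \<kappa> j * Yt n (t - int j) \<omega>) + (2 * \<delta>) * (1 + (\<Sum>j=1..p. \<bar>Yt n (t - int j) \<omega>\<bar>))"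
            unfolding mult_minus_left by linarith+
          then have "sh n \<kappa> (- (2 * \<delta>)) t \<omega> \<le> T" "T \<le> sh n \<kappa> (2 * \<delta>) t \<omega>"
            unfolding T sh_def using rn by (intro divide_right_mono; simp)+
          moreover have "eh n \<omega> t = \<epsilon> n t \<omega> - (et n t \<omega> + T)"
            unfolding T et_def using eqn t n by (intro eh_eq) auto
          ultimately show ?thesis by auto
        qed
        have lo: "Cnt (- (2 * \<delta>)) \<le> Ch" unfolding Cnt_def Ch_def
        proof (intro sum_mono diff_right_mono)
          fix t assume "t \<in> {1..int n}"
          from sandwich[OF this refl] show "(if \<epsilon> n t \<omega> \<le> c + (et n t \<omega> + sh n \<kappa> (- (2 * \<delta>)) t \<omega>) then 1 else 0) \<le> (if eh n \<omega> t \<le> c then 1 else 0 :: real)"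
            by auto
        qed
        have hi: "Ch \<le> Cnt (2 * \<delta>)" unfolding Cnt_def Ch_def
        proof (intro sum_mono diff_right_mono)
          fix t assume "t \<in> {1..int n}"
          from sandwich[OF this refl] show "(if eh n \<omega> t \<le> c then 1 else 0 :: real) \<le> (if \<epsilon> n t \<omega> \<le> c + (et n t \<omega> + sh n \<kappa> (2 * \<delta>) t \<omega>) then 1 else 0)"
            by auto
        qed
        have "\<bar>X n \<kappa> (2 * \<delta>) \<omega>\<bar> \<le> e / 4" "\<bar>X n \<kappa> (- (2 * \<delta>)) \<omega>\<bar> \<le> e / 4" using Xe \<kappa>G by auto
        then have X: "Cnt (2 * \<delta>) / sqrt n - sqrt n * gm n * jump n c - G' n c * (\<kappa> 0 + 2 * \<delta> * Wb n \<omega>) \<le> e / 4"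
          "- (e / 4) \<le> Cnt (- (2 * \<delta>)) / sqrt n - sqrt n * gm n * jump n c - G' n c * (\<kappa> 0 - 2 * \<delta> * Wb n \<omega>)"
          unfolding X_def Cnt_def[symmetric] mult_minus_left add_uminus_conv_diff by linarith+
        have a: "\<bar>G' n c * (dev n \<omega> 0 - \<kappa> 0)\<bar> \<le> e / 4"
        proof -
          have "\<bar>G' n c * (dev n \<omega> 0 - \<kappa> 0)\<bar> \<le> C * \<delta>" unfolding abs_mult
            using G'(3) \<kappa>d[of 0] C0 by (intro mult_mono) auto
          then show ?thesis using \<delta>(2) by simp
        qed
        have b: "\<bar>G' n c * (2 * \<delta> * Wb n \<omega>)\<bar> \<le> e / 2"
        proof -
          have "\<bar>Wb n \<omega>\<bar> \<le> \<bar>A\<bar>" using WA by linarith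
          then have "\<bar>2 * \<delta> * Wb n \<omega>\<bar> \<le> 2 * \<delta> * \<bar>A\<bar>" using \<delta>(1) by (simp add: abs_mult)
          then have "\<bar>G' n c * (2 * \<delta> * Wb n \<omega>)\<bar> \<le> C * (2 * \<delta> * \<bar>A\<bar>)" unfolding abs_mult[of "G' n c"]
            using G'(3) C0 by (intro mult_mono) auto
          then show ?thesis using \<delta>(3) by simp
        qed
        have "Cnt (- (2 * \<delta>)) / sqrt n \<le> Ch / sqrt n" "Ch / sqrt n \<le> Cnt (2 * \<delta>) / sqrt n"
          using lo hi rn by (simp_all add: divide_right_mono)
        then show "\<bar>(\<Sum>t\<in>{1..int n}. (if eh n \<omega> t \<le> c then 1 else 0) - (if \<epsilon> n t \<omega> \<le> c then 1 else 0)) / sqrt n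
           - sqrt n * gm n * jump n c - G' n c * dev n \<omega> 0\<bar> \<le> e"
          unfolding Ch_def[symmetric]
          using X[unfolded distrib_left right_diff_distrib] a[unfolded right_diff_distrib] b by linarith
      qed
    qed (use \<eta> in simp)
  qed
  show thesis by (rule that[of G']) (use G'(4) main in auto)
qed

end

section \<open>Central limit theorem and negligible sequences\<close>

lemma exp_minus_approx:
  fixes x :: real assumes "0 \<le> x" shows "\<bar>exp (- x) - (1 - x)\<bar> \<le> x\<^sup>2 / 2"
proof -
  let ?f = "\<lambda>x. 1 - x + x\<^sup>2 / 2 - exp (- x) :: real"
  have "?f 0 \<le> ?f x"
  proof (rule DERIV_nonneg_imp_nondecreasing[OF assms])
    fix y :: real assume "0 \<le> y" "y \<le> x"
    have "(?f has_real_derivative (- 1 + y + exp (- y))) (at y)"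
      by (auto intro!: derivative_eq_intros)
    moreover have "0 \<le> - 1 + y + exp (- y)" using exp_ge_add_one_self[of "- y"] by simp
    ultimately show "\<exists>d. (?f has_real_derivative d) (at y) \<and> 0 \<le> d" by blast
  qed
  moreover have "1 - x \<le> exp (- x)" using exp_ge_add_one_self[of "- x"] by simp
  ultimately show ?thesis by simp
qed

text \<open>In each row the characteristic function is a product whose factors differ from those of
  a normal law with variance \<open>V n / n\<close> by order \<open>n^(-3/2)\<close>; the products
  differ by at most the sum of these errors. Boundedness does the work of a Lindeberg condition, and
  the limit variance may be zero.\<close>

lemma clt_bounded_array:
  fixes X :: "nat \<Rightarrow> int \<Rightarrow> 'w \<Rightarrow> real" and M :: "nat \<Rightarrow> 'w measure"
  assumes M: "\<And>n. 1 \<le> n \<Longrightarrow> prob_space (M n)"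
    and ind: "\<And>n. 1 \<le> n \<Longrightarrow> prob_space.indep_vars (M n) (\<lambda>_. borel) (X n) {1..int n}"
    and bd: "\<And>n t \<omega>. 1 \<le> n \<Longrightarrow> \<bar>X n t \<omega>\<bar> \<le> K"
    and mean: "\<And>n t. 1 \<le> n \<Longrightarrow> t \<in> {1..int n} \<Longrightarrow> (\<integral>\<omega>. X n t \<omega> \<partial>M n) = 0"
    and var: "\<And>n t. 1 \<le> n \<Longrightarrow> t \<in> {1..int n} \<Longrightarrow> (\<integral>\<omega>. (X n t \<omega>)\<^sup>2 \<partial>M n) = V n"
    and lim: "V \<longlonglongrightarrow> V'"
  shows "(\<lambda>n. CLINT \<omega>|M n. iexp ((\<Sum>t\<in>{1..int n}. X n t \<omega>) / sqrt n)) \<longlonglongrightarrow> complex_of_real (exp (- V' / 2))"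
proof -
  have K0: "0 \<le> K" using bd[of 1] by (meson abs_ge_zero order_refl order_trans)
  \<comment> \<open>The first term is the third order Taylor error of the \<open>n\<close> factors;
    the second comes from expanding the normal exponential.\<close>
  define err where "err n = (K ^ 3 / 6) * inverse (sqrt (real n)) + (K\<^sup>2)\<^sup>2 / 8 * inverse (real n)" for n :: nat
  have bound: "norm ((CLINT \<omega>|M n. iexp ((\<Sum>t\<in>{1..int n}. X n t \<omega>) / sqrt n)) - complex_of_real (exp (- V n / 2))) \<le> err n"
    if n: "1 \<le> n" for n
  proof -
    interpret prob_space "M n" by (rule M[OF n])
    let ?T = "{1..int n}"
    define s where "s = 1 / sqrt (real n)"
    have s: "0 < s" "s\<^sup>2 = 1 / real n" using n by (simp_all add: s_def power_divide)
    have Xm: "X n t \<in> borel_measurable (M n)" if "t \<in> ?T" for t using ind[OF n] that unfolding indep_vars_def2 by auto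
    have iX: "integrable (M n) (X n t)" "integrable (M n) (\<lambda>\<omega>. (X n t \<omega>)\<^sup>2)" if "t \<in> ?T" for t
    proof -
      show "integrable (M n) (X n t)" by (rule integrable_const_bound[of _ K]) (use bd[OF n] Xm[OF that] in auto)
      show "integrable (M n) (\<lambda>\<omega>. (X n t \<omega>)\<^sup>2)"
      proof (rule integrable_const_bound[of _ "K\<^sup>2"])
        show "AE \<omega> in M n. norm ((X n t \<omega>)\<^sup>2) \<le> K\<^sup>2"
          using power_mono[OF bd[OF n] abs_ge_zero, of _ _ 2] by (intro AE_I2) simp
      qed (use Xm[OF that] in measurable)
    qed
    have Vn: "0 \<le> V n" "V n \<le> K\<^sup>2"
    proof -
      have t: "1 \<in> ?T" using n by simp
      show "0 \<le> V n" unfolding var[OF n t, symmetric] by simp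
      have "(\<integral>\<omega>. (X n 1 \<omega>)\<^sup>2 \<partial>M n) \<le> (\<integral>\<omega>. K\<^sup>2 \<partial>M n)"
        using power_mono[OF bd[OF n] abs_ge_zero, of _ _ 2] iX(2)[OF t] by (intro integral_mono) auto
      then show "V n \<le> K\<^sup>2" unfolding var[OF n t] by (simp add: prob_space)
    qed
    let ?\<phi> = "\<lambda>t. char (distr (M n) borel (X n t)) s"
    let ?c = "complex_of_real (exp (- (V n * s\<^sup>2 / 2)))"
    have "(CLINT \<omega>|M n. iexp ((\<Sum>t\<in>?T. X n t \<omega>) / sqrt n)) = char (distr (M n) borel (\<lambda>\<omega>. \<Sum>t\<in>?T. X n t \<omega>)) s"
    proof -
      have "(\<lambda>\<omega>. \<Sum>t\<in>?T. X n t \<omega>) \<in> borel_measurable (M n)" using Xm by (intro borel_measurable_sum)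
      then show ?thesis unfolding char_def by (subst integral_distr) (auto simp: s_def mult.commute)
    qed
    also have "\<dots> = (\<Prod>t\<in>?T. ?\<phi> t)" by (rule char_distr_sum[OF ind[OF n]])
    finally have \<phi>: "(CLINT \<omega>|M n. iexp ((\<Sum>t\<in>?T. X n t \<omega>) / sqrt n)) = (\<Prod>t\<in>?T. ?\<phi> t)" .
    have c: "complex_of_real (exp (- V n / 2)) = (\<Prod>t\<in>?T. ?c)"
      using n s(2) by (simp add: exp_of_nat_mult[symmetric] flip: of_real_power)
    have each: "norm (?\<phi> t - ?c) \<le> K ^ 3 / 6 * s ^ 3 + (K\<^sup>2)\<^sup>2 / 8 * s ^ 4" if t: "t \<in> ?T" for t
    proof -
      have v: "variance (X n t) = V n" using mean[OF n t] var[OF n t] by simp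
      have "norm (?\<phi> t - (1 - s\<^sup>2 * V n / 2)) \<le> (s\<^sup>2 / 6) * expectation (\<lambda>\<omega>. min (6 * (X n t \<omega>)\<^sup>2) (\<bar>s\<bar> * \<bar>X n t \<omega>\<bar> ^ 3))"
        using char_approx3'[OF Xm[OF t] iX[OF t] mean[OF n t] v refl, of s] by simp
      also have "expectation (\<lambda>\<omega>. min (6 * (X n t \<omega>)\<^sup>2) (\<bar>s\<bar> * \<bar>X n t \<omega>\<bar> ^ 3)) \<le> expectation (\<lambda>\<omega>. s * K ^ 3)"
      proof (rule integral_mono)
        have le: "\<bar>s\<bar> * \<bar>X n t \<omega>\<bar> ^ 3 \<le> s * K ^ 3" for \<omega>
          using s(1) power_mono[OF bd[OF n] abs_ge_zero, of t \<omega> 3] by (simp add: mult_left_mono)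
        then show "min (6 * (X n t \<omega>)\<^sup>2) (\<bar>s\<bar> * \<bar>X n t \<omega>\<bar> ^ 3) \<le> s * K ^ 3" for \<omega> by (meson min.coboundedI2)
        show "integrable (M n) (\<lambda>\<omega>. min (6 * (X n t \<omega>)\<^sup>2) (\<bar>s\<bar> * \<bar>X n t \<omega>\<bar> ^ 3))"
        proof (rule integrable_const_bound[of _ "s * K ^ 3"])
          show "AE \<omega> in M n. norm (min (6 * (X n t \<omega>)\<^sup>2) (\<bar>s\<bar> * \<bar>X n t \<omega>\<bar> ^ 3)) \<le> s * K ^ 3"
          proof (intro AE_I2)
            fix \<omega>
            have "0 \<le> min (6 * (X n t \<omega>)\<^sup>2) (\<bar>s\<bar> * \<bar>X n t \<omega>\<bar> ^ 3)" by simp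
            then show "norm (min (6 * (X n t \<omega>)\<^sup>2) (\<bar>s\<bar> * \<bar>X n t \<omega>\<bar> ^ 3)) \<le> s * K ^ 3"
              unfolding real_norm_def using min.coboundedI2[OF le[of \<omega>]] by (simp only: abs_of_nonneg)
          qed
        qed (use Xm[OF t] in measurable)
      qed simp
      finally have 1: "norm (?\<phi> t - (1 - s\<^sup>2 * V n / 2)) \<le> K ^ 3 / 6 * s ^ 3"
        using s(1) by (simp add: prob_space mult_left_mono power2_eq_square power3_eq_cube mult_ac)
      have "norm (complex_of_real (1 - s\<^sup>2 * V n / 2) - ?c) = \<bar>exp (- (V n * s\<^sup>2 / 2)) - (1 - V n * s\<^sup>2 / 2)\<bar>"
        by (subst of_real_diff[symmetric]) (simp only: norm_of_real abs_minus_commute mult.commute)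
      also have "\<dots> \<le> (V n * s\<^sup>2 / 2)\<^sup>2 / 2" using Vn by (intro exp_minus_approx) simp
      also have "\<dots> \<le> (K\<^sup>2 * s\<^sup>2 / 2)\<^sup>2 / 2"
        using Vn by (intro divide_right_mono power_mono mult_right_mono) auto
      also have "\<dots> = (K\<^sup>2)\<^sup>2 / 8 * s ^ 4" by (simp add: power_divide power_mult_distrib)
      finally have 2: "norm (complex_of_real (1 - s\<^sup>2 * V n / 2) - ?c) \<le> (K\<^sup>2)\<^sup>2 / 8 * s ^ 4" .
      show ?thesis using norm_triangle_mono[OF 1 2] by simp
    qed
    have "norm ((\<Prod>t\<in>?T. ?\<phi> t) - (\<Prod>t\<in>?T. ?c)) \<le> (\<Sum>t\<in>?T. norm (?\<phi> t - ?c))"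
    proof (rule norm_prod_diff)
      show "norm (?\<phi> t) \<le> 1" if "t \<in> ?T" for t
        using Xm[OF that] by (intro real_distribution.cmod_char_le_1 real_distribution_distr)
      show "norm ?c \<le> 1" using Vn by simp
    qed
    also have "\<dots> \<le> (\<Sum>t\<in>?T. K ^ 3 / 6 * s ^ 3 + (K\<^sup>2)\<^sup>2 / 8 * s ^ 4)" by (intro sum_mono each)
    also have "\<dots> = err n"
    proof -
      have "real n * s ^ 3 = s" "real n * s ^ 4 = 1 / real n"
        using n s(2) by (simp_all add: power3_eq_cube power4_eq_xxxx power2_eq_square field_simps)
      note e = this
      have "real n * (K ^ 3 / 6 * s ^ 3 + (K\<^sup>2)\<^sup>2 / 8 * s ^ 4) = K ^ 3 / 6 * s + (K\<^sup>2)\<^sup>2 / 8 * (1 / real n)"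
      proof -
        have "N * (a * b + c * d) = a * (N * b) + c * (N * d)" for N a b c d :: real by (simp add: algebra_simps)
        from this[of "real n" "K ^ 3 / 6" "s ^ 3" "(K\<^sup>2)\<^sup>2 / 8" "s ^ 4"] show ?thesis unfolding e .
      qed
      then show ?thesis by (simp add: err_def s_def inverse_eq_divide)
    qed
    finally show ?thesis unfolding \<phi> c .
  qed
  have "err \<longlonglongrightarrow> K ^ 3 / 6 * 0 + (K\<^sup>2)\<^sup>2 / 8 * 0" unfolding err_def[abs_def]
    by (intro tendsto_intros tendsto_inverse_0_at_top filterlim_real_sequentially filterlim_compose[OF sqrt_at_top filterlim_real_sequentially])
  then have diff: "(\<lambda>n. (CLINT \<omega>|M n. iexp ((\<Sum>t\<in>{1..int n}. X n t \<omega>) / sqrt n)) - complex_of_real (exp (- V n / 2))) \<longlonglongrightarrow> 0"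
    by (intro Lim_null_comparison[OF eventually_mono[OF eventually_ge_at_top[of 1] bound]]) simp_all
  have main: "(\<lambda>n. complex_of_real (exp (- V n / 2))) \<longlonglongrightarrow> complex_of_real (exp (- V' / 2))"
    by (intro tendsto_intros lim) simp
  show ?thesis by (rule Lim_transform[OF main diff])
qed

section \<open>Sequences that tend to zero in probability\<close>

context prob_seq begin

definition negl :: "(nat \<Rightarrow> 'w \<Rightarrow> real) \<Rightarrow> bool"
  where "negl X \<longleftrightarrow> (\<forall>e>0. asure M (\<lambda>n \<omega>. \<bar>X n \<omega>\<bar> \<le> e))"

lemma negl_dominated:
  "negl Y \<Longrightarrow> \<forall>\<^sub>F n in sequentially. \<forall>\<omega>\<in>space (M n). \<bar>X n \<omega>\<bar> \<le> \<bar>Y n \<omega>\<bar> \<Longrightarrow> negl X"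
  unfolding negl_def
proof (intro allI impI)
  fix e :: real assume Y: "\<forall>e>0. asure M (\<lambda>n \<omega>. \<bar>Y n \<omega>\<bar> \<le> e)" and le: "\<forall>\<^sub>F n in sequentially. \<forall>\<omega>\<in>space (M n). \<bar>X n \<omega>\<bar> \<le> \<bar>Y n \<omega>\<bar>" and e: "0 < e"
  show "asure M (\<lambda>n \<omega>. \<bar>X n \<omega>\<bar> \<le> e)"
    by (rule asure_mono[OF Y[rule_format, OF e]]) (use le in \<open>auto elim!: eventually_mono intro: order_trans\<close>)
qed

lemma negl_add: assumes "negl X" "negl Y" shows "negl (\<lambda>n \<omega>. X n \<omega> + Y n \<omega>)"
  unfolding negl_def
proof (intro allI impI)
  fix e :: real assume "0 < e"
  then have e: "0 < e / 2" by simp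
  from asure_conj[OF assms[unfolded negl_def, rule_format, OF e]] show "asure M (\<lambda>n \<omega>. \<bar>X n \<omega> + Y n \<omega>\<bar> \<le> e)"
    by (rule asure_mono) (auto intro!: always_eventually)
qed

lemma negl_seq: assumes "a \<longlonglongrightarrow> 0" shows "negl (\<lambda>n \<omega>. a n)"
  unfolding negl_def
proof (intro allI impI)
  fix e :: real assume e: "0 < e"
  have "\<forall>\<^sub>F n in sequentially. \<bar>a n\<bar> \<le> e"
    using tendstoD[OF assms e] by (auto elim!: eventually_mono)
  then show "asure M (\<lambda>n \<omega>. \<bar>a n\<bar> \<le> e)" by (intro asure_mono[OF asure_true]) (auto elim!: eventually_mono)
qed

lemma negl_mult_tight: assumes "tight M X" "negl Y" shows "negl (\<lambda>n \<omega>. X n \<omega> * Y n \<omega>)"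
  unfolding negl_def asure_def
proof (intro allI impI)
  fix e \<eta> :: real assume e: "0 < e" "0 < \<eta>"
  obtain K where K: "likely M (\<eta>/2) (\<lambda>n \<omega>. \<bar>X n \<omega>\<bar> \<le> K)" using assms(1) e unfolding tight_def by (meson half_gt_zero)
  define d where "d = e / (\<bar>K\<bar> + 1)"
  have d: "0 < d" using e by (simp add: d_def)
  then have "likely M (\<eta>/2) (\<lambda>n \<omega>. \<bar>Y n \<omega>\<bar> \<le> d)"
    using assms(2)[unfolded negl_def asure_def, rule_format, OF d, of "\<eta>/2"] e by simp
  from likely_conj[OF K this] show "likely M \<eta> (\<lambda>n \<omega>. \<bar>X n \<omega> * Y n \<omega>\<bar> \<le> e)"
  proof (rule likely_mono)
    show "\<forall>\<^sub>F n in sequentially. \<forall>\<omega>\<in>space (M n). \<bar>X n \<omega>\<bar> \<le> K \<and> \<bar>Y n \<omega>\<bar> \<le> d \<longrightarrow> \<bar>X n \<omega> * Y n \<omega>\<bar> \<le> e"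
    proof (intro always_eventually allI ballI impI)
      fix n \<omega> assume *: "\<bar>X n \<omega>\<bar> \<le> K \<and> \<bar>Y n \<omega>\<bar> \<le> d"
      have "\<bar>X n \<omega> * Y n \<omega>\<bar> \<le> (\<bar>K\<bar> + 1) * d" unfolding abs_mult using * d by (intro mult_mono) auto
      also have "\<dots> = e" by (simp add: d_def)
      finally show "\<bar>X n \<omega> * Y n \<omega>\<bar> \<le> e" .
    qed
  qed simp
qed

lemma negl_cmult: "negl X \<Longrightarrow> negl (\<lambda>n \<omega>. c * X n \<omega>)"
  by (rule negl_mult_tight[OF tight_const])

lemma negl_sum: assumes "finite I" "\<And>i. i \<in> I \<Longrightarrow> negl (X i)" shows "negl (\<lambda>n \<omega>. \<Sum>i\<in>I. X i n \<omega>)"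
  using assms
proof (induction I)
  case empty
  then show ?case using negl_seq[of "\<lambda>_. 0"] by simp
qed (auto intro: negl_add)

lemma negl_tight: assumes "negl X" shows "tight M X"
  unfolding tight_def using assms by (auto simp: negl_def asure_def intro!: exI[of _ 1])

text \<open>The difference of squares factors, and the second factor \<open>(B - A) + 2 * A\<close>
  is tight.\<close>

lemma negl_square_diff:
  assumes A: "tight M A" and BA: "negl (\<lambda>n \<omega>. B n \<omega> - A n \<omega>)"
  shows "negl (\<lambda>n \<omega>. (B n \<omega>)\<^sup>2 - (A n \<omega>)\<^sup>2)"
proof -
  have "tight M (\<lambda>n \<omega>. (B n \<omega> - A n \<omega>) + 2 * A n \<omega>)"
    by (intro tight_add tight_mult tight_const A negl_tight[OF BA])
  from negl_mult_tight[OF this BA] show ?thesis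
    by (rule negl_dominated) (auto simp: power2_eq_square algebra_simps)
qed

end

section \<open>Symmetrized cell counts\<close>

context cells begin

text \<open>With intervals open on the left and closed on the right, a pair of opposite cells is
  exactly the difference of two consecutive bands, and a band is a difference of two events of the
  form \<open>e \<le> c\<close>.\<close>

definition band :: "nat \<Rightarrow> real \<Rightarrow> real"
  where "band j e = (if - x j < ereal e \<and> ereal e \<le> x j then 1 else 0)"

definition in_cell :: "nat \<Rightarrow> real \<Rightarrow> real" where "in_cell j e = band j e - band (j - 1) e"

lemma band_0: "band 0 e = 0"
  using edge_0 by (auto simp: band_def zero_ereal_def)

lemma band_m: "band m e = 1"
  using edge_m by (simp add: band_def)

lemma band_eq: "0 < j \<Longrightarrow> j < m \<Longrightarrow> band j e = (if e \<le> edge j then 1 else 0) - (if e \<le> - edge j then 1 else 0)"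
  using edge_pos[of j] x_eq_edge[of j] by (auto simp: band_def)

lemma band_measurable [measurable]: "band j \<in> borel_measurable borel"
  unfolding band_def[abs_def] by measurable

lemma in_cell_measurable [measurable]: "in_cell j \<in> borel_measurable borel"
  unfolding in_cell_def[abs_def] by measurable

lemma in_cell_eq: assumes "j \<in> {1..m}"
  shows "in_cell j e = (if e \<in> cell_pos x j then 1 else 0) + (if e \<in> cell_neg x j then 1 else 0)"
    and in_cell_01: "in_cell j e = 0 \<or> in_cell j e = 1"
proof -
  have a: "x (j - 1) = ereal (edge (j - 1))" "0 \<le> edge (j - 1)"
  proof -
    have "j - 1 < m" using assms by auto
    then show "x (j - 1) = ereal (edge (j - 1))" by (rule x_eq_edge)
    show "0 \<le> edge (j - 1)"
    proof (cases "j - 1 = 0")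
      case True
      then show ?thesis by (simp only: edge_0')
    next
      case False
      then show ?thesis using edge_pos[of "j - 1"] \<open>j - 1 < m\<close> by linarith
    qed
  qed
  show "in_cell j e = (if e \<in> cell_pos x j then 1 else 0) + (if e \<in> cell_neg x j then 1 else 0)"
    "in_cell j e = 0 \<or> in_cell j e = 1"
  proof (atomize(full), cases "j = m")
    case True
    then have "x j = \<infinity>" by (simp add: edge_m)
    then show "in_cell j e = (if e \<in> cell_pos x j then 1 else 0) + (if e \<in> cell_neg x j then 1 else 0) \<and>
      (in_cell j e = 0 \<or> in_cell j e = 1)"
      unfolding in_cell_def band_def cell_pos_def cell_neg_def using a by auto
  next
    case False
    then have "x j = ereal (edge j)" "edge (j - 1) < edge j"
      using x_eq_edge[of j] edge_mono[of "j - 1" j] assms by auto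
    then show "in_cell j e = (if e \<in> cell_pos x j then 1 else 0) + (if e \<in> cell_neg x j then 1 else 0) \<and>
      (in_cell j e = 0 \<or> in_cell j e = 1)"
      unfolding in_cell_def band_def cell_pos_def cell_neg_def using a by auto
  qed
qed

lemma in_cell_nonneg: "j \<in> {1..m} \<Longrightarrow> 0 \<le> in_cell j e"
  using in_cell_01[of j e] by auto

lemma sum_in_cell: "(\<Sum>j=1..m. in_cell j e) = 1"
proof -
  have "(\<Sum>j=1..k. in_cell j e) = band k e - band 0 e" for k
    by (induction k) (auto simp: in_cell_def)
  then show ?thesis by (simp add: band_0 band_m)
qed

lemma in_cell_prod: assumes "i \<in> {1..m}" "j \<in> {1..m}" "i \<noteq> j" shows "in_cell i e * in_cell j e = 0"
proof (rule ccontr)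
  assume "in_cell i e * in_cell j e \<noteq> 0"
  then have "in_cell i e = 1" "in_cell j e = 1" using in_cell_01[OF assms(1)] in_cell_01[OF assms(2)] by force+
  moreover have "(\<Sum>l\<in>{i, j}. in_cell l e) \<le> (\<Sum>l=1..m. in_cell l e)"
    using assms(1,2) by (intro sum_mono2 in_cell_nonneg) auto
  ultimately show False using assms(3) unfolding sum_in_cell by simp
qed

text \<open>The cells are disjoint and their indicators idempotent.\<close>

lemma square_sum_in_cell: "(\<Sum>j=1..m. a j * in_cell j e)\<^sup>2 = (\<Sum>j=1..m. (a j)\<^sup>2 * in_cell j e)"
proof -
  have "(\<Sum>j=1..m. a j * in_cell j e)\<^sup>2 = (\<Sum>i=1..m. \<Sum>j=1..m. a i * a j * (in_cell i e * in_cell j e))"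
    by (simp add: power2_eq_square sum_product mult_ac)
  also have "\<dots> = (\<Sum>i=1..m. \<Sum>j=1..m. if j = i then (a i)\<^sup>2 * in_cell i e else 0)"
  proof (intro sum.cong refl)
    fix i j assume "i \<in> {1..m}" "j \<in> {1..m}"
    then show "a i * a j * (in_cell i e * in_cell j e) = (if j = i then (a i)\<^sup>2 * in_cell i e else 0)"
      using in_cell_prod[of i j e] in_cell_01[of i e] by (cases "j = i") (auto simp: power2_eq_square)
  qed
  also have "\<dots> = (\<Sum>i=1..m. (a i)\<^sup>2 * in_cell i e)" by simp
  finally show ?thesis .
qed

lemma cell_count_eq: assumes "j \<in> {1..m}" shows "real (cell_count x n e j) = (\<Sum>t\<in>{1..int n}. in_cell j (e t))"
proof -
  have c: "real (card {t \<in> {1..int n}. e t \<in> A}) = (\<Sum>t\<in>{1..int n}. if e t \<in> A then 1 else 0)" for A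
    by (simp add: sum.If_cases Int_def)
  show ?thesis unfolding cell_count_def of_nat_add c in_cell_eq[OF assms] sum.distrib ..
qed

lemma sum_cell_count: "(\<Sum>j=1..m. real (cell_count x n e j)) = real n"
proof -
  have "(\<Sum>j=1..m. real (cell_count x n e j)) = (\<Sum>j=1..m. \<Sum>t\<in>{1..int n}. in_cell j (e t))"
    by (intro sum.cong refl cell_count_eq)
  also have "\<dots> = (\<Sum>t\<in>{1..int n}. \<Sum>j=1..m. in_cell j (e t))" by (rule sum.swap)
  finally show ?thesis unfolding sum_in_cell by simp
qed

end

context ar_array begin

interpretation H: real_distribution H by (rule H)
interpretation Q: real_distribution Q by (rule Q)

lemma Gn_at_top: "(Gn n \<longlongrightarrow> 1) at_top"
proof -
  have "((\<lambda>u. (1 - local_rate (\<rho> n) n) * std_normal_cdf (u / \<theta>\<^sub>0) + local_rate (\<rho> n) n * cdf H u) \<longlongrightarrow>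
      (1 - local_rate (\<rho> n) n) * 1 + local_rate (\<rho> n) n * 1) at_top"
    by (intro tendsto_intros scaled_cdf_at_top theta0 H.cdf_lim_at_top_prob)
  then show ?thesis by (simp add: local_alt_def[abs_def])
qed

lemma Gn_minus: "Gn n (- u) = 1 - Gn n u"
  by (simp add: local_alt_def H_symmetric std_normal_cdf_minus algebra_simps)

definition pn :: "nat \<Rightarrow> nat \<Rightarrow> real" where "pn n j = sym_increment x (Gn n) j"

lemma pn_eq: assumes "j \<in> {1..m}"
  shows "pn n j = cell_prob x j \<theta>\<^sub>0 + local_rate (\<rho> n) n * (sym_increment x (cdf H) j - cell_prob x j \<theta>\<^sub>0)"
proof -
  have V: "val_at (Gn n) (x i) = (1 - local_rate (\<rho> n) n) * val_at (\<lambda>u. std_normal_cdf (u / \<theta>\<^sub>0)) (x i) + local_rate (\<rho> n) n * val_at (cdf H) (x i)"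
    if "i \<le> m" for i
  proof (cases "i = m")
    case True
    then show ?thesis
      by (simp add: val_at_top[OF Gn_at_top] val_at_top[OF scaled_cdf_at_top[OF theta0]] val_at_top[OF H.cdf_lim_at_top_prob])
  next
    case False
    then have "i < m" using that by simp
    then show ?thesis by (simp only: val_at_edge local_alt_def)
  qed
  have "j \<le> m" "j - 1 \<le> m" using assms by auto
  then show ?thesis unfolding pn_def cell_prob_def sym_increment_def by (simp only: V) (simp add: algebra_simps)
qed

lemma pn_limit: assumes "j \<in> {1..m}"
  shows "(\<lambda>n. sqrt n * (pn n j - cell_prob x j \<theta>\<^sub>0)) \<longlonglongrightarrow> \<rho>' * (sym_increment x (cdf H) j - cell_prob x j \<theta>\<^sub>0)"
    "(\<lambda>n. pn n j) \<longlonglongrightarrow> cell_prob x j \<theta>\<^sub>0"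
proof -
  note g = local_rate_limits[OF rho(2)]
  have "(\<lambda>n. (sqrt n * local_rate (\<rho> n) n) * (sym_increment x (cdf H) j - cell_prob x j \<theta>\<^sub>0)) \<longlonglongrightarrow> \<rho>' * (sym_increment x (cdf H) j - cell_prob x j \<theta>\<^sub>0)"
    by (intro tendsto_intros g)
  then show "(\<lambda>n. sqrt n * (pn n j - cell_prob x j \<theta>\<^sub>0)) \<longlonglongrightarrow> \<rho>' * (sym_increment x (cdf H) j - cell_prob x j \<theta>\<^sub>0)"
    by (simp add: pn_eq[OF assms] mult.assoc)
  have "(\<lambda>n. cell_prob x j \<theta>\<^sub>0 + local_rate (\<rho> n) n * (sym_increment x (cdf H) j - cell_prob x j \<theta>\<^sub>0)) \<longlonglongrightarrow>
     cell_prob x j \<theta>\<^sub>0 + 0 * (sym_increment x (cdf H) j - cell_prob x j \<theta>\<^sub>0)"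
    by (intro tendsto_intros g)
  then show "(\<lambda>n. pn n j) \<longlonglongrightarrow> cell_prob x j \<theta>\<^sub>0" by (simp add: pn_eq[OF assms])
qed

text \<open>By symmetry of the local alternative, the band up to the edge \<open>x i\<close> has
  probability twice the value there minus one, and the cell pair is a difference of two bands. At
  the edge \<open>0\<close> the value is one half.\<close>

lemma expectation_in_cell:
  assumes n: "1 \<le> n" and j: "j \<in> {1..m}"
  shows "(\<integral>\<omega>. in_cell j (\<epsilon> n t \<omega>) \<partial>M n) = pn n j"
proof -
  interpret A: contaminated_ar "M n" p n \<beta> \<nu> "Gn n" "gm n" Q "\<epsilon> n" "v n" "z n" "\<xi> n" by (rule model[OF n])
  have step: "A.expectation (\<lambda>\<omega>. if \<epsilon> n t \<omega> \<le> c then 1 else 0) = Gn n c" for c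
  proof -
    have "A.expectation (\<lambda>\<omega>. if \<epsilon> n t \<omega> \<le> c then 1 else 0) = A.expectation (indicator (\<epsilon> n t -` {..c} \<inter> space (M n)))"
      by (intro Bochner_Integration.integral_cong refl) (simp add: indicator_def)
    also have "\<dots> = cdf (distr (M n) borel (\<epsilon> n t)) c"
      unfolding cdf_def by (subst measure_distr) auto
    finally show ?thesis by (simp add: A.eps_law)
  qed
  have istep: "integrable (M n) (\<lambda>\<omega>. if \<epsilon> n t \<omega> \<le> c then 1 else 0 :: real)" for c
    by (rule A.integrable_const_bound[of _ 1]) auto
  have b: "A.expectation (\<lambda>\<omega>. band i (\<epsilon> n t \<omega>)) = 2 * val_at (Gn n) (x i) - 1" if i: "i \<le> m" for i
  proof -
    consider "i = 0" | "i = m" | "0 < i" "i < m" using i by linarith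
    then show ?thesis
    proof cases
      case 1
      have "Gn n 0 = 1 / 2" using Gn_minus[of n 0] by simp
      moreover have "val_at (Gn n) (x 0) = Gn n 0" using val_at_edge[of 0 "Gn n"] m by (simp add: edge_0')
      ultimately show ?thesis using 1 by (simp add: band_0)
    next
      case 2
      then show ?thesis by (simp add: band_m val_at_top[OF Gn_at_top] A.prob_space)
    next
      case 3
      then show ?thesis
        by (simp add: band_eq val_at_edge Bochner_Integration.integral_diff[OF istep istep] step Gn_minus)
    qed
  qed
  have ib: "integrable (M n) (\<lambda>\<omega>. band i (\<epsilon> n t \<omega>))" for i
    by (rule A.integrable_const_bound[of _ 1]) (auto simp: band_def)
  have "j \<le> m" "j - 1 \<le> m" using j by auto
  then show ?thesis unfolding in_cell_def pn_def sym_increment_def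
    by (simp add: Bochner_Integration.integral_diff[OF ib ib] b)
qed

text \<open>The local alternative is within \<open>local_rate (\<rho> n) n\<close> of the normal
  distribution function everywhere, so the integrals converge for every law
  \<open>Q\<close>.\<close>

lemma jump_limit: "(\<lambda>n. jump n c) \<longlonglongrightarrow> Delta0 p \<beta> \<theta>\<^sub>0 Q c"
proof -
  have Phi: "0 \<le> std_normal_cdf u" "std_normal_cdf u \<le> 1" for u using std_normal_cdf_bounds[of u] by auto
  have Gclose: "\<bar>Gn n u - std_normal_cdf (u / \<theta>\<^sub>0)\<bar> \<le> local_rate (\<rho> n) n" for n u
  proof -
    have "Gn n u - std_normal_cdf (u / \<theta>\<^sub>0) = local_rate (\<rho> n) n * (cdf H u - std_normal_cdf (u / \<theta>\<^sub>0))"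
      by (simp add: local_alt_def algebra_simps)
    moreover have "\<bar>cdf H u - std_normal_cdf (u / \<theta>\<^sub>0)\<bar> \<le> 1"
      using H.cdf_nonneg[of u] H.cdf_bounded_prob[of u] Phi[of "u / \<theta>\<^sub>0"] by linarith
    ultimately show ?thesis using local_rate_bounds(1)[OF rho(1), of n n] by (simp add: abs_mult mult_left_le)
  qed
  have Pm[measurable]: "std_normal_cdf \<in> borel_measurable borel"
    by (intro borel_measurable_continuous_onI continuous_at_imp_continuous_on ballI) (rule DERIV_isCont[OF DERIV_std_normal_cdf])
  have cH[measurable]: "cdf H \<in> borel_measurable borel"
    by (intro borel_measurable_continuous_onI continuous_at_imp_continuous_on ballI differentiable_imp_continuous_within H_differentiable)
  have [measurable]: "Gn n \<in> borel_measurable borel" for n unfolding local_alt_def[abs_def] by measurable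
  have iP: "integrable Q (\<lambda>s. std_normal_cdf ((c + b * s) / \<theta>\<^sub>0))" for b
    by (rule Q.integrable_const_bound[of _ 1]) (use Phi in auto)
  have G01: "\<bar>Gn n u\<bar> \<le> 2" for n u
    using Gclose[of n u] local_rate_bounds(2)[of "\<rho> n" n] Phi[of "u / \<theta>\<^sub>0"] by linarith
  have iG: "integrable Q (\<lambda>s. Gn n (c + b * s) - Gn n c)" for n b
    by (intro Bochner_Integration.integrable_diff Q.integrable_const_bound[of _ 2]) (use G01 in auto)
  have "\<bar>jump n c - Delta0 p \<beta> \<theta>\<^sub>0 Q c\<bar> \<le> (real p + 1) * (2 * local_rate (\<rho> n) n)" for n
  proof -
    have D: "Delta0 p \<beta> \<theta>\<^sub>0 Q c = (\<Sum>i\<le>p. \<integral>s. std_normal_cdf ((c + bi i * s) / \<theta>\<^sub>0) - std_normal_cdf (c / \<theta>\<^sub>0) \<partial>Q)"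
      unfolding Delta0_def bi_def atLeast0AtMost
      using iP by (intro sum.cong refl) (subst Bochner_Integration.integral_diff, auto simp: Q.prob_space[unfolded Q.space_eq_univ])
    have "\<bar>jump n c - Delta0 p \<beta> \<theta>\<^sub>0 Q c\<bar> \<le> (\<Sum>i\<le>p. 2 * local_rate (\<rho> n) n)"
      unfolding D jump_def sum_subtractf[symmetric]
    proof (rule order_trans[OF sum_abs], rule sum_mono)
      fix i
      let ?P = "\<lambda>s. std_normal_cdf ((c + bi i * s) / \<theta>\<^sub>0) - std_normal_cdf (c / \<theta>\<^sub>0)"
      let ?G = "\<lambda>s. Gn n (c + bi i * s) - Gn n c"
      have iP': "integrable Q ?P" using iP[of "bi i"] by simp
      have "\<bar>(\<integral>s. ?G s \<partial>Q) - (\<integral>s. ?P s \<partial>Q)\<bar> \<le> (\<integral>s. \<bar>?G s - ?P s\<bar> \<partial>Q)"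
        by (subst Bochner_Integration.integral_diff[symmetric, OF iG iP']) (rule integral_abs_bound)
      also have "\<dots> \<le> (\<integral>s. 2 * local_rate (\<rho> n) n \<partial>Q)"
      proof (intro integral_mono integrable_abs Bochner_Integration.integrable_diff[OF iG iP'])
        fix s
        show "\<bar>?G s - ?P s\<bar> \<le> 2 * local_rate (\<rho> n) n"
          using Gclose[of n "c + bi i * s"] Gclose[of n c] by linarith
      qed simp
      finally show "\<bar>(\<integral>s. ?G s \<partial>Q) - (\<integral>s. ?P s \<partial>Q)\<bar> \<le> 2 * local_rate (\<rho> n) n"
        by (simp add: Q.prob_space[unfolded Q.space_eq_univ])
    qed
    then show ?thesis by (simp add: algebra_simps)
  qed
  then have b: "\<forall>n. norm (jump n c - Delta0 p \<beta> \<theta>\<^sub>0 Q c) \<le> (real p + 1) * (2 * local_rate (\<rho> n) n)"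
    unfolding real_norm_def by blast
  have "(\<lambda>n. (real p + 1) * (2 * local_rate (\<rho> n) n)) \<longlonglongrightarrow> (real p + 1) * (2 * 0)"
    by (intro tendsto_intros local_rate_limits(2)[OF rho(2)])
  then have "(\<lambda>n. (real p + 1) * (2 * local_rate (\<rho> n) n)) \<longlonglongrightarrow> 0" by (simp only: mult_zero_right)
  from Lim_null_comparison[OF always_eventually[OF b] this] show ?thesis by (rule LIM_zero_cancel)
qed

text \<open>Each term of \<open>Delta0\<close> tends to zero at infinity by dominated convergence.
  At \<open>- u\<close> the symmetry of the normal law turns a term with factor \<open>b\<close>
  into minus the term with factor \<open>- b\<close> at \<open>u\<close>, so the same limit
  applies.\<close>

lemma DeltaS_at_top: "(DeltaS p \<beta> \<theta>\<^sub>0 Q \<longlongrightarrow> 0) at_top"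
proof -
  have Phi: "0 \<le> std_normal_cdf u" "std_normal_cdf u \<le> 1" for u using std_normal_cdf_bounds[of u] by auto
  have [measurable]: "std_normal_cdf \<in> borel_measurable borel"
    by (intro borel_measurable_continuous_onI continuous_at_imp_continuous_on ballI) (rule DERIV_isCont[OF DERIV_std_normal_cdf])
  have top: "((\<lambda>u. (\<integral>s. std_normal_cdf ((u + b * s) / \<theta>\<^sub>0) \<partial>Q) - std_normal_cdf (u / \<theta>\<^sub>0)) \<longlongrightarrow> 0) at_top" for b
  proof -
    have "((\<lambda>u. \<integral>s. std_normal_cdf ((u + b * s) / \<theta>\<^sub>0) \<partial>Q) \<longlongrightarrow> (\<integral>s. 1 \<partial>Q)) at_top"
    proof (rule integral_dominated_convergence_at_top[where w = "\<lambda>_. 1"])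
      show "AE s in Q. ((\<lambda>u. std_normal_cdf ((u + b * s) / \<theta>\<^sub>0)) \<longlongrightarrow> 1) at_top"
        by (intro AE_I2 filterlim_compose[OF scaled_cdf_at_top[OF theta0]] filterlim_tendsto_add_at_top[OF tendsto_const filterlim_ident, THEN filterlim_cong[THEN iffD1, rotated -1]]) (auto simp: add.commute)
    qed (use Phi in auto)
    then have "((\<lambda>u. (\<integral>s. std_normal_cdf ((u + b * s) / \<theta>\<^sub>0) \<partial>Q) - std_normal_cdf (u / \<theta>\<^sub>0)) \<longlongrightarrow> (\<integral>s. 1 \<partial>Q) - 1) at_top"
      by (intro tendsto_diff scaled_cdf_at_top theta0)
    then show ?thesis by (simp add: Q.prob_space[unfolded Q.space_eq_univ])
  qed
  have "(Delta0 p \<beta> \<theta>\<^sub>0 Q \<longlongrightarrow> (\<Sum>j=0..p. 0)) at_top"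
    unfolding Delta0_def[abs_def] by (intro tendsto_sum top)
  moreover have "((\<lambda>u. Delta0 p \<beta> \<theta>\<^sub>0 Q (- u)) \<longlongrightarrow> (\<Sum>j=0..p. 0)) at_top"
    unfolding Delta0_def
  proof (intro tendsto_sum)
    fix j
    let ?b = "if j = 0 then -1 else \<beta> j"
    have "(\<integral>s. std_normal_cdf ((- u + ?b * s) / \<theta>\<^sub>0) \<partial>Q) - std_normal_cdf (- u / \<theta>\<^sub>0) =
       - ((\<integral>s. std_normal_cdf ((u + (- ?b) * s) / \<theta>\<^sub>0) \<partial>Q) - std_normal_cdf (u / \<theta>\<^sub>0))" for u
    proof -
      have "(- u + ?b * s) / \<theta>\<^sub>0 = - ((u + (- ?b) * s) / \<theta>\<^sub>0)" for s using theta0 by (simp add: field_simps)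
      then have "(\<integral>s. std_normal_cdf ((- u + ?b * s) / \<theta>\<^sub>0) \<partial>Q) = (\<integral>s. 1 - std_normal_cdf ((u + (- ?b) * s) / \<theta>\<^sub>0) \<partial>Q)"
        by (simp only: std_normal_cdf_minus)
      also have "\<dots> = 1 - (\<integral>s. std_normal_cdf ((u + (- ?b) * s) / \<theta>\<^sub>0) \<partial>Q)"
        by (subst Bochner_Integration.integral_diff)
          (use Phi in \<open>auto intro!: Q.integrable_const_bound[of _ 1] simp: Q.prob_space[unfolded Q.space_eq_univ]\<close>)
      finally show ?thesis using std_normal_cdf_minus[of "u / \<theta>\<^sub>0"] by simp
    qed
    then show "((\<lambda>u. (\<integral>s. std_normal_cdf ((- u + ?b * s) / \<theta>\<^sub>0) \<partial>Q) - std_normal_cdf (- u / \<theta>\<^sub>0)) \<longlongrightarrow> 0) at_top"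
      using tendsto_minus[OF top[of "- ?b"]] by (simp only: minus_zero)
  qed
  ultimately have "((\<lambda>u. (Delta0 p \<beta> \<theta>\<^sub>0 Q u - Delta0 p \<beta> \<theta>\<^sub>0 Q (- u)) / 2) \<longlongrightarrow> ((\<Sum>j=0..p. 0) - (\<Sum>j=0..p. 0)) / 2) at_top"
    by (intro tendsto_intros) auto
  then show ?thesis by (simp add: DeltaS_def[abs_def])
qed

text \<open>The one-sided approximations at \<open>edge j\<close> and \<open>- edge j\<close> are
  subtracted. At the two extreme edges the bands are constant and \<open>DeltaS\<close> is zero, so
  nothing has to be approximated there.\<close>

lemma band_counts:
  assumes "j \<le> m"
  shows "negl (\<lambda>n \<omega>. (\<Sum>t\<in>{1..int n}. band j (eh n \<omega> t) - band j (\<epsilon> n t \<omega>)) / sqrt n - \<gamma>' * (2 * val_at (DeltaS p \<beta> \<theta>\<^sub>0 Q) (x j)))"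
proof -
  consider "j = 0" | "j = m" | "0 < j" "j < m" using assms by linarith
  then show ?thesis
  proof cases
    case 1
    have "val_at (DeltaS p \<beta> \<theta>\<^sub>0 Q) (x 0) = 0" using val_at_edge[of 0 "DeltaS p \<beta> \<theta>\<^sub>0 Q"] m by (simp add: edge_0' DeltaS_def)
    then show ?thesis using 1 negl_seq[of "\<lambda>_. 0"] by (simp add: band_0)
  next
    case 2
    then show ?thesis using negl_seq[of "\<lambda>_. 0"] by (simp add: band_m val_at_top[OF DeltaS_at_top])
  next
    case 3
    obtain G' where G': "\<And>n u. G' n (- u) = G' n u"
      "\<And>c e. 0 < e \<Longrightarrow> asure M (\<lambda>n \<omega>. \<bar>(\<Sum>t\<in>{1..int n}. (if eh n \<omega> t \<le> c then 1 else 0) - (if \<epsilon> n t \<omega> \<le> c then 1 else 0)) / sqrt n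
       - sqrt n * gm n * jump n c - G' n c * dev n \<omega> 0\<bar> \<le> e)" by (rule one_sided_counts) blast
    define X where "X c n \<omega> = (\<Sum>t\<in>{1..int n}. (if eh n \<omega> t \<le> c then 1 else 0) - (if \<epsilon> n t \<omega> \<le> c then 1 else 0)) / sqrt n
       - sqrt n * gm n * jump n c - G' n c * dev n \<omega> 0" for c n \<omega>
    have X: "negl (X c)" for c unfolding negl_def X_def using G'(2) by blast
    let ?c = "edge j"
    have "(\<lambda>n. (sqrt n * gm n) * (jump n ?c - jump n (- ?c)) - \<gamma>' * (2 * DeltaS p \<beta> \<theta>\<^sub>0 Q ?c)) \<longlonglongrightarrow>
       \<gamma>' * (Delta0 p \<beta> \<theta>\<^sub>0 Q ?c - Delta0 p \<beta> \<theta>\<^sub>0 Q (- ?c)) - \<gamma>' * (2 * DeltaS p \<beta> \<theta>\<^sub>0 Q ?c)"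
      by (intro tendsto_intros jump_limit local_rate_limits(1)[OF gamma(2)])
    then have "(\<lambda>n. (sqrt n * gm n) * (jump n ?c - jump n (- ?c)) - \<gamma>' * (2 * DeltaS p \<beta> \<theta>\<^sub>0 Q ?c)) \<longlonglongrightarrow> 0"
    proof (rule tendsto_eq_rhs)
      have "2 * DeltaS p \<beta> \<theta>\<^sub>0 Q ?c = Delta0 p \<beta> \<theta>\<^sub>0 Q ?c - Delta0 p \<beta> \<theta>\<^sub>0 Q (- ?c)" by (simp add: DeltaS_def)
      then show "\<gamma>' * (Delta0 p \<beta> \<theta>\<^sub>0 Q ?c - Delta0 p \<beta> \<theta>\<^sub>0 Q (- ?c)) - \<gamma>' * (2 * DeltaS p \<beta> \<theta>\<^sub>0 Q ?c) = 0" by simp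
    qed
    from negl_add[OF negl_add[OF X[of ?c] negl_cmult[OF X[of "- ?c"], of "-1"]] negl_seq[OF this]]
    show ?thesis
    proof (rule negl_dominated, intro always_eventually allI ballI)
      fix n \<omega>
      have "(\<Sum>t\<in>{1..int n}. band j (eh n \<omega> t) - band j (\<epsilon> n t \<omega>)) =
        (\<Sum>t\<in>{1..int n}. (if eh n \<omega> t \<le> ?c then 1 else 0) - (if \<epsilon> n t \<omega> \<le> ?c then 1 else 0)) -
        (\<Sum>t\<in>{1..int n}. (if eh n \<omega> t \<le> - ?c then 1 else 0) - (if \<epsilon> n t \<omega> \<le> - ?c then 1 else 0))"
        unfolding sum_subtractf[symmetric] band_eq[OF 3] by (intro sum.cong refl) linarith
      then have "(\<Sum>t\<in>{1..int n}. band j (eh n \<omega> t) - band j (\<epsilon> n t \<omega>)) / sqrt n - \<gamma>' * (2 * val_at (DeltaS p \<beta> \<theta>\<^sub>0 Q) (x j))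
        = X ?c n \<omega> + - 1 * X (- ?c) n \<omega> + ((sqrt n * gm n) * (jump n ?c - jump n (- ?c)) - \<gamma>' * (2 * DeltaS p \<beta> \<theta>\<^sub>0 Q ?c))"
        unfolding X_def G'(1) val_at_edge[OF 3(2)] by (simp add: diff_divide_distrib right_diff_distrib)
      then show "\<bar>(\<Sum>t\<in>{1..int n}. band j (eh n \<omega> t) - band j (\<epsilon> n t \<omega>)) / sqrt n - \<gamma>' * (2 * val_at (DeltaS p \<beta> \<theta>\<^sub>0 Q) (x j))\<bar> \<le>
         \<bar>X ?c n \<omega> + - 1 * X (- ?c) n \<omega> + ((sqrt n * gm n) * (jump n ?c - jump n (- ?c)) - \<gamma>' * (2 * DeltaS p \<beta> \<theta>\<^sub>0 Q ?c))\<bar>"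
        by simp
    qed
  qed
qed

lemma cell_counts:
  assumes j: "j \<in> {1..m}"
  shows "negl (\<lambda>n \<omega>. (real (cell_count x n (eh n \<omega>) j) - (\<Sum>t\<in>{1..int n}. in_cell j (\<epsilon> n t \<omega>))) / sqrt n - \<gamma>' * delta x p \<beta> \<theta>\<^sub>0 Q j)"
proof -
  have "j \<le> m" "j - 1 \<le> m" using j by auto
  from negl_add[OF band_counts[OF this(1)] negl_cmult[OF band_counts[OF this(2)], of "-1"]]
  show ?thesis
  proof (rule negl_dominated, intro always_eventually allI ballI)
    fix n \<omega>
    show "\<bar>(real (cell_count x n (eh n \<omega>) j) - (\<Sum>t\<in>{1..int n}. in_cell j (\<epsilon> n t \<omega>))) / sqrt n - \<gamma>' * delta x p \<beta> \<theta>\<^sub>0 Q j\<bar> \<le>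
      \<bar>(\<Sum>t\<in>{1..int n}. band j (eh n \<omega> t) - band j (\<epsilon> n t \<omega>)) / sqrt n - \<gamma>' * (2 * val_at (DeltaS p \<beta> \<theta>\<^sub>0 Q) (x j)) +
       - 1 * ((\<Sum>t\<in>{1..int n}. band (j - 1) (eh n \<omega> t) - band (j - 1) (\<epsilon> n t \<omega>)) / sqrt n - \<gamma>' * (2 * val_at (DeltaS p \<beta> \<theta>\<^sub>0 Q) (x (j - 1))))\<bar>"
    proof -
      have id: "((a1 - a0) - (c1 - c0)) / r - g * (2 * (v1 - v0)) = ((a1 - c1) / r - g * (2 * v1)) + - 1 * ((a0 - c0) / r - g * (2 * v0))"
        for a1 a0 c1 c0 v1 v0 r g :: real by (simp add: diff_divide_distrib right_diff_distrib)
      show ?thesis unfolding cell_count_eq[OF j] in_cell_def delta_def sym_increment_def sum_subtractf id by (rule order_refl)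
    qed
  qed
qed

end

section \<open>An orthonormal basis adapted to the scale equation\<close>

context cells begin

lemma b_vec_eq: "j \<in> {1..m} \<Longrightarrow> 0 < \<theta> \<Longrightarrow> b_vec x \<theta> j = cell_deriv j \<theta> / sqrt (cell_prob x j \<theta>)"
  by (simp add: b_vec_def deriv_cell_prob)

lemma alpha_vec_sum:
  assumes \<theta>: "0 < \<theta>"
  shows "(\<Sum>j=1..m. alpha_vec x m \<theta> j * y j)\<^sup>2 =
    (\<Sum>j=1..m. y j * (cell_deriv j \<theta> / sqrt (cell_prob x j \<theta>)))\<^sup>2 / (\<Sum>j=1..m. (cell_deriv j \<theta>)\<^sup>2 / cell_prob x j \<theta>)"
proof -
  let ?B = "\<Sum>j=1..m. (cell_deriv j \<theta>)\<^sup>2 / cell_prob x j \<theta>"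
  have "L2_set (b_vec x \<theta>) {1..m} = sqrt ?B"
    unfolding L2_set_def using b_vec_eq[OF _ \<theta>] cell_prob_pos[OF _ \<theta>]
    by (intro arg_cong[where f = sqrt] sum.cong) (auto simp: power_divide less_imp_le)
  then have "(\<Sum>j=1..m. alpha_vec x m \<theta> j * y j) = (\<Sum>j=1..m. y j * (cell_deriv j \<theta> / sqrt (cell_prob x j \<theta>))) / sqrt ?B"
    unfolding alpha_vec_def sum_divide_distrib using b_vec_eq[OF _ \<theta>] by (intro sum.cong) auto
  then show ?thesis using fisher_pos[OF \<theta>] by (simp add: power_divide)
qed

text \<open>\<open>alpha_vec\<close> and the roots of the cell probabilities are orthonormal, as the
  probabilities add up to one and their derivatives to zero. They are the directions lost to the
  estimated scale and to the fixed total; any completion to an orthonormal basis supplies the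
  \<open>m - 2\<close> coordinates of the limit.\<close>

lemma complement_basis:
  assumes \<theta>: "0 < \<theta>"
  obtains w :: "nat \<Rightarrow> nat \<Rightarrow> real"
  where "\<And>y. (\<Sum>j=1..m. (y j)\<^sup>2) = (\<Sum>j=1..m. alpha_vec x m \<theta> j * y j)\<^sup>2 + (\<Sum>j=1..m. sqrt (cell_prob x j \<theta>) * y j)\<^sup>2
      + (\<Sum>i<m - 2. (\<Sum>j=1..m. w i j * y j)\<^sup>2)"
    and "\<And>i i'. i < m - 2 \<Longrightarrow> i' < m - 2 \<Longrightarrow> (\<Sum>j=1..m. w i j * w i' j) = (if i = i' then 1 else 0)"
    and "\<And>i. i < m - 2 \<Longrightarrow> (\<Sum>j=1..m. w i j * sqrt (cell_prob x j \<theta>)) = 0"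
    and "(\<Sum>j=1..m. (alpha_vec x m \<theta> j)\<^sup>2) = 1"
proof -
  let ?J = "{1..m}" and ?\<alpha> = "alpha_vec x m \<theta>" and ?q = "\<lambda>j. sqrt (cell_prob x j \<theta>)"
  note pos = cell_prob_pos[OF _ \<theta>]
  let ?B = "\<Sum>j=1..m. (cell_deriv j \<theta>)\<^sup>2 / cell_prob x j \<theta>"
  have L: "L2_set (b_vec x \<theta>) ?J = sqrt ?B"
    unfolding L2_set_def using b_vec_eq[OF _ \<theta>] pos
    by (intro arg_cong[where f = sqrt] sum.cong) (auto simp: power_divide less_imp_le)
  have \<alpha>: "?\<alpha> j = cell_deriv j \<theta> / sqrt (cell_prob x j \<theta>) / sqrt ?B" if "j \<in> ?J" for j
    unfolding alpha_vec_def L using b_vec_eq[OF that \<theta>] by simp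
  have aa: "(\<Sum>j\<in>?J. ?\<alpha> j * ?\<alpha> j) = 1"
  proof -
    have "(\<Sum>j\<in>?J. ?\<alpha> j * ?\<alpha> j) = (\<Sum>j\<in>?J. (cell_deriv j \<theta>)\<^sup>2 / cell_prob x j \<theta> / ?B)"
    proof (intro sum.cong refl)
      fix j assume j: "j \<in> ?J"
      have "(d / s / r) * (d / s / r) = d\<^sup>2 / s\<^sup>2 / r\<^sup>2" for d s r :: real by (simp add: power2_eq_square)
      from this[of "cell_deriv j \<theta>" "sqrt (cell_prob x j \<theta>)" "sqrt ?B"]
      show "?\<alpha> j * ?\<alpha> j = (cell_deriv j \<theta>)\<^sup>2 / cell_prob x j \<theta> / ?B"
        unfolding \<alpha>[OF j] using pos[OF j] fisher_pos[OF \<theta>] by (simp add: less_imp_le)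
    qed
    also have "\<dots> = 1" unfolding sum_divide_distrib[symmetric] using fisher_pos[OF \<theta>] by simp
    finally show ?thesis .
  qed
  have aq: "(\<Sum>j\<in>?J. ?\<alpha> j * ?q j) = 0"
  proof -
    have "(\<Sum>j\<in>?J. ?\<alpha> j * ?q j) = (\<Sum>j\<in>?J. cell_deriv j \<theta> / sqrt ?B)"
    proof (intro sum.cong refl)
      fix j assume j: "j \<in> ?J"
      have "d / s / r * s = d / r" if "0 < s" for d s r :: real using that by simp
      from this[of "sqrt (cell_prob x j \<theta>)"] show "?\<alpha> j * ?q j = cell_deriv j \<theta> / sqrt ?B"
        unfolding \<alpha>[OF j] using pos[OF j] by simp
    qed
    then show ?thesis unfolding sum_divide_distrib[symmetric] sum_cell_deriv by simp
  qed
  have qq: "(\<Sum>j\<in>?J. ?q j * ?q j) = 1"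
  proof -
    have "(\<Sum>j\<in>?J. ?q j * ?q j) = (\<Sum>j\<in>?J. cell_prob x j \<theta>)"
      using pos by (intro sum.cong) (auto simp: less_imp_le)
    then show ?thesis unfolding sum_cell_prob[OF \<theta>] .
  qed
  define u where "u i = (if i = 0 then ?\<alpha> else ?q)" for i :: nat
  have "orthonormal ?J u 2"
    unfolding orthonormal_def
  proof (intro allI impI)
    fix i i' :: nat assume "i < 2" "i' < 2"
    moreover have "(\<Sum>j\<in>?J. ?q j * ?\<alpha> j) = 0" using aq by (simp add: mult.commute)
    ultimately show "(\<Sum>j\<in>?J. u i j * u i' j) = (if i = i' then 1 else 0)"
      using aa aq qq unfolding u_def by (cases "i = 0"; cases "i' = 0") (simp_all only: if_True if_False, auto)
  qed
  then obtain e where e: "orthonormal ?J e (card ?J)" "\<And>i. i < 2 \<Longrightarrow> e i = u i"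
    by (rule orthonormal_extend[rotated]) (use m in auto)
  have eo: "(\<Sum>j\<in>?J. e i j * e i' j) = (if i = i' then 1 else 0)" if "i < card ?J" "i' < card ?J" for i i'
    using e(1) that unfolding orthonormal_def by blast
  have c: "card ?J = Suc (Suc (m - 2))" using m by simp
  show thesis
  \<comment> \<open>Indices \<open>0\<close> and \<open>1\<close> of the completed basis are the two
    given vectors.\<close>
  proof (rule that[of "\<lambda>i. e (i + 2)"])
    fix y
    have "(\<Sum>j\<in>?J. (y j)\<^sup>2) = (\<Sum>i<Suc (Suc (m - 2)). (\<Sum>j\<in>?J. e i j * y j)\<^sup>2)"
      using orthonormal_parseval[OF _ e(1), of y] unfolding c by simp
    also have "\<dots> = (\<Sum>j\<in>?J. e 0 j * y j)\<^sup>2 + ((\<Sum>j\<in>?J. e 1 j * y j)\<^sup>2 + (\<Sum>i<m - 2. (\<Sum>j\<in>?J. e (i + 2) j * y j)\<^sup>2))"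
      unfolding sum.lessThan_Suc_shift by simp
    finally show "(\<Sum>j\<in>?J. (y j)\<^sup>2) = (\<Sum>j\<in>?J. ?\<alpha> j * y j)\<^sup>2 + (\<Sum>j\<in>?J. ?q j * y j)\<^sup>2 + (\<Sum>i<m - 2. (\<Sum>j\<in>?J. e (i + 2) j * y j)\<^sup>2)"
      using e(2)[of 0] e(2)[of 1] by (simp add: u_def)
  next
    fix i i' assume "i < m - 2" "i' < m - 2"
    then have "i + 2 < card ?J" "i' + 2 < card ?J" by auto
    from eo[OF this] show "(\<Sum>j\<in>?J. e (i + 2) j * e (i' + 2) j) = (if i = i' then 1 else 0)" by simp
  next
    fix i assume "i < m - 2"
    then have "i + 2 < card ?J" "1 < card ?J" using m by auto
    from eo[OF this] have "(\<Sum>j\<in>?J. e (i + 2) j * e 1 j) = 0" by simp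
    then show "(\<Sum>j\<in>?J. e (i + 2) j * ?q j) = 0" using e(2)[of 1] by (simp add: u_def)
  next
    show "(\<Sum>j\<in>?J. (?\<alpha> j)\<^sup>2) = 1" using aa by (simp add: power2_eq_square)
  qed
qed

end

section \<open>Joint limit of the cell counts\<close>

context ar_array begin


abbreviation pr :: "nat \<Rightarrow> real" where "pr j \<equiv> cell_prob x j \<theta>\<^sub>0"

text \<open>Centred at the exact probabilities under the alternative, so that the mean is zero for
  each \<open>n\<close>; their distance from the normal ones goes into \<open>drift\<close>.\<close>

definition Sn :: "nat \<Rightarrow> nat \<Rightarrow> 'w \<Rightarrow> real"
  where "Sn n j \<omega> = (\<Sum>t\<in>{1..int n}. in_cell j (\<epsilon> n t \<omega>) - pn n j) / sqrt n"

definition Xh :: "nat \<Rightarrow> nat \<Rightarrow> 'w \<Rightarrow> real"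
  where "Xh n j \<omega> = (real (cell_count x n (eh n \<omega>) j) - real n * pr j) / sqrt n"

definition drift :: "nat \<Rightarrow> real"
  where "drift j = \<rho>' * (sym_increment x (cdf H) j - pr j) + \<gamma>' * delta x p \<beta> \<theta>\<^sub>0 Q j"

lemma pn_bounds: assumes "1 \<le> n" "j \<in> {1..m}" shows "0 \<le> pn n j" "pn n j \<le> 1"
proof -
  interpret A: contaminated_ar "M n" p n \<beta> \<nu> "Gn n" "gm n" Q "\<epsilon> n" "v n" "z n" "\<xi> n" by (rule model[OF assms(1)])
  have b: "0 \<le> in_cell j e" "in_cell j e \<le> 1" for e using in_cell_01[OF assms(2), of e] by auto
  have i: "integrable (M n) (\<lambda>\<omega>. in_cell j (\<epsilon> n 0 \<omega>))"
    using b by (intro A.integrable_const_bound[of _ 1]) (auto simp: abs_le_iff intro: order_trans[of _ 0])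
  show "0 \<le> pn n j" unfolding expectation_in_cell[OF assms, of 0, symmetric] using b by simp
  have "A.expectation (\<lambda>\<omega>. in_cell j (\<epsilon> n 0 \<omega>)) \<le> A.expectation (\<lambda>\<omega>. 1)" using b i by (intro integral_mono) auto
  then show "pn n j \<le> 1" unfolding expectation_in_cell[OF assms] by (simp add: A.prob_space)
qed

lemma in_cell_centred: assumes "1 \<le> n" "j \<in> {1..m}" shows "\<bar>in_cell j e - pn n j\<bar> \<le> 1"
  using pn_bounds[OF assms] in_cell_01[OF assms(2), of e] by auto

text \<open>Applied to centred cell indicators and their linear combinations: independence feeds the
  central limit theorem, and orthogonality gives tightness.\<close>

lemma innovation_array:
  assumes n: "1 \<le> n" and f: "f \<in> borel_measurable borel" "\<And>e. \<bar>f e\<bar> \<le> K"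
    and mean: "\<And>t. (\<integral>\<omega>. f (\<epsilon> n t \<omega>) \<partial>M n) = 0"
  shows "prob_space.indep_vars (M n) (\<lambda>_. borel) (\<lambda>t \<omega>. f (\<epsilon> n t \<omega>)) {1..int n}"
    and "prob_space.l1 (M n) (\<lambda>\<omega>. (\<Sum>t\<in>{1..int n}. f (\<epsilon> n t \<omega>)) / sqrt n) K"
proof -
  interpret A: contaminated_ar "M n" p n \<beta> \<nu> "Gn n" "gm n" Q "\<epsilon> n" "v n" "z n" "\<xi> n" by (rule model[OF n])
  note f(1)[measurable]
  have K0: "0 \<le> K" using f(2)[of 0] by linarith
  have "A.indep_vars (\<lambda>t. Pi\<^sub>M {Inl t} (\<lambda>_. borel)) (\<lambda>t \<omega>. \<lambda>i\<in>{Inl t}. A.src i \<omega>) {1..int n}"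
    by (rule A.indep_vars_restrict[OF A.indep_src]) (auto simp: disjoint_family_on_def)
  then have "A.indep_vars (\<lambda>_. borel) (\<lambda>t. (\<lambda>h. f (h (Inl t))) \<circ> (\<lambda>\<omega>. \<lambda>i\<in>{Inl t}. A.src i \<omega>)) {1..int n}"
    by (rule A.indep_vars_compose) measurable
  then show ind: "A.indep_vars (\<lambda>_. borel) (\<lambda>t \<omega>. f (\<epsilon> n t \<omega>)) {1..int n}"
    by (simp add: comp_def)
  have gen: "(\<lambda>\<omega>. f (\<epsilon> n t \<omega>)) \<in> borel_measurable (A.gen {Inl t})" for t
    using A.src_gen[of "Inl t" "{Inl t}"] by simp
  have int: "integrable (M n) (\<lambda>\<omega>. f (\<epsilon> n t \<omega>))" for t
    by (rule A.integrable_const_bound[of _ K]) (use f(2) in auto)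
  have prod: "A.expectation (\<lambda>\<omega>. f (\<epsilon> n s \<omega>) * f (\<epsilon> n t \<omega>)) = 0" if "s \<noteq> t" for s t
    using A.expectation_mult_gen(1)[OF _ _ _ gen[of s] gen[of t] int int] that mean by auto
  have ip: "integrable (M n) (\<lambda>\<omega>. f (\<epsilon> n s \<omega>) * f (\<epsilon> n t \<omega>))" for s t
    by (rule A.integrable_const_bound[of _ "K * K"]) (use f(2) K0 in \<open>auto simp: abs_mult intro!: mult_mono\<close>)
  have sq: "A.expectation (\<lambda>\<omega>. f (\<epsilon> n t \<omega>) * f (\<epsilon> n t \<omega>)) \<le> K * K" for t
  proof -
    have le: "f e * f e \<le> K * K" for e
      using mult_mono[OF f(2)[of e] f(2)[of e]] K0 by (simp flip: abs_mult)
    have "A.expectation (\<lambda>\<omega>. f (\<epsilon> n t \<omega>) * f (\<epsilon> n t \<omega>)) \<le> A.expectation (\<lambda>\<omega>. K * K)"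
      by (intro integral_mono ip le) simp
    then show ?thesis by (simp add: A.prob_space)
  qed
  have "(\<Sum>t\<in>{1..int n}. A.expectation (\<lambda>\<omega>. f (\<epsilon> n t \<omega>) * f (\<epsilon> n t \<omega>))) \<le> (\<Sum>t\<in>{1..int n}. K * K)"
    by (intro sum_mono sq)
  then have V: "(\<Sum>t\<in>{1..int n}. A.expectation (\<lambda>\<omega>. f (\<epsilon> n t \<omega>) * f (\<epsilon> n t \<omega>))) \<le> real n * (K * K)" by simp
  have "A.l1 (\<lambda>\<omega>. \<Sum>t\<in>{1..int n}. f (\<epsilon> n t \<omega>)) (sqrt (real n * (K * K)))"
    using A.abs_sum_orthogonal_le[OF _ _ ip prod V] unfolding A.l1_def by simp
  from A.l1_cmult[OF this, of "1 / sqrt n"] show "A.l1 (\<lambda>\<omega>. (\<Sum>t\<in>{1..int n}. f (\<epsilon> n t \<omega>)) / sqrt n) K"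
    using n K0 by (simp add: real_sqrt_mult)
qed

lemma mean_in_cell_centred:
  assumes "1 \<le> n" "j \<in> {1..m}" shows "(\<integral>\<omega>. in_cell j (\<epsilon> n t \<omega>) - pn n j \<partial>M n) = 0"
    "integrable (M n) (\<lambda>\<omega>. in_cell j (\<epsilon> n t \<omega>))"
proof -
  interpret A: contaminated_ar "M n" p n \<beta> \<nu> "Gn n" "gm n" Q "\<epsilon> n" "v n" "z n" "\<xi> n" by (rule model[OF assms(1)])
  have "\<bar>in_cell j e\<bar> \<le> 1" for e using in_cell_01[OF assms(2), of e] by auto
  then show i: "integrable (M n) (\<lambda>\<omega>. in_cell j (\<epsilon> n t \<omega>))"
    by (intro A.integrable_const_bound[of _ 1]) auto
  show "(\<integral>\<omega>. in_cell j (\<epsilon> n t \<omega>) - pn n j \<partial>M n) = 0"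
    by (subst Bochner_Integration.integral_diff[OF i]) (simp_all add: expectation_in_cell[OF assms] A.prob_space)
qed

lemma tight_Sn: assumes j: "j \<in> {1..m}" shows "tight M (\<lambda>n. Sn n j)"
proof (rule tight_l1[of _ 1])
  fix n :: nat assume n: "1 \<le> n"
  have "prob_space.l1 (M n) (\<lambda>\<omega>. (\<Sum>t\<in>{1..int n}. (\<lambda>e. in_cell j e - pn n j) (\<epsilon> n t \<omega>)) / sqrt n) 1"
    by (rule innovation_array(2)[OF n _ in_cell_centred[OF n j] mean_in_cell_centred(1)[OF n j]]) simp
  then show "prob_space.l1 (M n) (Sn n j) 1" by (simp add: Sn_def[abs_def])
qed

text \<open>A linear combination of the cell counts is a sum of bounded independent variables. The
  exponent is the quadratic form of the multinomial covariance, the diagonal of the cell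
  probabilities minus their outer product.\<close>

lemma clt_cells:
  "(\<lambda>n. CLINT \<omega>|M n. iexp (\<Sum>j=1..m. a j * Sn n j \<omega>)) \<longlonglongrightarrow>
    complex_of_real (exp (- ((\<Sum>j=1..m. (a j)\<^sup>2 * pr j) - (\<Sum>j=1..m. a j * pr j)\<^sup>2) / 2))"
proof -
  define K where "K = (\<Sum>j=1..m. \<bar>a j\<bar>)"
  define f where "f n e = (\<Sum>j=1..m. a j * (in_cell j e - pn n j))" for n e
  define V where "V n = (\<Sum>j=1..m. (a j)\<^sup>2 * pn n j) - (\<Sum>j=1..m. a j * pn n j)\<^sup>2" for n
  have fm: "f n \<in> borel_measurable borel" for n unfolding f_def[abs_def] by measurable
  have fK: "\<bar>f n e\<bar> \<le> K" if n: "1 \<le> n" for n e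
    unfolding f_def K_def
  proof (rule order_trans[OF sum_abs], rule sum_mono)
    fix j assume "j \<in> {1..m}"
    from in_cell_centred[OF n this, of e] show "\<bar>a j * (in_cell j e - pn n j)\<bar> \<le> \<bar>a j\<bar>"
      by (simp add: abs_mult mult_left_le)
  qed
  have mean: "(\<integral>\<omega>. f n (\<epsilon> n t \<omega>) \<partial>M n) = 0" if n: "1 \<le> n" for n t
  proof -
    have "(\<integral>\<omega>. f n (\<epsilon> n t \<omega>) \<partial>M n) = (\<Sum>j=1..m. \<integral>\<omega>. a j * (in_cell j (\<epsilon> n t \<omega>) - pn n j) \<partial>M n)"
      unfolding f_def
    proof (rule Bochner_Integration.integral_sum)
      fix j assume j: "j \<in> {1..m}"
      interpret prob_space "M n" by (rule M_prob[OF n])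
      show "integrable (M n) (\<lambda>\<omega>. a j * (in_cell j (\<epsilon> n t \<omega>) - pn n j))"
        using mean_in_cell_centred(2)[OF n j] by simp
    qed
    also have "\<dots> = 0" using mean_in_cell_centred(1)[OF n] by (intro sum.neutral) auto
    finally show ?thesis .
  qed
  have var: "(\<integral>\<omega>. (f n (\<epsilon> n t \<omega>))\<^sup>2 \<partial>M n) = V n" if n: "1 \<le> n" for n t
  proof -
    interpret prob_space "M n" by (rule M_prob[OF n])
    define c where "c = (\<Sum>j=1..m. a j * pn n j)"
    have ic: "integrable (M n) (\<lambda>\<omega>. b j * in_cell j (\<epsilon> n t \<omega>))" if "j \<in> {1..m}" for j and b :: "nat \<Rightarrow> real"
      using mean_in_cell_centred(2)[OF n that] by simp
    have E: "expectation (\<lambda>\<omega>. \<Sum>j=1..m. b j * in_cell j (\<epsilon> n t \<omega>)) = (\<Sum>j=1..m. b j * pn n j)"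
      "integrable (M n) (\<lambda>\<omega>. \<Sum>j=1..m. b j * in_cell j (\<epsilon> n t \<omega>))" for b :: "nat \<Rightarrow> real"
      using ic expectation_in_cell[OF n] by (auto simp: Bochner_Integration.integral_sum)
    have f2: "(f n e)\<^sup>2 = (\<Sum>j=1..m. (a j)\<^sup>2 * in_cell j e) - 2 * c * (\<Sum>j=1..m. a j * in_cell j e) + c\<^sup>2" for e
    proof -
      have "f n e = (\<Sum>j=1..m. a j * in_cell j e) - c" by (simp add: f_def c_def right_diff_distrib sum_subtractf)
      then show ?thesis unfolding square_sum_in_cell[symmetric] by (simp add: power2_diff)
    qed
    have i2: "integrable (M n) (\<lambda>\<omega>. 2 * c * (\<Sum>j=1..m. a j * in_cell j (\<epsilon> n t \<omega>)))" using E(2)[of a] by (rule integrable_mult_right)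
    have "(\<integral>\<omega>. (f n (\<epsilon> n t \<omega>))\<^sup>2 \<partial>M n) = (\<Sum>j=1..m. (a j)\<^sup>2 * pn n j) - 2 * c * (\<Sum>j=1..m. a j * pn n j) + c\<^sup>2"
      unfolding f2
      by (subst Bochner_Integration.integral_add[OF Bochner_Integration.integrable_diff[OF E(2) i2]], simp,
          subst Bochner_Integration.integral_diff[OF E(2) i2], subst integral_mult_right_zero, simp only: E(1), simp add: prob_space)
    then show ?thesis unfolding V_def c_def[symmetric] by (simp add: power2_eq_square)
  qed
  have lim: "V \<longlonglongrightarrow> (\<Sum>j=1..m. (a j)\<^sup>2 * pr j) - (\<Sum>j=1..m. a j * pr j)\<^sup>2"
    unfolding V_def[abs_def] by (intro tendsto_intros pn_limit(2))
  have "(\<lambda>n. CLINT \<omega>|M n. iexp ((\<Sum>t\<in>{1..int n}. f n (\<epsilon> n t \<omega>)) / sqrt n)) \<longlonglongrightarrow>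
     complex_of_real (exp (- ((\<Sum>j=1..m. (a j)\<^sup>2 * pr j) - (\<Sum>j=1..m. a j * pr j)\<^sup>2) / 2))"
    by (rule clt_bounded_array[OF M_prob innovation_array(1)[OF _ fm fK mean] fK mean var lim]) auto
  moreover have "(\<Sum>t\<in>{1..int n}. f n (\<epsilon> n t \<omega>)) / sqrt n = (\<Sum>j=1..m. a j * Sn n j \<omega>)" for n \<omega>
    unfolding f_def Sn_def by (subst sum.swap) (simp add: sum_divide_distrib[symmetric] sum_distrib_left[symmetric])
  ultimately show ?thesis by (simp only:)
qed

text \<open>The drift has two sources: residual counts differ from innovation counts through the
  contamination, and the exact cell probabilities differ from the normal ones through the
  alternative.\<close>

lemma Xh_approx: assumes j: "j \<in> {1..m}" shows "negl (\<lambda>n \<omega>. Xh n j \<omega> - (Sn n j \<omega> + drift j))"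
proof -
  have "(\<lambda>n. sqrt n * (pn n j - pr j) - \<rho>' * (sym_increment x (cdf H) j - pr j)) \<longlonglongrightarrow> 0"
    using pn_limit(1)[OF j] by (simp add: LIM_zero_iff)
  from negl_add[OF cell_counts[OF j] negl_seq[OF this]] show ?thesis
  proof (rule negl_dominated, intro eventually_mono[OF eventually_ge_at_top[of 1]] ballI)
    fix n :: nat and \<omega> assume n: "1 \<le> n"
    have "(c - r * r * p0) / r - ((s - r * r * p1) / r + (a + b)) = ((c - s) / r - b) + (r * (p1 - p0) - a)"
      if "0 < r" for c r p0 p1 s a b :: real using that by (simp add: field_simps)
    from this[of "sqrt n"] n
    have id: "(c - real n * p0) / sqrt n - ((s - real n * p1) / sqrt n + (a + b)) = ((c - s) / sqrt n - b) + (sqrt n * (p1 - p0) - a)"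
      for c p0 p1 s a b by simp
    have "Xh n j \<omega> - (Sn n j \<omega> + drift j) = ((real (cell_count x n (eh n \<omega>) j) - (\<Sum>t\<in>{1..int n}. in_cell j (\<epsilon> n t \<omega>))) / sqrt n - \<gamma>' * delta x p \<beta> \<theta>\<^sub>0 Q j) +
       (sqrt n * (pn n j - pr j) - \<rho>' * (sym_increment x (cdf H) j - pr j))"
      unfolding Xh_def Sn_def drift_def id[symmetric] by (simp add: sum_subtractf)
    then show "\<bar>Xh n j \<omega> - (Sn n j \<omega> + drift j)\<bar> \<le> \<bar>((real (cell_count x n (eh n \<omega>) j) - (\<Sum>t\<in>{1..int n}. in_cell j (\<epsilon> n t \<omega>))) / sqrt n - \<gamma>' * delta x p \<beta> \<theta>\<^sub>0 Q j) +
       (sqrt n * (pn n j - pr j) - \<rho>' * (sym_increment x (cdf H) j - pr j))\<bar>" by simp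
  qed
qed

lemma tight_Xh: assumes j: "j \<in> {1..m}" shows "tight M (\<lambda>n. Xh n j)"
proof -
  have "tight M (\<lambda>n \<omega>. (Xh n j \<omega> - (Sn n j \<omega> + drift j)) + (Sn n j \<omega> + drift j))"
    by (intro tight_add tight_const tight_Sn[OF j] negl_tight[OF Xh_approx[OF j]])
  then show ?thesis by simp
qed

text \<open>The deterministic \<open>pearson_expansion\<close> applies on the intersection of three
  likely events: bounded normalized counts, a bounded scale error, and validity of the scale
  equation.\<close>

lemma pearson_quadratic:
  "negl (\<lambda>n \<omega>. pearson_stat x m n (eh n \<omega>) (\<theta>h n \<omega>) -
     ((\<Sum>j=1..m. (Xh n j \<omega>)\<^sup>2 / pr j) - (\<Sum>j=1..m. Xh n j \<omega> * (cell_deriv j \<theta>\<^sub>0 / pr j))\<^sup>2 / (\<Sum>j=1..m. (cell_deriv j \<theta>\<^sub>0)\<^sup>2 / pr j)))"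
  unfolding negl_def asure_def
proof (intro allI impI)
  fix e \<eta> :: real assume e: "0 < e" and \<eta>: "0 < \<eta>"
  obtain K where K: "0 < K" "likely M (\<eta>/3) (\<lambda>n \<omega>. \<forall>j\<in>{1..m}. \<bar>Xh n j \<omega>\<bar> \<le> K)"
    by (rule tight_ball[of "{1..m}" "\<lambda>j n. Xh n j" "\<eta>/3"]) (use \<eta> tight_Xh in auto)
  obtain K' where K': "likely M (\<eta>/3) (\<lambda>n \<omega>. \<bar>sqrt (real n) * (\<theta>h n \<omega> - \<theta>\<^sub>0)\<bar> \<le> K')"
    using theta_hat \<eta> unfolding tight_def by (meson divide_pos_pos zero_less_numeral)
  define K2 where "K2 = max K K'"
  have sol: "likely M (\<eta>/3) (\<lambda>n \<omega>. solves_scale_equation x m n (eh n \<omega>) (\<theta>h n \<omega>))"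
    using asure_likely[OF solution, of "\<eta>/3"] \<eta> by (simp add: eh_def)
  obtain N0 where N0: "\<And>n c \<theta>. N0 \<le> n \<Longrightarrow> 0 < \<theta> \<Longrightarrow> (\<forall>j\<in>{1..m}. \<bar>c j - real n * pr j\<bar> \<le> K2 * sqrt n) \<Longrightarrow>
     \<bar>sqrt n * (\<theta> - \<theta>\<^sub>0)\<bar> \<le> K2 \<Longrightarrow> (\<Sum>j=1..m. c j / cell_prob x j \<theta> * cell_deriv j \<theta>) = 0 \<Longrightarrow>
     \<bar>(\<Sum>j=1..m. (c j - n * cell_prob x j \<theta>)\<^sup>2 / (n * cell_prob x j \<theta>)) -
       ((\<Sum>j=1..m. ((c j - n * pr j) / sqrt n)\<^sup>2 / pr j) -
        (\<Sum>j=1..m. (c j - n * pr j) / sqrt n * (cell_deriv j \<theta>\<^sub>0 / pr j))\<^sup>2 / (\<Sum>j=1..m. (cell_deriv j \<theta>\<^sub>0)\<^sup>2 / pr j))\<bar> < e"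
    using pearson_expansion[OF theta0 DERIV_cell_prob isCont_cell_deriv[OF theta0] cell_prob_pos sum_cell_deriv finite_atLeastAtMost fisher_pos[OF theta0] e, of K2]
    by blast
  show "likely M \<eta> (\<lambda>n \<omega>. \<bar>pearson_stat x m n (eh n \<omega>) (\<theta>h n \<omega>) -
     ((\<Sum>j=1..m. (Xh n j \<omega>)\<^sup>2 / pr j) - (\<Sum>j=1..m. Xh n j \<omega> * (cell_deriv j \<theta>\<^sub>0 / pr j))\<^sup>2 / (\<Sum>j=1..m. (cell_deriv j \<theta>\<^sub>0)\<^sup>2 / pr j))\<bar> \<le> e)"
  proof (rule likely_mono[OF likely_conj[OF likely_conj[OF K(2) K'] sol]])
    show "\<forall>\<^sub>F n in sequentially. \<forall>\<omega>\<in>space (M n). ((\<forall>j\<in>{1..m}. \<bar>Xh n j \<omega>\<bar> \<le> K) \<and> \<bar>sqrt (real n) * (\<theta>h n \<omega> - \<theta>\<^sub>0)\<bar> \<le> K') \<and>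
        solves_scale_equation x m n (eh n \<omega>) (\<theta>h n \<omega>) \<longrightarrow>
        \<bar>pearson_stat x m n (eh n \<omega>) (\<theta>h n \<omega>) -
     ((\<Sum>j=1..m. (Xh n j \<omega>)\<^sup>2 / pr j) - (\<Sum>j=1..m. Xh n j \<omega> * (cell_deriv j \<theta>\<^sub>0 / pr j))\<^sup>2 / (\<Sum>j=1..m. (cell_deriv j \<theta>\<^sub>0)\<^sup>2 / pr j))\<bar> \<le> e"
      using eventually_ge_at_top[of N0] eventually_ge_at_top[of 1]
    proof (eventually_elim, intro ballI impI, elim conjE)
      fix n \<omega> assume n: "N0 \<le> n" "1 \<le> n" and X: "\<forall>j\<in>{1..m}. \<bar>Xh n j \<omega>\<bar> \<le> K" and T: "\<bar>sqrt (real n) * (\<theta>h n \<omega> - \<theta>\<^sub>0)\<bar> \<le> K'"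
        and s: "solves_scale_equation x m n (eh n \<omega>) (\<theta>h n \<omega>)"
      let ?c = "\<lambda>j. real (cell_count x n (eh n \<omega>) j)"
      have \<theta>: "0 < \<theta>h n \<omega>" "(\<Sum>j=1..m. ?c j / cell_prob x j (\<theta>h n \<omega>) * cell_deriv j (\<theta>h n \<omega>)) = 0"
        using s deriv_cell_prob unfolding solves_scale_equation_def by auto
      have "\<forall>j\<in>{1..m}. \<bar>?c j - real n * pr j\<bar> \<le> K2 * sqrt n"
      proof
        fix j assume "j \<in> {1..m}"
        with X have "\<bar>(?c j - real n * pr j) / sqrt n\<bar> \<le> K2" unfolding Xh_def K2_def by fastforce
        then show "\<bar>?c j - real n * pr j\<bar> \<le> K2 * sqrt n" using n(2) by (simp add: abs_divide field_simps)
      qed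
      moreover have "\<bar>sqrt n * (\<theta>h n \<omega> - \<theta>\<^sub>0)\<bar> \<le> K2" using T by (simp add: K2_def)
      ultimately show "\<bar>pearson_stat x m n (eh n \<omega>) (\<theta>h n \<omega>) -
       ((\<Sum>j=1..m. (Xh n j \<omega>)\<^sup>2 / pr j) - (\<Sum>j=1..m. Xh n j \<omega> * (cell_deriv j \<theta>\<^sub>0 / pr j))\<^sup>2 / (\<Sum>j=1..m. (cell_deriv j \<theta>\<^sub>0)\<^sup>2 / pr j))\<bar> \<le> e"
        unfolding pearson_stat_def Xh_def using N0[OF n(1) \<theta>(1) _ _ \<theta>(2)] by (intro less_imp_le) blast
    qed
  qed (use \<eta> in simp)
qed

end

section \<open>The limit law\<close>

context cells begin

text \<open>In coordinates divided by the roots of the cell probabilities, a zero total removes the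
  component along these roots, and the subtracted square removes the one along
  \<open>alpha_vec\<close>. The first version serves the drift, the second the Pearson
  statistic.\<close>

lemma quadratic_form_basis:
  assumes \<theta>: "0 < \<theta>" and X: "(\<Sum>j=1..m. X j) = 0"
    and w: "\<And>y. (\<Sum>j=1..m. (y j)\<^sup>2) = (\<Sum>j=1..m. alpha_vec x m \<theta> j * y j)\<^sup>2 + (\<Sum>j=1..m. sqrt (cell_prob x j \<theta>) * y j)\<^sup>2
      + (\<Sum>i<m - 2. (\<Sum>j=1..m. w i j * y j)\<^sup>2)"
  shows "(\<Sum>j=1..m. (X j / sqrt (cell_prob x j \<theta>))\<^sup>2) - (\<Sum>j=1..m. alpha_vec x m \<theta> j * (X j / sqrt (cell_prob x j \<theta>)))\<^sup>2
      = (\<Sum>i<m - 2. (\<Sum>j=1..m. w i j / sqrt (cell_prob x j \<theta>) * X j)\<^sup>2)"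
    and "(\<Sum>j=1..m. (X j)\<^sup>2 / cell_prob x j \<theta>) -
        (\<Sum>j=1..m. X j * (cell_deriv j \<theta> / cell_prob x j \<theta>))\<^sup>2 / (\<Sum>j=1..m. (cell_deriv j \<theta>)\<^sup>2 / cell_prob x j \<theta>)
      = (\<Sum>i<m - 2. (\<Sum>j=1..m. w i j / sqrt (cell_prob x j \<theta>) * X j)\<^sup>2)"
proof -
  let ?y = "\<lambda>j. X j / sqrt (cell_prob x j \<theta>)"
  note pos = cell_prob_pos[OF _ \<theta>]
  have "(\<Sum>j=1..m. sqrt (cell_prob x j \<theta>) * ?y j) = (\<Sum>j=1..m. X j)"
  proof (intro sum.cong refl)
    fix j assume "j \<in> {1..m}"
    from pos[OF this] show "sqrt (cell_prob x j \<theta>) * ?y j = X j" by simp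
  qed
  then show 1: "(\<Sum>j=1..m. (?y j)\<^sup>2) - (\<Sum>j=1..m. alpha_vec x m \<theta> j * ?y j)\<^sup>2
      = (\<Sum>i<m - 2. (\<Sum>j=1..m. w i j / sqrt (cell_prob x j \<theta>) * X j)\<^sup>2)"
    using w[of ?y] X by simp
  have 2: "(\<Sum>j=1..m. (?y j)\<^sup>2) = (\<Sum>j=1..m. (X j)\<^sup>2 / cell_prob x j \<theta>)"
    using pos by (intro sum.cong) (auto simp: power_divide less_imp_le)
  have "(\<Sum>j=1..m. ?y j * (cell_deriv j \<theta> / sqrt (cell_prob x j \<theta>))) = (\<Sum>j=1..m. X j * (cell_deriv j \<theta> / cell_prob x j \<theta>))"
  proof (intro sum.cong refl)
    fix j assume "j \<in> {1..m}"
    then have "sqrt (cell_prob x j \<theta>) * sqrt (cell_prob x j \<theta>) = cell_prob x j \<theta>" using pos by (simp add: less_imp_le)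
    then show "?y j * (cell_deriv j \<theta> / sqrt (cell_prob x j \<theta>)) = X j * (cell_deriv j \<theta> / cell_prob x j \<theta>)"
      by (simp add: times_divide_times_eq)
  qed
  then show "(\<Sum>j=1..m. (X j)\<^sup>2 / cell_prob x j \<theta>) -
        (\<Sum>j=1..m. X j * (cell_deriv j \<theta> / cell_prob x j \<theta>))\<^sup>2 / (\<Sum>j=1..m. (cell_deriv j \<theta>)\<^sup>2 / cell_prob x j \<theta>)
      = (\<Sum>i<m - 2. (\<Sum>j=1..m. w i j / sqrt (cell_prob x j \<theta>) * X j)\<^sup>2)"
    using 1 unfolding 2 alpha_vec_sum[OF \<theta>] by simp
qed

text \<open>For a unit vector the matrix is an orthogonal projection, and Pythagoras gives the
  squared length of the projected vector.\<close>

lemma noncentrality_eq: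
  assumes unit: "(\<Sum>j=1..m. (alpha_vec x m \<theta> j)\<^sup>2) = 1"
    and d: "\<And>j. d j = \<rho> * (sym_increment x (cdf H) j - cell_prob x j \<theta>) + \<gamma> * delta x p \<beta> \<theta> Q j"
  shows "noncentrality x m p \<beta> \<theta> H Q \<rho> \<gamma> = (\<Sum>j=1..m. (d j / sqrt (cell_prob x j \<theta>))\<^sup>2)
     - (\<Sum>j=1..m. alpha_vec x m \<theta> j * (d j / sqrt (cell_prob x j \<theta>)))\<^sup>2"
proof -
  let ?a = "alpha_vec x m \<theta>" and ?y = "\<lambda>j. d j / sqrt (cell_prob x j \<theta>)"
  define s where "s = (\<Sum>j=1..m. ?a j * ?y j)"
  have id: "((if i = j then 1 else 0) - b * c) * y = (if i = j then y else 0) - b * (c * y)" for i j :: nat and b c y :: real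
    by (simp add: left_diff_distrib)
  have "(\<Sum>j=1..m. ((if i = j then 1 else 0) - ?a i * ?a j) * ?y j) = ?y i - ?a i * s" if "i \<in> {1..m}" for i
  proof -
    have "(\<Sum>j=1..m. ((if i = j then 1 else 0) - ?a i * ?a j) * ?y j) = (\<Sum>j=1..m. (if i = j then ?y j else 0) - ?a i * (?a j * ?y j))"
      using id by (intro sum.cong refl)
    also have "\<dots> = (\<Sum>j=1..m. if i = j then ?y j else 0) - ?a i * s" unfolding s_def sum_distrib_left by (rule sum_subtractf)
    also have "(\<Sum>j=1..m. if i = j then ?y j else 0) = ?y i" using that by simp
    finally show ?thesis .
  qed
  then have "noncentrality x m p \<beta> \<theta> H Q \<rho> \<gamma> = (L2_set (\<lambda>i. ?y i - ?a i * s) {1..m})\<^sup>2"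
    unfolding noncentrality_def d[symmetric] by (intro arg_cong[where f = "\<lambda>r. r\<^sup>2"] L2_set_cong) auto
  also have "\<dots> = (\<Sum>i=1..m. (?y i - ?a i * s)\<^sup>2)"
    unfolding L2_set_def by (intro real_sqrt_pow2 sum_nonneg) simp
  also have "\<dots> = (\<Sum>i=1..m. (?y i)\<^sup>2 - 2 * s * (?a i * ?y i) + s\<^sup>2 * (?a i)\<^sup>2)"
    by (intro sum.cong refl) (simp add: power2_eq_square algebra_simps)
  also have "\<dots> = (\<Sum>i=1..m. (?y i)\<^sup>2) - 2 * s * s + s\<^sup>2 * 1"
    unfolding sum.distrib sum_subtractf sum_distrib_left[symmetric] unit s_def ..
  finally show ?thesis unfolding s_def[symmetric] by (simp add: power2_eq_square)
qed

text \<open>For \<open>\<theta> \<le> 0\<close> the value at \<open>\<infinity>\<close> is still a limit, namely \<open>0\<close>, or \<open>1/2\<close> if \<open>\<theta> = 0\<close> since \<open>u / 0 = 0\<close>.\<close>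

lemma cell_prob_measurable: assumes j: "j \<in> {1..m}" shows "cell_prob x j \<in> borel_measurable borel"
proof -
  have phi: "std_normal_cdf \<in> borel_measurable borel"
    by (intro borel_measurable_continuous_onI continuous_at_imp_continuous_on ballI DERIV_isCont[OF DERIV_std_normal_cdf])
  have V: "(\<lambda>\<theta>. val_at (\<lambda>u. std_normal_cdf (u / \<theta>)) (x i)) \<in> borel_measurable borel" if i: "i \<le> m" for i
  proof (cases "i = m")
    case True
    have neg: "((\<lambda>u. std_normal_cdf (u / \<theta>)) \<longlongrightarrow> 0) at_top" if "\<theta> < 0" for \<theta>
    proof -
      have "((\<lambda>u. 1 - std_normal_cdf (u / (- \<theta>))) \<longlongrightarrow> 1 - 1) at_top"
        using that by (intro tendsto_intros scaled_cdf_at_top) simp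
      then show ?thesis by (simp add: std_normal_cdf_minus[symmetric])
    qed
    have "val_at (\<lambda>u. std_normal_cdf (u / \<theta>)) (x i) = (if 0 < \<theta> then 1 else if \<theta> = 0 then 1 / 2 else 0)" for \<theta>
      using True val_at_top[OF scaled_cdf_at_top[of \<theta>]] val_at_top[OF neg[of \<theta>]]
        val_at_top[of "\<lambda>u. std_normal_cdf (u / 0)" "1/2"] by (auto simp: std_normal_cdf_0)
    then show ?thesis by simp
  next
    case False
    then have "i < m" using i by simp
    then show ?thesis unfolding val_at_edge[OF \<open>i < m\<close>] using phi by measurable
  qed
  show ?thesis
    unfolding cell_prob_def[abs_def] sym_increment_def
    by (intro borel_measurable_times borel_measurable_diff borel_measurable_const V) (use j in auto)
qed

end

context ar_array begin

interpretation H: real_distribution H by (rule H)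

lemma sum_drift: "(\<Sum>j=1..m. drift j) = 0"
proof -
  have "cdf H 0 = 1 / 2" using H_symmetric[of 0] by simp
  then have 1: "(\<Sum>j=1..m. sym_increment x (cdf H) j) = 1"
    unfolding sum_increment val_at_top[OF H.cdf_lim_at_top_prob] by simp
  have 2: "(\<Sum>j=1..m. delta x p \<beta> \<theta>\<^sub>0 Q j) = 0"
    unfolding delta_def sum_increment val_at_top[OF DeltaS_at_top] by (simp add: DeltaS_def)
  show ?thesis
    unfolding drift_def sum.distrib sum_distrib_left[symmetric] sum_subtractf 1 2 sum_cell_prob[OF theta0] by simp
qed

lemma sum_Xh: "(\<Sum>j=1..m. Xh n j \<omega>) = 0"
  unfolding Xh_def sum_divide_distrib[symmetric] sum_subtractf sum_cell_count sum_distrib_left[symmetric] sum_cell_prob[OF theta0]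
  by simp

lemma eh_measurable: assumes n: "1 \<le> n" and t: "t \<in> {1..int n}" shows "(\<lambda>\<omega>. eh n \<omega> t) \<in> borel_measurable (M n)"
proof -
  interpret A: contaminated_ar "M n" p n \<beta> \<nu> "Gn n" "gm n" Q "\<epsilon> n" "v n" "z n" "\<xi> n" by (rule model[OF n])
  have obs: "(\<lambda>\<omega>. observation (v n) (z n) (\<xi> n) \<omega> s) \<in> borel_measurable (M n)" if "s \<in> {1 - int p..int n}" for s
    unfolding observation_def
    by (intro borel_measurable_add borel_measurable_times A.v_measurable A.z_measurable[OF that] A.xi_measurable[OF that])
  show ?thesis
    unfolding eh_def residual_def
    by (intro borel_measurable_diff borel_measurable_sum borel_measurable_times obs estimators_measurable[OF n])
      (use t in auto)
qed

lemma cell_count_measurable: assumes n: "1 \<le> n" and j: "j \<in> {1..m}"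
  shows "(\<lambda>\<omega>. real (cell_count x n (eh n \<omega>) j)) \<in> borel_measurable (M n)"
  unfolding cell_count_eq[OF j]
  by (intro borel_measurable_sum measurable_compose[OF eh_measurable[OF n] in_cell_measurable])

lemma pearson_measurable: assumes n: "1 \<le> n"
  shows "(\<lambda>\<omega>. pearson_stat x m n (eh n \<omega>) (\<theta>h n \<omega>)) \<in> borel_measurable (M n)"
  unfolding pearson_stat_def
  by (intro borel_measurable_sum borel_measurable_divide borel_measurable_power borel_measurable_diff borel_measurable_times
      cell_count_measurable[OF n] borel_measurable_const measurable_compose[OF estimators_measurable(3)[OF n] cell_prob_measurable])

lemma Sn_measurable: assumes n: "1 \<le> n" shows "Sn n j \<in> borel_measurable (M n)"
proof -
  interpret A: contaminated_ar "M n" p n \<beta> \<nu> "Gn n" "gm n" Q "\<epsilon> n" "v n" "z n" "\<xi> n" by (rule model[OF n])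
  show ?thesis unfolding Sn_def[abs_def] by measurable
qed

text \<open>In the basis \<open>w\<close> the statistic is, up to a negligible term, the squared
  length of \<open>m - 2\<close> asymptotically independent standard normal variables shifted by the
  \<open>a i\<close>, whose squares add up to the noncentrality.\<close>

theorem pearson_limit:
  "(\<lambda>n. measure (M n) {\<omega> \<in> space (M n). pearson_stat x m n (eh n \<omega>) (\<theta>h n \<omega>) \<le> u}) \<longlonglongrightarrow>
    cdf (noncentral_chi_square (m - 2) (noncentrality x m p \<beta> \<theta>\<^sub>0 H Q \<rho>' \<gamma>')) u"
proof -
  obtain w where w: "\<And>y. (\<Sum>j=1..m. (y j)\<^sup>2) = (\<Sum>j=1..m. alpha_vec x m \<theta>\<^sub>0 j * y j)\<^sup>2 + (\<Sum>j=1..m. sqrt (pr j) * y j)\<^sup>2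
      + (\<Sum>i<m - 2. (\<Sum>j=1..m. w i j * y j)\<^sup>2)"
    and ww: "\<And>i i'. i < m - 2 \<Longrightarrow> i' < m - 2 \<Longrightarrow> (\<Sum>j=1..m. w i j * w i' j) = (if i = i' then 1 else 0)"
    and wq: "\<And>i. i < m - 2 \<Longrightarrow> (\<Sum>j=1..m. w i j * sqrt (pr j)) = 0"
    and unit: "(\<Sum>j=1..m. (alpha_vec x m \<theta>\<^sub>0 j)\<^sup>2) = 1"
    by (rule complement_basis[OF theta0]) blast
  let ?l = "noncentrality x m p \<beta> \<theta>\<^sub>0 H Q \<rho>' \<gamma>'"
  \<comment> \<open>Division by the roots of the cell probabilities and passage to coordinates with
    respect to \<open>w\<close>, in one matrix.\<close>
  define c where "c i j = w i j / sqrt (pr j)" for i j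
  define S where "S n i \<omega> = (\<Sum>j=1..m. c i j * Sn n j \<omega>)" for n i \<omega>
  define a where "a i = (\<Sum>j=1..m. c i j * drift j)" for i
  define T where "T n \<omega> = (\<Sum>i<m - 2. (S n i \<omega> + a i)\<^sup>2)" for n \<omega>
  define T' where "T' n \<omega> = pearson_stat x m n (eh n \<omega>) (\<theta>h n \<omega>)" for n \<omega>
  have l: "(\<Sum>i<m - 2. (a i)\<^sup>2) = ?l"
    unfolding a_def c_def noncentrality_eq[OF unit drift_def] by (rule quadratic_form_basis(1)[OF theta0 sum_drift w, symmetric])
  have l0: "0 \<le> ?l" unfolding l[symmetric] by (intro sum_nonneg) simp
  have Sm: "S n i \<in> borel_measurable (M n)" if "1 \<le> n" for n i
    unfolding S_def[abs_def] using Sn_measurable[OF that] by measurable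
  have Tm: "T n \<in> borel_measurable (M n)" if "1 \<le> n" for n
    unfolding T_def[abs_def] using Sm[OF that] by measurable
  have T'm: "T' n \<in> borel_measurable (M n)" if "1 \<le> n" for n
    unfolding T'_def[abs_def] by (rule pearson_measurable[OF that])
  have cf: "(\<lambda>n. CLINT \<omega>|M n. iexp (\<Sum>i<m - 2. g i * S n i \<omega>)) \<longlonglongrightarrow> complex_of_real (exp (- (\<Sum>i<m - 2. (g i)\<^sup>2) / 2))" for g :: "nat \<Rightarrow> real"
  proof -
    define f where "f j = (\<Sum>i<m - 2. g i * c i j)" for j
    have eq: "(\<Sum>i<m - 2. g i * S n i \<omega>) = (\<Sum>j=1..m. f j * Sn n j \<omega>)" for n \<omega>
      unfolding S_def f_def sum_distrib_left sum_distrib_right by (subst sum.swap) (simp add: mult.assoc)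
    \<comment> \<open>With these weights the multinomial variance becomes the squared length of
      \<open>g\<close>: the \<open>w i\<close> are orthonormal, and their orthogonality to the roots
      of the cell probabilities removes the outer product.\<close>
    have fp: "f j * sqrt (pr j) = (\<Sum>i<m - 2. g i * w i j)" if "j \<in> {1..m}" for j
      unfolding f_def c_def sum_distrib_right using cell_prob_pos[OF that theta0] by (intro sum.cong) auto
    have id: "c * c * p = (c * r) * (c * r)" if "r * r = p" for c r p :: real using that by auto
    have sq: "sqrt (pr j) * sqrt (pr j) = pr j" if "j \<in> {1..m}" for j using cell_prob_pos[OF that theta0] by simp
    have "(\<Sum>j=1..m. (f j)\<^sup>2 * pr j) = (\<Sum>j=1..m. (\<Sum>i<m - 2. g i * w i j) * (\<Sum>i<m - 2. g i * w i j))"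
    proof (intro sum.cong refl)
      fix j assume j: "j \<in> {1..m}"
      have "(f j)\<^sup>2 * pr j = (f j * sqrt (pr j)) * (f j * sqrt (pr j))"
        using id[OF sq[OF j], of "f j"] by (simp add: power2_eq_square)
      then show "(f j)\<^sup>2 * pr j = (\<Sum>i<m - 2. g i * w i j) * (\<Sum>i<m - 2. g i * w i j)" unfolding fp[OF j] .
    qed
    also have "\<dots> = (\<Sum>j=1..m. \<Sum>i<m - 2. \<Sum>i'<m - 2. g i * g i' * (w i j * w i' j))"
      by (simp add: sum_product mult_ac)
    also have "\<dots> = (\<Sum>i<m - 2. \<Sum>i'<m - 2. g i * g i' * (\<Sum>j=1..m. w i j * w i' j))"
      by (subst sum.swap, rule sum.cong[OF refl], subst sum.swap) (simp add: sum_distrib_left)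
    also have "\<dots> = (\<Sum>i<m - 2. \<Sum>i'<m - 2. if i = i' then (g i)\<^sup>2 else 0)"
      using ww by (intro sum.cong refl) (auto simp: power2_eq_square)
    also have "\<dots> = (\<Sum>i<m - 2. (g i)\<^sup>2)" by simp
    finally have 1: "(\<Sum>j=1..m. (f j)\<^sup>2 * pr j) = (\<Sum>i<m - 2. (g i)\<^sup>2)" .
    have "(\<Sum>j=1..m. f j * pr j) = (\<Sum>j=1..m. \<Sum>i<m - 2. g i * (w i j * sqrt (pr j)))"
    proof (intro sum.cong refl)
      fix j assume j: "j \<in> {1..m}"
      have "f j * pr j = (f j * sqrt (pr j)) * sqrt (pr j)" using sq[OF j] by simp
      then show "f j * pr j = (\<Sum>i<m - 2. g i * (w i j * sqrt (pr j)))"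
        unfolding fp[OF j] by (simp add: sum_distrib_right mult.assoc)
    qed
    also have "\<dots> = (\<Sum>i<m - 2. g i * (\<Sum>j=1..m. w i j * sqrt (pr j)))" by (subst sum.swap) (simp add: sum_distrib_left)
    also have "\<dots> = 0" using wq by (intro sum.neutral) auto
    finally have 2: "(\<Sum>j=1..m. f j * pr j) = 0" .
    show ?thesis using clt_cells[of f] unfolding eq 1 2 by simp
  qed
  have diff: "negl (\<lambda>n \<omega>. T' n \<omega> - T n \<omega>)"
  proof -
    define U where "U n i \<omega> = (\<Sum>j=1..m. c i j * Xh n j \<omega>)" for n i \<omega>
    have 1: "negl (\<lambda>n \<omega>. T' n \<omega> - (\<Sum>i<m - 2. (U n i \<omega>)\<^sup>2))"
      using pearson_quadratic unfolding quadratic_form_basis(2)[OF theta0 sum_Xh w] T'_def U_def c_def .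
    have "negl (\<lambda>n \<omega>. U n i \<omega> - (S n i \<omega> + a i))" for i
    proof -
      have "negl (\<lambda>n \<omega>. \<Sum>j=1..m. c i j * (Xh n j \<omega> - (Sn n j \<omega> + drift j)))"
        by (intro negl_sum negl_cmult Xh_approx) auto
      moreover have "(\<Sum>j=1..m. c i j * (Xh n j \<omega> - (Sn n j \<omega> + drift j))) = U n i \<omega> - (S n i \<omega> + a i)" for n \<omega>
        unfolding U_def S_def a_def by (simp add: right_diff_distrib distrib_left sum_subtractf sum.distrib)
      ultimately show ?thesis by simp
    qed
    moreover have "tight M (\<lambda>n \<omega>. S n i \<omega> + a i)" for i
      unfolding S_def by (intro tight_add tight_const tight_sum tight_mult tight_Sn) auto
    ultimately have "negl (\<lambda>n \<omega>. \<Sum>i<m - 2. (U n i \<omega>)\<^sup>2 - (S n i \<omega> + a i)\<^sup>2)"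
      by (intro negl_sum negl_square_diff) auto
    from negl_add[OF 1 this] show ?thesis by (simp add: T_def sum_subtractf)
  qed
  have k: "1 \<le> m - 2" using m by simp
  \<comment> \<open>The general limit lemmas take a probability space for every index, whereas the
    model starts at \<open>n = 1\<close>; hence the shift to \<open>Suc n\<close>.\<close>
  have T0: "AE \<omega> in M (Suc n). 0 \<le> T (Suc n) \<omega>" for n by (simp add: T_def sum_nonneg)
  have lap: "(\<lambda>n. \<integral>\<omega>. exp (- real s * T (Suc n) \<omega>) \<partial>M (Suc n)) \<longlonglongrightarrow> (\<integral>t. exp (- real s * t) \<partial>noncentral_chi_square (m - 2) ?l)" for s :: nat
    unfolding noncentral_chi_square_laplace[OF of_nat_0_le_iff l0 k] T_def
    unfolding l[symmetric]
    by (rule gaussian_limit_laplace[OF M_prob Sm LIMSEQ_Suc[OF cf] tendsto_const of_nat_0_le_iff]) simp_all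
  have d: "(\<lambda>n. measure (M (Suc n)) {\<omega> \<in> space (M (Suc n)). e < \<bar>T' (Suc n) \<omega> - T (Suc n) \<omega>\<bar>}) \<longlonglongrightarrow> 0" if e: "0 < e" for e
  proof (rule LIMSEQ_Suc, rule LIMSEQ_I)
    fix \<eta> :: real assume \<eta>: "0 < \<eta>"
    have "\<forall>\<^sub>F n in sequentially. measure (M n) {\<omega> \<in> space (M n). \<not> \<bar>T' n \<omega> - T n \<omega>\<bar> \<le> e} < \<eta>"
    proof (rule asure_measure_compl[OF diff[unfolded negl_def, rule_format, OF e] _ \<eta>])
      fix n :: nat assume "1 \<le> n"
      note Tm[OF this, measurable] T'm[OF this, measurable]
      show "{\<omega> \<in> space (M n). \<not> \<bar>T' n \<omega> - T n \<omega>\<bar> \<le> e} \<in> sets (M n)" by measurable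
    qed
    then show "\<exists>no. \<forall>n\<ge>no. norm (measure (M n) {\<omega> \<in> space (M n). e < \<bar>T' n \<omega> - T n \<omega>\<bar>} - 0) < \<eta>"
      by (simp add: eventually_sequentially not_le)
  qed
  have "(\<lambda>n. measure (M (Suc n)) {\<omega> \<in> space (M (Suc n)). T' (Suc n) \<omega> \<le> u}) \<longlonglongrightarrow> cdf (noncentral_chi_square (m - 2) ?l) u"
    by (rule laplace_conv_imp_cdf_conv[OF M_prob Tm T0 real_distribution_noncentral_chi_square noncentral_chi_square_nonneg lap T'm d
          isCont_cdf_noncentral_chi_square[OF k]]) simp_all
  then show ?thesis unfolding T'_def by (rule LIMSEQ_imp_Suc)
qed

end

section \<open>Uniformity in the parameters\<close>

text \<open>A failure yields bad parameters along some sequence of indices, and by compactness a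
  subsequence of them converges. As the hypothesis speaks of full sequences, the remaining indices
  are filled with the limit.\<close>

lemma eventually_uniform_on_compact:
  fixes P :: "nat \<Rightarrow> 'a::metric_space \<Rightarrow> bool"
  assumes K: "compact K"
    and seq: "\<And>s l. (\<And>n. s n \<in> K) \<Longrightarrow> l \<in> K \<Longrightarrow> s \<longlonglongrightarrow> l \<Longrightarrow> \<forall>\<^sub>F n in sequentially. P n (s n)"
  shows "\<forall>\<^sub>F n in sequentially. \<forall>a\<in>K. P n a"
proof (rule ccontr)
  assume "\<not> ?thesis"
  from not_eventually_sequentiallyD[OF this] obtain r :: "nat \<Rightarrow> nat"
    where r: "strict_mono r" "\<And>k. \<exists>a\<in>K. \<not> P (r k) a" by blast
  then obtain a where a: "\<And>k. a k \<in> K" "\<And>k. \<not> P (r k) (a k)" by metis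
  obtain l q where l: "l \<in> K" and q: "strict_mono (q :: nat \<Rightarrow> nat)" and lim: "(a \<circ> q) \<longlonglongrightarrow> l"
    using K a(1) unfolding compact_eq_seq_compact_metric by (metis seq_compactE)
  define s where "s n = (if n \<in> range (r \<circ> q) then a (q (inv (r \<circ> q) n)) else l)" for n
  have rq: "strict_mono (r \<circ> q)" using r(1) q by (rule strict_mono_o)
  have s_rq: "s (r (q k)) = a (q k)" for k
    using inv_f_f[OF strict_mono_imp_inj_on[OF rq], of k] by (simp add: s_def image_iff) blast
  have "s \<longlonglongrightarrow> l"
  proof (rule metric_LIMSEQ_I)
    fix e :: real assume e: "0 < e"
    obtain N where N: "\<And>k. N \<le> k \<Longrightarrow> dist (a (q k)) l < e"
      using metric_LIMSEQ_D[OF lim e] by auto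
    have "dist (s n) l < e" if "r (q N) \<le> n" for n
    proof (cases "n \<in> range (r \<circ> q)")
      case True
      then obtain k where k: "n = r (q k)" by auto
      then have "N \<le> k" using that strict_mono_less_eq[OF rq, of N k] by simp
      then show ?thesis using N s_rq k by simp
    next
      case False
      then show ?thesis using e by (simp add: s_def)
    qed
    then show "\<exists>no. \<forall>n\<ge>no. dist (s n) l < e" by blast
  qed
  moreover have "s n \<in> K" for n using a(1) l by (simp add: s_def)
  ultimately have "\<forall>\<^sub>F n in sequentially. P n (s n)" using l seq by blast
  then obtain N where N: "\<And>n. N \<le> n \<Longrightarrow> P n (s n)" by (auto simp: eventually_sequentially)
  have "P (r (q N)) (s (r (q N)))" using seq_suble[OF rq, of N] by (intro N) simp
  then show False using a(2)[of "q N"] by (simp add: s_rq)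
qed

context prob_seq begin

lemma tight_measure:
  assumes X: "\<And>n. 1 \<le> n \<Longrightarrow> X n \<in> borel_measurable (M n)"
    and C: "\<And>\<eta>. 0 < \<eta> \<Longrightarrow> \<exists>C. \<forall>\<^sub>F n in sequentially. measure (M n) {\<omega> \<in> space (M n). C < \<bar>X n \<omega>\<bar>} < \<eta>"
  shows "tight M X"
  unfolding tight_def
proof (intro allI impI)
  fix \<eta> :: real assume "0 < \<eta>"
  from C[OF this] obtain C where C: "\<forall>\<^sub>F n in sequentially. measure (M n) {\<omega> \<in> space (M n). C < \<bar>X n \<omega>\<bar>} < \<eta>" by blast
  have "likely M \<eta> (\<lambda>n \<omega>. \<bar>X n \<omega>\<bar> \<le> C)"
  proof (rule likely_compl, use C eventually_ge_at_top[of 1] in eventually_elim)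
    fix n :: nat assume n: "1 \<le> n" and c: "measure (M n) {\<omega> \<in> space (M n). C < \<bar>X n \<omega>\<bar>} < \<eta>"
    note X[OF n, measurable]
    show "{\<omega> \<in> space (M n). \<not> \<bar>X n \<omega>\<bar> \<le> C} \<in> sets (M n) \<and> measure (M n) {\<omega> \<in> space (M n). \<not> \<bar>X n \<omega>\<bar> \<le> C} < \<eta>"
      using c by (simp add: not_le)
  qed
  then show "\<exists>K. likely M \<eta> (\<lambda>n \<omega>. \<bar>X n \<omega>\<bar> \<le> K)" by blast
qed

text \<open>The sets need not be assumed measurable: a set of nonzero \<open>measure\<close> is.\<close>

lemma asure_measure:
  assumes "\<And>\<eta>. 0 < \<eta> \<Longrightarrow> \<forall>\<^sub>F n in sequentially. 1 - \<eta> < measure (M n) {\<omega> \<in> space (M n). P n \<omega>}"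
  shows "asure M P"
  unfolding asure_def likely_def
proof (intro allI impI)
  fix \<eta> :: real assume "0 < \<eta>"
  then have "\<forall>\<^sub>F n in sequentially. 1 - min \<eta> 1 < measure (M n) {\<omega> \<in> space (M n). P n \<omega>}" by (intro assms) simp
  then show "\<forall>\<^sub>F n in sequentially. \<exists>B\<in>sets (M n). (\<forall>\<omega>\<in>B. P n \<omega>) \<and> 1 - \<eta> < measure (M n) B"
  proof eventually_elim
    case (elim n)
    then have "measure (M n) {\<omega> \<in> space (M n). P n \<omega>} \<noteq> 0" by auto
    then have "{\<omega> \<in> space (M n). P n \<omega>} \<in> sets (M n)" using measure_notin_sets by blast
    then show ?case using elim by (intro bexI[of _ "{\<omega> \<in> space (M n). P n \<omega>}"]) auto
  qed
qed

end

text \<open>The Laplace transforms are continuous in the noncentrality, so the distribution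
  functions converge at every point; continuity of the limit makes this uniform.\<close>

lemma cdf_noncentral_chi_square_uniform:
  assumes k: "1 \<le> k" and l: "l \<longlonglongrightarrow> l'" "\<And>n. 0 \<le> l n" and e: "0 < e"
  shows "\<forall>\<^sub>F n in sequentially. \<forall>u. \<bar>cdf (noncentral_chi_square k (l n)) u - cdf (noncentral_chi_square k l') u\<bar> < e"
proof -
  interpret N: real_distribution "noncentral_chi_square k a" for a by (rule real_distribution_noncentral_chi_square)
  have l'0: "0 \<le> l'" using l by (intro LIMSEQ_le_const[OF l(1)]) auto
  have lap: "(\<lambda>n. \<integral>t. exp (- real s * t) \<partial>noncentral_chi_square k (l n)) \<longlonglongrightarrow> (\<integral>t. exp (- real s * t) \<partial>noncentral_chi_square k l')" for s :: nat
    unfolding noncentral_chi_square_laplace[OF of_nat_0_le_iff l(2) k] noncentral_chi_square_laplace[OF of_nat_0_le_iff l'0 k]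
    by (intro tendsto_intros l(1)) simp
  have "(\<lambda>n. measure (noncentral_chi_square k (l n)) {t \<in> space (noncentral_chi_square k (l n)). t \<le> u}) \<longlonglongrightarrow> cdf (noncentral_chi_square k l') u" for u
    by (rule laplace_conv_imp_cdf_conv[OF N.prob_space_axioms _ noncentral_chi_square_nonneg real_distribution_noncentral_chi_square
          noncentral_chi_square_nonneg lap _ _ isCont_cdf_noncentral_chi_square[OF k]]) simp_all
  then have "(\<lambda>n. cdf (noncentral_chi_square k (l n)) u) \<longlonglongrightarrow> cdf (noncentral_chi_square k l') u" for u
    by (simp add: cdf_def atMost_def)
  then show ?thesis
    by (intro monotone_conv_imp_uniform_conv N.cdf_nonneg N.cdf_bounded_prob N.cdf_lim_at_bot N.cdf_lim_at_top_prob e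
        monoI N.cdf_nondecreasing continuous_at_imp_continuous_on ballI isCont_cdf_noncentral_chi_square[OF k])
qed

lemma noncentrality_nonneg: "0 \<le> noncentrality x m p \<beta> \<theta>\<^sub>0 H Q \<rho> \<gamma>"
  by (simp add: noncentrality_def)

lemma noncentrality_tendsto:
  "a \<longlonglongrightarrow> \<rho> \<Longrightarrow> b \<longlonglongrightarrow> \<gamma> \<Longrightarrow>
    (\<lambda>n. noncentrality x m p \<beta> \<theta>\<^sub>0 H Q (a n) (b n)) \<longlonglongrightarrow> noncentrality x m p \<beta> \<theta>\<^sub>0 H Q \<rho> \<gamma>"
  unfolding noncentrality_def L2_set_def divide_inverse by (intro tendsto_intros)

context ar_array begin

text \<open>Both distribution functions are compared with the one at the limit parameters, at a cost
  of \<open>e / 2\<close> each.\<close>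

theorem pearson_uniform_limit:
  assumes e: "0 < e"
  shows "\<forall>\<^sub>F n in sequentially. \<forall>u. \<bar>measure (M n) {\<omega> \<in> space (M n). pearson_stat x m n (eh n \<omega>) (\<theta>h n \<omega>) \<le> u}
    - cdf (noncentral_chi_square (m - 2) (noncentrality x m p \<beta> \<theta>\<^sub>0 H Q (\<rho> n) (\<gamma> n))) u\<bar> < e"
proof -
  let ?l = "noncentrality x m p \<beta> \<theta>\<^sub>0 H Q"
  interpret N: real_distribution "noncentral_chi_square (m - 2) a" for a by (rule real_distribution_noncentral_chi_square)
  define F where "F n u = measure (M n) {\<omega> \<in> space (M n). pearson_stat x m n (eh n \<omega>) (\<theta>h n \<omega>) \<le> u}" for n u
  define G where "G = cdf (noncentral_chi_square (m - 2) (?l \<rho>' \<gamma>'))"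
  have k: "1 \<le> m - 2" using m by simp
  have "\<forall>\<^sub>F n in sequentially. \<forall>u. \<bar>F (Suc n) u - G u\<bar> < e / 2"
    unfolding G_def
  proof (rule monotone_conv_imp_uniform_conv)
    fix n
    interpret A: prob_space "M (Suc n)" by (rule M_prob) simp
    have [measurable]: "(\<lambda>\<omega>. pearson_stat x m (Suc n) (eh (Suc n) \<omega>) (\<theta>h (Suc n) \<omega>)) \<in> borel_measurable (M (Suc n))"
      by (rule pearson_measurable) simp
    show "mono (F (Suc n))" unfolding F_def by (intro monoI A.finite_measure_mono) auto
    show "0 \<le> F (Suc n) u" "F (Suc n) u \<le> 1" for u by (simp_all add: F_def)
  next
    fix u show "(\<lambda>n. F (Suc n) u) \<longlonglongrightarrow> cdf (noncentral_chi_square (m - 2) (?l \<rho>' \<gamma>')) u"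
      unfolding F_def by (rule LIMSEQ_Suc[OF pearson_limit])
  qed (use e in \<open>auto intro!: N.cdf_lim_at_bot N.cdf_lim_at_top_prob continuous_at_imp_continuous_on isCont_cdf_noncentral_chi_square[OF k]\<close>)
  then have "\<forall>\<^sub>F n in sequentially. \<forall>u. \<bar>F n u - G u\<bar> < e / 2"
    by (rule eventually_sequentially_Suc[THEN iffD1])
  moreover have "\<forall>\<^sub>F n in sequentially. \<forall>u. \<bar>cdf (noncentral_chi_square (m - 2) (?l (\<rho> n) (\<gamma> n))) u - G u\<bar> < e / 2"
    unfolding G_def using e
    by (intro cdf_noncentral_chi_square_uniform[OF k noncentrality_tendsto[OF rho(2) gamma(2)] noncentrality_nonneg]) simp
  ultimately show ?thesis
  proof eventually_elim
    case (elim n)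
    show ?case
    proof
      fix u
      have "\<bar>F n u - G u\<bar> < e / 2" "\<bar>cdf (noncentral_chi_square (m - 2) (?l (\<rho> n) (\<gamma> n))) u - G u\<bar> < e / 2" using elim by blast+
      then show "\<bar>measure (M n) {\<omega> \<in> space (M n). pearson_stat x m n (eh n \<omega>) (\<theta>h n \<omega>) \<le> u}
        - cdf (noncentral_chi_square (m - 2) (?l (\<rho> n) (\<gamma> n))) u\<bar> < e" unfolding F_def[symmetric] by linarith
    qed
  qed
qed

end

theorem theorem2p2:
  fixes p m :: nat and \<beta> :: "nat \<Rightarrow> real" and \<nu> \<mu> \<theta>\<^sub>0 R \<Gamma> :: real
    and x :: "nat \<Rightarrow> ereal" and H Q :: "real measure"
    and M :: "nat \<Rightarrow> real \<Rightarrow> real \<Rightarrow> 'w measure"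
    and \<epsilon> v z \<xi> :: "nat \<Rightarrow> real \<Rightarrow> real \<Rightarrow> int \<Rightarrow> 'w \<Rightarrow> real"
    and \<mu>_hat \<theta>_hat :: "nat \<Rightarrow> real \<Rightarrow> real \<Rightarrow> 'w \<Rightarrow> real"
    and \<beta>_hat :: "nat \<Rightarrow> real \<Rightarrow> real \<Rightarrow> 'w \<Rightarrow> nat \<Rightarrow> real"
    and \<epsilon>_hat :: "nat \<Rightarrow> real \<Rightarrow> real \<Rightarrow> 'w \<Rightarrow> int \<Rightarrow> real"
  assumes p: "1 \<le> p" and roots: "char_roots_inside p \<beta>"
    and mu: "\<nu> = (1 - (\<Sum>j=1..p. \<beta> j)) * \<mu>"
    and theta0: "0 < \<theta>\<^sub>0"
    and Q: "real_distribution Q"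
    and H: "real_distribution H"
    and H_mean: "integrable H (\<lambda>u. u)" "(\<integral>u. u \<partial>H) = 0"
    and H_variance: "integrable H (\<lambda>u. u\<^sup>2)"
    and H_twice_differentiable: "\<And>u. cdf H differentiable (at u)"
      "\<And>u. deriv (cdf H) differentiable (at u)"
    and H_second_derivative: "bounded (range (deriv (deriv (cdf H))))"
    and H_symmetric: "\<And>u. cdf H (- u) = 1 - cdf H u"
    and m: "2 < m"
    and edges: "x 0 = 0" "\<And>j. j < m \<Longrightarrow> x j < x (Suc j)" "x m = \<infinity>"
    and model: "\<And>n \<rho> \<gamma>. 1 \<le> n \<Longrightarrow> 0 \<le> \<rho> \<Longrightarrow> 0 \<le> \<gamma> \<Longrightarrow>
      contaminated_ar (M n \<rho> \<gamma>) p n \<beta> \<nu> (local_alt \<theta>\<^sub>0 H \<rho> n) (local_rate \<gamma> n) Q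
        (\<epsilon> n \<rho> \<gamma>) (v n \<rho> \<gamma>) (z n \<rho> \<gamma>) (\<xi> n \<rho> \<gamma>)"
    and estimators_measurable: "\<And>n \<rho> \<gamma>. 1 \<le> n \<Longrightarrow> 0 \<le> \<rho> \<Longrightarrow> 0 \<le> \<gamma> \<Longrightarrow>
      \<mu>_hat n \<rho> \<gamma> \<in> borel_measurable (M n \<rho> \<gamma>) \<and>
      (\<forall>j\<in>{1..p}. (\<lambda>\<omega>. \<beta>_hat n \<rho> \<gamma> \<omega> j) \<in> borel_measurable (M n \<rho> \<gamma>)) \<and>
      \<theta>_hat n \<rho> \<gamma> \<in> borel_measurable (M n \<rho> \<gamma>)"
    and mu_hat: "unif_bounded_in_prob M (\<lambda>n \<rho> \<gamma> \<omega>. sqrt (real n) * (\<mu>_hat n \<rho> \<gamma> \<omega> - \<mu>))"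
    and beta_hat: "unif_bounded_in_prob M
      (\<lambda>n \<rho> \<gamma> \<omega>. sqrt (real n) * L2_set (\<lambda>j. \<beta>_hat n \<rho> \<gamma> \<omega> j - \<beta> j) {1..p})"
    and residuals: "\<And>n \<rho> \<gamma> \<omega>. \<epsilon>_hat n \<rho> \<gamma> \<omega> =
      residual p (observation (v n \<rho> \<gamma>) (z n \<rho> \<gamma>) (\<xi> n \<rho> \<gamma>) \<omega>)
        (\<mu>_hat n \<rho> \<gamma> \<omega>) (\<beta>_hat n \<rho> \<gamma> \<omega>)"
    and theta_hat_consistent:
      "unif_bounded_in_prob M (\<lambda>n \<rho> \<gamma> \<omega>. sqrt (real n) * (\<theta>_hat n \<rho> \<gamma> \<omega> - \<theta>\<^sub>0))"
    and theta_hat_solution: "unif_asymp_sure M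
      (\<lambda>n \<rho> \<gamma> \<omega>. solves_scale_equation x m n (\<epsilon>_hat n \<rho> \<gamma> \<omega>) (\<theta>_hat n \<rho> \<gamma> \<omega>))"
    and R: "0 \<le> R" and Gamma: "0 \<le> \<Gamma>"
  shows "(\<lambda>n. SUP (u, \<rho>, \<gamma>) \<in> UNIV \<times> {0..R} \<times> {0..\<Gamma>}.
      \<bar>measure (M n \<rho> \<gamma>)
          {\<omega> \<in> space (M n \<rho> \<gamma>).
             pearson_stat x m n (\<epsilon>_hat n \<rho> \<gamma> \<omega>) (\<theta>_hat n \<rho> \<gamma> \<omega>) \<le> u}
        - cdf (noncentral_chi_square (m - 2) (noncentrality x m p \<beta> \<theta>\<^sub>0 H Q \<rho> \<gamma>)) u\<bar>)
    \<longlonglongrightarrow> 0"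
proof -
  let ?D = "\<lambda>n u \<rho> \<gamma>. \<bar>measure (M n \<rho> \<gamma>)
          {\<omega> \<in> space (M n \<rho> \<gamma>). pearson_stat x m n (\<epsilon>_hat n \<rho> \<gamma> \<omega>) (\<theta>_hat n \<rho> \<gamma> \<omega>) \<le> u}
        - cdf (noncentral_chi_square (m - 2) (noncentrality x m p \<beta> \<theta>\<^sub>0 H Q \<rho> \<gamma>)) u\<bar>"
  have unif: "\<forall>\<^sub>F n in sequentially. \<forall>a\<in>{0..R} \<times> {0..\<Gamma>}. \<forall>u. ?D n u (fst a) (snd a) < e" if e: "0 < e" for e
  \<comment> \<open>The predicate already quantifies over \<open>u\<close>, so compactness is needed
    in the two parameters only.\<close>
  proof (rule eventually_uniform_on_compact)
    show "compact ({0..R} \<times> {0..\<Gamma>})" by (intro compact_Times compact_Icc)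
    fix s l assume s: "\<And>n. s n \<in> {0..R} \<times> {0..\<Gamma>}" and lim: "s \<longlonglongrightarrow> l"
    define \<rho> where "\<rho> n = fst (s n)" for n
    define \<gamma> where "\<gamma> n = snd (s n)" for n :: nat
    have in_range: "\<rho> n \<in> {0..R}" "\<gamma> n \<in> {0..\<Gamma>}" for n using s[of n] by (auto simp: \<rho>_def \<gamma>_def mem_Times_iff)
    then have nonneg: "0 \<le> \<rho> n" "0 \<le> \<gamma> n" for n by auto
    interpret S: prob_seq "\<lambda>n. M n (\<rho> n) (\<gamma> n)"
      by (intro prob_seq.intro contaminated_ar.axioms(1)[OF model[OF _ nonneg]])
    have meas: "\<mu>_hat n (\<rho> n) (\<gamma> n) \<in> borel_measurable (M n (\<rho> n) (\<gamma> n))"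
      "j \<in> {1..p} \<Longrightarrow> (\<lambda>\<omega>. \<beta>_hat n (\<rho> n) (\<gamma> n) \<omega> j) \<in> borel_measurable (M n (\<rho> n) (\<gamma> n))"
      "\<theta>_hat n (\<rho> n) (\<gamma> n) \<in> borel_measurable (M n (\<rho> n) (\<gamma> n))" if "1 \<le> n" for n j
      using estimators_measurable[OF that nonneg] by auto
    \<comment> \<open>The constant that bounds the whole parameter range also serves along the
      particular sequence.\<close>
    have tight: "tight (\<lambda>n. M n (\<rho> n) (\<gamma> n)) (\<lambda>n. X n (\<rho> n) (\<gamma> n))"
      if X: "unif_bounded_in_prob M X" and m: "\<And>n. 1 \<le> n \<Longrightarrow> X n (\<rho> n) (\<gamma> n) \<in> borel_measurable (M n (\<rho> n) (\<gamma> n))" for X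
    proof (rule S.tight_measure[OF m])
      fix \<eta> :: real assume "0 < \<eta>"
      then obtain C where "\<forall>\<^sub>F n in sequentially. \<forall>\<rho>\<in>{0..R}. \<forall>\<gamma>\<in>{0..\<Gamma>}. measure (M n \<rho> \<gamma>) {\<omega> \<in> space (M n \<rho> \<gamma>). C < \<bar>X n \<rho> \<gamma> \<omega>\<bar>} < \<eta>"
        using X R Gamma unfolding unif_bounded_in_prob_def by blast
      then show "\<exists>C. \<forall>\<^sub>F n in sequentially. measure (M n (\<rho> n) (\<gamma> n)) {\<omega> \<in> space (M n (\<rho> n) (\<gamma> n)). C < \<bar>X n (\<rho> n) (\<gamma> n) \<omega>\<bar>} < \<eta>"
        using in_range by (intro exI[of _ C]) (auto elim!: eventually_mono)
    qed
    interpret ar_array x m "\<lambda>n. M n (\<rho> n) (\<gamma> n)" p \<beta> \<nu> \<mu> \<theta>\<^sub>0 Q H \<rho> \<gamma> "fst l" "snd l" "\<lambda>n. \<epsilon> n (\<rho> n) (\<gamma> n)" "\<lambda>n. v n (\<rho> n) (\<gamma> n)"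
      "\<lambda>n. z n (\<rho> n) (\<gamma> n)" "\<lambda>n. \<xi> n (\<rho> n) (\<gamma> n)" "\<lambda>n. \<mu>_hat n (\<rho> n) (\<gamma> n)" "\<lambda>n. \<theta>_hat n (\<rho> n) (\<gamma> n)" "\<lambda>n. \<beta>_hat n (\<rho> n) (\<gamma> n)"
    proof (intro ar_array.intro cells.intro ar_array_axioms.intro S.prob_seq_axioms, fold residuals)
      show "\<rho> \<longlonglongrightarrow> fst l" "\<gamma> \<longlonglongrightarrow> snd l"
        unfolding \<rho>_def[abs_def] \<gamma>_def[abs_def] using lim by (auto intro: tendsto_fst tendsto_snd)
      show "asure (\<lambda>n. M n (\<rho> n) (\<gamma> n)) (\<lambda>n \<omega>. solves_scale_equation x m n (\<epsilon>_hat n (\<rho> n) (\<gamma> n) \<omega>) (\<theta>_hat n (\<rho> n) (\<gamma> n) \<omega>))"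
      proof (rule S.asure_measure)
        fix \<eta> :: real assume "0 < \<eta>"
        then have "\<forall>\<^sub>F n in sequentially. \<forall>\<rho>\<in>{0..R}. \<forall>\<gamma>\<in>{0..\<Gamma>}. 1 - \<eta> < measure (M n \<rho> \<gamma>) {\<omega> \<in> space (M n \<rho> \<gamma>). solves_scale_equation x m n (\<epsilon>_hat n \<rho> \<gamma> \<omega>) (\<theta>_hat n \<rho> \<gamma> \<omega>)}"
          using theta_hat_solution R Gamma unfolding unif_asymp_sure_def by blast
        then show "\<forall>\<^sub>F n in sequentially. 1 - \<eta> < measure (M n (\<rho> n) (\<gamma> n)) {\<omega> \<in> space (M n (\<rho> n) (\<gamma> n)). solves_scale_equation x m n (\<epsilon>_hat n (\<rho> n) (\<gamma> n) \<omega>) (\<theta>_hat n (\<rho> n) (\<gamma> n) \<omega>)}"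
          using in_range by (auto elim!: eventually_mono)
      qed
      have "(\<lambda>\<omega>. L2_set (\<lambda>j. \<beta>_hat n (\<rho> n) (\<gamma> n) \<omega> j - \<beta> j) {1..p}) \<in> borel_measurable (M n (\<rho> n) (\<gamma> n))" if "1 \<le> n" for n
        unfolding L2_set_def using meas(2)[OF that] by (intro measurable_compose[OF _ borel_measurable_sqrt] borel_measurable_sum borel_measurable_power borel_measurable_diff) auto
      then show "tight (\<lambda>n. M n (\<rho> n) (\<gamma> n)) (\<lambda>n \<omega>. sqrt (real n) * L2_set (\<lambda>j. \<beta>_hat n (\<rho> n) (\<gamma> n) \<omega> j - \<beta> j) {1..p})"
        by (intro tight[OF beta_hat]) auto
      show "tight (\<lambda>n. M n (\<rho> n) (\<gamma> n)) (\<lambda>n \<omega>. sqrt (real n) * (\<mu>_hat n (\<rho> n) (\<gamma> n) \<omega> - \<mu>))"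
        using meas by (intro tight[OF mu_hat]) auto
      show "tight (\<lambda>n. M n (\<rho> n) (\<gamma> n)) (\<lambda>n \<omega>. sqrt (real n) * (\<theta>_hat n (\<rho> n) (\<gamma> n) \<omega> - \<theta>\<^sub>0))"
        using meas by (intro tight[OF theta_hat_consistent]) auto
    qed (rule p roots mu theta0 Q H H_variance H_twice_differentiable H_second_derivative H_symmetric m edges nonneg
        model[OF _ nonneg] meas | assumption)+
    show "\<forall>\<^sub>F n in sequentially. \<forall>u. ?D n u (fst (s n)) (snd (s n)) < e"
      using pearson_uniform_limit[OF e] unfolding eh_def residuals[symmetric] unfolding \<rho>_def \<gamma>_def .
  qed
  show ?thesis
  proof (rule LIMSEQ_I)
    fix e :: real assume "0 < e"
    \<comment> \<open>Half of \<open>e\<close>, because a supremum of values below a bound may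
      attain that bound.\<close>
    then have e2: "0 < e / 2" by simp
    from unif[OF e2] have "\<forall>\<^sub>F n in sequentially. norm ((SUP (u, \<rho>, \<gamma>) \<in> UNIV \<times> {0..R} \<times> {0..\<Gamma>}. ?D n u \<rho> \<gamma>) - 0) < e"
    proof eventually_elim
      case (elim n)
      let ?S = "SUP (u, \<rho>, \<gamma>) \<in> UNIV \<times> {0..R} \<times> {0..\<Gamma>}. ?D n u \<rho> \<gamma>"
      have bound: "(case a of (u, \<rho>, \<gamma>) \<Rightarrow> ?D n u \<rho> \<gamma>) \<le> e / 2" if "a \<in> UNIV \<times> {0..R} \<times> {0..\<Gamma>}" for a
      proof -
        obtain u \<rho> \<gamma> where a: "a = (u, \<rho>, \<gamma>)" by (cases a) auto
        then have "?D n u (fst (\<rho>, \<gamma>)) (snd (\<rho>, \<gamma>)) < e / 2" using elim that by blast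
        then show ?thesis unfolding a by (simp only: prod.case fst_conv snd_conv less_imp_le)
      qed
      \<comment> \<open>The point shows that the index set is nonempty, and nonnegativity of the
        supremum is read off at it.\<close>
      have mem: "(0, 0, 0) \<in> (UNIV :: real set) \<times> {0..R} \<times> {0..\<Gamma>}" using R Gamma by simp
      have "?S \<le> e / 2" using mem by (intro cSUP_least bound) auto
      moreover have "0 \<le> ?S"
        by (rule cSUP_upper2[OF bdd_aboveI2[OF bound] mem]) simp_all
      ultimately show ?case using \<open>0 < e\<close> by simp
    qed
    then show "\<exists>no. \<forall>n\<ge>no. norm ((SUP (u, \<rho>, \<gamma>) \<in> UNIV \<times> {0..R} \<times> {0..\<Gamma>}. ?D n u \<rho> \<gamma>) - 0) < e"
      by (simp add: eventually_sequentially)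
  qed
qed

end
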